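(* Let $\varphi\in Q$, $W\in A_{p(\varphi)}$ and $k\in\mathbb R^+$. Then there is a constant $C>0$ depending only on $\varphi$, $k$ and $W$ such that for every $f\in L_W^\varphi$ and every $n\in\mathbb N$, $$\left(\prod_{j=1}^nE_j(f)_{\varphi,W}\right)^{1/n}\le C\,\Omega_k\left(f,\tfrac1n\right)_{\varphi,W}.$$
   Context: $\mathbb R^+=(0,\infty)$, $\mathbb N=\{1,2,\dots\}$, $\mathsf T=[0,2\pi]$; functions on $\mathsf T$ are regarded as $2\pi$-periodic functions on $\mathbb R$. Young functions: $\varphi:\mathbb R\to[0,\infty)$ is a Young function if it is even, continuous, increasing on $(0,\infty)$, $\varphi(0)=0$ and $\lim_{x\to\infty}\varphi(x)=\infty$. A function $\varphi$ on $[0,\infty)$ is quasiconvex if there are a convex Young function $\Phi$ and $C\ge1$ with $\Phi(x)\le\varphi(x)\le\Phi(Cx)$ for all $x\ge0$. A Young function satisfies $\Delta_2$ if for some $C>0$, $\varphi(2x)\le C\varphi(x)$ for all $x$. $Q$ is the class of Young functions $\varphi$ satisfying $\Delta_2$ such that $\varphi^\theta$ is quasiconvex for some $\theta\in(0,1)$. The index $p(\varphi)$ is defined by $\frac1{p(\varphi)}=\inf\{p>0:\varphi^p\text{ is quasiconvex}\}$. Weights: a weight is a measurable, a.e. positive, $2\pi$-periodic function $\omega$. For $1<p<\infty$, $\omega\in A_p$ if $\sup_J\left(\frac1{|J|}\int_J\omega\right)\left(\frac1{|J|}\int_J\omega^{1/(1-p)}\right)^{p-1}<\infty$, the supremum over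 all subintervals $J$. Orlicz space: $L_W^\varphi$ is the space of measurable $f:\mathsf T\to\mathbb R$ with $\int_{\mathsf T}\varphi(C|f|)W\,dx<\infty$ for some $C>0$, with norm $\|f\|_{\varphi,W}=\sup\{\int_{\mathsf T}|fg|W\,dx:\int_{\mathsf T}\tilde\varphi(|g|)W\,dx\le1\}$, where $\tilde\varphi(y)=\sup_{x\ge0}\{xy-\varphi(x)\}$, $y\ge0$. Modulus of smoothness: $\mathcal A_hf(x)=\frac1h\int_{-h/2}^{h/2}f(x+t)\,dt$ for $h>0$; for $k\in\mathbb R^+$, $(I-\mathcal A_h)^kf=\sum_{j=0}^\infty(-1)^j\binom kj\mathcal A_h^jf$ (convergent in $\|\cdot\|_{\varphi,W}$), where $\binom kj=\frac{\Gamma(k+1)}{\Gamma(j+1)\Gamma(k-j+1)}$ ($1/\Gamma$ being $0$ at poles of $\Gamma$); $\Omega_k(f,\delta)_{\varphi,W}=\sup_{0<h\le\delta}\|(I-\mathcal A_h)^kf\|_{\varphi,W}$. Best approximation: $E_n(f)_{\varphi,W}=\inf\{\|f-T\|_{\varphi,W}:T\in\mathcal T_n\}$, $\mathcal T_n$ the real trigonometric polynomials of degree at most $n$. *)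

theory Defs
  imports "HOL-Analysis.Analysis"
begin

text \<open>Real powers on the extended nonnegative reals, meant for positive exponents.\<close>

definition ennreal_powr :: "ennreal \<Rightarrow> real \<Rightarrow> ennreal" where
  "ennreal_powr x a = (if x = \<infinity> then \<infinity> else ennreal (enn2real x powr a))"

text \<open>``Increasing'' is read as nondecreasing.\<close>

definition young_function :: "(real \<Rightarrow> real) \<Rightarrow> bool" where
  "young_function \<phi> \<longleftrightarrow>
     (\<forall>x. 0 \<le> \<phi> x) \<and> (\<forall>x. \<phi> (- x) = \<phi> x) \<and> continuous_on UNIV \<phi> \<and>
     mono_on {0<..} \<phi> \<and> \<phi> 0 = 0 \<and> filterlim \<phi> at_top at_top"

definition quasiconvex :: "(real \<Rightarrow> real) \<Rightarrow> bool" where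
  "quasiconvex \<phi> \<longleftrightarrow>
     (\<exists>\<Phi> C. young_function \<Phi> \<and> convex_on UNIV \<Phi> \<and> 1 \<le> C \<and>
        (\<forall>x\<ge>0. \<Phi> x \<le> \<phi> x \<and> \<phi> x \<le> \<Phi> (C * x)))"

definition delta2 :: "(real \<Rightarrow> real) \<Rightarrow> bool" where
  "delta2 \<phi> \<longleftrightarrow> (\<exists>C>0. \<forall>x. \<phi> (2 * x) \<le> C * \<phi> x)"

definition class_Q :: "(real \<Rightarrow> real) set" where
  "class_Q = {\<phi>. young_function \<phi> \<and> delta2 \<phi> \<and>
     (\<exists>\<theta>. 0 < \<theta> \<and> \<theta> < 1 \<and> quasiconvex (\<lambda>x. \<phi> x powr \<theta>))}"

definition young_index :: "(real \<Rightarrow> real) \<Rightarrow> real" where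
  "young_index \<phi> = 1 / Inf {p. 0 < p \<and> quasiconvex (\<lambda>x. \<phi> x powr p)}"

text \<open>The complementary function, with values in \<open>[0,\<infinity>]\<close>. Truncating negative values of
  \<open>x * y - \<phi> x\<close> to 0 does not change the supremum, since \<open>x = 0\<close> contributes 0.\<close>

definition young_compl :: "(real \<Rightarrow> real) \<Rightarrow> real \<Rightarrow> ennreal" where
  "young_compl \<phi> y = (SUP x\<in>{0..}. ennreal (x * y - \<phi> x))"

definition periodic_2pi :: "(real \<Rightarrow> real) \<Rightarrow> bool" where
  "periodic_2pi f \<longleftrightarrow> (\<forall>x. f (x + 2 * pi) = f x)"

definition weight :: "(real \<Rightarrow> real) \<Rightarrow> bool" where
  "weight W \<longleftrightarrow>
     W \<in> borel_measurable lebesgue \<and> (AE x in lebesgue. 0 < W x) \<and> periodic_2pi W"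

text \<open>The intervals range over all bounded intervals of the real line, as weights are periodic
  functions on the line; in particular they may cross multiples of \<open>2\<pi>\<close>.\<close>

definition Muckenhoupt :: "real \<Rightarrow> (real \<Rightarrow> real) set" where
  "Muckenhoupt p = {W. 1 < p \<and> weight W \<and>
     (SUP (a, b)\<in>{(a, b). a < b}.
        (ennreal (1 / (b - a)) * (\<integral>\<^sup>+x\<in>{a..b}. ennreal (W x) \<partial>lebesgue)) *
        ennreal_powr
          (ennreal (1 / (b - a)) * (\<integral>\<^sup>+x\<in>{a..b}. ennreal (W x powr (1 / (1 - p))) \<partial>lebesgue))
          (p - 1)) < \<infinity>}"

text \<open>Functions on \<open>[0, 2\<pi>]\<close> are represented by their \<open>2\<pi>\<close>-periodic extensions to the line.\<close>

definition orlicz_space :: "(real \<Rightarrow> real) \<Rightarrow> (real \<Rightarrow> real) \<Rightarrow> (real \<Rightarrow> real) set" where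
  "orlicz_space \<phi> W = {f. f \<in> borel_measurable lebesgue \<and> periodic_2pi f \<and>
     (\<exists>C>0. (\<integral>\<^sup>+x\<in>{0..2*pi}. ennreal (\<phi> (C * \<bar>f x\<bar>) * W x) \<partial>lebesgue) < \<infinity>)}"

definition orlicz_norm :: "(real \<Rightarrow> real) \<Rightarrow> (real \<Rightarrow> real) \<Rightarrow> (real \<Rightarrow> real) \<Rightarrow> ennreal" where
  "orlicz_norm \<phi> W f =
     (SUP g\<in>{g. g \<in> borel_measurable lebesgue \<and> periodic_2pi g \<and>
           (\<integral>\<^sup>+x\<in>{0..2*pi}. young_compl \<phi> \<bar>g x\<bar> * ennreal (W x) \<partial>lebesgue) \<le> 1}.
        \<integral>\<^sup>+x\<in>{0..2*pi}. ennreal (\<bar>f x * g x\<bar> * W x) \<partial>lebesgue)"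

text \<open>The Lebesgue measure on the completed sigma-algebra is used because \<open>f\<close> need not be
  Borel measurable.\<close>

definition steklov :: "real \<Rightarrow> (real \<Rightarrow> real) \<Rightarrow> real \<Rightarrow> real" where
  "steklov h f x = (1 / h) * (LINT t:{- (h / 2)..h / 2}|lebesgue. f (x + t))"

definition gen_binom :: "real \<Rightarrow> nat \<Rightarrow> real" where
  "gen_binom k j = Gamma (k + 1) * rGamma (real j + 1) * rGamma (k - real j + 1)"

text \<open>\<open>is_frac_diff \<phi> W k h f g\<close> says that \<open>g\<close> is the sum of the binomial series
  for \<open>(I - A\<^sub>h)\<^sup>k f\<close> in the sense of convergence in the norm.\<close>

definition is_frac_diff ::
  "(real \<Rightarrow> real) \<Rightarrow> (real \<Rightarrow> real) \<Rightarrow> real \<Rightarrow> real \<Rightarrow> (real \<Rightarrow> real) \<Rightarrow> (real \<Rightarrow> real) \<Rightarrow> bool" where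
  "is_frac_diff \<phi> W k h f g \<longleftrightarrow> g \<in> orlicz_space \<phi> W \<and>
     (\<lambda>N. orlicz_norm \<phi> W
        (\<lambda>x. (\<Sum>j<N. (-1) ^ j * gen_binom k j * (steklov h ^^ j) f x) - g x)) \<longlonglongrightarrow> 0"

text \<open>The sum is determined only up to null sets, so a representative is chosen; its norm does
  not depend on the choice.\<close>

definition frac_diff ::
  "(real \<Rightarrow> real) \<Rightarrow> (real \<Rightarrow> real) \<Rightarrow> real \<Rightarrow> real \<Rightarrow> (real \<Rightarrow> real) \<Rightarrow> real \<Rightarrow> real" where
  "frac_diff \<phi> W k h f = (SOME g. is_frac_diff \<phi> W k h f g)"

definition modulus_smooth ::
  "(real \<Rightarrow> real) \<Rightarrow> (real \<Rightarrow> real) \<Rightarrow> real \<Rightarrow> (real \<Rightarrow> real) \<Rightarrow> real \<Rightarrow> ennreal" where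
  "modulus_smooth \<phi> W k f \<delta> = (SUP h\<in>{0<..\<delta>}. orlicz_norm \<phi> W (frac_diff \<phi> W k h f))"

definition trig_polys :: "nat \<Rightarrow> (real \<Rightarrow> real) set" where
  "trig_polys n =
     {T. \<exists>a b. T = (\<lambda>x. \<Sum>i\<le>n. a i * cos (real i * x) + b i * sin (real i * x))}"

definition best_approx ::
  "(real \<Rightarrow> real) \<Rightarrow> (real \<Rightarrow> real) \<Rightarrow> nat \<Rightarrow> (real \<Rightarrow> real) \<Rightarrow> ennreal" where
  "best_approx \<phi> W n f = (INF T\<in>trig_polys n. orlicz_norm \<phi> W (\<lambda>x. f x - T x))"

end

theory Submission
  imports Defs
begin

text \<open>
  Write \<open>A = A\<^sub>h\<close> with \<open>h = 1 / n\<close> and let \<open>V\<close> be convolution with a Jackson kernel of degree at most \<open>j\<close>.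
  Everything reduces to \<open>E\<^sub>j(f) \<le> C (n / j)\<^sup>r \<parallel>(I - A)\<^sup>k f\<parallel>\<close> for \<open>1 \<le> j \<le> n\<close>, because the geometric mean of the
  factors \<open>n / j\<close> is at most \<open>e\<close>. Multiplying by the bounded operator \<open>(I - A)\<^bsup>r - k\<^esup>\<close> makes the exponent a
  natural number, and since \<open>I - V\<close> and \<open>I - A\<close> commute it is enough to bound \<open>I - V\<close> by \<open>I - A\<close> once.
  Split the averaging kernel as \<open>\<kappa> + \<theta>\<close> with \<open>\<theta>\<close> proportional to the second primitive of \<open>A - I\<close>. Then
  \<open>I - A = (I - \<kappa>) - \<theta>\<close>, the Neumann series of \<open>\<kappa>\<close> converges since its mass is less than 1, and
  \<open>(I - V) \<theta>\<close> is the product of \<open>I - A\<close> and an operator of norm \<open>O((n / j)\<^sup>2)\<close>, by positivity and the second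
  moment of the Jackson kernel.

  All operators are controlled through averages over intervals, and these are uniformly bounded without any maximal
  theorem: Jensen's inequality and the Muckenhoupt condition give a modular inequality, which passes to the Orlicz norm
  by duality. As the infimum defining \<open>p(\<phi>)\<close> need not be attained, the condition \<open>A\<^sub>p\<close> is first improved to
  \<open>A\<^bsub>p - \<epsilon>\<^esub>\<close> by a reverse Hoelder inequality.
\<close>

section \<open>Reverse Hoelder inequality\<close>

text \<open>The step 1/n of the difference is kept for every degree j, which costs a factor (n/j)^2
  per difference. Such a loss would spoil an inequality of Jackson type, but a geometric mean does
  not see any fixed power of n/j. So neither the sharp order nor the exponent k itself has to be
  tracked.

  The obstacle is the constant D in the bound for averages: it may be large, so composing operators
  must not multiply their norms. Powers of the average A and of \<kappa> are therefore estimated at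
  the level of kernels: each power is dominated by one even kernel decreasing away from 0, and D is
  paid once. For A this gives a bound independent of the power, so that the binomial series defines
  a bounded operator; for \<kappa> it gives a multiple of N (7/8)^(N-1), so that the Neumann series
  converges. A itself has mass 1, and I - A annihilates constants; this is why \<theta> is split
  off, and why I - V, which annihilates constants as well, stands in front.

  Norms take values in [0, \<infinity>], so the remainder of the Neumann series disappears only for
  functions of finite norm; this finiteness is carried along.\<close>

lemma nn_integral_Holder:
  fixes f g :: "'a \<Rightarrow> real" and p X Y :: real
  assumes [measurable]: "f \<in> borel_measurable M" "g \<in> borel_measurable M"
    and f0: "\<And>x. 0 \<le> f x" and g0: "\<And>x. 0 \<le> g x" and p: "1 < p" and X: "0 \<le> X" and Y: "0 \<le> Y"
    and fX: "(\<integral>\<^sup>+x. ennreal (f x powr p) \<partial>M) \<le> ennreal X"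
    and gY: "(\<integral>\<^sup>+x. ennreal (g x powr (p / (p - 1))) \<partial>M) \<le> ennreal Y"
  shows "(\<integral>\<^sup>+x. ennreal (f x * g x) \<partial>M) \<le> ennreal (X powr (1 / p) * Y powr (1 - 1 / p))"
proof (cases "X = 0 \<or> Y = 0")
  case True
  have "AE x in M. f x * g x = 0"
  proof -
    have *: "AE x in M. h x = 0" if "h \<in> borel_measurable M" "(\<integral>\<^sup>+x. ennreal (h x powr r) \<partial>M) \<le> ennreal 0"
      for h :: "'a \<Rightarrow> real" and r
    proof -
      have "AE x in M. ennreal (h x powr r) = 0"
        using that by (subst nn_integral_0_iff_AE[symmetric]) auto
      then show ?thesis
        by eventually_elim (auto simp: ennreal_eq_0_iff)
    qed
    from True show ?thesis
    proof
      assume "X = 0" with * [of f p] fX show ?thesis by (auto elim: eventually_mono)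
    next
      assume "Y = 0" with * [of g "p / (p - 1)"] gY show ?thesis by (auto elim: eventually_mono)
    qed
  qed
  then have "(\<integral>\<^sup>+x. ennreal (f x * g x) \<partial>M) = (\<integral>\<^sup>+x. 0 \<partial>M)"
    by (intro nn_integral_cong_AE) (auto elim: eventually_mono)
  then show ?thesis by simp
next
  case False
  then have X: "0 < X" and Y: "0 < Y" using X Y by auto
  define q where "q = p / (p - 1)"
  have q: "1 < q" "1 / p + 1 / q = 1" "1 - 1 / p = 1 / q"
    using p by (auto simp: q_def field_simps)
  define c where "c = X powr (1 / p) * Y powr (1 / q)"
  have c: "0 \<le> c" by (auto simp: c_def)
  \<comment> \<open>Young's inequality for the factors normalised by \<open>X powr (1 / p)\<close>
    and \<open>Y powr (1 / q)\<close>; the zero cases were removed because of these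
    divisions.\<close>
  have pw: "f x * g x \<le> c / (p * X) * f x powr p + c / (q * Y) * g x powr q" for x
  proof -
    have "(f x / X powr (1 / p)) * (g x / Y powr (1 / q))
      \<le> (f x / X powr (1 / p)) powr p / p + (g x / Y powr (1 / q)) powr q / q"
      by (rule Youngs_inequality) (use p q f0 g0 in auto)
    also have "\<dots> = f x powr p / (p * X) + g x powr q / (q * Y)"
      using p q X Y f0 g0 by (simp add: powr_divide powr_powr field_simps)
    finally have "c * ((f x / X powr (1 / p)) * (g x / Y powr (1 / q)))
      \<le> c * (f x powr p / (p * X) + g x powr q / (q * Y))"
      using c by (rule mult_left_mono)
    then show ?thesis using X Y by (simp add: c_def field_simps)
  qed
  have "(\<integral>\<^sup>+x. ennreal (f x * g x) \<partial>M) \<le>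
     (\<integral>\<^sup>+x. ennreal (c / (p * X)) * ennreal (f x powr p) + ennreal (c / (q * Y)) * ennreal (g x powr q) \<partial>M)"
    using pw c X Y p q
    by (intro nn_integral_mono) (simp add: ennreal_mult[symmetric] flip: ennreal_plus)
  also have "\<dots> = ennreal (c / (p * X)) * (\<integral>\<^sup>+x. ennreal (f x powr p) \<partial>M)
      + ennreal (c / (q * Y)) * (\<integral>\<^sup>+x. ennreal (g x powr q) \<partial>M)"
    by (subst nn_integral_add) (auto simp: nn_integral_cmult)
  also have "\<dots> \<le> ennreal (c / (p * X)) * ennreal X + ennreal (c / (q * Y)) * ennreal Y"
    using fX gY by (intro add_mono mult_left_mono) (auto simp: q_def)
  also have "\<dots> = ennreal (c * (1 / p + 1 / q))"
    using c X Y p q by (simp add: ennreal_mult[symmetric] field_simps flip: ennreal_plus)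
  also have "\<dots> = ennreal c" by (simp only: q(2) mult_1_right)
  finally show ?thesis by (simp add: c_def q)
qed

text \<open>The union of the maximal dyadic subintervals of \<open>{a..<b}\<close>, up to generation \<open>N\<close>, on which the average of
  \<open>\<mu>\<close> exceeds \<open>l\<close>.\<close>

primrec dyadic_stop :: "nat \<Rightarrow> real measure \<Rightarrow> real \<Rightarrow> real \<Rightarrow> real \<Rightarrow> real set" where
  "dyadic_stop 0 \<mu> l a b = (if ennreal (l * (b - a)) < emeasure \<mu> {a..<b} then {a..<b} else {})"
| "dyadic_stop (Suc N) \<mu> l a b = (if ennreal (l * (b - a)) < emeasure \<mu> {a..<b} then {a..<b}
     else dyadic_stop N \<mu> l a ((a + b) / 2) \<union> dyadic_stop N \<mu> l ((a + b) / 2) b)"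

text \<open>The maximal dyadic subintervals, up to generation \<open>N\<close>, that lie inside
  \<open>U\<close>: an exhaustion of an open set from within. Its pieces belong to the same dyadic
  tree as those of \<open>dyadic_stop\<close>, so that the two can be compared by one
  induction.\<close>

primrec dyadic_inner :: "nat \<Rightarrow> real set \<Rightarrow> real \<Rightarrow> real \<Rightarrow> real set" where
  "dyadic_inner 0 U a b = (if {a..<b} \<subseteq> U then {a..<b} else {})"
| "dyadic_inner (Suc N) U a b = (if {a..<b} \<subseteq> U then {a..<b}
     else dyadic_inner N U a ((a + b) / 2) \<union> dyadic_inner N U ((a + b) / 2) b)"

lemma dyadic_stop_subset: "a \<le> b \<Longrightarrow> dyadic_stop N \<mu> l a b \<subseteq> {a..<b}"
proof (induction N arbitrary: a b)
  case (Suc N)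
  have "dyadic_stop N \<mu> l a ((a + b) / 2) \<subseteq> {a..<(a + b) / 2}"
    "dyadic_stop N \<mu> l ((a + b) / 2) b \<subseteq> {(a + b) / 2..<b}"
    using Suc by (auto intro!: Suc.IH)
  with Suc.prems show ?case by (auto simp: subset_iff)
qed auto

lemma dyadic_inner_subset: "a \<le> b \<Longrightarrow> dyadic_inner N U a b \<subseteq> {a..<b}"
proof (induction N arbitrary: a b)
  case (Suc N)
  have "dyadic_inner N U a ((a + b) / 2) \<subseteq> {a..<(a + b) / 2}"
    "dyadic_inner N U ((a + b) / 2) b \<subseteq> {(a + b) / 2..<b}"
    using Suc by (auto intro!: Suc.IH)
  with Suc.prems show ?case by (auto simp: subset_iff)
qed auto

lemma dyadic_inner_subset_set: "dyadic_inner N U a b \<subseteq> U"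
  by (induction N arbitrary: a b) auto

lemma dyadic_stop_borel [measurable]: "dyadic_stop N \<mu> l a b \<in> sets borel"
  by (induction N arbitrary: a b) auto

lemma dyadic_inner_borel [measurable]: "dyadic_inner N U a b \<in> sets borel"
  by (induction N arbitrary: a b) auto

lemma dyadic_stop_mono: "dyadic_stop N \<mu> l a b \<subseteq> dyadic_stop (Suc N) \<mu> l a b"
proof (induction N arbitrary: a b)
  case (Suc N)
  from Suc[of a "(a+b)/2"] Suc[of "(a+b)/2" b] show ?case
    by (subst (1 2) dyadic_stop.simps) (auto simp del: dyadic_stop.simps)
qed auto

lemma dyadic_inner_mono: "dyadic_inner N U a b \<subseteq> dyadic_inner (Suc N) U a b"
proof (induction N arbitrary: a b)
  case (Suc N)
  from Suc[of a "(a+b)/2"] Suc[of "(a+b)/2" b] show ?case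
    by (subst (1 2) dyadic_inner.simps) (auto simp del: dyadic_inner.simps)
qed auto

lemma emeasure_split_halves:
  fixes a b :: real
  assumes "a \<le> b" "A \<subseteq> {a..<(a + b) / 2}" "B \<subseteq> {(a + b) / 2..<b}" "A \<in> sets M" "B \<in> sets M"
  shows "emeasure M (A \<union> B) = emeasure M A + emeasure M B"
proof -
  have "A \<inter> B \<subseteq> {a..<(a + b) / 2} \<inter> {(a + b) / 2..<b}"
    using assms by blast
  also have "\<dots> = {}" by auto
  finally show ?thesis
    using assms by (intro plus_emeasure[symmetric]) auto
qed

text \<open>The stopping set is a disjoint union of intervals on each of which the average of
  \<open>\<mu>\<close> exceeds \<open>l\<close>; the estimates are added up along the tree.\<close>

lemma dyadic_stop_Chebyshev:
  assumes [measurable_cong]: "sets \<mu> = sets borel" and "a \<le> b" "0 \<le> l"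
  shows "ennreal l * emeasure lborel (dyadic_stop N \<mu> l a b) \<le> emeasure \<mu> (dyadic_stop N \<mu> l a b)"
  using \<open>a \<le> b\<close>
proof (induction N arbitrary: a b)
  case 0
  then show ?case using \<open>0 \<le> l\<close>
    by (auto simp: ennreal_mult[symmetric])
next
  case (Suc N)
  let ?m = "(a + b) / 2"
  have m: "a \<le> ?m" "?m \<le> b" using Suc.prems by auto
  show ?case
  proof (cases "ennreal (l * (b - a)) < emeasure \<mu> {a..<b}")
    case True then show ?thesis using Suc.prems \<open>0 \<le> l\<close> by (auto simp: ennreal_mult[symmetric])
  next
    case False
    have e: "emeasure M (dyadic_stop N \<mu> l a ?m \<union> dyadic_stop N \<mu> l ?m b)
      = emeasure M (dyadic_stop N \<mu> l a ?m) + emeasure M (dyadic_stop N \<mu> l ?m b)"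
      if "sets M = sets borel" for M
      by (rule emeasure_split_halves[OF Suc.prems dyadic_stop_subset[OF m(1)] dyadic_stop_subset[OF m(2)]])
        (simp_all add: that)
    show ?thesis
      using Suc.IH[OF m(1)] Suc.IH[OF m(2)] False
      by (simp add: e assms(1) distrib_left add_mono)
  qed
qed

text \<open>The case of an interval that is itself stopped at level \<open>l\<close>. By
  \<open>dyadic_stop_Chebyshev\<close> the part stopped at level \<open>4 * l\<close> has length at
  most the mass of the interval divided by \<open>4 * l\<close>, and the upper bound
  \<open>2 * l\<close> on the average turns this into half of the length. This is exactly the size
  to which hypothesis \<open>A\<close> applies.\<close>

lemma dyadic_stop_step_above:
  assumes [measurable_cong]: "sets \<mu> = sets borel"
    and A: "\<And>a b E. a < b \<Longrightarrow> E \<in> sets borel \<Longrightarrow> E \<subseteq> {a..<b} \<Longrightarrow> 2 * emeasure lborel E \<le> ennreal (b - a)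
       \<Longrightarrow> emeasure \<mu> E \<le> c * emeasure \<mu> {a..<b}"
    and "a < b" "0 < l" "emeasure \<mu> {a..<b} \<le> ennreal (2 * l * (b - a))"
    and above: "ennreal (l * (b - a)) < emeasure \<mu> {a..<b}"
  shows "emeasure \<mu> (dyadic_stop N \<mu> (4 * l) a b) \<le> c * emeasure \<mu> (dyadic_stop N \<mu> l a b)"
proof -
  let ?E = "dyadic_stop N \<mu> (4 * l) a b"
  have s: "?E \<subseteq> {a..<b}" using assms by (intro dyadic_stop_subset) auto
  have "ennreal (4 * l) * emeasure lborel ?E \<le> emeasure \<mu> ?E"
    using assms by (intro dyadic_stop_Chebyshev) auto
  also have "\<dots> \<le> emeasure \<mu> {a..<b}" using s by (intro emeasure_mono) auto
  also have "\<dots> \<le> ennreal (2 * l) * ennreal (b - a)" using assms by (simp add: ennreal_mult[symmetric])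
  also have "ennreal (4 * l) = ennreal (2 * l) * 2" using ennreal_mult[of "2 * l" 2] \<open>0 < l\<close> by simp
  finally have "ennreal (2 * l) * (2 * emeasure lborel ?E) \<le> ennreal (2 * l) * ennreal (b - a)"
    by (simp only: mult.assoc)
  then have "2 * emeasure lborel ?E \<le> ennreal (b - a)"
    using \<open>0 < l\<close> by (subst (asm) ennreal_mult_le_mult_iff) auto
  then have "emeasure \<mu> ?E \<le> c * emeasure \<mu> {a..<b}"
    using A[of a b ?E] s \<open>a < b\<close> by simp
  also have "dyadic_stop N \<mu> l a b = {a..<b}" using above by (cases N) auto
  ultimately show ?thesis by simp
qed

text \<open>Applies the previous estimate to each interval stopped at level \<open>l\<close>: its
  parent was not stopped, so its own average is at most \<open>2 * l\<close>, and the premise with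
  the factor 2 reproduces itself down the tree. The ratio 4 of the levels is this 2 times the 2 of
  the half-length condition in \<open>A\<close>.\<close>

lemma dyadic_stop_step:
  assumes [measurable_cong]: "sets \<mu> = sets borel"
    and A: "\<And>a b E. a < b \<Longrightarrow> E \<in> sets borel \<Longrightarrow> E \<subseteq> {a..<b} \<Longrightarrow> 2 * emeasure lborel E \<le> ennreal (b - a)
       \<Longrightarrow> emeasure \<mu> E \<le> c * emeasure \<mu> {a..<b}"
    and "a < b" "0 < l" "emeasure \<mu> {a..<b} \<le> ennreal (2 * l * (b - a))"
  shows "emeasure \<mu> (dyadic_stop N \<mu> (4 * l) a b) \<le> c * emeasure \<mu> (dyadic_stop N \<mu> l a b)"
  using assms(3,5)
proof (induction N arbitrary: a b)
  case (0 a b)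
  show ?case
  proof (cases "ennreal (l * (b - a)) < emeasure \<mu> {a..<b}")
    case False
    have "l * (b - a) \<le> 4 * l * (b - a)" using 0 \<open>0 < l\<close> by auto
    then have "ennreal (l * (b - a)) \<le> ennreal (4 * l * (b - a))" by (rule ennreal_leI)
    then have "\<not> ennreal (4 * l * (b - a)) < emeasure \<mu> {a..<b}"
      using False by order
    then show ?thesis by simp
  next
    case True
    show ?thesis by (rule dyadic_stop_step_above[OF assms(1) A]) (use 0 \<open>0 < l\<close> True in auto)
  qed
next
  case (Suc N a b)
  let ?m = "(a + b) / 2"
  have m: "a < ?m" "?m < b" using Suc.prems by auto
  show ?case
  proof (cases "ennreal (l * (b - a)) < emeasure \<mu> {a..<b}")
    case True
    show ?thesis by (rule dyadic_stop_step_above[OF assms(1) A]) (use Suc.prems \<open>0 < l\<close> True in auto)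
  next
    case False
    have "l * (b - a) \<le> 4 * l * (b - a)" using Suc.prems \<open>0 < l\<close> by auto
    then have "ennreal (l * (b - a)) \<le> ennreal (4 * l * (b - a))" by (rule ennreal_leI)
    then have n4: "\<not> ennreal (4 * l * (b - a)) < emeasure \<mu> {a..<b}"
      using False by order
    have e: "emeasure \<mu> (dyadic_stop N \<mu> l a ?m \<union> dyadic_stop N \<mu> l ?m b)
      = emeasure \<mu> (dyadic_stop N \<mu> l a ?m) + emeasure \<mu> (dyadic_stop N \<mu> l ?m b)" for l
      by (rule emeasure_split_halves[OF less_imp_le[OF Suc.prems(1)] dyadic_stop_subset[OF less_imp_le[OF m(1)]]
            dyadic_stop_subset[OF less_imp_le[OF m(2)]]]) (simp_all add: assms)
    have half: "emeasure \<mu> {u..<v} \<le> ennreal (2 * l * (v - u))" if "{u..<v} \<subseteq> {a..<b}" "v - u = (b - a) / 2" for u v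
    proof -
      have "emeasure \<mu> {u..<v} \<le> emeasure \<mu> {a..<b}" using that by (intro emeasure_mono) auto
      also have "\<dots> \<le> ennreal (l * (b - a))" using False by auto
      also have "l * (b - a) = 2 * l * (v - u)" using that by simp
      finally show ?thesis .
    qed
    have "emeasure \<mu> (dyadic_stop N \<mu> (4 * l) a ?m) \<le> c * emeasure \<mu> (dyadic_stop N \<mu> l a ?m)"
      using m by (intro Suc.IH half) (auto simp: field_simps)
    moreover have "emeasure \<mu> (dyadic_stop N \<mu> (4 * l) ?m b) \<le> c * emeasure \<mu> (dyadic_stop N \<mu> l ?m b)"
      using m by (intro Suc.IH half) (auto simp: field_simps)
    ultimately show ?thesis
      using False n4 by (simp only: dyadic_stop.simps if_False e distrib_left add_mono)
  qed
qed

text \<open>Geometric decay: raising the level by a factor 4 costs a factor \<open>c\<close> in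
  mass. The bounds do not depend on the depth \<open>N\<close>, so they survive the monotone
  union.\<close>

lemma dyadic_stop_iterate:
  assumes [measurable_cong]: "sets \<mu> = sets borel"
    and A: "\<And>a b E. a < b \<Longrightarrow> E \<in> sets borel \<Longrightarrow> E \<subseteq> {a..<b} \<Longrightarrow> 2 * emeasure lborel E \<le> ennreal (b - a)
       \<Longrightarrow> emeasure \<mu> E \<le> c * emeasure \<mu> {a..<b}"
    and "a < b" "0 < l" "emeasure \<mu> {a..<b} \<le> ennreal (l * (b - a))"
  shows "emeasure \<mu> (\<Union>N. dyadic_stop N \<mu> (4 ^ k * l) a b) \<le> c ^ k * emeasure \<mu> {a..<b}"
proof -
  have *: "emeasure \<mu> (dyadic_stop N \<mu> (4 ^ k * l) a b) \<le> c ^ k * emeasure \<mu> {a..<b}" for N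
  proof (induction k)
    case 0
    show ?case using \<open>a < b\<close> dyadic_stop_subset[of a b N \<mu> l] by (auto intro!: emeasure_mono)
  next
    case (Suc k)
    have "1 * (l * (b - a)) \<le> (2 * 4 ^ k) * (l * (b - a))"
    proof (rule mult_right_mono)
      have "1 \<le> (4::real) ^ k" by simp
      then show "1 \<le> (2 * 4 ^ k :: real)" by linarith
    qed (use \<open>a < b\<close> \<open>0 < l\<close> in auto)
    then have "emeasure \<mu> {a..<b} \<le> ennreal (2 * (4 ^ k * l) * (b - a))"
      using assms(5) by (intro order.trans[OF assms(5)] ennreal_leI) (simp add: mult_ac)
    then have "emeasure \<mu> (dyadic_stop N \<mu> (4 * (4 ^ k * l)) a b) \<le> c * emeasure \<mu> (dyadic_stop N \<mu> (4 ^ k * l) a b)"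
      using assms by (intro dyadic_stop_step) auto
    also have "\<dots> \<le> c * (c ^ k * emeasure \<mu> {a..<b})"
      using Suc by (intro mult_left_mono) auto
    finally show ?case by (simp add: mult_ac)
  qed
  have "incseq (\<lambda>N. dyadic_stop N \<mu> (4 ^ k * l) a b)"
    by (intro incseq_SucI dyadic_stop_mono)
  then have "emeasure \<mu> (\<Union>N. dyadic_stop N \<mu> (4 ^ k * l) a b) = (SUP N. emeasure \<mu> (dyadic_stop N \<mu> (4 ^ k * l) a b))"
    by (subst SUP_emeasure_incseq) auto
  also have "\<dots> \<le> c ^ k * emeasure \<mu> {a..<b}" by (intro SUP_least *)
  finally show ?thesis .
qed

lemma dyadic_inner_Un:
  assumes "open U" "a \<le> b"
  shows "U \<inter> {a..<b} \<subseteq> (\<Union>N. dyadic_inner N U a b)"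
proof
  fix x assume x: "x \<in> U \<inter> {a..<b}"
  then obtain r where r: "0 < r" "ball x r \<subseteq> U" using \<open>open U\<close> by (auto simp: open_contains_ball)
  have *: "x \<in> {a..<b} \<Longrightarrow> (b - a) / 2 ^ N < r \<Longrightarrow> x \<in> dyadic_inner N U a b" for N a b
  proof (induction N arbitrary: a b)
    case 0
    then have "{a..<b} \<subseteq> ball x r" by (auto simp: dist_real_def)
    then show ?case using 0 r by auto
  next
    case (Suc N)
    show ?case
    proof (cases "x < (a + b) / 2")
      case True
      have "x \<in> dyadic_inner N U a ((a + b) / 2)"
        using Suc.prems True by (intro Suc.IH) (auto simp: field_simps)
      then show ?thesis using Suc.prems by auto
    next
      case False
      have "x \<in> dyadic_inner N U ((a + b) / 2) b"
        using Suc.prems False by (intro Suc.IH) (auto simp: field_simps)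
      then show ?thesis using Suc.prems by auto
    qed
  qed
  have "(\<lambda>N. (b - a) * (1 / 2) ^ N) \<longlonglongrightarrow> (b - a) * 0"
    by (intro tendsto_intros LIMSEQ_realpow_zero) auto
  then have "eventually (\<lambda>N. (b - a) * (1 / 2) ^ N < r) sequentially"
    using r by (intro order_tendstoD) auto
  then obtain N where "(b - a) / 2 ^ N < r" by (auto simp: eventually_sequentially power_divide)
  with * x show "x \<in> (\<Union>N. dyadic_inner N U a b)" by auto
qed

lemma dyadic_stop_Un_rec:
  assumes "\<not> ennreal (l * (b - a)) < emeasure \<mu> {a..<b}"
  shows "(\<Union>N. dyadic_stop N \<mu> l a b)
    = (\<Union>N. dyadic_stop N \<mu> l a ((a + b) / 2)) \<union> (\<Union>N. dyadic_stop N \<mu> l ((a + b) / 2) b)"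
proof -
  have "(\<Union>N. dyadic_stop N \<mu> l a b) = (\<Union>N. dyadic_stop (Suc N) \<mu> l a b)"
    using dyadic_stop_mono[of _ \<mu> l a b] by blast
  also have "\<dots> = (\<Union>N. dyadic_stop N \<mu> l a ((a + b) / 2)) \<union> (\<Union>N. dyadic_stop N \<mu> l ((a + b) / 2) b)"
    using assms by auto
  finally show ?thesis .
qed

text \<open>Descending the tree, a piece of \<open>U\<close> is met either inside a stopped
  interval, where nothing is left after subtracting the stopping set, or in an interval that is not
  stopped, whose mass is at most \<open>l\<close> times its length.\<close>

lemma emeasure_off_stop_inner:
  assumes [measurable_cong]: "sets \<mu> = sets borel" and "a \<le> b" "0 \<le> l"
  shows "emeasure \<mu> (dyadic_inner N U a b - (\<Union>N. dyadic_stop N \<mu> l a b))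
    \<le> ennreal l * emeasure lborel (dyadic_inner N U a b)"
  using \<open>a \<le> b\<close>
proof (induction N arbitrary: a b)
  case (0 a b)
  show ?case
  proof (cases "ennreal (l * (b - a)) < emeasure \<mu> {a..<b}")
    case True
    then have "(\<Union>N. dyadic_stop N \<mu> l a b) \<supseteq> {a..<b}" by (auto intro!: exI[of _ 0])
    then have "dyadic_inner 0 U a b - (\<Union>N. dyadic_stop N \<mu> l a b) = {}" by auto
    then show ?thesis by (metis emeasure_empty zero_le)
  next
    case False
    have "emeasure \<mu> ({a..<b} - (\<Union>N. dyadic_stop N \<mu> l a b)) \<le> emeasure \<mu> {a..<b}"
      by (intro emeasure_mono) auto
    also have "\<dots> \<le> ennreal (l * (b - a))" using False by auto
    finally show ?thesis using 0 \<open>0 \<le> l\<close> by (auto simp: ennreal_mult)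
  qed
next
  case (Suc N a b)
  let ?m = "(a + b) / 2"
  have m: "a \<le> ?m" "?m \<le> b" using Suc.prems by auto
  show ?case
  proof (cases "ennreal (l * (b - a)) < emeasure \<mu> {a..<b}")
    case True
    then have *: "(\<Union>N. dyadic_stop N \<mu> l a b) \<supseteq> {a..<b}" by (auto intro!: exI[of _ 0])
    then have "dyadic_inner (Suc N) U a b - (\<Union>N. dyadic_stop N \<mu> l a b) = {}"
      using dyadic_inner_subset[OF Suc.prems, of "Suc N" U] by blast
    then show ?thesis by (metis emeasure_empty zero_le)
  next
    case False
    show ?thesis
    proof (cases "{a..<b} \<subseteq> U")
      case True
      have "emeasure \<mu> ({a..<b} - (\<Union>N. dyadic_stop N \<mu> l a b)) \<le> emeasure \<mu> {a..<b}"
        by (intro emeasure_mono) auto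
      also have "\<dots> \<le> ennreal (l * (b - a))" using False by auto
      finally show ?thesis using Suc.prems \<open>0 \<le> l\<close> True by (auto simp: ennreal_mult)
    next
      case nU: False
      let ?L = "dyadic_inner N U a ?m" and ?R = "dyadic_inner N U ?m b"
      let ?SL = "\<Union>N. dyadic_stop N \<mu> l a ?m" and ?SR = "\<Union>N. dyadic_stop N \<mu> l ?m b"
      have "emeasure \<mu> (dyadic_inner (Suc N) U a b - (\<Union>N. dyadic_stop N \<mu> l a b))
        \<le> emeasure \<mu> ((?L - ?SL) \<union> (?R - ?SR))"
        unfolding dyadic_stop_Un_rec[OF False] using nU by (intro emeasure_mono) auto
      also have "\<dots> \<le> emeasure \<mu> (?L - ?SL) + emeasure \<mu> (?R - ?SR)"
        by (intro emeasure_subadditive) auto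
      also have "\<dots> \<le> ennreal l * emeasure lborel ?L + ennreal l * emeasure lborel ?R"
        using Suc.IH m by (intro add_mono) auto
      also have "\<dots> = ennreal l * emeasure lborel (?L \<union> ?R)"
        by (subst emeasure_split_halves[OF Suc.prems dyadic_inner_subset[OF m(1)] dyadic_inner_subset[OF m(2)]])
          (simp_all add: distrib_left)
      finally show ?thesis using nU by simp
    qed
  qed
qed

text \<open>A substitute for the Lebesgue differentiation theorem: off the stopping set, the density of \<open>\<mu>\<close> is at
  most \<open>l\<close>.\<close>

lemma emeasure_off_stop:
  assumes [measurable_cong]: "sets \<mu> = sets borel" and "a \<le> b" "0 \<le> l"
    and [measurable]: "E \<in> sets borel" and E: "E \<subseteq> {a..<b} - (\<Union>N. dyadic_stop N \<mu> l a b)"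
  shows "emeasure \<mu> E \<le> ennreal l * emeasure lborel E"
proof -
  let ?S = "\<Union>N. dyadic_stop N \<mu> l a b"
  \<comment> \<open>An open superset is exhausted by dyadic intervals; outer regularity of Lebesgue
    measure then lets the superset shrink to \<open>E\<close>.\<close>
  have *: "emeasure \<mu> E \<le> ennreal l * emeasure lborel U" if U: "open U" "E \<subseteq> U" for U
  proof -
    have [measurable]: "U \<in> sets borel" using U by auto
    have "E \<subseteq> (\<Union>N. dyadic_inner N U a b - ?S)"
    proof
      fix x assume "x \<in> E"
      then have "x \<in> U \<inter> {a..<b}" "x \<notin> ?S" using E U(2) by auto
      then show "x \<in> (\<Union>N. dyadic_inner N U a b - ?S)"
        using dyadic_inner_Un[OF U(1) \<open>a \<le> b\<close>] by auto
    qed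
    then have "emeasure \<mu> E \<le> emeasure \<mu> (\<Union>N. dyadic_inner N U a b - ?S)"
      by (intro emeasure_mono) auto
    also have "\<dots> = (SUP N. emeasure \<mu> (dyadic_inner N U a b - ?S))"
      by (subst SUP_emeasure_incseq) (auto intro!: incseq_SucI dyadic_inner_mono[THEN subsetD] simp del: dyadic_inner.simps)
    also have "\<dots> \<le> ennreal l * emeasure lborel U"
    proof (rule SUP_least)
      fix N
      have "emeasure \<mu> (dyadic_inner N U a b - ?S) \<le> ennreal l * emeasure lborel (dyadic_inner N U a b)"
        using assms by (intro emeasure_off_stop_inner)
      also have "\<dots> \<le> ennreal l * emeasure lborel U"
        by (intro mult_left_mono emeasure_mono dyadic_inner_subset_set) auto
      finally show "emeasure \<mu> (dyadic_inner N U a b - ?S) \<le> ennreal l * emeasure lborel U" .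
    qed
    finally show ?thesis .
  qed
  show ?thesis
  proof (rule ennreal_le_epsilon)
    fix e :: real assume "0 < e"
    \<comment> \<open>The summand 1 covers \<open>l = 0\<close>, where \<open>e / l\<close> would be
      0.\<close>
    define d where "d = e / (l + 1)"
    have d: "0 < d" "l * d \<le> e" using \<open>0 < e\<close> \<open>0 \<le> l\<close> by (auto simp: d_def field_simps)
    obtain U where U: "open U" "E \<subseteq> U" "emeasure lborel (U - E) < ennreal d"
      using outer_regular_lborel[of E d] d by auto
    then have [measurable]: "U \<in> sets borel" by auto
    have "emeasure lborel U \<le> emeasure lborel E + emeasure lborel (U - E)"
      using U emeasure_subadditive[of E lborel "U - E"] by (simp add: Un_absorb1)
    also have "\<dots> \<le> emeasure lborel E + ennreal d" using U by (intro add_left_mono) auto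
    finally have "ennreal l * emeasure lborel U \<le> ennreal l * (emeasure lborel E + ennreal d)"
      by (rule mult_left_mono) auto
    also have "\<dots> = ennreal l * emeasure lborel E + ennreal (l * d)"
      using d \<open>0 \<le> l\<close> by (simp add: distrib_left ennreal_mult)
    also have "\<dots> \<le> ennreal l * emeasure lborel E + ennreal e"
      using d by (intro add_left_mono ennreal_leI)
    finally show "emeasure \<mu> E \<le> ennreal l * emeasure lborel E + ennreal e"
      using *[OF U(1,2)] by (rule order.trans[rotated])
  qed
qed

text \<open>Layer decomposition over the stopping sets \<open>T k\<close> at the levels
  \<open>4 ^ k * l\<close>, with \<open>l\<close> the average of \<open>\<sigma>\<close>. Outside
  \<open>T (Suc k)\<close> the density is at most \<open>4 ^ Suc k * l\<close>, while
  \<open>T k\<close> carries at most the share \<open>c ^ k\<close> of the mass. So layer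
  \<open>k\<close> contributes a multiple of \<open>(4 powr \<delta> * c) ^ k\<close>, and the
  condition on \<open>\<delta>\<close> makes the geometric series converge.\<close>

lemma reverse_Holder:
  fixes \<sigma> :: "real \<Rightarrow> real" and c \<delta> :: real
  assumes [measurable]: "\<sigma> \<in> borel_measurable borel" and \<sigma>0: "\<And>x. 0 < \<sigma> x"
    and c: "0 \<le> c" and \<delta>: "0 \<le> \<delta>" "4 powr \<delta> * c < 1"
    and A: "\<And>a b E. a < b \<Longrightarrow> E \<in> sets borel \<Longrightarrow> E \<subseteq> {a..<b} \<Longrightarrow> 2 * emeasure lborel E \<le> ennreal (b - a)
       \<Longrightarrow> (\<integral>\<^sup>+x\<in>E. ennreal (\<sigma> x) \<partial>lborel) \<le> ennreal c * (\<integral>\<^sup>+x\<in>{a..<b}. ennreal (\<sigma> x) \<partial>lborel)"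
  shows "\<exists>C\<ge>0. \<forall>a b S. a < b \<longrightarrow> 0 < S \<longrightarrow> (\<integral>\<^sup>+x\<in>{a..<b}. ennreal (\<sigma> x) \<partial>lborel) = ennreal S \<longrightarrow>
    (\<integral>\<^sup>+x\<in>{a..<b}. ennreal (\<sigma> x powr (1 + \<delta>)) \<partial>lborel) \<le> ennreal (C * ((b - a) * (S / (b - a)) powr (1 + \<delta>)))"
proof -
  define \<mu> where "\<mu> = density lborel (\<lambda>x. ennreal (\<sigma> x))"
  have sets_\<mu> [measurable_cong]: "sets \<mu> = sets borel" by (simp add: \<mu>_def)
  have \<mu>: "emeasure \<mu> E = (\<integral>\<^sup>+x\<in>E. ennreal (\<sigma> x) \<partial>lborel)" if "E \<in> sets borel" for E
    using that by (simp add: \<mu>_def emeasure_density)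
  define r where "r = 4 powr \<delta> * c"
  have r: "0 \<le> r" "r < 1" using c \<delta> by (auto simp: r_def)
  \<comment> \<open>The 1 accounts for the points with \<open>\<sigma> x \<le> l\<close>, the series
    for all others; \<open>4 powr \<delta>\<close> comes from bounding layer \<open>k\<close> by the
    next level.\<close>
  define C where "C = 1 + 4 powr \<delta> * (1 / (1 - r))"
  have "0 \<le> C" using r by (auto simp: C_def)
  moreover have "(\<integral>\<^sup>+x\<in>{a..<b}. ennreal (\<sigma> x powr (1 + \<delta>)) \<partial>lborel)
      \<le> ennreal (C * ((b - a) * (S / (b - a)) powr (1 + \<delta>)))"
    if ab: "a < b" and S: "0 < S" "(\<integral>\<^sup>+x\<in>{a..<b}. ennreal (\<sigma> x) \<partial>lborel) = ennreal S" for a b S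
  proof -
    define l where "l = S / (b - a)"
    have l: "0 < l" "l * (b - a) = S" using ab S by (auto simp: l_def)
    define T where "T k = (\<Union>N. dyadic_stop N \<mu> (4 ^ k * l) a b)" for k :: nat
    have T_sub: "T k \<subseteq> {a..<b}" for k
      using dyadic_stop_subset[of a b _ \<mu> "4 ^ k * l"] ab by (auto simp: T_def)
    have T_meas [measurable]: "T k \<in> sets borel" for k by (auto simp: T_def)
    have T_le: "emeasure \<mu> (T k) \<le> ennreal (c ^ k * S)" for k
    proof -
      have "emeasure \<mu> (T k) \<le> ennreal c ^ k * emeasure \<mu> {a..<b}"
        unfolding T_def
        by (rule dyadic_stop_iterate) (use ab l S A in \<open>auto simp: sets_\<mu> \<mu>\<close>)
      also have "\<dots> = ennreal (c ^ k * S)"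
        using S c by (simp add: \<mu> ennreal_mult ennreal_power)
      finally show ?thesis .
    qed
    \<comment> \<open>On the exceptional set \<open>E\<close> the excess
      \<open>\<sigma> x - L\<close> is positive, yet \<open>emeasure_off_stop\<close> forces its
      integral to vanish. The finite length of \<open>E\<close> permits the cancellation in
      \<open>ennreal\<close>.\<close>
    have off: "AE x in lborel. x \<in> {a..<b} \<longrightarrow> x \<notin> T k \<longrightarrow> \<sigma> x \<le> 4 ^ k * l" for k
    proof -
      define L where "L = 4 ^ k * l"
      define E where "E = {x \<in> {a..<b}. x \<notin> T k \<and> L < \<sigma> x}"
      have L: "0 < L" using l by (simp add: L_def)
      have [measurable]: "E \<in> sets borel" unfolding E_def by measurable
      have "emeasure lborel E \<le> emeasure lborel {a..<b}"
        by (intro emeasure_mono) (auto simp: E_def)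
      also have "\<dots> < \<infinity>" using ab by simp
      finally have fin: "emeasure lborel E < \<infinity>" .
      have "emeasure \<mu> E \<le> ennreal L * emeasure lborel E"
        using ab L by (intro emeasure_off_stop[where a = a and b = b]) (auto simp: sets_\<mu> E_def T_def L_def)
      moreover have "emeasure \<mu> E = (\<integral>\<^sup>+x\<in>E. ennreal (\<sigma> x - L) \<partial>lborel) + ennreal L * emeasure lborel E"
      proof -
        have "emeasure \<mu> E = (\<integral>\<^sup>+x. ennreal (\<sigma> x - L) * indicator E x + ennreal L * indicator E x \<partial>lborel)"
          unfolding \<mu>[OF \<open>E \<in> sets borel\<close>] using L
          by (intro nn_integral_cong) (auto simp: indicator_def E_def simp flip: ennreal_plus)
        also have "\<dots> = (\<integral>\<^sup>+x\<in>E. ennreal (\<sigma> x - L) \<partial>lborel) + ennreal L * emeasure lborel E"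
          by (subst nn_integral_add) (auto simp: nn_integral_cmult)
        finally show ?thesis .
      qed
      ultimately have "ennreal L * emeasure lborel E + (\<integral>\<^sup>+x\<in>E. ennreal (\<sigma> x - L) \<partial>lborel) \<le> ennreal L * emeasure lborel E + 0"
        by (simp add: add.commute)
      moreover have "ennreal L * emeasure lborel E < \<infinity>" using fin by (simp add: ennreal_mult_less_top)
      ultimately have "(\<integral>\<^sup>+x\<in>E. ennreal (\<sigma> x - L) \<partial>lborel) = 0"
        by (subst (asm) ennreal_add_left_cancel_le) auto
      then have "AE x in lborel. ennreal (\<sigma> x - L) * indicator E x = 0"
        by (subst (asm) nn_integral_0_iff_AE) auto
      then show ?thesis
      proof eventually_elim
        case (elim x)
        then show ?case by (auto simp: indicator_def E_def L_def ennreal_eq_0_iff split: if_splits)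
      qed
    qed
    let ?s = "\<lambda>k::nat. (4 ^ Suc k * l) powr \<delta>"
    have pw: "AE x in lborel. ennreal (\<sigma> x powr (1 + \<delta>)) * indicator {a..<b} x
       \<le> ennreal (l powr \<delta>) * (ennreal (\<sigma> x) * indicator {a..<b} x)
         + (\<Sum>k. ennreal (?s k) * (ennreal (\<sigma> x) * indicator (T k) x))"
    proof -
      have "AE x in lborel. \<forall>k. x \<in> {a..<b} \<longrightarrow> x \<notin> T k \<longrightarrow> \<sigma> x \<le> 4 ^ k * l"
        unfolding AE_all_countable using off by blast
      then show ?thesis
      proof eventually_elim
        case (elim x)
        show ?case
        proof (cases "x \<in> {a..<b}")
          case x: True
          have ex: "\<exists>k. x \<notin> T k \<or> \<sigma> x \<le> 4 ^ k * l"
          proof -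
            obtain k where "\<sigma> x / l < 4 ^ k" using real_arch_pow[of 4 "\<sigma> x / l"] by auto
            then show ?thesis using l by (intro exI[of _ k]) (auto simp: field_simps)
          qed
          \<comment> \<open>The first level at which the point has left the stopping sets or is
            already small. Minimality puts \<open>x\<close> into the stopping set one level lower,
            whereas the size of \<open>\<sigma> x\<close> is controlled by level \<open>k\<close>:
            hence the shift by one between \<open>?s\<close> and \<open>T\<close>.\<close>
          define k where "k = (LEAST k. x \<notin> T k \<or> \<sigma> x \<le> 4 ^ k * l)"
          have "x \<notin> T k \<or> \<sigma> x \<le> 4 ^ k * l" unfolding k_def using ex by (rule LeastI_ex)
          then have \<sigma>k: "\<sigma> x \<le> 4 ^ k * l" using elim x by auto
          have eq: "\<sigma> x powr (1 + \<delta>) = \<sigma> x powr \<delta> * \<sigma> x" using \<sigma>0[of x] by (simp add: powr_add)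
          show ?thesis
          proof (cases k)
            case 0
            have "\<sigma> x powr (1 + \<delta>) \<le> l powr \<delta> * \<sigma> x"
              unfolding eq using \<sigma>k \<sigma>0[of x] \<delta> 0 by (intro mult_right_mono powr_mono2) auto
            then have "ennreal (\<sigma> x powr (1 + \<delta>)) \<le> ennreal (l powr \<delta>) * ennreal (\<sigma> x)"
              using \<sigma>0[of x] by (simp add: ennreal_mult[symmetric] less_imp_le)
            then show ?thesis using x by (auto intro: order.trans add_increasing2)
          next
            case (Suc j)
            have "x \<in> T j" using not_less_Least[of j "\<lambda>k. x \<notin> T k \<or> \<sigma> x \<le> 4 ^ k * l"] Suc by (auto simp: k_def)
            have "\<sigma> x powr (1 + \<delta>) \<le> ?s j * \<sigma> x"
              unfolding eq using \<sigma>k \<sigma>0[of x] \<delta> Suc by (intro mult_right_mono powr_mono2) auto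
            then have "ennreal (\<sigma> x powr (1 + \<delta>)) * indicator {a..<b} x
              \<le> ennreal (?s j) * (ennreal (\<sigma> x) * indicator (T j) x)"
              using \<sigma>0[of x] x \<open>x \<in> T j\<close> by (simp add: ennreal_mult[symmetric] less_imp_le)
            also have "\<dots> \<le> (\<Sum>k. ennreal (?s k) * (ennreal (\<sigma> x) * indicator (T k) x))"
              using sum_le_suminf[of "\<lambda>k. ennreal (?s k) * (ennreal (\<sigma> x) * indicator (T k) x)" "{j}"] by simp
            finally show ?thesis by (rule order.trans) simp
          qed
        qed auto
      qed
    qed
    have geo: "(\<lambda>k. 4 powr \<delta> * r ^ k) sums (4 powr \<delta> * (1 / (1 - r)))"
      using r by (intro sums_mult geometric_sums) auto
    have lS: "l powr \<delta> * S = (b - a) * l powr (1 + \<delta>)" using l S ab by (simp add: powr_add field_simps l(2)[symmetric])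
    have "(\<integral>\<^sup>+x\<in>{a..<b}. ennreal (\<sigma> x powr (1 + \<delta>)) \<partial>lborel)
      \<le> (\<integral>\<^sup>+x. ennreal (l powr \<delta>) * (ennreal (\<sigma> x) * indicator {a..<b} x)
         + (\<Sum>k. ennreal (?s k) * (ennreal (\<sigma> x) * indicator (T k) x)) \<partial>lborel)"
      by (rule nn_integral_mono_AE[OF pw])
    also have "\<dots> = ennreal (l powr \<delta>) * emeasure \<mu> {a..<b} + (\<Sum>k. ennreal (?s k) * emeasure \<mu> (T k))"
      by (subst nn_integral_add) (auto simp: nn_integral_cmult nn_integral_suminf \<mu>)
    also have "\<dots> \<le> ennreal (l powr \<delta> * S) + (\<Sum>k. ennreal (l powr \<delta> * S * (4 powr \<delta> * r ^ k)))"
    proof (intro add_mono suminf_le)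
      show "ennreal (l powr \<delta>) * emeasure \<mu> {a..<b} \<le> ennreal (l powr \<delta> * S)"
        using S by (simp add: \<mu> ennreal_mult)
      fix k
      have eq: "?s k * (c ^ k * S) = l powr \<delta> * S * (4 powr \<delta> * r ^ k)"
        using l by (simp add: r_def powr_mult powr_realpow[symmetric] powr_powr powr_power power_mult_distrib mult_ac)
      then have "ennreal (?s k) * ennreal (c ^ k * S) = ennreal (l powr \<delta> * S * (4 powr \<delta> * r ^ k))"
        unfolding eq[symmetric] using c S by (intro ennreal_mult[symmetric]) auto
      then show "ennreal (?s k) * emeasure \<mu> (T k) \<le> ennreal (l powr \<delta> * S * (4 powr \<delta> * r ^ k))"
        using mult_left_mono[OF T_le[of k], of "ennreal (?s k)"] by simp
    qed auto
    also have "(\<Sum>k. ennreal (l powr \<delta> * S * (4 powr \<delta> * r ^ k))) = ennreal (l powr \<delta> * S * (4 powr \<delta> * (1 / (1 - r))))"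
      by (rule suminf_ennreal_eq[OF _ sums_mult[OF geo]]) (use r S in auto)
    also have "ennreal (l powr \<delta> * S) + ennreal (l powr \<delta> * S * (4 powr \<delta> * (1 / (1 - r)))) = ennreal (l powr \<delta> * S * C)"
      using r S by (simp add: C_def distrib_left flip: ennreal_plus)
    also have "l powr \<delta> * S * C = C * ((b - a) * (S / (b - a)) powr (1 + \<delta>))"
      using lS by (simp add: l_def[symmetric])
    finally show ?thesis .
  qed
  ultimately show ?thesis by blast
qed

section \<open>Self-improvement of the Muckenhoupt condition\<close>

text \<open>The witnesses \<open>w\<close> and \<open>s\<close> record that both integrals are
  finite and positive, so that all further computations are with real numbers. Half-open intervals
  fit the dyadic splitting.\<close>

definition Ap_bound :: "(real \<Rightarrow> real) \<Rightarrow> real \<Rightarrow> real \<Rightarrow> bool" where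
  "Ap_bound W p A \<longleftrightarrow> 1 < p \<and> W \<in> borel_measurable borel \<and> (\<forall>x. 0 < W x) \<and>
    (\<forall>a b. a < b \<longrightarrow> (\<exists>w s. 0 < w \<and> 0 < s \<and> (\<integral>\<^sup>+x\<in>{a..<b}. ennreal (W x) \<partial>lborel) = ennreal w \<and>
      (\<integral>\<^sup>+x\<in>{a..<b}. ennreal (W x powr (1 / (1 - p))) \<partial>lborel) = ennreal s \<and>
      w / (b - a) * (s / (b - a)) powr (p - 1) \<le> A))"

lemma Ap_boundE:
  assumes "Ap_bound W p A" "a < b"
  obtains w s where "0 < w" "0 < s" "(\<integral>\<^sup>+x\<in>{a..<b}. ennreal (W x) \<partial>lborel) = ennreal w"
    "(\<integral>\<^sup>+x\<in>{a..<b}. ennreal (W x powr (1 / (1 - p))) \<partial>lborel) = ennreal s"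
    "w / (b - a) * (s / (b - a)) powr (p - 1) \<le> A"
  using assms unfolding Ap_bound_def by blast

lemma nn_integral_Ico_pos:
  fixes f :: "real \<Rightarrow> real"
  assumes [measurable]: "f \<in> borel_measurable borel" and "\<And>x. 0 < f x" "a < b"
  shows "0 < (\<integral>\<^sup>+x\<in>{a..<b}. ennreal (f x) \<partial>lborel)"
proof (rule ccontr)
  assume "\<not> ?thesis"
  then have "(\<integral>\<^sup>+x\<in>{a..<b}. ennreal (f x) \<partial>lborel) = 0" by (simp add: zero_less_iff_neq_zero)
  then have "AE x in lborel. ennreal (f x) * indicator {a..<b} x = 0"
    by (subst (asm) nn_integral_0_iff_AE) auto
  then have "AE x in lborel. x \<notin> {a..<b}"
  proof eventually_elim
    case (elim x)
    then show ?case using assms(2)[of x] by (auto simp: indicator_def ennreal_eq_0_iff split: if_splits)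
  qed
  then have "{a..<b} \<in> null_sets lborel" by (subst AE_iff_null_sets) auto
  then have "emeasure lborel {a..<b} = 0" by auto
  then show False using \<open>a < b\<close> by simp
qed

lemma Ap_bound_pos:
  assumes "Ap_bound W p A" shows "0 < A"
proof -
  obtain w s :: real where *: "0 < w" "0 < s" "w / (1 - 0) * (s / (1 - 0)) powr (p - 1) \<le> A"
    by (rule Ap_boundE[OF assms, of 0 1]) auto
  then have "0 < w / (1 - 0) * (s / (1 - 0)) powr (p - 1)" by simp
  with * show ?thesis by linarith
qed

text \<open>The complement \<open>E'\<close> has at least half of the length. Hoelder's inequality
  for \<open>\<sigma> x powr (1 / q) * W x powr (1 / p) = 1\<close> on \<open>E'\<close> bounds this
  length by the \<open>\<sigma>\<close>-mass of \<open>E'\<close> and the \<open>W\<close>-mass of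
  the whole interval, and the Muckenhoupt bound trades the latter for the
  \<open>\<sigma>\<close>-mass of the interval. So \<open>E'\<close> keeps at least a fixed share
  \<open>\<gamma>\<close> of the mass, and \<open>E\<close> gets at most
  \<open>1 - \<gamma>\<close>.\<close>

lemma Ap_bound_Ainfty:
  assumes Ap: "Ap_bound W p A"
  defines "\<sigma> \<equiv> \<lambda>x. W x powr (1 / (1 - p))"
  shows "\<exists>c. 0 < c \<and> c < 1 \<and> (\<forall>a b E. a < b \<longrightarrow> E \<in> sets borel \<longrightarrow> E \<subseteq> {a..<b} \<longrightarrow> 2 * emeasure lborel E \<le> ennreal (b - a)
       \<longrightarrow> (\<integral>\<^sup>+x\<in>E. ennreal (\<sigma> x) \<partial>lborel) \<le> ennreal c * (\<integral>\<^sup>+x\<in>{a..<b}. ennreal (\<sigma> x) \<partial>lborel))"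
proof -
  have p: "1 < p" and [measurable]: "W \<in> borel_measurable borel" and W0: "\<And>x. 0 < W x"
    using Ap by (auto simp: Ap_bound_def)
  have A: "0 < A" using Ap by (rule Ap_bound_pos)
  have [measurable]: "\<sigma> \<in> borel_measurable borel" unfolding \<sigma>_def by measurable
  have \<sigma>0: "0 < \<sigma> x" for x using W0[of x] by (simp add: \<sigma>_def)
  define q where "q = p / (p - 1)"
  have q: "1 < q" "1 / q = (p - 1) / p" "q / (q - 1) = p" "1 - 1 / q = 1 / p"
    using p by (auto simp: q_def field_simps)
  \<comment> \<open>The solution of
    \<open>2 powr (- p) * s powr (p - 1) = A * s2 powr (p - 1)\<close> for the ratio
    \<open>s2 / s\<close>.\<close>
  define \<gamma> where "\<gamma> = (2 powr (- p) / A) powr (1 / (p - 1))"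
  have \<gamma>: "0 < \<gamma>" using A by (simp add: \<gamma>_def)
  \<comment> \<open>The maximum with \<open>1 / 2\<close> guarantees \<open>0 < c\<close>, so that a
    logarithm of \<open>c\<close> can be taken later.\<close>
  define c where "c = max (1 - \<gamma>) (1 / 2)"
  have main: "(\<integral>\<^sup>+x\<in>E. ennreal (\<sigma> x) \<partial>lborel) \<le> ennreal c * (\<integral>\<^sup>+x\<in>{a..<b}. ennreal (\<sigma> x) \<partial>lborel)"
    if ab: "a < b" and [measurable]: "E \<in> sets borel" and E: "E \<subseteq> {a..<b}" "2 * emeasure lborel E \<le> ennreal (b - a)" for a b E
  proof -
    obtain w s where w: "0 < w" "0 < s" "(\<integral>\<^sup>+x\<in>{a..<b}. ennreal (W x) \<partial>lborel) = ennreal w"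
      "(\<integral>\<^sup>+x\<in>{a..<b}. ennreal (\<sigma> x) \<partial>lborel) = ennreal s"
      "w / (b - a) * (s / (b - a)) powr (p - 1) \<le> A"
      unfolding \<sigma>_def by (rule Ap_boundE[OF Ap ab])
    define E' where "E' = {a..<b} - E"
    have [measurable]: "E' \<in> sets borel" by (simp add: E'_def)
    have split: "(\<integral>\<^sup>+x\<in>{a..<b}. f x \<partial>lborel) = (\<integral>\<^sup>+x\<in>E. f x \<partial>lborel) + (\<integral>\<^sup>+x\<in>E'. f x \<partial>lborel)"
      if [measurable]: "f \<in> borel_measurable borel" for f :: "real \<Rightarrow> ennreal"
      using E by (subst nn_integral_add[symmetric]) (auto intro!: nn_integral_cong simp: E'_def indicator_def)
    have fin: "emeasure lborel E < \<infinity>" "emeasure lborel E' < \<infinity>"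
    proof -
      have "emeasure lborel E \<le> emeasure lborel {a..<b}" "emeasure lborel E' \<le> emeasure lborel {a..<b}"
        using E by (auto intro!: emeasure_mono simp: E'_def)
      moreover have "emeasure lborel {a..<b} < \<infinity>" using ab by simp
      ultimately show "emeasure lborel E < \<infinity>" "emeasure lborel E' < \<infinity>" by (auto intro: order.strict_trans1)
    qed
    define e e' where "e = measure lborel E" and "e' = measure lborel E'"
    have e: "emeasure lborel E = ennreal e" "emeasure lborel E' = ennreal e'" "0 \<le> e" "0 \<le> e'"
      using fin by (auto simp: e_def e'_def emeasure_eq_ennreal_measure less_top[symmetric])
    have "ennreal (b - a) = ennreal e + ennreal e'"
      using split[of "\<lambda>_. 1"] ab by (simp add: e)
    then have ee: "e + e' = b - a" using e ab by (simp flip: ennreal_plus)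
    have "ennreal (2 * e) \<le> ennreal (b - a)" using E(2) e ennreal_mult[of 2 e] by simp
    then have "2 * e \<le> b - a" using ab by (subst (asm) ennreal_le_iff) auto
    with ee have e'_ge: "(b - a) / 2 \<le> e'" by simp
    define s1 s2 where "s1 = enn2real (\<integral>\<^sup>+x\<in>E. ennreal (\<sigma> x) \<partial>lborel)" and "s2 = enn2real (\<integral>\<^sup>+x\<in>E'. ennreal (\<sigma> x) \<partial>lborel)"
    have sfin: "(\<integral>\<^sup>+x\<in>E. ennreal (\<sigma> x) \<partial>lborel) + (\<integral>\<^sup>+x\<in>E'. ennreal (\<sigma> x) \<partial>lborel) = ennreal s"
      using w(4) by (simp add: split)
    then have s: "(\<integral>\<^sup>+x\<in>E. ennreal (\<sigma> x) \<partial>lborel) = ennreal s1" "(\<integral>\<^sup>+x\<in>E'. ennreal (\<sigma> x) \<partial>lborel) = ennreal s2" "0 \<le> s1" "0 \<le> s2"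
      by (auto simp: s1_def s2_def less_top[symmetric] intro!: ennreal_enn2real[symmetric])
    have ss: "s1 + s2 = s" using sfin s w by (simp flip: ennreal_plus)
    have "(\<integral>\<^sup>+x. ennreal ((\<sigma> x powr (1 / q) * indicator E' x) * (W x powr (1 / p) * indicator {a..<b} x)) \<partial>lborel)
      \<le> ennreal (s2 powr (1 / q) * w powr (1 - 1 / q))"
    proof (rule nn_integral_Holder)
      have "(\<integral>\<^sup>+x. ennreal ((\<sigma> x powr (1 / q) * indicator E' x) powr q) \<partial>lborel) = (\<integral>\<^sup>+x\<in>E'. ennreal (\<sigma> x) \<partial>lborel)"
        using q \<sigma>0 by (intro nn_integral_cong) (auto simp: indicator_def powr_powr less_imp_le)
      then show "(\<integral>\<^sup>+x. ennreal ((\<sigma> x powr (1 / q) * indicator E' x) powr q) \<partial>lborel) \<le> ennreal s2" using s by simp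
      have "(\<integral>\<^sup>+x. ennreal ((W x powr (1 / p) * indicator {a..<b} x) powr (q / (q - 1))) \<partial>lborel)
        = (\<integral>\<^sup>+x\<in>{a..<b}. ennreal (W x) \<partial>lborel)"
        unfolding q using p W0 by (intro nn_integral_cong) (auto simp: indicator_def powr_powr less_imp_le)
      then show "(\<integral>\<^sup>+x. ennreal ((W x powr (1 / p) * indicator {a..<b} x) powr (q / (q - 1))) \<partial>lborel) \<le> ennreal w"
        using w by simp
    qed (use q s w in auto)
    also have "(\<integral>\<^sup>+x. ennreal ((\<sigma> x powr (1 / q) * indicator E' x) * (W x powr (1 / p) * indicator {a..<b} x)) \<partial>lborel)
      = (\<integral>\<^sup>+x. indicator E' x \<partial>lborel)"
    proof (intro nn_integral_cong)
      fix x
      have "\<sigma> x powr (1 / q) = W x powr (- 1 / p)"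
        using p unfolding \<sigma>_def powr_powr q(2) by (intro arg_cong[of _ _ "\<lambda>t. W x powr t"]) (auto simp: field_simps)
      then have "\<sigma> x powr (1 / q) * W x powr (1 / p) = 1"
        using W0[of x] by (simp add: powr_minus_divide)
      then show "ennreal ((\<sigma> x powr (1 / q) * indicator E' x) * (W x powr (1 / p) * indicator {a..<b} x)) = indicator E' x"
        by (auto simp: indicator_def E'_def)
    qed
    finally have "ennreal e' \<le> ennreal (s2 powr (1 / q) * w powr (1 / p))" using e q by simp
    then have "e' \<le> s2 powr (1 / q) * w powr (1 / p)" by (simp add: ennreal_le_iff)
    then have "((b - a) / 2) powr p \<le> (s2 powr (1 / q) * w powr (1 / p)) powr p"
      using e'_ge ab p by (intro powr_mono2) auto
    also have "\<dots> = s2 powr (p - 1) * w"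
      using p w s q by (simp add: powr_mult powr_powr)
    finally have 1: "((b - a) / 2) powr p \<le> s2 powr (p - 1) * w" .
    have "w * s powr (p - 1) = (w / (b - a) * (s / (b - a)) powr (p - 1)) * (b - a) powr p"
      using ab w by (simp add: powr_divide powr_diff field_simps)
    also have "\<dots> \<le> A * (b - a) powr p" using w by (intro mult_right_mono) auto
    finally have 2: "w * s powr (p - 1) \<le> A * (b - a) powr p" .
    have "(2 powr (- p) / A) * s powr (p - 1) \<le> s2 powr (p - 1)"
    proof -
      have "(b - a) powr p * (w * s powr (p - 1)) * 2 powr (-p) = ((b - a) / 2) powr p * (w * s powr (p - 1))"
        using ab by (simp add: powr_divide powr_minus field_simps)
      also have "\<dots> \<le> (s2 powr (p - 1) * w) * (A * (b - a) powr p)"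
        by (rule mult_mono[OF 1 2]) (use w s A in auto)
      finally have "(w * (b - a) powr p) * (2 powr (- p) * s powr (p - 1)) \<le> (w * (b - a) powr p) * (A * s2 powr (p - 1))"
        by (simp add: mult_ac)
      then have "2 powr (- p) * s powr (p - 1) \<le> A * s2 powr (p - 1)"
        using w ab by (subst (asm) mult_le_cancel_left_pos) auto
      then show ?thesis using A by (simp add: field_simps)
    qed
    then have "((2 powr (- p) / A) * s powr (p - 1)) powr (1 / (p - 1)) \<le> (s2 powr (p - 1)) powr (1 / (p - 1))"
      using p A by (intro powr_mono2) auto
    moreover have "((2 powr (- p) / A) * s powr (p - 1)) powr (1 / (p - 1)) = \<gamma> * s"
      by (subst powr_mult) (use p A w in \<open>auto simp: powr_powr \<gamma>_def\<close>)
    ultimately have "\<gamma> * s \<le> s2" using p s by (simp add: powr_powr)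
    then have "s1 \<le> (1 - \<gamma>) * s" using ss by (simp add: algebra_simps)
    also have "\<dots> \<le> c * s" using w by (intro mult_right_mono) (auto simp: c_def)
    finally have "ennreal s1 \<le> ennreal (c * s)" by (rule ennreal_leI)
    also have "\<dots> = ennreal c * ennreal s" using w by (intro ennreal_mult) (auto simp: c_def)
    finally show ?thesis using s w by simp
  qed
  have "0 < c" "c < 1" using \<gamma> by (auto simp: c_def)
  with main show ?thesis by blast
qed

text \<open>The reverse Hoelder inequality for \<open>\<sigma>\<close> with exponent
  \<open>1 + \<delta>\<close> becomes the Muckenhoupt bound for \<open>p0\<close> as soon as
  \<open>(1 + \<delta>) * (p0 - 1) = p - 1\<close>, because then
  \<open>\<sigma> x powr (1 + \<delta>)\<close> is the dual weight for \<open>p0\<close>. A whole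
  range of exponents is covered, not just one, since the exponent finally needed is dictated by the
  Young function.\<close>

lemma Ap_bound_open_ended:
  assumes Ap: "Ap_bound W p A"
  shows "\<exists>p1. 1 \<le> p1 \<and> p1 < p \<and> (\<forall>p0. p1 < p0 \<longrightarrow> p0 \<le> p \<longrightarrow> (\<exists>A0. Ap_bound W p0 A0))"
proof -
  have p: "1 < p" and [measurable]: "W \<in> borel_measurable borel" and W0: "\<And>x. 0 < W x"
    using Ap by (auto simp: Ap_bound_def)
  define \<sigma> where "\<sigma> = (\<lambda>x. W x powr (1 / (1 - p)))"
  have [measurable]: "\<sigma> \<in> borel_measurable borel" unfolding \<sigma>_def by measurable
  have \<sigma>0: "0 < \<sigma> x" for x using W0[of x] by (simp add: \<sigma>_def)
  obtain c where c: "0 < c" "c < 1" and A': "\<And>a b E. a < b \<Longrightarrow> E \<in> sets borel \<Longrightarrow> E \<subseteq> {a..<b} \<Longrightarrow> 2 * emeasure lborel E \<le> ennreal (b - a)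
       \<Longrightarrow> (\<integral>\<^sup>+x\<in>E. ennreal (\<sigma> x) \<partial>lborel) \<le> ennreal c * (\<integral>\<^sup>+x\<in>{a..<b}. ennreal (\<sigma> x) \<partial>lborel)"
    using Ap_bound_Ainfty[OF Ap] unfolding \<sigma>_def by blast
  \<comment> \<open>Chosen so that \<open>4 powr d = c powr (- 1 / 2)\<close>; then
    \<open>4 powr d * c\<close> is the square root of \<open>c\<close>, hence below 1.\<close>
  define d where "d = - ln c / (2 * ln 4)"
  have d: "0 < d" using c divide_neg_pos[of "ln c" "2 * ln 4"] by (simp add: d_def)
  have "4 powr d = c powr (- 1 / 2)" using c by (simp add: powr_def d_def)
  then have dc: "4 powr d * c = c powr (1 / 2)"
    using c powr_add[of c "- 1 / 2" 1] by simp
  have dc1: "c powr (1 / 2) < 1" using c powr_less_mono2[of "1 / 2" c 1] by simp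
  \<comment> \<open>The exponent \<open>p0\<close> that corresponds to the largest admissible value
    \<open>\<delta> = d\<close>.\<close>
  define p1 where "p1 = 1 + (p - 1) / (1 + d)"
  have "1 \<le> p1" "p1 < p" using p d by (auto simp: p1_def field_simps)
  moreover have "\<exists>A0. Ap_bound W p0 A0" if p0: "p1 < p0" "p0 \<le> p" for p0
  proof -
    have p01: "1 < p0" using p0 \<open>1 \<le> p1\<close> by simp
    define \<delta> where "\<delta> = (p - 1) / (p0 - 1) - 1"
    have \<delta>: "0 \<le> \<delta>" "\<delta> \<le> d" "(1 + \<delta>) * (p0 - 1) = p - 1"
      using p0 p01 d p by (auto simp: \<delta>_def p1_def field_simps)
    have "4 powr \<delta> * c \<le> 4 powr d * c" using \<delta> c by (intro mult_right_mono powr_mono) auto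
    then have \<delta>c: "4 powr \<delta> * c < 1" using dc dc1 by simp
    obtain C where C: "0 \<le> C" and rh: "\<And>a b S. a < b \<Longrightarrow> 0 < S \<Longrightarrow> (\<integral>\<^sup>+x\<in>{a..<b}. ennreal (\<sigma> x) \<partial>lborel) = ennreal S \<Longrightarrow>
      (\<integral>\<^sup>+x\<in>{a..<b}. ennreal (\<sigma> x powr (1 + \<delta>)) \<partial>lborel) \<le> ennreal (C * ((b - a) * (S / (b - a)) powr (1 + \<delta>)))"
      using reverse_Holder[of \<sigma> c \<delta>] \<sigma>0 c \<delta> \<delta>c A' by auto
    have ex: "1 / (1 - p) * (1 + \<delta>) = 1 / (1 - p0)"
    proof -
      have "1 / (1 - p) = - (1 / (p - 1))" "1 / (1 - p0) = - (1 / (p0 - 1))"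
        using p p01 by (auto simp: divide_simps)
      then show ?thesis using p p01 by (simp add: \<delta>_def)
    qed
    have W\<sigma>: "W x powr (1 / (1 - p0)) = \<sigma> x powr (1 + \<delta>)" for x
      by (simp only: \<sigma>_def powr_powr ex)
    have "\<exists>w s. 0 < w \<and> 0 < s \<and> (\<integral>\<^sup>+x\<in>{a..<b}. ennreal (W x) \<partial>lborel) = ennreal w \<and>
      (\<integral>\<^sup>+x\<in>{a..<b}. ennreal (W x powr (1 / (1 - p0))) \<partial>lborel) = ennreal s \<and>
      w / (b - a) * (s / (b - a)) powr (p0 - 1) \<le> C powr (p0 - 1) * A" if ab: "a < b" for a b
    proof -
      obtain w s where w: "0 < w" "0 < s" "(\<integral>\<^sup>+x\<in>{a..<b}. ennreal (W x) \<partial>lborel) = ennreal w"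
        "(\<integral>\<^sup>+x\<in>{a..<b}. ennreal (\<sigma> x) \<partial>lborel) = ennreal s"
        "w / (b - a) * (s / (b - a)) powr (p - 1) \<le> A"
        unfolding \<sigma>_def by (rule Ap_boundE[OF Ap ab])
      let ?I = "\<integral>\<^sup>+x\<in>{a..<b}. ennreal (\<sigma> x powr (1 + \<delta>)) \<partial>lborel"
      let ?B = "C * ((b - a) * (s / (b - a)) powr (1 + \<delta>))"
      have I: "?I \<le> ennreal ?B" by (rule rh[OF ab w(2,4)])
      have I0: "0 < ?I" using \<sigma>0 ab by (intro nn_integral_Ico_pos) (auto simp: less_le)
      obtain s' where s': "?I = ennreal s'" "0 \<le> s'" using I by (cases ?I) (auto simp: top_unique)
      then have s'0: "0 < s'" using I0 by (cases "s' = 0") auto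
      have B: "s' \<le> ?B" using I s' C ab by (simp add: ennreal_le_iff)
      have "s' / (b - a) \<le> C * (s / (b - a)) powr (1 + \<delta>)" using B ab by (simp add: field_simps)
      then have "(s' / (b - a)) powr (p0 - 1) \<le> (C * (s / (b - a)) powr (1 + \<delta>)) powr (p0 - 1)"
        using s' ab p01 by (intro powr_mono2) auto
      also have "\<dots> = C powr (p0 - 1) * (s / (b - a)) powr (p - 1)"
        using C by (simp add: powr_mult powr_powr \<delta>)
      finally have "w / (b - a) * (s' / (b - a)) powr (p0 - 1) \<le> w / (b - a) * (C powr (p0 - 1) * (s / (b - a)) powr (p - 1))"
        using w ab by (intro mult_left_mono) auto
      also have "\<dots> = C powr (p0 - 1) * (w / (b - a) * (s / (b - a)) powr (p - 1))" by (simp add: mult_ac)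
      also have "\<dots> \<le> C powr (p0 - 1) * A" using w by (intro mult_left_mono) auto
      finally show ?thesis using w s' s'0 by (auto simp: W\<sigma>)
    qed
    then show ?thesis using p01 W0 unfolding Ap_bound_def by (intro exI[of _ "C powr (p0 - 1) * A"]) auto
  qed
  ultimately show ?thesis by blast
qed

section \<open>Integrals of periodic functions\<close>

text \<open>A polymorphic version of \<open>periodic_2pi\<close>, since functions with values in
  \<open>ennreal\<close> are treated as well.\<close>

definition per :: "(real \<Rightarrow> 'a) \<Rightarrow> bool" where
  "per f \<longleftrightarrow> (\<forall>x. f (x + 2 * pi) = f x)"

text \<open>The period is half-open so that its translates tile the line without overlap.\<close>

definition per_int :: "(real \<Rightarrow> ennreal) \<Rightarrow> ennreal" where
  "per_int F = (\<integral>\<^sup>+x\<in>{0..<2*pi}. F x \<partial>lborel)"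

lemma perD: "per f \<Longrightarrow> f (x + 2 * pi) = f x"
  by (simp add: per_def)

lemma per_of_int:
  assumes "per f" shows "f (x + 2 * pi * of_int k) = f x"
proof (induction k arbitrary: x rule: int_induct[where k = 0])
  case (step1 i)
  have "f (x + 2 * pi * of_int (i + 1)) = f ((x + 2 * pi * of_int i) + 2 * pi)"
    by (rule arg_cong[of _ _ f]) (simp add: algebra_simps)
  then show ?case using step1 perD[OF assms] by simp
next
  case (step2 i)
  have "f (x + 2 * pi * of_int (i - 1)) = f ((x + 2 * pi * of_int (i - 1)) + 2 * pi)"
    using perD[OF assms] by simp
  also have "\<dots> = f (x + 2 * pi * of_int i)" by (rule arg_cong[of _ _ f]) (simp add: algebra_simps)
  finally show ?case using step2 by simp
qed simp

lemma per_shift: "per f \<Longrightarrow> per (\<lambda>x. f (x + t))"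
  using perD[of f "_ + t"] by (simp add: per_def add_ac)

lemma per_shift_minus: "per f \<Longrightarrow> per (\<lambda>x. f (x - t))"
  using per_shift[of f "- t"] by simp

lemma nn_integral_shift:
  fixes f :: "real \<Rightarrow> ennreal"
  assumes [measurable]: "f \<in> borel_measurable borel"
  shows "(\<integral>\<^sup>+x. f (x + t) \<partial>lborel) = (\<integral>\<^sup>+x. f x \<partial>lborel)"
  using nn_integral_real_affine[of f 1 t] by (simp add: add.commute)

lemma nn_integral_reflect:
  fixes f :: "real \<Rightarrow> ennreal"
  assumes [measurable]: "f \<in> borel_measurable borel"
  shows "(\<integral>\<^sup>+x. f (- x) \<partial>lborel) = (\<integral>\<^sup>+x. f x \<partial>lborel)"
  using nn_integral_real_affine[of f "- 1" 0] by simp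

lemma nn_integral_Ico_split:
  fixes f :: "real \<Rightarrow> ennreal"
  assumes [measurable]: "f \<in> borel_measurable borel" and "a \<le> b" "b \<le> c"
  shows "(\<integral>\<^sup>+x\<in>{a..<c}. f x \<partial>lborel) = (\<integral>\<^sup>+x\<in>{a..<b}. f x \<partial>lborel) + (\<integral>\<^sup>+x\<in>{b..<c}. f x \<partial>lborel)"
  using assms by (subst nn_integral_add[symmetric]) (auto intro!: nn_integral_cong simp: indicator_def)

lemma nn_integral_Ico_shift:
  fixes f :: "real \<Rightarrow> ennreal"
  assumes [measurable]: "f \<in> borel_measurable borel"
  shows "(\<integral>\<^sup>+x\<in>{a..<b}. f (x + t) \<partial>lborel) = (\<integral>\<^sup>+x\<in>{a+t..<b+t}. f x \<partial>lborel)"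
  by (subst nn_integral_shift[symmetric, of _ t]) (auto intro!: nn_integral_cong simp: indicator_def)

text \<open>After a shift by a multiple of the period the interval starts inside
  \<open>{0..<2*pi}\<close>; the piece beyond \<open>2 * pi\<close> is moved back and fills the gap
  at the beginning.\<close>

lemma per_int_Ico:
  assumes [measurable]: "F \<in> borel_measurable borel" and "per F"
  shows "(\<integral>\<^sup>+x\<in>{t..<t+2*pi}. F x \<partial>lborel) = per_int F"
proof -
  define k where "k = \<lfloor>t / (2 * pi)\<rfloor>"
  define s where "s = t - 2 * pi * of_int k"
  have "of_int k \<le> t / (2 * pi)" "t / (2 * pi) < of_int k + 1" by (auto simp: k_def)
  then have s: "0 \<le> s" "s < 2 * pi" by (auto simp: s_def field_simps)
  have "(\<integral>\<^sup>+x\<in>{t..<t+2*pi}. F x \<partial>lborel) = (\<integral>\<^sup>+x\<in>{s + 2 * pi * of_int k..<(s + 2 * pi) + 2 * pi * of_int k}. F x \<partial>lborel)"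
    by (simp add: s_def)
  also have "\<dots> = (\<integral>\<^sup>+x\<in>{s..<s + 2 * pi}. F (x + 2 * pi * of_int k) \<partial>lborel)"
    by (rule nn_integral_Ico_shift[symmetric]) simp
  also have "\<dots> = (\<integral>\<^sup>+x\<in>{s..<s + 2 * pi}. F x \<partial>lborel)"
    by (simp add: per_of_int[OF \<open>per F\<close>])
  also have "\<dots> = (\<integral>\<^sup>+x\<in>{s..<2 * pi}. F x \<partial>lborel) + (\<integral>\<^sup>+x\<in>{0 + 2 * pi..<s + 2 * pi}. F x \<partial>lborel)"
    using s by (subst nn_integral_Ico_split[of F s "2 * pi"]) auto
  also have "(\<integral>\<^sup>+x\<in>{0 + 2 * pi..<s + 2 * pi}. F x \<partial>lborel) = (\<integral>\<^sup>+x\<in>{0..<s}. F x \<partial>lborel)"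
    by (subst nn_integral_Ico_shift[symmetric]) (auto simp: perD[OF \<open>per F\<close>])
  finally show ?thesis
    using s nn_integral_Ico_split[of F 0 s "2 * pi"] by (simp add: per_int_def add.commute)
qed

lemma per_int_shift:
  assumes [measurable]: "F \<in> borel_measurable borel" and "per F"
  shows "per_int (\<lambda>x. F (x + t)) = per_int F"
proof -
  have "per_int (\<lambda>x. F (x + t)) = (\<integral>\<^sup>+x\<in>{0 + t..<2 * pi + t}. F x \<partial>lborel)"
    unfolding per_int_def by (rule nn_integral_Ico_shift) simp
  then show ?thesis using per_int_Ico[OF assms, of t] by (simp add: add.commute)
qed

lemma per_int_Ico_finite:
  assumes [measurable]: "F \<in> borel_measurable borel" and "per F" "per_int F < \<infinity>"
  shows "(\<integral>\<^sup>+x\<in>{a..<b}. F x \<partial>lborel) < \<infinity>"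
proof -
  have *: "(\<integral>\<^sup>+x\<in>{a..<a + 2 * pi * real n}. F x \<partial>lborel) < \<infinity>" for n
  proof (induction n)
    case (Suc n)
    have eq: "a + 2 * pi * real (Suc n) = (a + 2 * pi * real n) + 2 * pi" by (simp add: algebra_simps)
    have "(\<integral>\<^sup>+x\<in>{a..<a + 2 * pi * real (Suc n)}. F x \<partial>lborel)
      = (\<integral>\<^sup>+x\<in>{a..<a + 2 * pi * real n}. F x \<partial>lborel) + per_int F"
      unfolding eq by (subst nn_integral_Ico_split[of F a "a + 2 * pi * real n"]) (auto simp: per_int_Ico[OF assms(1,2)])
    then show ?case using Suc assms(3) by simp
  qed auto
  obtain n :: nat where "(b - a) / (2 * pi) \<le> real n" using real_arch_simple by blast
  then have "b \<le> a + 2 * pi * real n" by (simp add: field_simps)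
  then have "(\<integral>\<^sup>+x\<in>{a..<b}. F x \<partial>lborel) \<le> (\<integral>\<^sup>+x\<in>{a..<a + 2 * pi * real n}. F x \<partial>lborel)"
    by (intro nn_integral_mono) (auto simp: indicator_def)
  also have "\<dots> < \<infinity>" by (rule *)
  finally show ?thesis .
qed

lemma per_int_mono: "(\<And>x. F x \<le> G x) \<Longrightarrow> per_int F \<le> per_int G"
  unfolding per_int_def by (intro nn_integral_mono mult_right_mono) auto

lemma per_int_add:
  "F \<in> borel_measurable borel \<Longrightarrow> G \<in> borel_measurable borel \<Longrightarrow> per_int (\<lambda>x. F x + G x) = per_int F + per_int G"
  unfolding per_int_def by (subst nn_integral_add[symmetric]) (auto simp: distrib_right)

lemma per_int_cmult:
  "F \<in> borel_measurable borel \<Longrightarrow> per_int (\<lambda>x. c * F x) = c * per_int F"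
  unfolding per_int_def by (subst nn_integral_cmult[symmetric]) (auto simp: mult_ac)

lemma per_int_nn_integral_swap:
  assumes [measurable]: "(\<lambda>(x, t). H x t) \<in> borel_measurable (borel \<Otimes>\<^sub>M borel)"
  shows "per_int (\<lambda>x. \<integral>\<^sup>+t. H x t \<partial>lborel) = (\<integral>\<^sup>+t. per_int (\<lambda>x. H x t) \<partial>lborel)"
proof -
  have "per_int (\<lambda>x. \<integral>\<^sup>+t. H x t \<partial>lborel) = (\<integral>\<^sup>+x. \<integral>\<^sup>+t. H x t * indicator {0..<2*pi} x \<partial>lborel \<partial>lborel)"
    unfolding per_int_def by (subst nn_integral_multc) auto
  also have "\<dots> = (\<integral>\<^sup>+t. \<integral>\<^sup>+x. H x t * indicator {0..<2*pi} x \<partial>lborel \<partial>lborel)"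
    by (rule lborel_pair.Fubini') measurable
  finally show ?thesis by (simp add: per_int_def)
qed

lemma per_int_conv:
  assumes [measurable]: "k \<in> borel_measurable borel" "H \<in> borel_measurable borel" and "per H"
  shows "per_int (\<lambda>x. \<integral>\<^sup>+t. k t * H (x + t) \<partial>lborel) = (\<integral>\<^sup>+t. k t \<partial>lborel) * per_int H"
proof -
  have "per_int (\<lambda>x. \<integral>\<^sup>+t. k t * H (x + t) \<partial>lborel) = (\<integral>\<^sup>+t. per_int (\<lambda>x. k t * H (x + t)) \<partial>lborel)"
    by (rule per_int_nn_integral_swap) measurable
  also have "\<dots> = (\<integral>\<^sup>+t. k t * per_int H \<partial>lborel)"
    by (simp add: per_int_cmult per_int_shift[OF assms(2,3)])
  also have "\<dots> = (\<integral>\<^sup>+t. k t \<partial>lborel) * per_int H" by (rule nn_integral_multc) simp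
  finally show ?thesis .
qed

text \<open>Interchange the integrals and translate by \<open>- t\<close> within the period. This
  moves an average from a function to the density of a test function, which is the form in which
  duality is used.\<close>

lemma per_int_conv_adjoint:
  assumes [measurable]: "k \<in> borel_measurable borel" "F \<in> borel_measurable borel" "u \<in> borel_measurable borel"
    and "per F" "per u"
  shows "per_int (\<lambda>x. (\<integral>\<^sup>+t. k t * F (x + t) \<partial>lborel) * u x) = per_int (\<lambda>x. F x * (\<integral>\<^sup>+t. k t * u (x - t) \<partial>lborel))"
proof -
  have "per_int (\<lambda>x. (\<integral>\<^sup>+t. k t * F (x + t) \<partial>lborel) * u x) = per_int (\<lambda>x. \<integral>\<^sup>+t. k t * F (x + t) * u x \<partial>lborel)"
    by (subst nn_integral_multc) auto
  also have "\<dots> = (\<integral>\<^sup>+t. per_int (\<lambda>x. k t * F (x + t) * u x) \<partial>lborel)"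
    by (rule per_int_nn_integral_swap) measurable
  also have "\<dots> = (\<integral>\<^sup>+t. per_int (\<lambda>x. F x * (k t * u (x - t))) \<partial>lborel)"
  proof (intro nn_integral_cong)
    fix t
    have "per (\<lambda>x. F x * (k t * u (x - t)))"
      using \<open>per F\<close> per_shift_minus[OF \<open>per u\<close>, of t] by (simp add: per_def)
    from per_int_shift[OF _ this, of t]
    show "per_int (\<lambda>x. k t * F (x + t) * u x) = per_int (\<lambda>x. F x * (k t * u (x - t)))"
      by (simp add: mult_ac)
  qed
  also have "\<dots> = per_int (\<lambda>x. \<integral>\<^sup>+t. F x * (k t * u (x - t)) \<partial>lborel)"
    by (rule per_int_nn_integral_swap[symmetric]) measurable
  also have "\<dots> = per_int (\<lambda>x. F x * (\<integral>\<^sup>+t. k t * u (x - t) \<partial>lborel))"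
    by (subst nn_integral_cmult) auto
  finally show ?thesis .
qed

lemma nn_conv_borel [measurable]:
  fixes k F :: "real \<Rightarrow> ennreal"
  assumes [measurable]: "k \<in> borel_measurable borel" "F \<in> borel_measurable borel"
  shows "(\<lambda>x. \<integral>\<^sup>+t. k t * F (x + t) \<partial>lborel) \<in> borel_measurable borel"
  by measurable

lemma nn_conv_per: "per F \<Longrightarrow> per (\<lambda>x. \<integral>\<^sup>+t. k t * F (x + t) \<partial>lborel)"
  using perD[of F "_ + _"] by (simp add: per_def add_ac)

section \<open>Orlicz norms by duality and the modular inequality on an interval\<close>

definition wtests :: "(real \<Rightarrow> real) \<Rightarrow> (real \<Rightarrow> real) \<Rightarrow> (real \<Rightarrow> real) set" where
  "wtests \<phi> W = {g. g \<in> borel_measurable borel \<and> per g \<and> (\<forall>x. 0 \<le> g x) \<and>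
     per_int (\<lambda>x. young_compl \<phi> (g x) * ennreal (W x)) \<le> 1}"

text \<open>Test functions may be taken nonnegative because only their moduli enter the norm;
  \<open>orlicz_norm_eq_wnorm\<close> makes the link to the given norm. Arguments with values in
  \<open>ennreal\<close> allow norms of integrals of |f| before finiteness is known.\<close>

definition wnorm :: "(real \<Rightarrow> real) \<Rightarrow> (real \<Rightarrow> real) \<Rightarrow> (real \<Rightarrow> ennreal) \<Rightarrow> ennreal" where
  "wnorm \<phi> W F = (SUP g\<in>wtests \<phi> W. per_int (\<lambda>x. F x * ennreal (g x * W x)))"

lemma young_convex_scale:
  assumes "convex_on UNIV \<Phi>" "\<Phi> 0 = 0" "1 \<le> (\<alpha>::real)"
  shows "\<Phi> (x / \<alpha>) \<le> \<Phi> x / \<alpha>"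
proof -
  have "\<Phi> ((1 - 1 / \<alpha>) *\<^sub>R 0 + (1 / \<alpha>) *\<^sub>R x) \<le> (1 - 1 / \<alpha>) * \<Phi> 0 + (1 / \<alpha>) * \<Phi> x"
    using assms by (intro convex_onD[OF assms(1)]) auto
  then show ?thesis using assms by simp
qed

lemma young_function_borel [measurable_dest]: "young_function \<phi> \<Longrightarrow> \<phi> \<in> borel_measurable borel"
  by (auto simp: young_function_def intro: borel_measurable_continuous_onI)

lemma young_functionD:
  assumes "young_function \<phi>"
  shows "0 \<le> \<phi> x" "\<phi> 0 = 0" "0 \<le> x \<Longrightarrow> x \<le> y \<Longrightarrow> \<phi> x \<le> \<phi> y"
proof -
  show "0 \<le> \<phi> x" "\<phi> 0 = 0" using assms by (auto simp: young_function_def)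
  assume "0 \<le> x" "x \<le> y"
  then show "\<phi> x \<le> \<phi> y"
    using assms mono_onD[of "{0<..}" \<phi> x y] unfolding young_function_def by (cases "x = 0") auto
qed

lemma set_nn_integral_eq_LINT:
  fixes h :: "real \<Rightarrow> real"
  assumes "set_integrable lborel J h" "\<And>x. x \<in> J \<Longrightarrow> 0 \<le> h x"
  shows "(\<integral>\<^sup>+x\<in>J. ennreal (h x) \<partial>lborel) = ennreal (LINT x:J|lborel. h x)"
proof -
  have "(\<integral>\<^sup>+x\<in>J. ennreal (h x) \<partial>lborel) = (\<integral>\<^sup>+x. ennreal (indicator J x *\<^sub>R h x) \<partial>lborel)"
    by (intro nn_integral_cong) (auto simp: indicator_def)
  also have "\<dots> = ennreal (LINT x:J|lborel. h x)"
    unfolding set_lebesgue_integral_def using assms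
    by (intro nn_integral_eq_integral) (auto simp: set_integrable_def indicator_def)
  finally show ?thesis .
qed

text \<open>Here \<open>m\<close> is the average of \<open>f\<close>. The factor 2 on the left is a
  reserve that pays for the doubling of intervals in \<open>modular_box_avg\<close>; the constant
  \<open>C\<close> sits inside \<open>\<phi>\<close> because this is what passes to the norm by
  duality. Boundedness of \<open>f\<close> keeps the integrals finite.\<close>

definition interval_modular :: "(real \<Rightarrow> real) \<Rightarrow> (real \<Rightarrow> real) \<Rightarrow> real \<Rightarrow> bool" where
  "interval_modular \<phi> W C \<longleftrightarrow> (\<forall>a b f m B. a < b \<longrightarrow> f \<in> borel_measurable borel \<longrightarrow> (\<forall>x. 0 \<le> f x \<and> f x \<le> B) \<longrightarrow>
    (\<integral>\<^sup>+x\<in>{a..<b}. ennreal (f x) \<partial>lborel) = ennreal (m * (b - a)) \<longrightarrow> 0 \<le> m \<longrightarrow>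
    2 * (ennreal (\<phi> (m / C)) * (\<integral>\<^sup>+x\<in>{a..<b}. ennreal (W x) \<partial>lborel))
      \<le> (\<integral>\<^sup>+x\<in>{a..<b}. ennreal (\<phi> (f x) * W x) \<partial>lborel))"

lemma interval_modularD:
  assumes "interval_modular \<phi> W C" "a < b" "f \<in> borel_measurable borel" "\<And>x. 0 \<le> f x \<and> f x \<le> B"
    "(\<integral>\<^sup>+x\<in>{a..<b}. ennreal (f x) \<partial>lborel) = ennreal (m * (b - a))" "0 \<le> m"
  shows "2 * (ennreal (\<phi> (m / C)) * (\<integral>\<^sup>+x\<in>{a..<b}. ennreal (W x) \<partial>lborel))
    \<le> (\<integral>\<^sup>+x\<in>{a..<b}. ennreal (\<phi> (f x) * W x) \<partial>lborel)"
  using assms unfolding interval_modular_def by blast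

text \<open>With \<open>p = 1 / q\<close>: Jensen's inequality for \<open>\<Phi>\<close>, then the
  lower comparison with \<open>\<phi>\<close> and Hoelder's inequality with exponent
  \<open>p\<close>, then the Muckenhoupt bound. This leaves the constant \<open>A\<close> in front
  of the integral; convexity of \<open>\<Phi>\<close> moves it into the argument of
  \<open>\<phi>\<close>.\<close>

lemma interval_modular_inequality:
  assumes \<Phi>: "young_function \<Phi>" "convex_on UNIV \<Phi>" and c: "1 \<le> c" and \<phi>: "young_function \<phi>"
    and q: "0 < q" "q < 1"
    and le: "\<And>x. 0 \<le> x \<Longrightarrow> \<Phi> x \<le> \<phi> x powr q" "\<And>x. 0 \<le> x \<Longrightarrow> \<phi> x powr q \<le> \<Phi> (c * x)"
    and Ap: "Ap_bound W (1 / q) A"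
  shows "\<exists>C>0. interval_modular \<phi> W C"
proof -
  have [measurable]: "W \<in> borel_measurable borel" and W0: "\<And>x. 0 < W x"
    using Ap by (auto simp: Ap_bound_def)
  have [measurable]: "\<Phi> \<in> borel_measurable borel" "\<phi> \<in> borel_measurable borel"
    using \<Phi> \<phi> young_function_borel by auto
  have A: "0 < A" using Ap by (rule Ap_bound_pos)
  define p where "p = 1 / q"
  have p: "1 < p" "1 / p = q" using q by (auto simp: p_def)
  \<comment> \<open>Dividing the argument of \<open>\<Phi>\<close> by \<open>\<alpha>\<close>
    reduces the \<open>p\<close>-th power of the value at least by the factor
    \<open>\<alpha> powr p\<close>, which is at least \<open>2 * A\<close>: this absorbs
    \<open>A\<close> and creates the reserve factor 2.\<close>
  define \<alpha> where "\<alpha> = max 1 ((2 * A) powr q)"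
  have \<alpha>: "1 \<le> \<alpha>" by (simp add: \<alpha>_def)
  have "2 * A = ((2 * A) powr q) powr p" using A q by (simp add: powr_powr p_def)
  also have "\<dots> \<le> \<alpha> powr p" using p by (intro powr_mono2) (auto simp: \<alpha>_def)
  finally have \<alpha>p: "2 * A \<le> \<alpha> powr p" .
  have main: "2 * (ennreal (\<phi> (m / (c * \<alpha>))) * (\<integral>\<^sup>+x\<in>{a..<b}. ennreal (W x) \<partial>lborel))
      \<le> (\<integral>\<^sup>+x\<in>{a..<b}. ennreal (\<phi> (f x) * W x) \<partial>lborel)"
    if ab: "a < b" and [measurable]: "f \<in> borel_measurable borel" and f: "\<And>x. 0 \<le> f x" "\<And>x. f x \<le> B"
      and m: "(\<integral>\<^sup>+x\<in>{a..<b}. ennreal (f x) \<partial>lborel) = ennreal (m * (b - a))" "0 \<le> m" for a b f m B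
  proof -
    obtain w s where w: "0 < w" "0 < s" "(\<integral>\<^sup>+x\<in>{a..<b}. ennreal (W x) \<partial>lborel) = ennreal w"
      "(\<integral>\<^sup>+x\<in>{a..<b}. ennreal (W x powr (1 / (1 - p))) \<partial>lborel) = ennreal s"
      "w / (b - a) * (s / (b - a)) powr (p - 1) \<le> A"
      unfolding p_def by (rule Ap_boundE[OF Ap ab])
    let ?J = "{a..<b}"
    have int_bdd: "set_integrable lborel ?J h" if [measurable]: "h \<in> borel_measurable borel" and "\<And>x. \<bar>h x\<bar> \<le> K" for h :: "real \<Rightarrow> real" and K
      unfolding set_integrable_def
    proof (rule Bochner_Integration.integrable_bound)
      show "integrable lborel (\<lambda>x. indicator ?J x *\<^sub>R K)" using ab by (simp add: integrable_indicator_iff)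
      show "AE x in lborel. norm (indicator ?J x *\<^sub>R h x) \<le> norm (indicator ?J x *\<^sub>R K)"
        using that(2) by (intro always_eventually allI) (auto simp: indicator_def intro: order.trans[OF that(2)] abs_ge_self)
    qed measurable
    have \<Phi>f: "0 \<le> \<Phi> (f x)" "\<Phi> (f x) \<le> \<Phi> B" for x using young_functionD[OF \<Phi>(1)] f by auto
    have \<phi>f: "0 \<le> \<phi> (f x)" "\<phi> (f x) \<le> \<phi> B" for x using young_functionD[OF \<phi>] f by auto
    have i1: "set_integrable lborel ?J f" using f by (intro int_bdd[of _ B]) auto
    have i2: "set_integrable lborel ?J (\<lambda>x. \<Phi> (f x))" using \<Phi>f by (intro int_bdd[of _ "\<Phi> B"]) auto
    have i3: "set_integrable lborel ?J (\<lambda>x. K)" for K :: real by (intro int_bdd[of _ "\<bar>K\<bar>"]) auto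
    have fm: "(LINT x:?J|lborel. f x) = m * (b - a)"
    proof -
      have "ennreal (LINT x:?J|lborel. f x) = ennreal (m * (b - a))"
        using set_nn_integral_eq_LINT[OF i1] f m by simp
      moreover have "0 \<le> (LINT x:?J|lborel. f x)" using f by (simp add: set_lebesgue_integral_def)
      ultimately show ?thesis using m ab by simp
    qed
    define P where "P = (LINT x:?J|lborel. \<Phi> (f x))"
    \<comment> \<open>The right-hand slope of \<open>\<Phi>\<close> at \<open>m\<close>, hence a
      supporting line; integrating it over the interval is Jensen's inequality.\<close>
    define k where "k = Inf ((\<lambda>t. (\<Phi> m - \<Phi> t) / (m - t)) ` ({m<..} \<inter> UNIV))"
    have sub: "\<Phi> m + k * (y - m) \<le> \<Phi> y" for y
      using convex_le_Inf_differential[OF \<Phi>(2), of m y] by (simp add: k_def)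
    have "(LINT x:?J|lborel. \<Phi> m + k * (f x - m)) \<le> P"
      unfolding P_def by (intro set_integral_mono) (use i1 i2 i3 sub in auto)
    also have "(LINT x:?J|lborel. \<Phi> m + k * (f x - m)) = \<Phi> m * (b - a) + k * ((LINT x:?J|lborel. f x) - m * (b - a))"
    proof -
      have "(LINT x:?J|lborel. K) = K * (b - a)" for K :: real
        using ab by (simp add: set_lebesgue_integral_def)
      then show ?thesis using i1 i3 by simp
    qed
    finally have Jensen: "\<Phi> m * (b - a) \<le> P" by (simp add: fm)
    have P0: "0 \<le> P" using Jensen young_functionD(1)[OF \<Phi>(1), of m] ab by (auto intro: order.trans[rotated])
    define X where "X = enn2real (\<integral>\<^sup>+x\<in>?J. ennreal (\<phi> (f x) * W x) \<partial>lborel)"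
    have "(\<integral>\<^sup>+x\<in>?J. ennreal (\<phi> (f x) * W x) \<partial>lborel) \<le> (\<integral>\<^sup>+x. ennreal (\<phi> B) * (ennreal (W x) * indicator ?J x) \<partial>lborel)"
      using \<phi>f W0 by (intro nn_integral_mono) (auto simp: indicator_def ennreal_mult[symmetric] less_imp_le young_functionD[OF \<phi>] intro!: mult_right_mono)
    also have "\<dots> = ennreal (\<phi> B) * ennreal w" by (subst nn_integral_cmult) (auto simp: w)
    also have "\<dots> < \<infinity>" by (simp add: ennreal_mult_less_top)
    finally have X: "(\<integral>\<^sup>+x\<in>?J. ennreal (\<phi> (f x) * W x) \<partial>lborel) = ennreal X" "0 \<le> X"
      by (auto simp: X_def)
    have "ennreal P = (\<integral>\<^sup>+x\<in>?J. ennreal (\<Phi> (f x)) \<partial>lborel)"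
      unfolding P_def using \<Phi>f by (intro set_nn_integral_eq_LINT[symmetric] i2) auto
    \<comment> \<open>The factors \<open>W x powr q\<close> and \<open>W x powr (- q)\<close> are
      inserted: the \<open>p\<close>-th power of the first part is controlled by
      \<open>\<phi> (f x) * W x\<close>, and the conjugate power of the second is the dual
      weight.\<close>
    also have "\<dots> = (\<integral>\<^sup>+x. ennreal ((\<Phi> (f x) * W x powr q * indicator ?J x) * (W x powr (- q) * indicator ?J x)) \<partial>lborel)"
      using W0 by (intro nn_integral_cong) (auto simp: indicator_def powr_minus less_imp_neq[OF W0, symmetric] mult.assoc)
    also have "\<dots> \<le> ennreal (X powr (1 / p) * s powr (1 - 1 / p))"
    proof (rule nn_integral_Holder)
      have "(\<Phi> (f x) * W x powr q * indicator ?J x) powr p \<le> \<phi> (f x) * W x * indicator ?J x" for x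
      proof -
        have "\<Phi> (f x) powr p \<le> (\<phi> (f x) powr q) powr p" using p \<Phi>f f le by (intro powr_mono2) auto
        also have "\<dots> = \<phi> (f x)" using \<phi>f q by (simp add: powr_powr p_def)
        finally have "\<Phi> (f x) powr p * W x \<le> \<phi> (f x) * W x" using W0[of x] by (intro mult_right_mono) auto
        then show ?thesis using W0[of x] \<Phi>f q by (auto simp: indicator_def powr_mult powr_powr p_def)
      qed
      then have "(\<integral>\<^sup>+x. ennreal ((\<Phi> (f x) * W x powr q * indicator ?J x) powr p) \<partial>lborel) \<le> (\<integral>\<^sup>+x\<in>?J. ennreal (\<phi> (f x) * W x) \<partial>lborel)"
        by (intro nn_integral_mono) (subst ennreal_indicator[symmetric], subst ennreal_mult''[symmetric], auto intro!: ennreal_leI)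
      then show "(\<integral>\<^sup>+x. ennreal ((\<Phi> (f x) * W x powr q * indicator ?J x) powr p) \<partial>lborel) \<le> ennreal X" using X by simp
      have "- q * (p / (p - 1)) = 1 / (1 - p)" 
      proof -
        have "p / (p - 1) = 1 / (1 - q)" "1 - p = - (1 - q) / q" using q by (auto simp: p_def divide_simps)
        then show ?thesis using q by (simp add: minus_divide_right)
      qed
      then have "(\<integral>\<^sup>+x. ennreal ((W x powr - q * indicator ?J x) powr (p / (p - 1))) \<partial>lborel)
        = (\<integral>\<^sup>+x\<in>?J. ennreal (W x powr (1 / (1 - p))) \<partial>lborel)"
        by (intro nn_integral_cong) (auto simp: indicator_def powr_powr)
      then show "(\<integral>\<^sup>+x. ennreal ((W x powr - q * indicator ?J x) powr (p / (p - 1))) \<partial>lborel) \<le> ennreal s" using w by simp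
    qed (use p w X \<Phi>f in auto)
    finally have "P \<le> X powr q * s powr (1 - q)" using p by (simp add: ennreal_le_iff)
    then have "P powr p \<le> (X powr q * s powr (1 - q)) powr p" using P0 p by (intro powr_mono2) auto
    also have "\<dots> = X * s powr (p - 1)"
    proof -
      have "(1 - q) * p = p - 1" using q by (simp add: p_def field_simps)
      then show ?thesis using X q by (subst powr_mult) (auto simp: powr_powr p_def)
    qed
    finally have P1: "P powr p \<le> X * s powr (p - 1)" .
    have "(\<Phi> m * (b - a)) powr p \<le> P powr p"
      using Jensen young_functionD(1)[OF \<Phi>(1)] ab p by (intro powr_mono2) auto
    with P1 have P2: "(\<Phi> m) powr p * (b - a) powr p \<le> X * s powr (p - 1)"
      using young_functionD(1)[OF \<Phi>(1)] ab by (simp add: powr_mult)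
    have "w * s powr (p - 1) = (w / (b - a) * (s / (b - a)) powr (p - 1)) * (b - a) powr p"
      using ab w by (simp add: powr_divide powr_diff field_simps)
    also have "\<dots> \<le> A * (b - a) powr p" using w by (intro mult_right_mono) auto
    finally have w2: "w * s powr (p - 1) \<le> A * (b - a) powr p" .
    have "(b - a) powr p * (\<Phi> m powr p * w) \<le> X * s powr (p - 1) * w"
      using mult_right_mono[OF P2, of w] w by (simp add: mult_ac)
    also have "\<dots> \<le> X * (A * (b - a) powr p)" using mult_left_mono[OF w2 X(2)] by (simp add: mult_ac)
    finally have "(b - a) powr p * (\<Phi> m powr p * w) \<le> (b - a) powr p * (A * X)" by (simp add: mult_ac)
    then have \<Phi>m: "\<Phi> m powr p * w \<le> A * X" using ab by (subst (asm) mult_le_cancel_left_pos) auto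
    have "\<phi> (m / (c * \<alpha>)) powr q \<le> \<Phi> (c * (m / (c * \<alpha>)))" using m c \<alpha> by (intro le) auto
    also have "c * (m / (c * \<alpha>)) = m / \<alpha>" using c by simp
    also have "\<Phi> (m / \<alpha>) \<le> \<Phi> m / \<alpha>" using \<Phi> \<alpha> young_functionD(2) by (intro young_convex_scale) auto
    finally have "(\<phi> (m / (c * \<alpha>)) powr q) powr p \<le> (\<Phi> m / \<alpha>) powr p" using p by (intro powr_mono2) auto
    then have \<phi>m: "\<phi> (m / (c * \<alpha>)) \<le> \<Phi> m powr p / \<alpha> powr p"
      using q young_functionD(1)[OF \<phi>] young_functionD(1)[OF \<Phi>(1)] \<alpha> by (simp add: powr_powr p_def powr_divide)
    have "2 * (\<phi> (m / (c * \<alpha>)) * w) \<le> 2 * (\<Phi> m powr p / \<alpha> powr p * w)"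
      using w by (intro mult_left_mono mult_right_mono \<phi>m) auto
    also have "\<dots> = 2 / \<alpha> powr p * (\<Phi> m powr p * w)" by simp
    also have "\<dots> \<le> 2 / \<alpha> powr p * (A * X)" by (intro mult_left_mono \<Phi>m) auto
    also have "\<dots> = (2 * A) / \<alpha> powr p * X" by simp
    also have "\<dots> \<le> 1 * X" using \<alpha>p \<alpha> X by (intro mult_right_mono) (auto simp: field_simps)
    finally have "ennreal (2 * (\<phi> (m / (c * \<alpha>)) * w)) \<le> ennreal X" by (intro ennreal_leI) simp
    then show ?thesis using X w young_functionD(1)[OF \<phi>] by (simp add: ennreal_mult)
  qed
  show ?thesis
    unfolding interval_modular_def using main c \<alpha> by (intro exI[of _ "c * \<alpha>"]) (auto intro!: main)
qed

section \<open>Averaging operators on weighted Orlicz spaces\<close>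

text \<open>The integral over a window of length \<open>s\<close> is not divided by
  \<open>s\<close>, because level sets of kernels produce it in this form; the bounds therefore
  carry \<open>D * s\<close>.\<close>

definition box_avg :: "real \<Rightarrow> (real \<Rightarrow> ennreal) \<Rightarrow> real \<Rightarrow> ennreal" where
  "box_avg s F x = (\<integral>\<^sup>+t. indicator {-(s/2)..<s/2} t * F (x + t) \<partial>lborel)"

lemma box_avg_borel [measurable]: "F \<in> borel_measurable borel \<Longrightarrow> box_avg s F \<in> borel_measurable borel"
  unfolding box_avg_def by measurable

lemma box_avg_per: "per F \<Longrightarrow> per (box_avg s F)"
  unfolding box_avg_def[abs_def] by (rule nn_conv_per)

lemma box_avg_eq:
  assumes [measurable]: "F \<in> borel_measurable borel"
  shows "box_avg s F x = (\<integral>\<^sup>+y\<in>{x - s/2..<x + s/2}. F y \<partial>lborel)"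
  unfolding box_avg_def
  by (subst nn_integral_shift[symmetric, of "\<lambda>y. F y * indicator {x - s/2..<x + s/2} y" x])
    (auto intro!: nn_integral_cong simp: indicator_def add_ac)

text \<open>For each \<open>z\<close> in the window of length \<open>s\<close> around
  \<open>y\<close>, that window lies in the one of length \<open>2 * s\<close> around
  \<open>z\<close>, so the average at \<open>y\<close> is at most twice the average
  \<open>m z\<close> over the larger window. Integrating over such \<open>z\<close> and
  interchanging the integrals leaves \<open>\<phi> (m z / C)\<close> times the mass of
  \<open>W\<close> near \<open>z\<close>, where \<open>int\<close> applies. The integral over
  \<open>z\<close> of its right-hand side is \<open>2 * s\<close> times the full modular, and the
  reserve factor in \<open>int\<close> cancels the 2.\<close>

lemma modular_box_avg:
  assumes \<phi>: "young_function \<phi>" and [measurable]: "W \<in> borel_measurable borel" and W0: "\<And>x. 0 < W x" and Wper: "per W"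
    and C: "0 < C"
    and int: "interval_modular \<phi> W C"
    and [measurable]: "f \<in> borel_measurable borel" and f: "\<And>x. 0 \<le> f x" "\<And>x. f x \<le> B" and fper: "per f" and s: "0 < s"
  shows "per_int (\<lambda>y. ennreal (\<phi> (enn2real (box_avg s (\<lambda>x. ennreal (f x)) y) / (2 * C * s)) * W y))
    \<le> per_int (\<lambda>y. ennreal (\<phi> (f y) * W y))"
proof -
  have [measurable]: "\<phi> \<in> borel_measurable borel" using \<phi> by (rule young_function_borel)
  let ?A = "\<lambda>r. box_avg r (\<lambda>x. ennreal (f x))"
  have fin: "?A r x \<le> ennreal (B * r)" if "0 < r" for r x
  proof -
    have "?A r x \<le> (\<integral>\<^sup>+t. indicator {-(r/2)..<r/2} t * ennreal B \<partial>lborel)"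
      unfolding box_avg_def using f by (intro nn_integral_mono mult_left_mono ennreal_leI) auto
    also have "\<dots> = ennreal (B * r)" using that f[of 0] by (subst nn_integral_multc) (auto simp: ennreal_mult[symmetric] mult.commute)
    finally show ?thesis .
  qed
  have fin': "?A r x < \<infinity>" if "0 < r" for r x
    by (rule order.strict_trans1[OF fin[OF that]]) simp
  define m where "m z = enn2real (?A (2 * s) z) / (2 * s)" for z
  define a where "a y = enn2real (?A s y)" for y
  have [measurable]: "m \<in> borel_measurable borel" "a \<in> borel_measurable borel" unfolding m_def[abs_def] a_def[abs_def] by measurable
  have m0: "0 \<le> m z" and a0: "0 \<le> a z" for z using s by (auto simp: m_def a_def)
  have Am: "?A (2 * s) z = ennreal (m z * (2 * s))" for z
    using fin'[of "2 * s" z] s by (simp add: m_def)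
  have mper: "per m" using box_avg_per[of "\<lambda>x. ennreal (f x)" "2 * s"] fper by (simp add: per_def m_def)
  have aper: "per a" using box_avg_per[of "\<lambda>x. ennreal (f x)" s] fper by (simp add: per_def a_def)
  have am: "a y \<le> 2 * s * m z" if "z \<in> {y - s/2..<y + s/2}" for y z
  proof -
    have "ennreal (a y) = ?A s y" using fin'[of s y] s by (simp add: a_def)
    also have "\<dots> \<le> ?A (2 * s) z"
      unfolding box_avg_eq[of "\<lambda>x. ennreal (f x)", simplified] using that by (intro nn_integral_mono) (auto simp: indicator_def)
    also have "\<dots> = ennreal (m z * (2 * s))" by (rule Am)
    finally show ?thesis using m0[of z] s by (simp add: ennreal_le_iff mult_ac)
  qed
  have Wz: "2 * (ennreal (\<phi> (m z / C)) * (\<integral>\<^sup>+x\<in>{z-s..<z+s}. ennreal (W x) \<partial>lborel)) \<le> box_avg (2 * s) (\<lambda>x. ennreal (\<phi> (f x) * W x)) z" for z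
  proof -
    have "(\<integral>\<^sup>+x\<in>{z-s..<z+s}. ennreal (f x) \<partial>lborel) = ennreal (m z * ((z + s) - (z - s)))"
      using Am[of z] by (simp add: box_avg_eq mult.commute)
    from interval_modularD[OF int, where B = B, OF _ _ _ this m0] show ?thesis using f s by (simp add: box_avg_eq)
  qed
  have "ennreal (\<phi> (a y / (2 * C * s)) * W y) * ennreal s
      \<le> (\<integral>\<^sup>+t. indicator {-(s/2)..<s/2} t * ennreal (\<phi> (m (y + t) / C)) \<partial>lborel) * ennreal (W y)" for y
  proof -
    have "ennreal (\<phi> (a y / (2 * C * s))) * ennreal s = (\<integral>\<^sup>+t. indicator {-(s/2)..<s/2} t * ennreal (\<phi> (a y / (2 * C * s))) \<partial>lborel)"
      using s by (subst nn_integral_multc) (auto simp: mult.commute)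
    also have "\<dots> \<le> (\<integral>\<^sup>+t. indicator {-(s/2)..<s/2} t * ennreal (\<phi> (m (y + t) / C)) \<partial>lborel)"
    proof (intro nn_integral_mono)
      fix t
      show "indicator {-(s/2)..<s/2} t * ennreal (\<phi> (a y / (2 * C * s))) \<le> indicator {-(s/2)..<s/2} t * ennreal (\<phi> (m (y + t) / C))"
      proof (cases "t \<in> {-(s/2)..<s/2}")
        case True
        then have "a y \<le> 2 * s * m (y + t)" by (intro am) auto
        then have "a y / (2 * C * s) \<le> m (y + t) / C" using C s by (simp add: field_simps)
        then have "\<phi> (a y / (2 * C * s)) \<le> \<phi> (m (y + t) / C)"
          using a0[of y] C s by (intro young_functionD(3)[OF \<phi>]) auto
        then show ?thesis by (intro mult_left_mono ennreal_leI) auto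
      qed simp
    qed
    finally have "ennreal (\<phi> (a y / (2 * C * s))) * ennreal s * ennreal (W y)
      \<le> (\<integral>\<^sup>+t. indicator {-(s/2)..<s/2} t * ennreal (\<phi> (m (y + t) / C)) \<partial>lborel) * ennreal (W y)"
      by (rule mult_right_mono) simp
    then show ?thesis using W0[of y] young_functionD(1)[OF \<phi>] by (simp add: ennreal_mult less_imp_le mult_ac)
  qed
  then have "per_int (\<lambda>y. ennreal s * ennreal (\<phi> (a y / (2 * C * s)) * W y))
    \<le> per_int (\<lambda>y. (\<integral>\<^sup>+t. indicator {-(s/2)..<s/2} t * ennreal (\<phi> (m (y + t) / C)) \<partial>lborel) * ennreal (W y))"
    by (intro per_int_mono) (simp add: mult.commute)
  also have "\<dots> = per_int (\<lambda>z. ennreal (\<phi> (m z / C)) * (\<integral>\<^sup>+t. indicator {-(s/2)..<s/2} t * ennreal (W (z - t)) \<partial>lborel))"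
    by (rule per_int_conv_adjoint) (use mper Wper in \<open>auto simp: per_def\<close>)
  also have "\<dots> \<le> per_int (\<lambda>z. ennreal (\<phi> (m z / C)) * (\<integral>\<^sup>+x\<in>{z-s..<z+s}. ennreal (W x) \<partial>lborel))"
  proof (intro per_int_mono mult_left_mono)
    fix z
    have "(\<integral>\<^sup>+t. indicator {-(s/2)..<s/2} t * ennreal (W (z - t)) \<partial>lborel)
      = (\<integral>\<^sup>+t. indicator {-(s/2)..<s/2} (- t) * ennreal (W (z + t)) \<partial>lborel)"
      by (subst nn_integral_reflect[symmetric]) auto
    also have "\<dots> \<le> (\<integral>\<^sup>+t. indicator {z-s..<z+s} (t + z) * ennreal (W (t + z)) \<partial>lborel)"
      using s by (intro nn_integral_mono) (auto simp: indicator_def add.commute)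
    also have "\<dots> = (\<integral>\<^sup>+x. indicator {z-s..<z+s} x * ennreal (W x) \<partial>lborel)"
      by (rule nn_integral_shift) measurable
    finally show "(\<integral>\<^sup>+t. indicator {-(s/2)..<s/2} t * ennreal (W (z - t)) \<partial>lborel) \<le> (\<integral>\<^sup>+x\<in>{z-s..<z+s}. ennreal (W x) \<partial>lborel)"
      by (simp add: mult.commute)
  qed simp
  finally have 1: "per_int (\<lambda>y. ennreal s * ennreal (\<phi> (a y / (2 * C * s)) * W y))
     \<le> per_int (\<lambda>z. ennreal (\<phi> (m z / C)) * (\<integral>\<^sup>+x\<in>{z-s..<z+s}. ennreal (W x) \<partial>lborel))" .
  have [measurable]: "(\<lambda>z. \<integral>\<^sup>+x\<in>{z-s..<z+s}. ennreal (W x) \<partial>lborel) \<in> borel_measurable borel"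
  proof -
    have "(\<lambda>z. \<integral>\<^sup>+x\<in>{z-s..<z+s}. ennreal (W x) \<partial>lborel) = box_avg (2 * s) (\<lambda>x. ennreal (W x))"
      by (auto simp: box_avg_eq)
    then show ?thesis by simp
  qed
  have "2 * (ennreal s * per_int (\<lambda>y. ennreal (\<phi> (a y / (2 * C * s)) * W y)))
     = 2 * per_int (\<lambda>y. ennreal s * ennreal (\<phi> (a y / (2 * C * s)) * W y))"
    by (subst per_int_cmult) auto
  also have "\<dots> \<le> 2 * per_int (\<lambda>z. ennreal (\<phi> (m z / C)) * (\<integral>\<^sup>+x\<in>{z-s..<z+s}. ennreal (W x) \<partial>lborel))"
    by (rule mult_left_mono[OF 1]) simp
  also have "\<dots> = per_int (\<lambda>z. 2 * (ennreal (\<phi> (m z / C)) * (\<integral>\<^sup>+x\<in>{z-s..<z+s}. ennreal (W x) \<partial>lborel)))"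
    by (rule per_int_cmult[symmetric]) measurable
  also have "\<dots> \<le> per_int (box_avg (2 * s) (\<lambda>x. ennreal (\<phi> (f x) * W x)))"
    by (rule per_int_mono) (rule Wz)
  also have "\<dots> = (\<integral>\<^sup>+t. indicator {-(2 * s / 2)..<2 * s / 2} t \<partial>lborel) * per_int (\<lambda>x. ennreal (\<phi> (f x) * W x))"
    unfolding box_avg_def[abs_def] using fper Wper by (intro per_int_conv) (auto simp: per_def)
  also have "\<dots> = 2 * (ennreal s * per_int (\<lambda>x. ennreal (\<phi> (f x) * W x)))"
  proof -
    have "(\<integral>\<^sup>+t. indicator {-(2 * s / 2)..<2 * s / 2} t \<partial>lborel) = ennreal (2 * s)" using s by simp
    then show ?thesis using s by (simp add: ennreal_mult mult.assoc)
  qed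
  finally have "ennreal s * per_int (\<lambda>y. ennreal (\<phi> (a y / (2 * C * s)) * W y)) \<le> ennreal s * per_int (\<lambda>x. ennreal (\<phi> (f x) * W x))"
    by (subst (asm) ennreal_mult_le_mult_iff) auto
  then show ?thesis unfolding a_def using s by (subst (asm) ennreal_mult_le_mult_iff) auto
qed

text \<open>A Borel selection in the supremum that defines the complementary function: the best
  choice among 0 and the first \<open>N\<close> points of the sequence \<open>r\<close>. Starting
  from 0 makes the attained value nonnegative when \<open>\<phi> 0 = 0\<close>.\<close>

primrec young_argmax :: "(real \<Rightarrow> real) \<Rightarrow> (nat \<Rightarrow> real) \<Rightarrow> nat \<Rightarrow> real \<Rightarrow> real" where
  "young_argmax \<phi> r 0 y = 0"
| "young_argmax \<phi> r (Suc N) y = (if r N * y - \<phi> (r N) > young_argmax \<phi> r N y * y - \<phi> (young_argmax \<phi> r N y)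
     then r N else young_argmax \<phi> r N y)"

lemma young_argmax_borel [measurable]:
  assumes [measurable]: "\<phi> \<in> borel_measurable borel"
  shows "young_argmax \<phi> r N \<in> borel_measurable borel"
proof (induction N)
  case 0
  have "young_argmax \<phi> r 0 = (\<lambda>_. 0)" by auto
  then show ?case by simp
next
  case (Suc N)
  note Suc [measurable]
  have "young_argmax \<phi> r (Suc N) = (\<lambda>y. if r N * y - \<phi> (r N) > young_argmax \<phi> r N y * y - \<phi> (young_argmax \<phi> r N y)
     then r N else young_argmax \<phi> r N y)" by auto
  also have "\<dots> \<in> borel_measurable borel" by measurable
  finally show ?case .
qed

lemma young_argmax_bounds:
  assumes "\<And>i. 0 \<le> r i"
  shows "0 \<le> young_argmax \<phi> r N y" "young_argmax \<phi> r N y \<le> (\<Sum>i<N. r i)"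
proof -
  show "0 \<le> young_argmax \<phi> r N y" by (induction N) (auto simp: assms)
  show "young_argmax \<phi> r N y \<le> (\<Sum>i<N. r i)"
  proof (induction N)
    case (Suc N)
    have "0 \<le> (\<Sum>i<N. r i)" by (intro sum_nonneg assms)
    then show ?case using Suc assms[of N] by auto
  qed auto
qed

lemma young_argmax_value:
  fixes \<phi> r y defines "h \<equiv> \<lambda>N. young_argmax \<phi> r N y * y - \<phi> (young_argmax \<phi> r N y)"
  shows "h N \<le> h (Suc N)" "i < N \<Longrightarrow> r i * y - \<phi> (r i) \<le> h N" "\<phi> 0 = 0 \<Longrightarrow> 0 \<le> h N"
proof -
  show m: "h N \<le> h (Suc N)" for N by (auto simp: h_def)
  have "mono h" using m by (rule incseq_SucI)
  moreover have "r i * y - \<phi> (r i) \<le> h (Suc i)" by (auto simp: h_def)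
  ultimately show "i < N \<Longrightarrow> r i * y - \<phi> (r i) \<le> h N" by (auto dest: monoD[of h "Suc i" N])
  show "\<phi> 0 = 0 \<Longrightarrow> 0 \<le> h N"
    using monoD[OF \<open>mono h\<close>, of 0 N] by (simp add: h_def)
qed

lemma ex_dense_enumeration: "\<exists>r::nat \<Rightarrow> real. (\<forall>i. 0 \<le> r i) \<and> (\<forall>x\<ge>0. \<forall>e>0. \<exists>i. \<bar>r i - x\<bar> < e)"
proof -
  define r where "r n = real (fst (prod_decode n)) / real (Suc (snd (prod_decode n)))" for n
  have "\<exists>i. \<bar>r i - x\<bar> < e" if "0 \<le> x" "0 < e" for x e :: real
  proof -
    obtain d where d: "1 / e < real d" using reals_Archimedean2 by blast
    define n where "n = nat \<lfloor>x * real (Suc d)\<rfloor>"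
    have "real n \<le> x * real (Suc d)" "x * real (Suc d) < real n + 1"
      using that by (auto simp: n_def)
    then have "real n / real (Suc d) \<le> x" "x < real n / real (Suc d) + 1 / real (Suc d)"
      by (simp_all add: field_simps del: of_nat_Suc)
    moreover have "1 / real (Suc d) < e" using d that by (simp add: field_simps)
    ultimately have "\<bar>real n / real (Suc d) - x\<bar> < e" by linarith
    then show ?thesis by (intro exI[of _ "prod_encode (n, d)"]) (simp add: r_def)
  qed
  then show ?thesis by (intro exI[of _ r]) (auto simp: r_def)
qed

text \<open>Continuity of \<open>\<phi>\<close> lets a dense sequence replace the full supremum. The
  representation by an increasing sequence of Borel functions yields measurability, and later
  monotone convergence.\<close>

lemma young_compl_eq_SUP:
  assumes \<phi>: "young_function \<phi>" and r: "\<And>i. 0 \<le> r i" "\<And>x e. 0 \<le> x \<Longrightarrow> 0 < e \<Longrightarrow> \<exists>i. \<bar>r i - x\<bar> < e"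
  shows "young_compl \<phi> y = (SUP N. ennreal (young_argmax \<phi> r N y * y - \<phi> (young_argmax \<phi> r N y)))"
proof (rule antisym)
  show "(SUP N. ennreal (young_argmax \<phi> r N y * y - \<phi> (young_argmax \<phi> r N y))) \<le> young_compl \<phi> y"
    unfolding young_compl_def using young_argmax_bounds(1)[of r, OF r(1)]
    by (intro SUP_least SUP_upper2[where i = "young_argmax \<phi> r N y" for N]) auto
  show "young_compl \<phi> y \<le> (SUP N. ennreal (young_argmax \<phi> r N y * y - \<phi> (young_argmax \<phi> r N y)))"
    unfolding young_compl_def
  proof (rule SUP_least)
    fix x :: real assume "x \<in> {0..}"
    then have x: "0 \<le> x" by simp
    let ?S = "SUP N. ennreal (young_argmax \<phi> r N y * y - \<phi> (young_argmax \<phi> r N y))"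
    have cont: "isCont (\<lambda>x. x * y - \<phi> x) x"
      using \<phi> by (auto simp: young_function_def continuous_on_eq_continuous_at intro!: continuous_intros)
    show "ennreal (x * y - \<phi> x) \<le> ?S"
    proof (rule ennreal_le_epsilon)
      fix e :: real assume "0 < e"
      then obtain d where d: "0 < d" "\<And>z. \<bar>z - x\<bar> < d \<Longrightarrow> \<bar>(z * y - \<phi> z) - (x * y - \<phi> x)\<bar> < e"
        using cont unfolding continuous_at_eps_delta dist_real_def by meson
      obtain i where "\<bar>r i - x\<bar> < d" using r(2)[OF x d(1)] by blast
      with d(2) have "x * y - \<phi> x \<le> (r i * y - \<phi> (r i)) + e" by (smt (verit))
      also have "r i * y - \<phi> (r i) \<le> young_argmax \<phi> r (Suc i) y * y - \<phi> (young_argmax \<phi> r (Suc i) y)"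
        by (rule young_argmax_value) simp
      finally have "ennreal (x * y - \<phi> x) \<le> ennreal ((young_argmax \<phi> r (Suc i) y * y - \<phi> (young_argmax \<phi> r (Suc i) y)) + e)"
        by (intro ennreal_leI) simp
      also have "\<dots> = ennreal (young_argmax \<phi> r (Suc i) y * y - \<phi> (young_argmax \<phi> r (Suc i) y)) + ennreal e"
        using \<open>0 < e\<close> young_argmax_value(3)[of \<phi> r "Suc i" y] young_functionD(2)[OF \<phi>] by (intro ennreal_plus) auto
      also have "\<dots> \<le> ?S + ennreal e" by (intro add_right_mono SUP_upper) auto
      finally show "ennreal (x * y - \<phi> x) \<le> ?S + ennreal e" .
    qed
  qed
qed

lemma young_compl_borel [measurable]:
  assumes \<phi>: "young_function \<phi>" shows "young_compl \<phi> \<in> borel_measurable borel"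
proof -
  have [measurable]: "\<phi> \<in> borel_measurable borel" using \<phi> by (rule young_function_borel)
  obtain r :: "nat \<Rightarrow> real" where r: "\<forall>i. 0 \<le> r i" "\<forall>x\<ge>0. \<forall>e>0. \<exists>i. \<bar>r i - x\<bar> < e"
    using ex_dense_enumeration by blast
  have "young_compl \<phi> = (\<lambda>y. SUP N. ennreal (young_argmax \<phi> r N y * y - \<phi> (young_argmax \<phi> r N y)))"
    using r by (intro ext young_compl_eq_SUP[OF \<phi>]) auto
  also have "\<dots> \<in> borel_measurable borel" by measurable
  finally show ?thesis .
qed

lemma Young_inequality_compl:
  assumes "young_function \<phi>" "0 \<le> x" "0 \<le> y"
  shows "ennreal (x * y) \<le> young_compl \<phi> y + ennreal (\<phi> x)"
proof -
  have "ennreal (x * y) \<le> ennreal (x * y - \<phi> x) + ennreal (\<phi> x)"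
    using young_functionD(1)[OF assms(1), of x] assms
    by (cases "x * y \<le> \<phi> x") (auto simp: ennreal_neg ennreal_leI simp flip: ennreal_plus)
  also have "\<dots> \<le> young_compl \<phi> y + ennreal (\<phi> x)"
    unfolding young_compl_def using assms by (intro add_right_mono SUP_upper) auto
  finally show ?thesis .
qed

text \<open>The adjoint of the averaging operator preserves test functions: the complementary function of \<open>g'\<close> is a
  supremum over measurable selections \<open>X\<close>, and moving the average from \<open>g\<close> to \<open>X\<close> brings in the modular
  inequality. No Luxemburg norm is needed.\<close>

lemma wtests_box_avg:
  assumes \<phi>: "young_function \<phi>" and [measurable]: "W \<in> borel_measurable borel" and W0: "\<And>x. 0 < W x" and Wper: "per W"
    and Wfin: "per_int (\<lambda>x. ennreal (W x)) < \<infinity>"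
    and D: "0 < D" and s: "0 < s"
    and modular: "\<And>f B. f \<in> borel_measurable borel \<Longrightarrow> (\<And>x. 0 \<le> f x) \<Longrightarrow> (\<And>x. f x \<le> B) \<Longrightarrow> per f \<Longrightarrow>
      per_int (\<lambda>y. ennreal (\<phi> (enn2real (box_avg s (\<lambda>x. ennreal (f x)) y) / (D * s)) * W y))
      \<le> per_int (\<lambda>y. ennreal (\<phi> (f y) * W y))"
    and g: "g \<in> wtests \<phi> W"
  shows "\<exists>g'\<in>wtests \<phi> W. \<forall>x. (\<integral>\<^sup>+t. indicator {-(s/2)..<s/2} t * ennreal (g (x - t) * W (x - t)) \<partial>lborel) = ennreal (D * s * (g' x * W x))"
proof -
  have [measurable]: "\<phi> \<in> borel_measurable borel" using \<phi> by (rule young_function_borel)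
  note young_compl_borel[OF \<phi>, measurable]
  have [measurable]: "g \<in> borel_measurable borel" and gper: "per g" and g0: "\<And>x. 0 \<le> g x"
    and g1: "per_int (\<lambda>x. young_compl \<phi> (g x) * ennreal (W x)) \<le> 1" using g by (auto simp: wtests_def)
  have \<phi>W: "ennreal (\<phi> z * W x) = ennreal (\<phi> z) * ennreal (W x)" for z x
    using young_functionD(1)[OF \<phi>] by (simp add: ennreal_mult')
  define u where "u x = ennreal (g x * W x)" for x
  have [measurable]: "u \<in> borel_measurable borel" unfolding u_def[abs_def] by measurable
  have uper: "per u" using gper Wper by (simp add: per_def u_def)
  \<comment> \<open>Young's inequality for the pair of 1 and \<open>g x\<close> shows that
    \<open>g\<close> times \<open>W\<close> is integrable; so \<open>v\<close> is finite and
    \<open>g'\<close> can be real valued.\<close>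
  have "per_int u \<le> per_int (\<lambda>x. young_compl \<phi> (g x) * ennreal (W x) + ennreal (\<phi> 1) * ennreal (W x))"
  proof (rule per_int_mono)
    fix x
    have "u x = ennreal (1 * g x) * ennreal (W x)" using W0[of x] g0[of x] by (simp add: u_def ennreal_mult less_imp_le)
    also have "\<dots> \<le> (young_compl \<phi> (g x) + ennreal (\<phi> 1)) * ennreal (W x)"
      using g0 by (intro mult_right_mono Young_inequality_compl[OF \<phi>]) auto
    finally show "u x \<le> young_compl \<phi> (g x) * ennreal (W x) + ennreal (\<phi> 1) * ennreal (W x)" by (simp add: distrib_right)
  qed
  also have "\<dots> = per_int (\<lambda>x. young_compl \<phi> (g x) * ennreal (W x)) + ennreal (\<phi> 1) * per_int (\<lambda>x. ennreal (W x))"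
    by (subst per_int_add) (auto simp: per_int_cmult)
  also have "\<dots> < \<infinity>" using Wfin g1 by (auto simp: less_top[symmetric] ennreal_mult_eq_top_iff top_unique)
  finally have ufin: "per_int u < \<infinity>" .
  let ?k = "indicator {-(s/2)..<s/2} :: real \<Rightarrow> ennreal"
  define v where "v x = (\<integral>\<^sup>+t. ?k t * u (x - t) \<partial>lborel)" for x
  have [measurable]: "v \<in> borel_measurable borel" unfolding v_def[abs_def] by measurable
  have vper: "per v" using uper perD[OF uper, of "_ - _"] by (simp add: per_def v_def algebra_simps)
  have vfin: "v x < \<infinity>" for x
  proof -
    have "v x = (\<integral>\<^sup>+t. ?k (- t) * u (x + t) \<partial>lborel)"
      unfolding v_def by (subst nn_integral_reflect[symmetric]) auto
    also have "\<dots> \<le> (\<integral>\<^sup>+t. indicator {x-s..<x+s} (t + x) * u (t + x) \<partial>lborel)"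
      using s by (intro nn_integral_mono) (auto simp: indicator_def add.commute)
    also have "\<dots> = (\<integral>\<^sup>+y. indicator {x-s..<x+s} y * u y \<partial>lborel)"
      by (rule nn_integral_shift) measurable
    also have "\<dots> < \<infinity>" using per_int_Ico_finite[OF _ uper ufin, of "x-s" "x+s"] by (simp add: mult.commute)
    finally show ?thesis .
  qed
  \<comment> \<open>Forced by the desired identity: the adjoint average of \<open>g\<close> times
    \<open>W\<close> has to be \<open>D * s\<close> times \<open>g'\<close> times
    \<open>W\<close>.\<close>
  define g' where "g' x = enn2real (v x) / (D * s * W x)" for x
  have [measurable]: "g' \<in> borel_measurable borel" unfolding g'_def[abs_def] by measurable
  have g'0: "0 \<le> g' x" for x using D s W0[of x] by (simp add: g'_def)
  have g'per: "per g'" using vper Wper by (simp add: per_def g'_def)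
  have vg': "v x = ennreal (D * s * (g' x * W x))" for x
    using vfin[of x] D s W0[of x] by (simp add: g'_def)
  obtain r :: "nat \<Rightarrow> real" where r: "\<And>i. 0 \<le> r i" "\<And>x e. 0 \<le> x \<Longrightarrow> 0 < e \<Longrightarrow> \<exists>i. \<bar>r i - x\<bar> < e"
    using ex_dense_enumeration by blast
  define X where "X N x = young_argmax \<phi> r N (g' x)" for N x
  have X_meas [measurable]: "X N \<in> borel_measurable borel" for N unfolding X_def[abs_def] by measurable
  have X0: "0 \<le> X N x" and XB: "X N x \<le> (\<Sum>i<N. r i)" for N x using young_argmax_bounds[of r \<phi> N "g' x"] r(1) by (auto simp: X_def)
  have Xper: "per (X N)" for N using g'per by (simp add: per_def X_def)
  define h where "h N x = X N x * g' x - \<phi> (X N x)" for N x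
  have h_meas [measurable]: "h N \<in> borel_measurable borel" for N unfolding h_def[abs_def] by measurable
  have h0: "0 \<le> h N x" for N x
    using young_argmax_value(3)[of \<phi> r N "g' x"] young_functionD(2)[OF \<phi>] by (simp add: h_def X_def)
  \<comment> \<open>By duality the integral of \<open>X N * g' * W\<close> is that of the average of
    \<open>X N\<close>, divided by \<open>D * s\<close>, against \<open>g * W\<close>. Young's
    inequality and the modular inequality bound it by 1 plus the modular of \<open>X N\<close>;
    subtracting this modular leaves the integral of \<open>h N\<close>.\<close>
  have hN: "per_int (\<lambda>x. ennreal (h N x) * ennreal (W x)) \<le> 1" for N
  proof -
    let ?A = "\<lambda>x. box_avg s (\<lambda>x. ennreal (X N x)) x"
    define a where "a x = enn2real (?A x)" for x
    have [measurable]: "a \<in> borel_measurable borel" unfolding a_def[abs_def] by measurable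
    have Afin: "?A x < \<infinity>" for x
    proof -
      have "?A x \<le> (\<integral>\<^sup>+t. ?k t * ennreal (\<Sum>i<N. r i) \<partial>lborel)"
        unfolding box_avg_def using XB by (intro nn_integral_mono mult_left_mono ennreal_leI) auto
      also have "\<dots> = ennreal s * ennreal (\<Sum>i<N. r i)" using s by (subst nn_integral_multc) auto
      also have "\<dots> < \<infinity>" by (simp add: ennreal_mult_less_top)
      finally show ?thesis .
    qed
    have aA: "ennreal (a x) = ?A x" and a0: "0 \<le> a x" for x using Afin[of x] by (auto simp: a_def)
    have "ennreal (D * s) * per_int (\<lambda>x. ennreal (X N x) * ennreal (g' x * W x)) = per_int (\<lambda>x. ennreal (X N x) * v x)"
      using D s X0 g'0 W0 by (subst per_int_cmult[symmetric]) (auto simp: vg' ennreal_mult[symmetric] less_imp_le mult_ac intro!: arg_cong[of _ _ per_int])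
    also have "\<dots> = per_int (\<lambda>x. ?A x * u x)"
      unfolding v_def box_avg_def using Xper uper by (intro per_int_conv_adjoint[symmetric]) (auto simp: per_def)
    also have "\<dots> = ennreal (D * s) * per_int (\<lambda>x. ennreal (a x / (D * s)) * u x)"
      using D s a0 by (subst per_int_cmult[symmetric]) (auto simp: aA[symmetric] mult.assoc[symmetric] ennreal_mult[symmetric])
    finally have "per_int (\<lambda>x. ennreal (X N x) * ennreal (g' x * W x)) = per_int (\<lambda>x. ennreal (a x / (D * s)) * u x)"
      using D s by (subst (asm) ennreal_mult_cancel_left) auto
    also have "\<dots> \<le> per_int (\<lambda>x. young_compl \<phi> (g x) * ennreal (W x) + ennreal (\<phi> (a x / (D * s)) * W x))"
    proof (rule per_int_mono)
      fix x
      have "ennreal (a x / (D * s)) * u x = ennreal (a x / (D * s) * g x) * ennreal (W x)"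
        using W0[of x] g0[of x] a0[of x] D s by (simp add: u_def ennreal_mult[symmetric] less_imp_le mult.assoc)
      also have "\<dots> \<le> (young_compl \<phi> (g x) + ennreal (\<phi> (a x / (D * s)))) * ennreal (W x)"
        using g0 a0 D s by (intro mult_right_mono Young_inequality_compl[OF \<phi>]) auto
      finally show "ennreal (a x / (D * s)) * u x \<le> young_compl \<phi> (g x) * ennreal (W x) + ennreal (\<phi> (a x / (D * s)) * W x)"
        by (simp add: distrib_right \<phi>W)
    qed
    also have "\<dots> = per_int (\<lambda>x. young_compl \<phi> (g x) * ennreal (W x)) + per_int (\<lambda>x. ennreal (\<phi> (a x / (D * s)) * W x))"
      by (rule per_int_add) measurable
    also have "\<dots> \<le> 1 + per_int (\<lambda>x. ennreal (\<phi> (X N x) * W x))"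
      using modular[of "X N" "\<Sum>i<N. r i"] X0 XB Xper g1 by (intro add_mono) (auto simp: a_def)
    finally have le: "per_int (\<lambda>x. ennreal (X N x) * ennreal (g' x * W x)) \<le> 1 + per_int (\<lambda>x. ennreal (\<phi> (X N x) * W x))" .
    \<comment> \<open>A selection from finitely many points is bounded, so its modular is finite and
      may be cancelled.\<close>
    have "per_int (\<lambda>x. ennreal (\<phi> (X N x) * W x)) \<le> per_int (\<lambda>x. ennreal (\<phi> (\<Sum>i<N. r i)) * ennreal (W x))"
      using XB X0 by (intro per_int_mono) (auto simp: \<phi>W intro!: mult_right_mono ennreal_leI young_functionD(3)[OF \<phi>])
    also have "\<dots> < \<infinity>" using Wfin by (subst per_int_cmult) (auto simp: ennreal_mult_less_top)
    finally have fin: "per_int (\<lambda>x. ennreal (\<phi> (X N x) * W x)) < \<infinity>" .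
    have "per_int (\<lambda>x. ennreal (X N x) * ennreal (g' x * W x)) = per_int (\<lambda>x. ennreal (h N x) * ennreal (W x) + ennreal (\<phi> (X N x) * W x))"
    proof (rule arg_cong[of _ _ per_int], rule ext)
      fix x
      have "X N x * (g' x * W x) = h N x * W x + \<phi> (X N x) * W x" by (simp add: h_def algebra_simps)
      then show "ennreal (X N x) * ennreal (g' x * W x) = ennreal (h N x) * ennreal (W x) + ennreal (\<phi> (X N x) * W x)"
        using h0[of N x] X0[of N x] g'0[of x] W0[of x] young_functionD(1)[OF \<phi>]
        by (simp add: ennreal_mult[symmetric] less_imp_le flip: ennreal_plus)
    qed
    also have "\<dots> = per_int (\<lambda>x. ennreal (h N x) * ennreal (W x)) + per_int (\<lambda>x. ennreal (\<phi> (X N x) * W x))"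
      by (rule per_int_add) measurable
    finally have "per_int (\<lambda>x. ennreal (\<phi> (X N x) * W x)) + per_int (\<lambda>x. ennreal (h N x) * ennreal (W x))
      \<le> per_int (\<lambda>x. ennreal (\<phi> (X N x) * W x)) + 1" using le by (simp add: add.commute)
    then show ?thesis using fin by (subst (asm) ennreal_add_left_cancel_le) auto
  qed
  have "per_int (\<lambda>x. young_compl \<phi> (g' x) * ennreal (W x)) = per_int (\<lambda>x. SUP N. ennreal (h N x) * ennreal (W x))"
    unfolding h_def X_def by (subst young_compl_eq_SUP[OF \<phi> r]) (auto simp: SUP_mult_right_ennreal)
  also have "\<dots> = (SUP N. per_int (\<lambda>x. ennreal (h N x) * ennreal (W x)))"
    unfolding per_int_def
  proof (subst nn_integral_monotone_convergence_SUP[symmetric])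
    show "incseq (\<lambda>N x. ennreal (h N x) * ennreal (W x) * indicator {0..<2 * pi} x)"
      using young_argmax_value(1)[of \<phi> r]
      by (intro incseq_SucI le_funI mult_right_mono ennreal_leI) (auto simp: h_def X_def)
  qed (auto simp: SUP_mult_right_ennreal)
  also have "\<dots> \<le> 1" by (intro SUP_least hN)
  finally have "g' \<in> wtests \<phi> W" using g'0 g'per by (auto simp: wtests_def)
  then show ?thesis using vg' unfolding v_def u_def by blast
qed

text \<open>The average is moved to the test function, which \<open>wtests_box_avg\<close> replaces
  by \<open>D * s\<close> times another admissible one.\<close>

lemma wnorm_box_avg:
  assumes \<phi>: "young_function \<phi>" and [measurable]: "W \<in> borel_measurable borel" and W0: "\<And>x. 0 < W x" and Wper: "per W"
    and Wfin: "per_int (\<lambda>x. ennreal (W x)) < \<infinity>"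
    and D: "0 < D" and s: "0 < s"
    and modular: "\<And>f B. f \<in> borel_measurable borel \<Longrightarrow> (\<And>x. 0 \<le> f x) \<Longrightarrow> (\<And>x. f x \<le> B) \<Longrightarrow> per f \<Longrightarrow>
      per_int (\<lambda>y. ennreal (\<phi> (enn2real (box_avg s (\<lambda>x. ennreal (f x)) y) / (D * s)) * W y))
      \<le> per_int (\<lambda>y. ennreal (\<phi> (f y) * W y))"
    and [measurable]: "F \<in> borel_measurable borel" and Fper: "per F"
  shows "wnorm \<phi> W (box_avg s F) \<le> ennreal (D * s) * wnorm \<phi> W F"
  unfolding wnorm_def[of _ _ "box_avg s F"]
proof (rule SUP_least)
  fix g assume g: "g \<in> wtests \<phi> W"
  then have [measurable]: "g \<in> borel_measurable borel" and gper: "per g" by (auto simp: wtests_def)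
  obtain g' where g': "g' \<in> wtests \<phi> W"
    "\<And>x. (\<integral>\<^sup>+t. indicator {-(s/2)..<s/2} t * ennreal (g (x - t) * W (x - t)) \<partial>lborel) = ennreal (D * s * (g' x * W x))"
  proof -
    have "\<exists>g'\<in>wtests \<phi> W. \<forall>x. (\<integral>\<^sup>+t. indicator {-(s/2)..<s/2} t * ennreal (g (x - t) * W (x - t)) \<partial>lborel) = ennreal (D * s * (g' x * W x))"
      by (rule wtests_box_avg[OF \<phi> assms(2) W0 Wper Wfin D s _ g]) (use modular in auto)
    then show thesis using that by blast
  qed
  then have [measurable]: "g' \<in> borel_measurable borel" by (auto simp: wtests_def)
  have "per_int (\<lambda>x. box_avg s F x * ennreal (g x * W x)) = per_int (\<lambda>x. F x * ennreal (D * s * (g' x * W x)))"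
    unfolding box_avg_def g'(2)[symmetric]
    by (rule per_int_conv_adjoint) (use Fper gper Wper in \<open>auto simp: per_def\<close>)
  also have "\<dots> = ennreal (D * s) * per_int (\<lambda>x. F x * ennreal (g' x * W x))"
    using D s by (subst per_int_cmult[symmetric]) (auto simp: ennreal_mult' mult_ac intro!: arg_cong[of _ _ per_int])
  also have "\<dots> \<le> ennreal (D * s) * wnorm \<phi> W F"
    unfolding wnorm_def using g'(1) by (intro mult_left_mono SUP_upper) auto
  finally show "per_int (\<lambda>x. box_avg s F x * ennreal (g x * W x)) \<le> ennreal (D * s) * wnorm \<phi> W F" .
qed

text \<open>Young's inequality bounds \<open>c\<close> times every pairing by 1 plus the
  modular.\<close>

lemma wnorm_finite:
  assumes \<phi>: "young_function \<phi>" and [measurable]: "W \<in> borel_measurable borel" and W0: "\<And>x. 0 < W x"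
    and [measurable]: "f \<in> borel_measurable borel" and c: "0 < c"
    and fin: "per_int (\<lambda>x. ennreal (\<phi> (c * \<bar>f x\<bar>) * W x)) < \<infinity>"
  shows "wnorm \<phi> W (\<lambda>x. ennreal \<bar>f x\<bar>) < \<infinity>"
proof -
  have [measurable]: "\<phi> \<in> borel_measurable borel" using \<phi> by (rule young_function_borel)
  note young_compl_borel[OF \<phi>, measurable]
  have le: "ennreal c * wnorm \<phi> W (\<lambda>x. ennreal \<bar>f x\<bar>) \<le> 1 + per_int (\<lambda>x. ennreal (\<phi> (c * \<bar>f x\<bar>) * W x))"
    unfolding wnorm_def SUP_mult_left_ennreal
  proof (rule SUP_least)
    fix g assume g: "g \<in> wtests \<phi> W"
    then have [measurable]: "g \<in> borel_measurable borel" and g0: "\<And>x. 0 \<le> g x" and g1: "per_int (\<lambda>x. young_compl \<phi> (g x) * ennreal (W x)) \<le> 1"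
      by (auto simp: wtests_def)
    have "ennreal c * per_int (\<lambda>x. ennreal \<bar>f x\<bar> * ennreal (g x * W x)) = per_int (\<lambda>x. ennreal c * (ennreal \<bar>f x\<bar> * ennreal (g x * W x)))"
      by (subst per_int_cmult) auto
    also have "\<dots> \<le> per_int (\<lambda>x. young_compl \<phi> (g x) * ennreal (W x) + ennreal (\<phi> (c * \<bar>f x\<bar>) * W x))"
    proof (rule per_int_mono)
      fix x
      have "ennreal c * (ennreal \<bar>f x\<bar> * ennreal (g x * W x)) = ennreal (c * \<bar>f x\<bar> * g x) * ennreal (W x)"
        using W0[of x] g0[of x] c by (simp add: ennreal_mult[symmetric] less_imp_le mult.assoc)
      also have "\<dots> \<le> (young_compl \<phi> (g x) + ennreal (\<phi> (c * \<bar>f x\<bar>))) * ennreal (W x)"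
        using g0 c by (intro mult_right_mono Young_inequality_compl[OF \<phi>]) auto
      finally show "ennreal c * (ennreal \<bar>f x\<bar> * ennreal (g x * W x)) \<le> young_compl \<phi> (g x) * ennreal (W x) + ennreal (\<phi> (c * \<bar>f x\<bar>) * W x)"
        using young_functionD(1)[OF \<phi>] by (simp add: distrib_right ennreal_mult')
    qed
    also have "\<dots> = per_int (\<lambda>x. young_compl \<phi> (g x) * ennreal (W x)) + per_int (\<lambda>x. ennreal (\<phi> (c * \<bar>f x\<bar>) * W x))"
      by (rule per_int_add) measurable
    also have "\<dots> \<le> 1 + per_int (\<lambda>x. ennreal (\<phi> (c * \<bar>f x\<bar>) * W x))" using g1 by (rule add_right_mono)
    finally show "ennreal c * per_int (\<lambda>x. ennreal \<bar>f x\<bar> * ennreal (g x * W x)) \<le> 1 + per_int (\<lambda>x. ennreal (\<phi> (c * \<bar>f x\<bar>) * W x))" .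
  qed
  also have "\<dots> < \<infinity>" using fin by simp
  finally show ?thesis using c by (auto simp: ennreal_mult_less_top)
qed

section \<open>Consequences for Young functions of class Q\<close>

lemma Ap_bound_per_int:
  assumes "Ap_bound W p A" shows "0 < per_int (\<lambda>x. ennreal (W x))" "per_int (\<lambda>x. ennreal (W x)) < \<infinity>"
proof -
  obtain w where "0 < w" "(\<integral>\<^sup>+x\<in>{0..<2*pi}. ennreal (W x) \<partial>lborel) = ennreal w"
    using Ap_boundE[OF assms, of 0 "2 * pi"] by auto
  then show "0 < per_int (\<lambda>x. ennreal (W x))" "per_int (\<lambda>x. ennreal (W x)) < \<infinity>"
    by (simp_all add: per_int_def)
qed

text \<open>The infimum in the index need not be attained, so an admissible \<open>q\<close> close
  to it is taken. Its reciprocal may lie below the index, but the open-ended range of Muckenhoupt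
  exponents still contains it.\<close>

lemma class_Q_interval_modular:
  assumes Q: "\<phi> \<in> class_Q" and Ap: "Ap_bound W (young_index \<phi>) A"
  shows "\<exists>C>0. interval_modular \<phi> W C"
proof -
  define S where "S = {p. 0 < p \<and> quasiconvex (\<lambda>x. \<phi> x powr p)}"
  have young: "young_function \<phi>" and ne: "S \<noteq> {}" using Q by (auto simp: class_Q_def S_def)
  have bdd: "bdd_below S" by (rule bdd_belowI[of _ 0]) (auto simp: S_def)
  have idx: "young_index \<phi> = 1 / Inf S" by (simp add: young_index_def S_def)
  have p: "1 < young_index \<phi>" using Ap by (simp add: Ap_bound_def)
  have "0 \<le> Inf S" using ne by (intro cInf_greatest) (auto simp: S_def)
  \<comment> \<open>Division by 0 yields 0, so a vanishing infimum would contradict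
    \<open>1 < young_index \<phi>\<close>.\<close>
  moreover have "Inf S \<noteq> 0" using p idx by auto
  ultimately have I: "0 < Inf S" by simp
  obtain p1 where p1: "1 \<le> p1" "p1 < young_index \<phi>" "\<And>p0. p1 < p0 \<Longrightarrow> p0 \<le> young_index \<phi> \<Longrightarrow> \<exists>A0. Ap_bound W p0 A0"
    using Ap_bound_open_ended[OF Ap] by blast
  have "Inf S < 1 / p1" using p1 I unfolding idx by (simp add: field_simps)
  then obtain q where q: "q \<in> S" "q < 1 / p1" using cInf_lessD[OF ne] by blast
  have Iq: "Inf S \<le> q" using bdd q by (intro cInf_lower)
  have q0: "0 < q" using q by (simp add: S_def)
  have q1: "q < 1" using q p1 by (auto intro: order.strict_trans2)
  have "p1 < 1 / q" "1 / q \<le> young_index \<phi>" using q q0 p1 Iq I by (auto simp: idx field_simps)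
  then obtain A0 where A0: "Ap_bound W (1 / q) A0" using p1(3) by blast
  obtain \<Phi> c where \<Phi>: "young_function \<Phi>" "convex_on UNIV \<Phi>" "1 \<le> c"
      "\<And>x. 0 \<le> x \<Longrightarrow> \<Phi> x \<le> \<phi> x powr q" "\<And>x. 0 \<le> x \<Longrightarrow> \<phi> x powr q \<le> \<Phi> (c * x)"
    using q unfolding S_def quasiconvex_def by blast
  show ?thesis by (rule interval_modular_inequality[OF \<Phi>(1,2,3) young q0 q1 \<Phi>(4,5) A0])
qed

lemma class_Q_box_avg:
  assumes Q: "\<phi> \<in> class_Q" and Ap: "Ap_bound W (young_index \<phi>) A" and Wper: "per W"
  shows "\<exists>D>0. \<forall>s F. 0 < s \<longrightarrow> F \<in> borel_measurable borel \<longrightarrow> per F \<longrightarrow> wnorm \<phi> W (box_avg s F) \<le> ennreal (D * s) * wnorm \<phi> W F"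
proof -
  have young: "young_function \<phi>" using Q by (simp add: class_Q_def)
  have W: "W \<in> borel_measurable borel" "\<And>x. 0 < W x" using Ap by (auto simp: Ap_bound_def)
  obtain C where C: "0 < C" and int: "interval_modular \<phi> W C"
    using class_Q_interval_modular[OF Q Ap] by blast
  have "wnorm \<phi> W (box_avg s F) \<le> ennreal (2 * C * s) * wnorm \<phi> W F"
    if "0 < s" "F \<in> borel_measurable borel" "per F" for s F
  proof (rule wnorm_box_avg[OF young W Wper Ap_bound_per_int(2)[OF Ap] _ that(1) _ that(2,3)])
    show "per_int (\<lambda>y. ennreal (\<phi> (enn2real (box_avg s (\<lambda>x. ennreal (f x)) y) / (2 * C * s)) * W y))
      \<le> per_int (\<lambda>y. ennreal (\<phi> (f y) * W y))"
      if "f \<in> borel_measurable borel" "\<And>x. 0 \<le> f x" "\<And>x. f x \<le> B" "per f" for f B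
      by (rule modular_box_avg[where f = f and B = B and s = s, OF young W Wper C int]) (use that \<open>0 < s\<close> in auto)
  qed (use C in auto)
  then show ?thesis using C by (intro exI[of _ "2 * C"]) auto
qed

text \<open>The modular inequality on a full period bounds \<open>\<phi>\<close> at the scaled mean
  of a truncation of \<open>c * |f|\<close> in terms of the modular; as \<open>\<phi>\<close> tends
  to infinity, these means stay bounded. Truncation supplies the boundedness demanded by
  \<open>interval_modular\<close>, and monotone convergence removes it.\<close>

lemma class_Q_integrable:
  assumes Q: "\<phi> \<in> class_Q" and Ap: "Ap_bound W (young_index \<phi>) A"
    and [measurable]: "f \<in> borel_measurable borel" and c: "0 < c"
    and fin: "per_int (\<lambda>x. ennreal (\<phi> (c * \<bar>f x\<bar>) * W x)) < \<infinity>"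
  shows "per_int (\<lambda>x. ennreal \<bar>f x\<bar>) < \<infinity>"
proof -
  have young: "young_function \<phi>" using Q by (simp add: class_Q_def)
  have [measurable]: "W \<in> borel_measurable borel" and W0: "\<And>x. 0 < W x" using Ap by (auto simp: Ap_bound_def)
  obtain C where C: "0 < C" and int: "interval_modular \<phi> W C"
    using class_Q_interval_modular[OF Q Ap] by blast
  define w where "w = enn2real (per_int (\<lambda>x. ennreal (W x)))"
  have w: "per_int (\<lambda>x. ennreal (W x)) = ennreal w" "0 < w"
    using Ap_bound_per_int[OF Ap] by (auto simp: w_def enn2real_positive_iff)
  define M where "M = enn2real (per_int (\<lambda>x. ennreal (\<phi> (c * \<bar>f x\<bar>) * W x)))"
  have M: "per_int (\<lambda>x. ennreal (\<phi> (c * \<bar>f x\<bar>) * W x)) = ennreal M" "0 \<le> M" using fin by (auto simp: M_def)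
  have "eventually (\<lambda>z. M / w < \<phi> z) at_top"
    using young unfolding young_function_def filterlim_at_top_dense by blast
  then obtain Z where Z: "\<And>z. Z \<le> z \<Longrightarrow> M / w < \<phi> z" by (auto simp: eventually_at_top_linorder)
  define fN where "fN N x = min (c * \<bar>f x\<bar>) (real N)" for N x
  have fN_meas [measurable]: "fN N \<in> borel_measurable borel" for N unfolding fN_def[abs_def] by measurable
  have fN0: "0 \<le> fN N x" "fN N x \<le> real N" "fN N x \<le> c * \<bar>f x\<bar>" for N x using c by (auto simp: fN_def)
  have le: "per_int (\<lambda>x. ennreal (fN N x)) \<le> ennreal (max 0 Z * C * (2 * pi))" for N
  proof -
    have "per_int (\<lambda>x. ennreal (fN N x)) \<le> per_int (\<lambda>x. ennreal (real N))"
      using fN0 by (intro per_int_mono ennreal_leI)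
    also have "\<dots> < \<infinity>" by (simp add: per_int_def nn_integral_cmult ennreal_mult_less_top)
    finally have "per_int (\<lambda>x. ennreal (fN N x)) < \<infinity>" .
    then obtain I where I: "per_int (\<lambda>x. ennreal (fN N x)) = ennreal I" "0 \<le> I"
      by (cases "per_int (\<lambda>x. ennreal (fN N x))") auto
    define m where "m = I / (2 * pi)"
    have m: "per_int (\<lambda>x. ennreal (fN N x)) = ennreal (m * (2 * pi - 0))" "0 \<le> m" using I by (auto simp: m_def)
    have "2 * (ennreal (\<phi> (m / C)) * per_int (\<lambda>x. ennreal (W x))) \<le> per_int (\<lambda>x. ennreal (\<phi> (fN N x) * W x))"
      using m unfolding per_int_def by (intro interval_modularD[OF int, where B = "real N"]) (auto simp: fN0)
    also have "\<dots> \<le> per_int (\<lambda>x. ennreal (\<phi> (c * \<bar>f x\<bar>) * W x))"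
      using fN0 W0 by (intro per_int_mono ennreal_leI mult_right_mono young_functionD(3)[OF young]) (auto simp: less_imp_le)
    finally have *: "2 * (ennreal (\<phi> (m / C)) * ennreal w) \<le> ennreal M" using w M by simp
    have "ennreal (\<phi> (m / C) * w) \<le> 2 * (ennreal (\<phi> (m / C)) * ennreal w)"
      using w young_functionD(1)[OF young] by (simp add: ennreal_mult mult_2 add_increasing)
    from order.trans[OF this *] have "\<phi> (m / C) * w \<le> M" using M by (simp add: ennreal_le_iff)
    then have "\<not> M / w < \<phi> (m / C)" using w by (simp add: field_simps)
    then have "m / C < Z" using Z[of "m / C"] by (meson not_le)
    then have "m / C \<le> max 0 Z" by simp
    then have "m \<le> max 0 Z * C" using C by (simp add: pos_divide_le_eq)
    then have "m * (2 * pi - 0) \<le> max 0 Z * C * (2 * pi)" by (simp add: mult_right_mono)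
    then show ?thesis unfolding m(1) by (rule ennreal_leI)
  qed
  have "ennreal c * per_int (\<lambda>x. ennreal \<bar>f x\<bar>) = per_int (\<lambda>x. ennreal (c * \<bar>f x\<bar>))"
    using c by (subst per_int_cmult[symmetric]) (auto simp: ennreal_mult)
  also have "\<dots> = per_int (\<lambda>x. SUP N. ennreal (fN N x))"
  proof (rule arg_cong[of _ _ per_int], rule ext, rule antisym)
    fix x
    obtain N :: nat where "c * \<bar>f x\<bar> \<le> real N" using real_arch_simple by blast
    then have "ennreal (c * \<bar>f x\<bar>) = ennreal (fN N x)" by (simp add: fN_def min_def)
    also have "\<dots> \<le> (SUP N. ennreal (fN N x))" by (rule SUP_upper) simp
    finally show "ennreal (c * \<bar>f x\<bar>) \<le> (SUP N. ennreal (fN N x))" .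
    show "(SUP N. ennreal (fN N x)) \<le> ennreal (c * \<bar>f x\<bar>)" by (intro SUP_least ennreal_leI fN0)
  qed
  also have "\<dots> = (SUP N. per_int (\<lambda>x. ennreal (fN N x)))"
    unfolding per_int_def
  proof (subst nn_integral_monotone_convergence_SUP[symmetric])
    show "incseq (\<lambda>N x. ennreal (fN N x) * indicator {0..<2 * pi} x)"
      by (intro incseq_SucI le_funI mult_right_mono ennreal_leI) (auto simp: fN_def)
  qed (auto simp: SUP_mult_right_ennreal)
  also have "\<dots> \<le> ennreal (max 0 Z * C * (2 * pi))" by (intro SUP_least le)
  also have "\<dots> < \<infinity>" by simp
  finally show ?thesis using c by (auto simp: ennreal_mult_less_top)
qed

section \<open>Convolution operators\<close>

lemma wnorm_mono: "(\<And>x. F x \<le> G x) \<Longrightarrow> wnorm \<phi> W F \<le> wnorm \<phi> W G"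
  unfolding wnorm_def by (intro SUP_mono' per_int_mono mult_right_mono) auto

lemma wnorm_zero: "wnorm \<phi> W (\<lambda>x. 0) = 0"
  unfolding wnorm_def per_int_def by (intro antisym SUP_least) auto

text \<open>The analytic input for all operator estimates that follow: averages at every scale
  \<open>s\<close> are bounded with one constant \<open>D\<close>.\<close>

locale box_bounded =
  fixes \<phi> W :: "real \<Rightarrow> real" and D :: real
  assumes W_borel [measurable]: "W \<in> borel_measurable borel"
    and W_per: "per W" and D_pos: "0 < D"
    and box: "0 < s \<Longrightarrow> F \<in> borel_measurable borel \<Longrightarrow> per F \<Longrightarrow>
      wnorm \<phi> W (box_avg s F) \<le> ennreal (D * s) * wnorm \<phi> W F"
begin

abbreviation nrm :: "(real \<Rightarrow> ennreal) \<Rightarrow> ennreal" where "nrm \<equiv> wnorm \<phi> W"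

abbreviation rnrm :: "(real \<Rightarrow> real) \<Rightarrow> ennreal" where "rnrm f \<equiv> wnorm \<phi> W (\<lambda>x. ennreal \<bar>f x\<bar>)"

lemma wtests_borel: "g \<in> wtests \<phi> W \<Longrightarrow> (\<lambda>x. ennreal (g x * W x)) \<in> borel_measurable borel"
  by (auto simp: wtests_def intro!: measurable_compose[OF _ measurable_ennreal] borel_measurable_times)

lemma nrm_add:
  assumes [measurable]: "F \<in> borel_measurable borel" "G \<in> borel_measurable borel"
  shows "nrm (\<lambda>x. F x + G x) \<le> nrm F + nrm G"
  unfolding wnorm_def[of _ _ "\<lambda>x. F x + G x"]
proof (rule SUP_least)
  fix g assume g: "g \<in> wtests \<phi> W"
  note wtests_borel[OF g, measurable]
  have "per_int (\<lambda>x. (F x + G x) * ennreal (g x * W x)) = per_int (\<lambda>x. F x * ennreal (g x * W x)) + per_int (\<lambda>x. G x * ennreal (g x * W x))"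
    unfolding distrib_right by (rule per_int_add) measurable
  also have "\<dots> \<le> nrm F + nrm G" unfolding wnorm_def by (intro add_mono SUP_upper g)
  finally show "per_int (\<lambda>x. (F x + G x) * ennreal (g x * W x)) \<le> nrm F + nrm G" .
qed

lemma nrm_cmult:
  assumes [measurable]: "F \<in> borel_measurable borel"
  shows "nrm (\<lambda>x. c * F x) \<le> c * nrm F"
  unfolding wnorm_def[of _ _ "\<lambda>x. c * F x"]
proof (rule SUP_least)
  fix g assume g: "g \<in> wtests \<phi> W"
  note wtests_borel[OF g, measurable]
  have "per_int (\<lambda>x. c * F x * ennreal (g x * W x)) = c * per_int (\<lambda>x. F x * ennreal (g x * W x))"
    unfolding mult.assoc by (rule per_int_cmult) measurable
  also have "\<dots> \<le> c * nrm F" unfolding wnorm_def by (intro mult_left_mono SUP_upper g) auto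
  finally show "per_int (\<lambda>x. c * F x * ennreal (g x * W x)) \<le> c * nrm F" .
qed

lemma nrm_suminf:
  assumes [measurable]: "\<And>i. F i \<in> borel_measurable borel"
  shows "nrm (\<lambda>x. \<Sum>i::nat. F i x) \<le> (\<Sum>i. nrm (F i))"
  unfolding wnorm_def[of _ _ "\<lambda>x. \<Sum>i. F i x"]
proof (rule SUP_least)
  fix g assume g: "g \<in> wtests \<phi> W"
  note wtests_borel[OF g, measurable]
  have "per_int (\<lambda>x. (\<Sum>i. F i x) * ennreal (g x * W x)) = (\<Sum>i. per_int (\<lambda>x. F i x * ennreal (g x * W x)))"
    unfolding per_int_def by (subst nn_integral_suminf[symmetric]) auto
  also have "\<dots> \<le> (\<Sum>i. nrm (F i))" unfolding wnorm_def by (intro suminf_le SUP_upper g) auto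
  finally show "per_int (\<lambda>x. (\<Sum>i. F i x) * ennreal (g x * W x)) \<le> (\<Sum>i. nrm (F i))" .
qed

lemma rnrm_add:
  assumes [measurable]: "f \<in> borel_measurable borel" "g \<in> borel_measurable borel"
  shows "rnrm (\<lambda>x. f x + g x) \<le> rnrm f + rnrm g"
proof -
  have "rnrm (\<lambda>x. f x + g x) \<le> nrm (\<lambda>x. ennreal \<bar>f x\<bar> + ennreal \<bar>g x\<bar>)"
    by (intro wnorm_mono) (simp flip: ennreal_plus)
  also have "\<dots> \<le> rnrm f + rnrm g" by (rule nrm_add) measurable
  finally show ?thesis .
qed

lemma rnrm_diff:
  assumes "f \<in> borel_measurable borel" "g \<in> borel_measurable borel"
  shows "rnrm (\<lambda>x. f x - g x) \<le> rnrm f + rnrm g"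
  using rnrm_add[of f "\<lambda>x. - g x"] assms by simp

lemma rnrm_cmult:
  assumes [measurable]: "f \<in> borel_measurable borel"
  shows "rnrm (\<lambda>x. c * f x) \<le> ennreal \<bar>c\<bar> * rnrm f"
  using nrm_cmult[of "\<lambda>x. ennreal \<bar>f x\<bar>" "ennreal \<bar>c\<bar>"] by (simp add: abs_mult ennreal_mult)

text \<open>By the layer cake representation, convolution with an even kernel that decreases away from 0
  is a mixture of box averages.\<close>

lemma nrm_decreasing_kernel:
  fixes M F :: "real \<Rightarrow> ennreal"
  assumes [measurable]: "M \<in> borel_measurable borel" "F \<in> borel_measurable borel" and Fper: "per F"
    and decr: "\<And>x y. \<bar>x\<bar> \<le> \<bar>y\<bar> \<Longrightarrow> M y \<le> M x" and Mfin: "\<And>t. M t < \<infinity>"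
    and Mint: "(\<integral>\<^sup>+t. M t \<partial>lborel) < \<infinity>"
  shows "nrm (\<lambda>x. \<integral>\<^sup>+t. M t * F (x + t) \<partial>lborel) \<le> ennreal D * (\<integral>\<^sup>+t. M t \<partial>lborel) * nrm F"
proof -
  \<comment> \<open>The indicator of the superlevel set of \<open>M\<close> at height
    \<open>y\<close>, as a function of both variables so that the integrals can be
    interchanged.\<close>
  define lev :: "real \<Rightarrow> real \<Rightarrow> ennreal" where "lev y t = (if 0 < y \<and> ennreal y < M t then 1 else 0)" for y t
  have lev_meas [measurable]: "(\<lambda>(y, t). lev y t) \<in> borel_measurable (borel \<Otimes>\<^sub>M borel)"
    unfolding lev_def by measurable
  have layer: "M t = (\<integral>\<^sup>+y. lev y t \<partial>lborel)" for t
  proof -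
    obtain m where m: "M t = ennreal m" "0 \<le> m" using Mfin[of t] by (cases "M t") auto
    have "(\<integral>\<^sup>+y. lev y t \<partial>lborel) = (\<integral>\<^sup>+y. indicator {0<..<m} y \<partial>lborel)"
      by (intro nn_integral_cong) (auto simp: lev_def m ennreal_less_iff indicator_def)
    then show ?thesis using m by simp
  qed
  have level: "nrm (\<lambda>x. \<integral>\<^sup>+t. lev y t * F (x + t) \<partial>lborel) \<le> ennreal D * (\<integral>\<^sup>+t. lev y t \<partial>lborel) * nrm F" for y
  proof (cases "\<exists>t. 0 < y \<and> ennreal y < M t")
    case False
    then have "lev y t = 0" for t by (auto simp: lev_def)
    then show ?thesis by (simp add: wnorm_zero)
  next
    case True
    define S where "S = {t. ennreal y < M t}"
    have y: "0 < y" and S_ne: "S \<noteq> {}" using True by (auto simp: S_def)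
    have [measurable]: "S \<in> sets borel" unfolding S_def by measurable
    have S_mem: "t' \<in> S" if "t \<in> S" "\<bar>t'\<bar> \<le> \<bar>t\<bar>" for t t'
      using decr[OF that(2)] that(1) by (auto simp: S_def)
    obtain I where I: "(\<integral>\<^sup>+t. M t \<partial>lborel) = ennreal I" "0 \<le> I" using Mint by (cases "\<integral>\<^sup>+t. M t \<partial>lborel") auto
    have bdd: "\<bar>t\<bar> \<le> I / (2 * y)" if "t \<in> S" for t
    proof -
      have "ennreal (2 * \<bar>t\<bar> * y) = (\<integral>\<^sup>+u. ennreal y * indicator {-\<bar>t\<bar>..\<bar>t\<bar>} u \<partial>lborel)"
        using y by (subst nn_integral_cmult) (auto simp: ennreal_mult[symmetric] mult.commute)
      also have "\<dots> \<le> (\<integral>\<^sup>+u. M u \<partial>lborel)"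
      proof (rule nn_integral_mono)
        fix u show "ennreal y * indicator {-\<bar>t\<bar>..\<bar>t\<bar>} u \<le> M u"
          using S_mem[OF that, of u] by (auto simp: indicator_def S_def abs_le_iff less_imp_le)
      qed
      finally show ?thesis using y I by (simp add: ennreal_le_iff field_simps)
    qed
    \<comment> \<open>By monotonicity the superlevel set is an interval symmetric about 0, up to its
      endpoints; \<open>r\<close> is its radius, finite because \<open>M\<close> is
      integrable.\<close>
    define r where "r = (SUP t\<in>S. \<bar>t\<bar>)"
    have bdd': "bdd_above ((\<lambda>t. \<bar>t\<bar>) ` S)" using bdd by (intro bdd_aboveI[of _ "I / (2 * y)"]) auto
    have S_le: "\<bar>t\<bar> \<le> r" if "t \<in> S" for t unfolding r_def using that bdd' by (rule cSUP_upper)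
    have S_ge: "t \<in> S" if t: "\<bar>t\<bar> < r" for t
    proof -
      obtain u where "u \<in> S" "\<bar>t\<bar> < \<bar>u\<bar>" using t unfolding r_def by (subst (asm) less_cSUP_iff[OF S_ne bdd']) auto
      then show ?thesis by (intro S_mem[of u t]) auto
    qed
    have r0: "0 \<le> r" using S_ne S_le by force
    have ae: "AE t in lborel. lev y t = indicator {-(2 * r / 2)..<2 * r / 2} t"
      using AE_lborel_singleton[of r] AE_lborel_singleton[of "- r"]
    proof eventually_elim
      case (elim t)
      have "t \<in> S \<longleftrightarrow> t \<in> {-(2 * r / 2)..<2 * r / 2}"
        using S_le[of t] S_ge[of t] elim by (auto simp: abs_le_iff abs_less_iff)
      then show ?case using y by (auto simp: lev_def S_def indicator_def)
    qed
    have eq: "(\<integral>\<^sup>+t. lev y t * F (x + t) \<partial>lborel) = box_avg (2 * r) F x" for x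
      unfolding box_avg_def using ae by (intro nn_integral_cong_AE) (auto elim!: eventually_mono)
    have "(\<integral>\<^sup>+t. lev y t \<partial>lborel) = (\<integral>\<^sup>+t. indicator {-(2 * r / 2)..<2 * r / 2} t \<partial>lborel)"
      using ae by (intro nn_integral_cong_AE) auto
    also have "\<dots> = ennreal (2 * r)" using r0 by simp
    finally have len: "(\<integral>\<^sup>+t. lev y t \<partial>lborel) = ennreal (2 * r)" .
    show ?thesis
    proof (cases "r = 0")
      case True
      then have "box_avg (2 * r) F x = 0" for x by (simp add: box_avg_def)
      then show ?thesis by (simp add: eq wnorm_zero)
    next
      case False
      then have "nrm (box_avg (2 * r) F) \<le> ennreal (D * (2 * r)) * nrm F" using r0 Fper by (intro box) auto
      then show ?thesis using r0 D_pos by (simp add: eq len ennreal_mult)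
    qed
  qed
  show ?thesis
    unfolding wnorm_def[of _ _ "\<lambda>x. \<integral>\<^sup>+t. M t * F (x + t) \<partial>lborel"]
  proof (rule SUP_least)
    fix g assume g: "g \<in> wtests \<phi> W"
    note wtests_borel[OF g, measurable]
    have "per_int (\<lambda>x. (\<integral>\<^sup>+t. M t * F (x + t) \<partial>lborel) * ennreal (g x * W x))
      = per_int (\<lambda>x. \<integral>\<^sup>+y. (\<integral>\<^sup>+t. lev y t * F (x + t) \<partial>lborel) * ennreal (g x * W x) \<partial>lborel)"
    proof (rule arg_cong[of _ _ per_int], rule ext)
      fix x
      have "(\<integral>\<^sup>+t. M t * F (x + t) \<partial>lborel) = (\<integral>\<^sup>+t. \<integral>\<^sup>+y. lev y t * F (x + t) \<partial>lborel \<partial>lborel)"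
        unfolding layer by (intro nn_integral_cong nn_integral_multc[symmetric]) measurable
      also have "\<dots> = (\<integral>\<^sup>+y. \<integral>\<^sup>+t. lev y t * F (x + t) \<partial>lborel \<partial>lborel)"
        by (rule lborel_pair.Fubini') measurable
      finally show "(\<integral>\<^sup>+t. M t * F (x + t) \<partial>lborel) * ennreal (g x * W x)
        = (\<integral>\<^sup>+y. (\<integral>\<^sup>+t. lev y t * F (x + t) \<partial>lborel) * ennreal (g x * W x) \<partial>lborel)"
        by (subst nn_integral_multc) auto
    qed
    also have "\<dots> = (\<integral>\<^sup>+y. per_int (\<lambda>x. (\<integral>\<^sup>+t. lev y t * F (x + t) \<partial>lborel) * ennreal (g x * W x)) \<partial>lborel)"
      by (rule per_int_nn_integral_swap) measurable
    also have "\<dots> \<le> (\<integral>\<^sup>+y. (ennreal D * nrm F) * (\<integral>\<^sup>+t. lev y t \<partial>lborel) \<partial>lborel)"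
    proof (rule nn_integral_mono)
      fix y
      have "per_int (\<lambda>x. (\<integral>\<^sup>+t. lev y t * F (x + t) \<partial>lborel) * ennreal (g x * W x)) \<le> nrm (\<lambda>x. \<integral>\<^sup>+t. lev y t * F (x + t) \<partial>lborel)"
        unfolding wnorm_def by (rule SUP_upper[OF g])
      also note level[of y]
      finally show "per_int (\<lambda>x. (\<integral>\<^sup>+t. lev y t * F (x + t) \<partial>lborel) * ennreal (g x * W x)) \<le> (ennreal D * nrm F) * (\<integral>\<^sup>+t. lev y t \<partial>lborel)"
        by (simp add: mult_ac)
    qed
    also have "\<dots> = (ennreal D * nrm F) * (\<integral>\<^sup>+y. \<integral>\<^sup>+t. lev y t \<partial>lborel \<partial>lborel)"
      by (rule nn_integral_cmult) measurable
    also have "(\<integral>\<^sup>+y. \<integral>\<^sup>+t. lev y t \<partial>lborel \<partial>lborel) = (\<integral>\<^sup>+t. M t \<partial>lborel)"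
      unfolding layer by (rule lborel_pair.Fubini') measurable
    finally show "per_int (\<lambda>x. (\<integral>\<^sup>+t. M t * F (x + t) \<partial>lborel) * ennreal (g x * W x)) \<le> ennreal D * (\<integral>\<^sup>+t. M t \<partial>lborel) * nrm F"
      by (simp add: mult_ac)
  qed
qed

end

text \<open>Boundedness and bounded support make convolution with a periodic integrable function
  converge absolutely at every point, not merely almost everywhere, so that identities between
  operators hold pointwise.\<close>

definition kernel :: "(real \<Rightarrow> real) \<Rightarrow> bool" where
  "kernel K \<longleftrightarrow> K \<in> borel_measurable borel \<and> (\<exists>R B. \<forall>t. \<bar>K t\<bar> \<le> B * indicator {-R..<R} t)"

definition per_L1 :: "(real \<Rightarrow> real) \<Rightarrow> bool" where
  "per_L1 f \<longleftrightarrow> f \<in> borel_measurable borel \<and> per f \<and> per_int (\<lambda>x. ennreal \<bar>f x\<bar>) < \<infinity>"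

text \<open>The sign convention matches \<open>steklov\<close>, which becomes \<open>conv\<close> of
  a box kernel. Composition corresponds to the ordinary convolution \<open>kconv\<close> of the
  kernels, see \<open>conv_conv\<close>.\<close>

definition conv :: "(real \<Rightarrow> real) \<Rightarrow> (real \<Rightarrow> real) \<Rightarrow> real \<Rightarrow> real" where
  "conv K f x = (\<integral>t. K t * f (x + t) \<partial>lborel)"

definition kconv :: "(real \<Rightarrow> real) \<Rightarrow> (real \<Rightarrow> real) \<Rightarrow> real \<Rightarrow> real" where
  "kconv K L u = (\<integral>s. K s * L (u - s) \<partial>lborel)"

lemma kernel_borel [measurable_dest]: "kernel K \<Longrightarrow> K \<in> borel_measurable borel"
  by (simp add: kernel_def)

lemma per_L1_borel [measurable_dest]: "per_L1 f \<Longrightarrow> f \<in> borel_measurable borel"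
  by (simp add: per_L1_def)

lemma kernelE:
  assumes "kernel K"
  obtains R B where "0 < R" "0 \<le> B" "\<And>t. \<bar>K t\<bar> \<le> B" "\<And>t. t \<notin> {-R..<R} \<Longrightarrow> K t = 0"
proof -
  obtain R B where RB: "\<And>t. \<bar>K t\<bar> \<le> B * indicator {-R..<R} t" using assms by (auto simp: kernel_def)
  show thesis
  proof (rule that[of "max R 1" "max B 0"])
    show "\<bar>K t\<bar> \<le> max B 0" for t
      using RB[of t] by (cases "t \<in> {-R..<R}") auto
    show "K t = 0" if "t \<notin> {- max R 1..<max R 1}" for t
      using RB[of t] that by (cases "t \<in> {-R..<R}") auto
  qed auto
qed

lemma kernelI:
  assumes "K \<in> borel_measurable borel" "\<And>t. \<bar>K t\<bar> \<le> B" "\<And>t. R < \<bar>t\<bar> \<Longrightarrow> K t = 0"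
  shows "kernel K"
  unfolding kernel_def
proof (intro conjI exI allI)
  fix t show "\<bar>K t\<bar> \<le> B * indicator {-(R + 1)..<R + 1} t"
    using assms(2)[of t] assms(3)[of t] by (auto simp: indicator_def)
qed fact

lemma per_L1_Ico_finite:
  assumes "per_L1 f" shows "(\<integral>\<^sup>+x\<in>{a..<b}. ennreal \<bar>f x\<bar> \<partial>lborel) < \<infinity>"
  using assms by (intro per_int_Ico_finite) (auto simp: per_L1_def per_def)

lemma kernel_nn_finite:
  assumes K: "kernel K" and f: "per_L1 f"
  shows "(\<integral>\<^sup>+t. ennreal \<bar>K t\<bar> * ennreal \<bar>f (x + t)\<bar> \<partial>lborel) < \<infinity>"
proof -
  have [measurable]: "K \<in> borel_measurable borel" "f \<in> borel_measurable borel" using K f kernel_borel per_L1_borel by auto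
  obtain R B where RB: "0 < R" "0 \<le> B" "\<And>t. \<bar>K t\<bar> \<le> B" "\<And>t. t \<notin> {-R..<R} \<Longrightarrow> K t = 0" by (rule kernelE[OF K]) blast
  have "(\<integral>\<^sup>+t. ennreal \<bar>K t\<bar> * ennreal \<bar>f (x + t)\<bar> \<partial>lborel)
    \<le> (\<integral>\<^sup>+t. ennreal B * (ennreal \<bar>f (t + x)\<bar> * indicator {-R..<R} t) \<partial>lborel)"
  proof (rule nn_integral_mono)
    fix t
    have "ennreal \<bar>K t\<bar> \<le> ennreal B * indicator {-R..<R} t"
      using RB(3,4)[of t] by (cases "t \<in> {-R..<R}") (auto intro: ennreal_leI)
    from mult_right_mono[OF this, of "ennreal \<bar>f (x + t)\<bar>"]
    show "ennreal \<bar>K t\<bar> * ennreal \<bar>f (x + t)\<bar> \<le> ennreal B * (ennreal \<bar>f (t + x)\<bar> * indicator {-R..<R} t)"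
      by (auto simp: indicator_def add.commute)
  qed
  also have "\<dots> = ennreal B * (\<integral>\<^sup>+t\<in>{-R..<R}. ennreal \<bar>f (t + x)\<bar> \<partial>lborel)"
    by (rule nn_integral_cmult) measurable
  also have "\<dots> = ennreal B * (\<integral>\<^sup>+t\<in>{-R+x..<R+x}. ennreal \<bar>f t\<bar> \<partial>lborel)"
    by (subst nn_integral_Ico_shift) auto
  also have "\<dots> < \<infinity>" using per_L1_Ico_finite[OF f] by (simp add: ennreal_mult_less_top)
  finally show ?thesis .
qed

lemma conv_integrable:
  assumes K: "kernel K" and f: "per_L1 f"
  shows "integrable lborel (\<lambda>t. K t * f (x + t))"
  using kernel_nn_finite[OF K f, of x] kernel_borel[OF K] per_L1_borel[OF f]
  by (intro integrableI_bounded) (auto simp: abs_mult ennreal_mult)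

lemma conv_borel [measurable]:
  assumes [measurable]: "K \<in> borel_measurable borel" "f \<in> borel_measurable borel"
  shows "conv K f \<in> borel_measurable borel"
  unfolding conv_def[abs_def] by measurable

lemma conv_per: "per f \<Longrightarrow> per (conv K f)"
  using perD[of f "_ + _"] by (simp add: per_def conv_def add_ac)

lemma abs_conv_le:
  assumes "kernel K" "per_L1 f"
  shows "ennreal \<bar>conv K f x\<bar> \<le> (\<integral>\<^sup>+t. ennreal \<bar>K t\<bar> * ennreal \<bar>f (x + t)\<bar> \<partial>lborel)"
proof -
  have "ennreal \<bar>conv K f x\<bar> \<le> (\<integral>\<^sup>+t. ennreal (norm (K t * f (x + t))) \<partial>lborel)"
    unfolding conv_def real_norm_def[symmetric] by (rule integral_norm_bound_ennreal[OF conv_integrable[OF assms]])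
  then show ?thesis by (simp add: abs_mult ennreal_mult)
qed

lemma kernel_integrable: assumes K: "kernel K" shows "integrable lborel K" "(\<integral>\<^sup>+t. ennreal \<bar>K t\<bar> \<partial>lborel) < \<infinity>"
proof -
  have [measurable]: "K \<in> borel_measurable borel" by (rule kernel_borel[OF K])
  obtain R B where RB: "0 < R" "0 \<le> B" "\<And>t. \<bar>K t\<bar> \<le> B" "\<And>t. t \<notin> {-R..<R} \<Longrightarrow> K t = 0" by (rule kernelE[OF K]) blast
  have "(\<integral>\<^sup>+t. ennreal \<bar>K t\<bar> \<partial>lborel) \<le> (\<integral>\<^sup>+t. ennreal B * indicator {-R..<R} t \<partial>lborel)"
  proof (rule nn_integral_mono)
    fix t show "ennreal \<bar>K t\<bar> \<le> ennreal B * indicator {-R..<R} t"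
      using RB(3,4)[of t] by (cases "t \<in> {-R..<R}") (auto intro: ennreal_leI)
  qed
  also have "\<dots> = ennreal B * ennreal (2 * R)" using RB by (subst nn_integral_cmult) auto
  also have "\<dots> < \<infinity>" by (simp add: ennreal_mult_less_top)
  finally show 1: "(\<integral>\<^sup>+t. ennreal \<bar>K t\<bar> \<partial>lborel) < \<infinity>" .
  then show "integrable lborel K" by (intro integrableI_bounded) auto
qed

lemma per_L1_conv:
  assumes K: "kernel K" and f: "per_L1 f"
  shows "per_L1 (conv K f)"
proof -
  have [measurable]: "K \<in> borel_measurable borel" "f \<in> borel_measurable borel" using K f kernel_borel per_L1_borel by auto
  have "per_int (\<lambda>x. ennreal \<bar>conv K f x\<bar>) \<le> per_int (\<lambda>x. \<integral>\<^sup>+t. ennreal \<bar>K t\<bar> * ennreal \<bar>f (x + t)\<bar> \<partial>lborel)"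
    by (intro per_int_mono abs_conv_le[OF K f])
  also have "\<dots> = (\<integral>\<^sup>+t. ennreal \<bar>K t\<bar> \<partial>lborel) * per_int (\<lambda>x. ennreal \<bar>f x\<bar>)"
    using f by (intro per_int_conv) (auto simp: per_L1_def per_def)
  also have "\<dots> < \<infinity>" using f kernel_integrable[OF K] by (auto simp: ennreal_mult_less_top per_L1_def)
  finally show ?thesis using f conv_per[of f K] by (simp add: per_L1_def)
qed

lemma per_L1_add: "per_L1 f \<Longrightarrow> per_L1 g \<Longrightarrow> per_L1 (\<lambda>x. f x + g x)"
proof -
  assume f: "per_L1 f" and g: "per_L1 g"
  have [measurable]: "g \<in> borel_measurable borel" "f \<in> borel_measurable borel" using f g per_L1_borel by auto
  have "per_int (\<lambda>x. ennreal \<bar>f x + g x\<bar>) \<le> per_int (\<lambda>x. ennreal \<bar>f x\<bar> + ennreal \<bar>g x\<bar>)"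
    by (intro per_int_mono) (simp flip: ennreal_plus)
  also have "\<dots> < \<infinity>" using f g by (subst per_int_add) (auto simp: per_L1_def)
  finally show ?thesis using f g by (simp add: per_L1_def per_def)
qed

lemma per_L1_cmult: "per_L1 f \<Longrightarrow> per_L1 (\<lambda>x. c * f x)"
proof -
  assume f: "per_L1 f"
  have [measurable]: "f \<in> borel_measurable borel" using f per_L1_borel by auto
  have "per_int (\<lambda>x. ennreal \<bar>c * f x\<bar>) = ennreal \<bar>c\<bar> * per_int (\<lambda>x. ennreal \<bar>f x\<bar>)"
    by (subst per_int_cmult[symmetric]) (auto simp: abs_mult ennreal_mult)
  also have "\<dots> < \<infinity>" using f by (auto simp: per_L1_def ennreal_mult_less_top)
  finally show ?thesis using f by (simp add: per_L1_def per_def)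
qed

lemma per_L1_diff: "per_L1 f \<Longrightarrow> per_L1 g \<Longrightarrow> per_L1 (\<lambda>x. f x - g x)"
  using per_L1_add[of f "\<lambda>x. (-1) * g x"] per_L1_cmult[of g "-1"] by simp

lemma conv_add: "kernel K \<Longrightarrow> per_L1 f \<Longrightarrow> per_L1 g \<Longrightarrow> conv K (\<lambda>x. f x + g x) = (\<lambda>x. conv K f x + conv K g x)"
  by (rule ext) (simp add: conv_def distrib_left conv_integrable)

lemma conv_diff: "kernel K \<Longrightarrow> per_L1 f \<Longrightarrow> per_L1 g \<Longrightarrow> conv K (\<lambda>x. f x - g x) = (\<lambda>x. conv K f x - conv K g x)"
  by (rule ext) (simp add: conv_def right_diff_distrib conv_integrable)

lemma conv_kernel_add: "kernel K \<Longrightarrow> kernel L \<Longrightarrow> per_L1 f \<Longrightarrow> conv (\<lambda>t. K t + L t) f = (\<lambda>x. conv K f x + conv L f x)"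
  by (rule ext) (simp add: conv_def distrib_right conv_integrable)

lemma conv_kernel_diff: "kernel K \<Longrightarrow> kernel L \<Longrightarrow> per_L1 f \<Longrightarrow> conv (\<lambda>t. K t - L t) f = (\<lambda>x. conv K f x - conv L f x)"
  by (rule ext) (simp add: conv_def left_diff_distrib conv_integrable)

lemma conv_kernel_cmult: "conv (\<lambda>t. c * K t) f = (\<lambda>x. c * conv K f x)"
  by (rule ext) (simp add: conv_def mult.assoc)

lemma kernel_kconv:
  assumes K: "kernel K" and L: "kernel L" shows "kernel (kconv K L)"
proof -
  have [measurable]: "K \<in> borel_measurable borel" "L \<in> borel_measurable borel" using K L kernel_borel by auto
  obtain R B where RB: "0 < R" "0 \<le> B" "\<And>t. \<bar>K t\<bar> \<le> B" "\<And>t. t \<notin> {-R..<R} \<Longrightarrow> K t = 0" by (rule kernelE[OF K]) blast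
  obtain R' B' where RB': "0 < R'" "0 \<le> B'" "\<And>t. \<bar>L t\<bar> \<le> B'" "\<And>t. t \<notin> {-R'..<R'} \<Longrightarrow> L t = 0" by (rule kernelE[OF L]) blast
  show ?thesis
  proof (rule kernelI)
    show "kconv K L \<in> borel_measurable borel" unfolding kconv_def[abs_def] by measurable
    show "\<bar>kconv K L u\<bar> \<le> (\<integral>s. \<bar>K s\<bar> * B' \<partial>lborel)" for u
    proof -
      have "\<bar>kconv K L u\<bar> \<le> (\<integral>s. \<bar>K s * L (u - s)\<bar> \<partial>lborel)" unfolding kconv_def by (rule integral_abs_bound)
      also have "\<dots> \<le> (\<integral>s. \<bar>K s\<bar> * B' \<partial>lborel)"
      proof (rule integral_mono')
        show "integrable lborel (\<lambda>s. \<bar>K s\<bar> * B')" using kernel_integrable(1)[OF K] by auto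
      qed (auto simp: abs_mult intro!: mult_left_mono mult_nonneg_nonneg RB')
      finally show ?thesis .
    qed
    show "kconv K L u = 0" if "R + R' < \<bar>u\<bar>" for u
    proof -
      have "K s * L (u - s) = 0" for s
      proof (cases "s \<in> {-R..<R}")
        case True
        then have "u - s \<notin> {-R'..<R'}" using that by (auto simp: abs_if split: if_splits)
        then show ?thesis using RB'(4) by simp
      qed (use RB(4) in auto)
      then have "(\<lambda>s. K s * L (u - s)) = (\<lambda>s. 0)" by blast
      then show ?thesis by (simp add: kconv_def del: mult_eq_0_iff)
    qed
  qed
qed

lemma conv_conv:
  assumes K: "kernel K" and L: "kernel L" and f: "per_L1 f"
  shows "conv K (conv L f) = conv (kconv K L) f"
proof
  fix x
  have [measurable]: "K \<in> borel_measurable borel" "L \<in> borel_measurable borel" "f \<in> borel_measurable borel"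
    using K L f kernel_borel per_L1_borel by auto
  have inner: "conv L f (x + s) = (\<integral>u. L (u - s) * f (x + u) \<partial>lborel)" for s
    using lborel_integral_real_affine[of 1 "\<lambda>u. L (u - s) * f (x + u)" s] by (simp add: conv_def add_ac)
  have int: "integrable (lborel \<Otimes>\<^sub>M lborel) (\<lambda>(s, u). K s * (L (u - s) * f (x + u)))"
  proof (rule integrableI_bounded)
    have "(\<integral>\<^sup>+z. ennreal (norm (case z of (s, u) \<Rightarrow> K s * (L (u - s) * f (x + u)))) \<partial>(lborel \<Otimes>\<^sub>M lborel))
      = (\<integral>\<^sup>+s. \<integral>\<^sup>+u. ennreal \<bar>K s\<bar> * (ennreal \<bar>L (u - s)\<bar> * ennreal \<bar>f (x + u)\<bar>) \<partial>lborel \<partial>lborel)"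
      by (subst lborel.nn_integral_fst[symmetric]) (auto simp: abs_mult ennreal_mult)
    also have "\<dots> = (\<integral>\<^sup>+s. ennreal \<bar>K s\<bar> * (\<integral>\<^sup>+u. ennreal \<bar>L u\<bar> * ennreal \<bar>f ((x + s) + u)\<bar> \<partial>lborel) \<partial>lborel)"
    proof (intro nn_integral_cong)
      fix s
      have "(\<integral>\<^sup>+u. ennreal \<bar>K s\<bar> * (ennreal \<bar>L (u - s)\<bar> * ennreal \<bar>f (x + u)\<bar>) \<partial>lborel)
        = ennreal \<bar>K s\<bar> * (\<integral>\<^sup>+u. ennreal \<bar>L (u - s)\<bar> * ennreal \<bar>f (x + u)\<bar> \<partial>lborel)"
        by (rule nn_integral_cmult) measurable
      also have "(\<integral>\<^sup>+u. ennreal \<bar>L (u - s)\<bar> * ennreal \<bar>f (x + u)\<bar> \<partial>lborel) = (\<integral>\<^sup>+u. ennreal \<bar>L u\<bar> * ennreal \<bar>f ((x + s) + u)\<bar> \<partial>lborel)"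
        by (subst nn_integral_shift[symmetric, of _ s]) (auto simp: add_ac)
      finally show "(\<integral>\<^sup>+u. ennreal \<bar>K s\<bar> * (ennreal \<bar>L (u - s)\<bar> * ennreal \<bar>f (x + u)\<bar>) \<partial>lborel)
        = ennreal \<bar>K s\<bar> * (\<integral>\<^sup>+u. ennreal \<bar>L u\<bar> * ennreal \<bar>f ((x + s) + u)\<bar> \<partial>lborel)" .
    qed
    also have "\<dots> < \<infinity>"
    proof -
      obtain R B where RB: "0 < R" "0 \<le> B" "\<And>t. \<bar>K t\<bar> \<le> B" "\<And>t. t \<notin> {-R..<R} \<Longrightarrow> K t = 0" by (rule kernelE[OF K]) blast
      obtain R' B' where RB': "0 < R'" "0 \<le> B'" "\<And>t. \<bar>L t\<bar> \<le> B'" "\<And>t. t \<notin> {-R'..<R'} \<Longrightarrow> L t = 0" by (rule kernelE[OF L]) blast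
      \<comment> \<open>A bounded interval that contains every argument of \<open>f\<close> at which
        both kernels are nonzero, so that integrability over the product reduces to integrability of
        \<open>f\<close> on it.\<close>
      let ?Q = "\<integral>\<^sup>+u\<in>{x-R-R'..<x+R+R'}. ennreal \<bar>f u\<bar> \<partial>lborel"
      have "ennreal \<bar>K s\<bar> * (\<integral>\<^sup>+u. ennreal \<bar>L u\<bar> * ennreal \<bar>f ((x + s) + u)\<bar> \<partial>lborel) \<le> ennreal \<bar>K s\<bar> * (ennreal B' * ?Q)" for s
      proof (cases "s \<in> {-R..<R}")
        case True
        have "(\<integral>\<^sup>+u. ennreal \<bar>L u\<bar> * ennreal \<bar>f ((x + s) + u)\<bar> \<partial>lborel)
          \<le> (\<integral>\<^sup>+u. ennreal B' * (ennreal \<bar>f (u + (x + s))\<bar> * indicator {x-R-R'..<x+R+R'} (u + (x + s))) \<partial>lborel)"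
        proof (rule nn_integral_mono)
          fix u
          show "ennreal \<bar>L u\<bar> * ennreal \<bar>f ((x + s) + u)\<bar> \<le> ennreal B' * (ennreal \<bar>f (u + (x + s))\<bar> * indicator {x-R-R'..<x+R+R'} (u + (x + s)))"
          proof (cases "u \<in> {-R'..<R'}")
            case uT: True
            then have "ennreal \<bar>L u\<bar> \<le> ennreal B'" using RB'(3)[of u] by (intro ennreal_leI) auto
            then have "ennreal \<bar>L u\<bar> * ennreal \<bar>f ((x + s) + u)\<bar> \<le> ennreal B' * ennreal \<bar>f ((x + s) + u)\<bar>" by (rule mult_right_mono) simp
            moreover have "u + (x + s) \<in> {x-R-R'..<x+R+R'}" using True uT by auto
            ultimately show ?thesis by (simp add: add.commute)
          next
            case False
            then have "L u = 0" using RB'(4)[of u] by auto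
            then show ?thesis by simp
          qed
        qed
        also have "\<dots> = (\<integral>\<^sup>+u. ennreal B' * (ennreal \<bar>f u\<bar> * indicator {x-R-R'..<x+R+R'} u) \<partial>lborel)"
          by (rule nn_integral_shift[of "\<lambda>u. ennreal B' * (ennreal \<bar>f u\<bar> * indicator {x-R-R'..<x+R+R'} u)"]) measurable
        also have "\<dots> = ennreal B' * ?Q" by (rule nn_integral_cmult) measurable
        finally show ?thesis by (rule mult_left_mono) simp
      next
        case False
        then have "K s = 0" using RB(4)[of s] by auto
        then show ?thesis by simp
      qed
      then have "(\<integral>\<^sup>+s. ennreal \<bar>K s\<bar> * (\<integral>\<^sup>+u. ennreal \<bar>L u\<bar> * ennreal \<bar>f ((x + s) + u)\<bar> \<partial>lborel) \<partial>lborel)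
        \<le> (\<integral>\<^sup>+s. ennreal \<bar>K s\<bar> * (ennreal B' * ?Q) \<partial>lborel)" by (rule nn_integral_mono)
      also have "\<dots> = (\<integral>\<^sup>+s. ennreal \<bar>K s\<bar> \<partial>lborel) * (ennreal B' * ?Q)" by (rule nn_integral_multc) measurable
      also have "\<dots> < \<infinity>" using kernel_integrable(2)[OF K] per_L1_Ico_finite[OF f] by (auto simp: ennreal_mult_less_top)
      finally show ?thesis .
    qed
    finally show "(\<integral>\<^sup>+z. ennreal (norm (case z of (s, u) \<Rightarrow> K s * (L (u - s) * f (x + u)))) \<partial>(lborel \<Otimes>\<^sub>M lborel)) < \<infinity>" .
  qed measurable
  have "conv K (conv L f) x = (\<integral>s. \<integral>u. K s * (L (u - s) * f (x + u)) \<partial>lborel \<partial>lborel)"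
    by (simp add: conv_def[of K] inner)
  also have "\<dots> = (\<integral>u. \<integral>s. K s * (L (u - s) * f (x + u)) \<partial>lborel \<partial>lborel)"
    by (rule lborel_pair.Fubini_integral[symmetric, OF int])
  also have "\<dots> = conv (kconv K L) f x"
    unfolding conv_def kconv_def by (simp add: mult.assoc[symmetric])
  finally show "conv K (conv L f) x = conv (kconv K L) f x" .
qed

lemma kconv_commute: "kconv K L = kconv L K"
proof
  fix u
  show "kconv K L u = kconv L K u"
    using lborel_integral_real_affine[of "-1" "\<lambda>s. K s * L (u - s)" u] by (simp add: kconv_def mult.commute)
qed

lemma conv_commute:
  "kernel K \<Longrightarrow> kernel L \<Longrightarrow> per_L1 f \<Longrightarrow> conv K (conv L f) = conv L (conv K f)"
  by (simp add: conv_conv kconv_commute[of K L])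

context box_bounded
begin

text \<open>Sign and shape of \<open>K\<close> do not matter once it has an even majorant decreasing
  away from 0, to which \<open>nrm_decreasing_kernel\<close> applies.\<close>

lemma rnrm_conv:
  assumes K: "kernel K" and f: "per_L1 f"
    and [measurable]: "M \<in> borel_measurable borel" and M: "\<And>x y. \<bar>x\<bar> \<le> \<bar>y\<bar> \<Longrightarrow> M y \<le> M x" "\<And>t. \<bar>K t\<bar> \<le> M t"
    and I: "(\<integral>\<^sup>+t. ennreal (M t) \<partial>lborel) \<le> ennreal I"
  shows "rnrm (conv K f) \<le> ennreal (D * I) * rnrm f"
proof -
  have [measurable]: "f \<in> borel_measurable borel" using f per_L1_borel by auto
  have "rnrm (conv K f) \<le> nrm (\<lambda>x. \<integral>\<^sup>+t. ennreal (M t) * ennreal \<bar>f (x + t)\<bar> \<partial>lborel)"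
    by (intro wnorm_mono order.trans[OF abs_conv_le[OF K f]] nn_integral_mono mult_right_mono ennreal_leI M) auto
  also have "\<dots> \<le> ennreal D * (\<integral>\<^sup>+t. ennreal (M t) \<partial>lborel) * rnrm f"
    using f I by (intro nrm_decreasing_kernel) (auto simp: per_L1_def per_def M intro!: ennreal_leI order.strict_trans1[OF I])
  also have "\<dots> \<le> ennreal D * ennreal I * rnrm f" using I by (intro mult_right_mono mult_left_mono) auto
  also have "\<dots> = ennreal (D * I) * rnrm f" using D_pos by (simp add: ennreal_mult')
  finally show ?thesis .
qed

end

section \<open>Inverting the difference of the identity and an average\<close>

definition box_ker :: "real \<Rightarrow> real \<Rightarrow> real" where
  "box_ker h t = (if \<bar>t\<bar> \<le> h / 2 then 1 / h else 0)"

text \<open>\<open>4 / h\<^sup>2\<close> times the function \<open>A \<bar>\<cdot>\<bar> - \<bar>\<cdot>\<bar>\<close>; this is the largest multiple that stays below the box kernel.\<close>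

definition cusp_ker :: "real \<Rightarrow> real \<Rightarrow> real" where
  "cusp_ker h t = 4 / h * (max 0 (1 / 2 - \<bar>t\<bar> / h))\<^sup>2"

text \<open>In the notation of the overview this is \<kappa>, while \<open>cusp_ker\<close> is
  \<theta> and \<open>box_ker\<close> is the kernel of \<open>A\<close>.\<close>

definition rest_ker :: "real \<Rightarrow> real \<Rightarrow> real" where
  "rest_ker h t = box_ker h t - cusp_ker h t"

text \<open>Half the second symmetric difference of the modulus function, see
  \<open>tri_ker_eq\<close>. Its second derivative in \<open>u\<close> is the combination of point
  masses at \<open>t\<close>, \<open>- t\<close> and 0 that takes second symmetric
  differences.\<close>

definition tri_ker :: "real \<Rightarrow> real \<Rightarrow> real" where
  "tri_ker t u = max 0 (\<bar>t\<bar> - \<bar>u\<bar>)"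

lemma box_ker_borel [measurable]: "box_ker h \<in> borel_measurable borel"
  unfolding box_ker_def[abs_def] by measurable

lemma cusp_ker_borel [measurable]: "cusp_ker h \<in> borel_measurable borel"
  unfolding cusp_ker_def[abs_def] by measurable

lemma rest_ker_borel [measurable]: "rest_ker h \<in> borel_measurable borel"
  unfolding rest_ker_def[abs_def] by measurable

lemma tri_ker_borel [measurable]: "(\<lambda>(t, u). tri_ker t u) \<in> borel_measurable (borel \<Otimes>\<^sub>M borel)"
  unfolding tri_ker_def[abs_def] by measurable

lemma kernel_box_ker: "0 < h \<Longrightarrow> kernel (box_ker h)"
  by (rule kernelI[of _ "1 / h" "h / 2"]) (auto simp: box_ker_def)

lemma cusp_ker_bounds:
  assumes "0 < h" shows "0 \<le> cusp_ker h t" "cusp_ker h t \<le> box_ker h t"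
proof -
  show "0 \<le> cusp_ker h t" using assms by (simp add: cusp_ker_def)
  show "cusp_ker h t \<le> box_ker h t"
  proof (cases "\<bar>t\<bar> \<le> h / 2")
    case True
    have "0 \<le> \<bar>t\<bar> / h" using assms by simp
    then have "max 0 (1 / 2 - \<bar>t\<bar> / h) \<le> 1 / 2" by linarith
    then have "(max 0 (1 / 2 - \<bar>t\<bar> / h))\<^sup>2 \<le> (1 / 2)\<^sup>2"
      by (rule power_mono) simp
    then have "4 / h * (max 0 (1 / 2 - \<bar>t\<bar> / h))\<^sup>2 \<le> 4 / h * (1 / 2)\<^sup>2"
      using assms by (intro mult_left_mono) auto
    then show ?thesis using True assms by (simp add: cusp_ker_def box_ker_def power2_eq_square)
  next
    case False
    then have "1 / 2 - \<bar>t\<bar> / h \<le> 0" using assms by (simp add: field_simps)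
    then show ?thesis using False by (simp add: cusp_ker_def box_ker_def max_def)
  qed
qed

lemma kernel_cusp_ker: assumes "0 < h" shows "kernel (cusp_ker h)"
proof (rule kernelI[of _ "1 / h" "h / 2"])
  fix t
  show "\<bar>cusp_ker h t\<bar> \<le> 1 / h" using cusp_ker_bounds[OF assms, of t] assms by (auto simp: box_ker_def split: if_splits)
  show "cusp_ker h t = 0" if "h / 2 < \<bar>t\<bar>" using cusp_ker_bounds[OF assms, of t] that by (auto simp: box_ker_def split: if_splits)
qed simp

lemma rest_ker_bounds:
  assumes "0 < h" shows "0 \<le> rest_ker h t" "rest_ker h t \<le> box_ker h t"
  using cusp_ker_bounds[OF assms, of t] by (auto simp: rest_ker_def)

lemma kernel_rest_ker: assumes "0 < h" shows "kernel (rest_ker h)"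
proof (rule kernelI[of _ "1 / h" "h / 2"])
  fix t
  show "\<bar>rest_ker h t\<bar> \<le> 1 / h" using rest_ker_bounds[OF assms, of t] assms by (auto simp: box_ker_def split: if_splits)
  show "rest_ker h t = 0" if "h / 2 < \<bar>t\<bar>" using rest_ker_bounds[OF assms, of t] that by (auto simp: box_ker_def split: if_splits)
qed simp

text \<open>The exact mass of the kernel is \<open>2 / 3\<close>; any bound below 1 is good enough.\<close>

lemma rest_ker_mass: assumes h: "0 < h" shows "(\<integral>\<^sup>+t. ennreal (rest_ker h t) \<partial>lborel) \<le> ennreal (7 / 8)"
proof -
  have pw: "ennreal (rest_ker h t) \<le> ennreal (3 / (4 * h)) * indicator {-(h/2)..h/2} t
      + ennreal (1 / (4 * h)) * (indicator {-(h/2)..-(h/4)} t + indicator {h/4..h/2} t)" for t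
  proof (cases "\<bar>t\<bar> \<le> h / 4")
    case True
    have "1 / 4 \<le> 1 / 2 - \<bar>t\<bar> / h" using True h by (simp add: field_simps)
    then have "1 / 4 \<le> max 0 (1 / 2 - \<bar>t\<bar> / h)" by linarith
    then have "(1 / 4)\<^sup>2 \<le> (max 0 (1 / 2 - \<bar>t\<bar> / h))\<^sup>2" by (rule power_mono) simp
    then have "4 / h * (1 / 4)\<^sup>2 \<le> cusp_ker h t" unfolding cusp_ker_def using h by (intro mult_left_mono) auto
    then have "rest_ker h t \<le> 1 / h - 1 / (4 * h)" using True h by (simp add: rest_ker_def box_ker_def power2_eq_square)
    also have "\<dots> = 3 / (4 * h)" using h by (simp add: field_simps)
    finally have "ennreal (rest_ker h t) \<le> ennreal (3 / (4 * h)) * indicator {-(h/2)..h/2} t"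
      using True h by (auto simp: indicator_def intro: ennreal_leI)
    then show ?thesis by (rule add_increasing2[rotated]) simp
  next
    case False
    show ?thesis
    proof (cases "\<bar>t\<bar> \<le> h / 2")
      case True
      have "rest_ker h t \<le> 1 / h" using rest_ker_bounds[OF h, of t] True by (simp add: box_ker_def)
      also have "1 / h = 3 / (4 * h) + 1 / (4 * h)" using h by (simp add: field_simps)
      finally have "ennreal (rest_ker h t) \<le> ennreal (3 / (4 * h)) * 1 + ennreal (1 / (4 * h)) * 1"
        using h by (simp add: ennreal_leI flip: ennreal_plus)
      also have "\<dots> \<le> ennreal (3 / (4 * h)) * indicator {-(h/2)..h/2} t
        + ennreal (1 / (4 * h)) * (indicator {-(h/2)..-(h/4)} t + indicator {h/4..h/2} t)"
      proof (intro add_mono mult_left_mono)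
        show "(1::ennreal) \<le> indicator {-(h/2)..h/2} t" using True by (auto simp: indicator_def abs_le_iff)
        have "t \<in> {-(h/2)..-(h/4)} \<or> t \<in> {h/4..h/2}" using True False unfolding atLeastAtMost_iff by arith
        then show "(1::ennreal) \<le> indicator {-(h/2)..-(h/4)} t + indicator {h/4..h/2} t"
          by (auto simp: indicator_def)
      qed auto
      finally show ?thesis .
    next
      case F: False
      then show ?thesis using rest_ker_bounds[OF h, of t] h by (auto simp: box_ker_def)
    qed
  qed
  have "(\<integral>\<^sup>+t. ennreal (rest_ker h t) \<partial>lborel) \<le> (\<integral>\<^sup>+t. ennreal (3 / (4 * h)) * indicator {-(h/2)..h/2} t
      + ennreal (1 / (4 * h)) * (indicator {-(h/2)..-(h/4)} t + indicator {h/4..h/2} t) \<partial>lborel)"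
    by (rule nn_integral_mono) (rule pw)
  also have "\<dots> = ennreal (3 / (4 * h)) * ennreal h + ennreal (1 / (4 * h)) * (ennreal (h / 4) + ennreal (h / 4))"
    using h by (subst nn_integral_add; simp add: nn_integral_cmult nn_integral_add)
  also have "\<dots> = ennreal (7 / 8)"
    using h by (simp add: ennreal_mult[symmetric] field_simps flip: ennreal_plus)
  finally show ?thesis .
qed

section \<open>The box average of the modulus function\<close>

lemma DERIV_mult_abs: "((\<lambda>v::real. v * \<bar>v\<bar> / 2) has_real_derivative \<bar>v\<bar>) (at v)"
proof (cases "v = 0")
  case True
  have "((\<lambda>y::real. (y * \<bar>y\<bar> / 2) / y) \<longlongrightarrow> 0) (at 0)"
  proof (rule Lim_transform_eventually)
    show "((\<lambda>y::real. \<bar>y\<bar> / 2) \<longlongrightarrow> 0) (at 0)" by (auto intro!: tendsto_eq_intros)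
    show "\<forall>\<^sub>F y in at 0. \<bar>y\<bar> / 2 = (y * \<bar>y\<bar> / 2) / (y::real)"
      by (auto simp: eventually_at_filter)
  qed
  then show ?thesis using True by (simp add: has_field_derivative_iff)
next
  case False
  then consider "0 < v" | "v < 0" by linarith
  then show ?thesis
  proof cases
    case 1
    have "((\<lambda>v::real. v * v / 2) has_real_derivative \<bar>v\<bar>) (at v)"
      using 1 by (auto intro!: derivative_eq_intros)
    then show ?thesis
      by (rule has_field_derivative_transform_within_open[of _ _ _ "{0<..}"]) (use 1 in auto)
  next
    case 2
    have "((\<lambda>v::real. v * (- v) / 2) has_real_derivative \<bar>v\<bar>) (at v)"
      using 2 by (auto intro!: derivative_eq_intros)
    then show ?thesis
      by (rule has_field_derivative_transform_within_open[of _ _ _ "{..<0}"]) (use 2 in auto)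
  qed
qed

lemma integral_abs_box_ker:
  assumes h: "0 < h"
  shows "integrable lborel (\<lambda>s. \<bar>s\<bar> * box_ker h (u - s))"
    and "(\<integral>s. \<bar>s\<bar> * box_ker h (u - s) \<partial>lborel) = \<bar>u\<bar> + h\<^sup>2 / 4 * cusp_ker h u"
proof -
  define F where "F v = v * \<bar>v\<bar> / 2" for v :: real
  have eq: "\<bar>s\<bar> * box_ker h (u - s) = 1 / h * (\<bar>s\<bar> * indicator {u - h/2..u + h/2} s)" for s
  proof -
    have "(\<bar>u - s\<bar> \<le> h / 2) = (s \<in> {u - h/2..u + h/2})" unfolding atLeastAtMost_iff by arith
    then show ?thesis by (simp add: box_ker_def indicator_def del: atLeastAtMost_iff)
  qed
  have hb: "has_bochner_integral lborel (\<lambda>s. \<bar>s\<bar> * indicator {u - h/2..u + h/2} s) (F (u + h/2) - F (u - h/2))"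
    using h DERIV_mult_abs unfolding F_def
    by (intro has_bochner_integral_FTC_Icc_real) (auto intro!: continuous_intros)
  then have hb': "has_bochner_integral lborel (\<lambda>s. \<bar>s\<bar> * box_ker h (u - s)) (1 / h * (F (u + h/2) - F (u - h/2)))"
    unfolding eq by (rule has_bochner_integral_mult_right)
  then show "integrable lborel (\<lambda>s. \<bar>s\<bar> * box_ker h (u - s))" by (rule integrable.intros)
  have "1 / h * (F (u + h/2) - F (u - h/2)) = \<bar>u\<bar> + h\<^sup>2 / 4 * cusp_ker h u"
  proof -
    \<comment> \<open>The cases say whether the window around \<open>u\<close> reaches across 0,
      where the modulus function has its corner, and on which side of 0 its centre lies.\<close>
    consider "h / 2 \<le> u" | "u \<le> - (h / 2)" | "0 \<le> u" "u < h / 2" | "- (h / 2) < u" "u < 0" by linarith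
    then show ?thesis
    proof cases
      case 1
      then have "max 0 (1 / 2 - \<bar>u\<bar> / h) = 0" using h by (simp add: field_simps max_def)
      then show ?thesis using 1 h by (simp add: F_def cusp_ker_def field_simps)
    next
      case 2
      then have "max 0 (1 / 2 - \<bar>u\<bar> / h) = 0" using h by (simp add: field_simps max_def)
      then show ?thesis using 2 h by (simp add: F_def cusp_ker_def abs_of_nonpos field_simps)
    next
      case 3
      then have "max 0 (1 / 2 - \<bar>u\<bar> / h) = 1 / 2 - u / h" using h by (simp add: field_simps max_def)
      then show ?thesis using 3 h by (simp add: F_def cusp_ker_def abs_of_nonpos field_simps power2_eq_square)
    next
      case 4
      then have "max 0 (1 / 2 - \<bar>u\<bar> / h) = 1 / 2 + u / h" using h by (simp add: field_simps max_def)
      then show ?thesis using 4 h by (simp add: F_def cusp_ker_def abs_of_nonpos field_simps power2_eq_square)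
    qed
  qed
  then show "(\<integral>s. \<bar>s\<bar> * box_ker h (u - s) \<partial>lborel) = \<bar>u\<bar> + h\<^sup>2 / 4 * cusp_ker h u"
    using hb' by (simp add: has_bochner_integral_integral_eq)
qed

lemma tri_ker_eq: "tri_ker t u = (\<bar>u - t\<bar> + \<bar>u + t\<bar> - 2 * \<bar>u\<bar>) / 2"
  by (auto simp: tri_ker_def max_def abs_if)

text \<open>\<open>I - A\<close> maps the modulus function to \<open>- (h\<^sup>2 / 4)\<close> times
  \<open>cusp_ker h\<close>; half the second symmetric difference of this identity is the claim. So
  second differences of \<open>cusp_ker\<close> are images under \<open>I - A\<close> of kernels of
  bounded support, although \<open>cusp_ker\<close> itself is not.\<close>

lemma tri_ker_box_ker:
  assumes h: "0 < h"
  shows "tri_ker t u - kconv (tri_ker t) (box_ker h) u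
    = h\<^sup>2 / 8 * (2 * cusp_ker h u - cusp_ker h (u - t) - cusp_ker h (u + t))"
proof -
  have sh: "integrable lborel (\<lambda>s. \<bar>s + c\<bar> * box_ker h (u - s))"
      "(\<integral>s. \<bar>s + c\<bar> * box_ker h (u - s) \<partial>lborel) = \<bar>u + c\<bar> + h\<^sup>2 / 4 * cusp_ker h (u + c)" for c
    using lborel_integrable_real_affine[OF integral_abs_box_ker(1)[OF h, of "u + c"], of 1 c]
      lborel_integral_real_affine[of 1 "\<lambda>s. \<bar>s\<bar> * box_ker h (u + c - s)" c] integral_abs_box_ker(2)[OF h, of "u + c"]
    by (simp_all add: add_ac)
  have "kconv (tri_ker t) (box_ker h) u
    = (\<integral>s. (\<bar>s + (- t)\<bar> * box_ker h (u - s) + \<bar>s + t\<bar> * box_ker h (u - s) - 2 * (\<bar>s + 0\<bar> * box_ker h (u - s))) / 2 \<partial>lborel)"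
    unfolding kconv_def tri_ker_eq by (intro Bochner_Integration.integral_cong) (auto simp: algebra_simps)
  also have "\<dots> = ((\<bar>u + (- t)\<bar> + h\<^sup>2 / 4 * cusp_ker h (u + (- t))) + (\<bar>u + t\<bar> + h\<^sup>2 / 4 * cusp_ker h (u + t))
      - 2 * (\<bar>u + 0\<bar> + h\<^sup>2 / 4 * cusp_ker h (u + 0))) / 2"
    by (simp only: integral_divide_zero Bochner_Integration.integral_add Bochner_Integration.integral_diff
      integral_mult_right_zero Bochner_Integration.integrable_add integrable_mult_right sh)
  finally show ?thesis unfolding tri_ker_eq by (simp add: field_simps)
qed

text \<open>The mixture of the kernels \<open>tri_ker t\<close> with weights \<open>J t\<close>. Up
  to the factor \<open>4 / h\<^sup>2\<close> it is the quotient of (I - V) \<theta> by I - A, where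
  V is convolution with \<open>J\<close>.\<close>

definition moment_ker :: "(real \<Rightarrow> real) \<Rightarrow> real \<Rightarrow> real" where
  "moment_ker J u = (\<integral>t. J t * tri_ker t u \<partial>lborel)"

lemma tri_ker_bounds: "0 \<le> tri_ker t u" "tri_ker t u \<le> \<bar>t\<bar>" "\<bar>t\<bar> \<le> \<bar>u\<bar> \<Longrightarrow> tri_ker t u = 0"
  by (auto simp: tri_ker_def)

lemma kernel_tri_integrable:
  assumes J: "kernel J" shows "integrable lborel (\<lambda>t. J t * tri_ker t u)"
proof -
  have [measurable]: "J \<in> borel_measurable borel" by (rule kernel_borel[OF J])
  obtain R B where RB: "0 < R" "0 \<le> B" "\<And>t. \<bar>J t\<bar> \<le> B" "\<And>t. t \<notin> {-R..<R} \<Longrightarrow> J t = 0" by (rule kernelE[OF J]) blast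
  show ?thesis
  proof (rule Bochner_Integration.integrable_bound)
    show "integrable lborel (\<lambda>t. \<bar>J t\<bar> * R)" using kernel_integrable(1)[OF J] by auto
    show "AE t in lborel. norm (J t * tri_ker t u) \<le> norm (\<bar>J t\<bar> * R)"
    proof (rule AE_I2)
      fix t show "norm (J t * tri_ker t u) \<le> norm (\<bar>J t\<bar> * R)"
      proof (cases "t \<in> {-R..<R}")
        case True
        then have "tri_ker t u \<le> R" using tri_ker_bounds(2)[of t u] by auto
        then show ?thesis using RB(1) tri_ker_bounds(1)[of t u] by (auto simp: abs_mult intro!: mult_left_mono)
      qed (use RB(4) in auto)
    qed
  qed measurable
qed

lemma moment_ker_borel [measurable]:
  assumes [measurable]: "J \<in> borel_measurable borel" shows "moment_ker J \<in> borel_measurable borel"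
  unfolding moment_ker_def[abs_def] tri_ker_def by measurable

lemma kernel_moment_ker:
  assumes J: "kernel J" shows "kernel (moment_ker J)"
proof -
  have [measurable]: "J \<in> borel_measurable borel" by (rule kernel_borel[OF J])
  obtain R B where RB: "0 < R" "0 \<le> B" "\<And>t. \<bar>J t\<bar> \<le> B" "\<And>t. t \<notin> {-R..<R} \<Longrightarrow> J t = 0" by (rule kernelE[OF J]) blast
  show ?thesis
  proof (rule kernelI)
    show "moment_ker J \<in> borel_measurable borel" by measurable
    show "\<bar>moment_ker J u\<bar> \<le> (\<integral>t. \<bar>J t\<bar> * R \<partial>lborel)" for u
    proof -
      have "\<bar>moment_ker J u\<bar> \<le> (\<integral>t. \<bar>J t * tri_ker t u\<bar> \<partial>lborel)" unfolding moment_ker_def by (rule integral_abs_bound)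
      also have "\<dots> \<le> (\<integral>t. \<bar>J t\<bar> * R \<partial>lborel)"
      proof (rule integral_mono')
        show "integrable lborel (\<lambda>s. \<bar>J s\<bar> * R)" using kernel_integrable(1)[OF J] by auto
        fix t show "\<bar>J t * tri_ker t u\<bar> \<le> \<bar>J t\<bar> * R"
        proof (cases "t \<in> {-R..<R}")
          case True
          then have "tri_ker t u \<le> R" using tri_ker_bounds(2)[of t u] by auto
          then show ?thesis using RB(1) tri_ker_bounds(1)[of t u] by (auto simp: abs_mult intro!: mult_left_mono)
        qed (use RB(4) in auto)
      qed (use RB in auto)
      finally show ?thesis .
    qed
    show "moment_ker J u = 0" if "R < \<bar>u\<bar>" for u
    proof -
      have "J t * tri_ker t u = 0" for t
      proof (cases "t \<in> {-R..<R}")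
        case True
        then have "\<bar>t\<bar> \<le> \<bar>u\<bar>" using that by auto
        then show ?thesis using tri_ker_bounds(3) by simp
      qed (use RB(4) in auto)
      then have "(\<lambda>t. J t * tri_ker t u) = (\<lambda>t. 0)" by blast
      then show ?thesis by (simp add: moment_ker_def del: mult_eq_0_iff)
    qed
  qed
qed

lemma kconv_moment_ker:
  assumes J: "kernel J" and L: "kernel L"
  shows "kconv (moment_ker J) L u = (\<integral>t. J t * kconv (tri_ker t) L u \<partial>lborel)"
proof -
  have [measurable]: "J \<in> borel_measurable borel" "L \<in> borel_measurable borel" using J L kernel_borel by auto
  obtain R B where RB: "0 < R" "0 \<le> B" "\<And>t. \<bar>J t\<bar> \<le> B" "\<And>t. t \<notin> {-R..<R} \<Longrightarrow> J t = 0" by (rule kernelE[OF J]) blast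
  obtain R' B' where RB': "0 < R'" "0 \<le> B'" "\<And>t. \<bar>L t\<bar> \<le> B'" "\<And>t. t \<notin> {-R'..<R'} \<Longrightarrow> L t = 0" by (rule kernelE[OF L]) blast
  have int: "integrable (lborel \<Otimes>\<^sub>M lborel) (\<lambda>(t, s). J t * (tri_ker t s * L (u - s)))"
  proof (rule Bochner_Integration.integrable_bound)
    show "integrable (lborel \<Otimes>\<^sub>M lborel) (\<lambda>z. (B * (R * B')) * indicat_real ({-R..<R} \<times> {-R..<R}) z)"
      using RB by (intro integrable_mult_right integrable_real_indicator) (auto simp: lborel.emeasure_pair_measure_Times ennreal_mult_less_top)
    show "AE z in lborel \<Otimes>\<^sub>M lborel. norm (case z of (t, s) \<Rightarrow> J t * (tri_ker t s * L (u - s))) \<le> norm ((B * (R * B')) * indicat_real ({-R..<R} \<times> {-R..<R}) z)"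
    proof (rule AE_I2)
      fix z :: "real \<times> real"
      obtain t s where z: "z = (t, s)" by (cases z)
      have "\<bar>J t * (tri_ker t s * L (u - s))\<bar> \<le> B * (R * B') * indicat_real ({-R..<R} \<times> {-R..<R}) (t, s)"
      proof (cases "t \<in> {-R..<R}")
        case t: True
        then have tR: "tri_ker t s \<le> R" using tri_ker_bounds(2)[of t s] by auto
        show ?thesis
        proof (cases "\<bar>t\<bar> \<le> \<bar>s\<bar>")
          case True then show ?thesis using tri_ker_bounds(3)[OF True] RB RB' by simp
        next
          case False
          then have "s \<in> {-R..<R}" using t by (auto simp: abs_if split: if_splits)
          moreover have "\<bar>J t\<bar> * (\<bar>tri_ker t s\<bar> * \<bar>L (u - s)\<bar>) \<le> B * (R * B')"
            using RB RB' tR tri_ker_bounds(1)[of t s] by (intro mult_mono) auto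
          ultimately show ?thesis using t by (simp add: abs_mult)
        qed
      next
        case False then show ?thesis using RB(4)[OF False] RB RB' by simp
      qed
      then show "norm (case z of (t, s) \<Rightarrow> J t * (tri_ker t s * L (u - s))) \<le> norm ((B * (R * B')) * indicat_real ({-R..<R} \<times> {-R..<R}) z)"
        unfolding z using RB RB' by (simp add: abs_mult)
    qed
  qed measurable
  have "kconv (moment_ker J) L u = (\<integral>s. \<integral>t. J t * (tri_ker t s * L (u - s)) \<partial>lborel \<partial>lborel)"
    unfolding kconv_def moment_ker_def by (simp add: mult.assoc[symmetric])
  also have "\<dots> = (\<integral>t. \<integral>s. J t * (tri_ker t s * L (u - s)) \<partial>lborel \<partial>lborel)"
    by (rule lborel_pair.Fubini_integral[OF int])
  finally show ?thesis by (simp add: kconv_def)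
qed

text \<open>Integrating \<open>tri_ker_box_ker\<close> against \<open>J\<close>: mass 1 reproduces
  \<open>cusp_ker h u\<close>, and evenness makes both translates contribute
  \<open>kconv J (cusp_ker h) u\<close>. The factor \<open>4 / h\<^sup>2\<close> is the inverse of
  \<open>2 * h\<^sup>2 / 8\<close>.\<close>

lemma cusp_ker_smoothing:
  assumes J: "kernel J" and even: "\<And>t. J (- t) = J t" and mass: "(\<integral>t. J t \<partial>lborel) = 1" and h: "0 < h"
  shows "cusp_ker h u - kconv J (cusp_ker h) u = 4 / h\<^sup>2 * (moment_ker J u - kconv (moment_ker J) (box_ker h) u)"
proof -
  let ?\<theta> = "cusp_ker h"
  have [measurable]: "J \<in> borel_measurable borel" using J kernel_borel by auto
  obtain B where B: "\<And>t. \<bar>?\<theta> t\<bar> \<le> B" by (rule kernelE[OF kernel_cusp_ker[OF h]]) blast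
  have int: "integrable lborel (\<lambda>t. J t * ?\<theta> (u - t))"
  proof (rule Bochner_Integration.integrable_bound)
    show "integrable lborel (\<lambda>t. \<bar>J t\<bar> * B)" using kernel_integrable(1)[OF J] by auto
    show "AE t in lborel. norm (J t * ?\<theta> (u - t)) \<le> norm (\<bar>J t\<bar> * B)"
      using B by (auto simp: abs_mult intro!: mult_left_mono order.trans[OF B abs_ge_self])
  qed measurable
  have int': "integrable lborel (\<lambda>t. J t * ?\<theta> (u + t))"
    using lborel_integrable_real_affine[OF int, of "-1" 0] by (simp add: even)
  have refl: "(\<integral>t. J t * ?\<theta> (u + t) \<partial>lborel) = kconv J ?\<theta> u"
    using lborel_integral_real_affine[of "-1" "\<lambda>t. J t * ?\<theta> (u - t)" 0] by (simp add: even kconv_def)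
  have intk: "integrable lborel (\<lambda>t. J t * kconv (tri_ker t) (box_ker h) u)"
  proof -
    have "J t * kconv (tri_ker t) (box_ker h) u = J t * tri_ker t u - h\<^sup>2 / 8 * (2 * ?\<theta> u * J t - J t * ?\<theta> (u - t) - J t * ?\<theta> (u + t))" for t
    proof -
      have "kconv (tri_ker t) (box_ker h) u = tri_ker t u - h\<^sup>2 / 8 * (2 * ?\<theta> u - ?\<theta> (u - t) - ?\<theta> (u + t))"
        using tri_ker_box_ker[OF h, of t u] by simp
      then show ?thesis by (simp only:) (simp add: field_simps)
    qed
    then show ?thesis using kernel_tri_integrable[OF J] kernel_integrable(1)[OF J] int int' by simp
  qed
  have "moment_ker J u - kconv (moment_ker J) (box_ker h) u
     = (\<integral>t. J t * tri_ker t u - J t * kconv (tri_ker t) (box_ker h) u \<partial>lborel)"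
    unfolding kconv_moment_ker[OF J kernel_box_ker[OF h]] moment_ker_def
    using kernel_tri_integrable[OF J] intk by simp
  also have "\<dots> = (\<integral>t. h\<^sup>2 / 8 * (2 * ?\<theta> u * J t - J t * ?\<theta> (u - t) - J t * ?\<theta> (u + t)) \<partial>lborel)"
  proof (intro Bochner_Integration.integral_cong refl)
    fix t
    have "J t * tri_ker t u - J t * kconv (tri_ker t) (box_ker h) u = J t * (tri_ker t u - kconv (tri_ker t) (box_ker h) u)"
      by (simp add: algebra_simps)
    also have "\<dots> = h\<^sup>2 / 8 * (2 * ?\<theta> u * J t - J t * ?\<theta> (u - t) - J t * ?\<theta> (u + t))"
      unfolding tri_ker_box_ker[OF h] by (simp add: algebra_simps)
    finally show "J t * tri_ker t u - J t * kconv (tri_ker t) (box_ker h) u = h\<^sup>2 / 8 * (2 * ?\<theta> u * J t - J t * ?\<theta> (u - t) - J t * ?\<theta> (u + t))" .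
  qed simp
  also have "\<dots> = h\<^sup>2 / 8 * (2 * ?\<theta> u - kconv J ?\<theta> u - kconv J ?\<theta> u)"
    using int int' kernel_integrable(1)[OF J] by (simp add: refl mass) (simp add: kconv_def)
  finally show ?thesis using h by (simp add: field_simps)
qed

lemma moment_ker_decr:
  assumes J: "kernel J" and J0: "\<And>t. 0 \<le> J t" and "\<bar>x\<bar> \<le> \<bar>y\<bar>"
  shows "moment_ker J y \<le> moment_ker J x"
  unfolding moment_ker_def using assms
  by (intro integral_mono kernel_tri_integrable mult_left_mono) (auto simp: tri_ker_def)

lemma moment_ker_nonneg:
  assumes J0: "\<And>t. 0 \<le> J t" shows "0 \<le> moment_ker J x"
  unfolding moment_ker_def using assms by (intro Bochner_Integration.integral_nonneg) (auto simp: tri_ker_def)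

text \<open>Interchange of integrals, with \<open>tri_ker t\<close> bounded by |t| on an interval of
  length 2 |t|. Its exact integral is the square of \<open>t\<close>; the cruder bound with the
  factor 2 is good enough.\<close>

lemma moment_ker_mass:
  assumes J: "kernel J" and J0: "\<And>t. 0 \<le> J t"
  shows "(\<integral>\<^sup>+u. ennreal (moment_ker J u) \<partial>lborel) \<le> 2 * (\<integral>\<^sup>+t. ennreal (J t * t\<^sup>2) \<partial>lborel)"
proof -
  have [measurable]: "J \<in> borel_measurable borel" using J kernel_borel by auto
  have "(\<integral>\<^sup>+u. ennreal (moment_ker J u) \<partial>lborel) = (\<integral>\<^sup>+u. \<integral>\<^sup>+t. ennreal (J t * tri_ker t u) \<partial>lborel \<partial>lborel)"
    unfolding moment_ker_def using J0 tri_ker_bounds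
    by (intro nn_integral_cong nn_integral_eq_integral[symmetric] kernel_tri_integrable J) auto
  also have "\<dots> = (\<integral>\<^sup>+t. \<integral>\<^sup>+u. ennreal (J t * tri_ker t u) \<partial>lborel \<partial>lborel)"
    by (rule lborel_pair.Fubini') measurable
  also have "\<dots> \<le> (\<integral>\<^sup>+t. \<integral>\<^sup>+u. ennreal (J t * \<bar>t\<bar>) * indicator {-\<bar>t\<bar>..\<bar>t\<bar>} u \<partial>lborel \<partial>lborel)"
  proof (intro nn_integral_mono)
    fix t u
    show "ennreal (J t * tri_ker t u) \<le> ennreal (J t * \<bar>t\<bar>) * indicator {-\<bar>t\<bar>..\<bar>t\<bar>} u"
    proof (cases "u \<in> {-\<bar>t\<bar>..\<bar>t\<bar>}")
      case True
      then show ?thesis using J0[of t] tri_ker_bounds[of t u] by (simp add: ennreal_leI mult_left_mono)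
    next
      case False
      then have "\<bar>t\<bar> \<le> \<bar>u\<bar>" unfolding atLeastAtMost_iff by arith
      then show ?thesis by (simp add: tri_ker_bounds(3))
    qed
  qed
  also have "\<dots> = (\<integral>\<^sup>+t. 2 * ennreal (J t * t\<^sup>2) \<partial>lborel)"
  proof (intro nn_integral_cong)
    fix t
    have "(\<integral>\<^sup>+u. ennreal (J t * \<bar>t\<bar>) * indicator {-\<bar>t\<bar>..\<bar>t\<bar>} u \<partial>lborel) = ennreal (J t * \<bar>t\<bar>) * ennreal (2 * \<bar>t\<bar>)"
      by (subst nn_integral_cmult) auto
    also have "\<dots> = ennreal (2 * (J t * t\<^sup>2))"
    proof -
      have "J t * \<bar>t\<bar> * (2 * \<bar>t\<bar>) = 2 * (J t * (\<bar>t\<bar> * \<bar>t\<bar>))" by simp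
      then have "J t * \<bar>t\<bar> * (2 * \<bar>t\<bar>) = 2 * (J t * t\<^sup>2)" by (simp only: abs_mult_self_eq power2_eq_square)
      then show ?thesis using J0[of t] by (simp add: ennreal_mult[symmetric])
    qed
    also have "\<dots> = 2 * ennreal (J t * t\<^sup>2)" using J0[of t] by (subst ennreal_mult) auto
    finally show "(\<integral>\<^sup>+u. ennreal (J t * \<bar>t\<bar>) * indicator {-\<bar>t\<bar>..\<bar>t\<bar>} u \<partial>lborel) = 2 * ennreal (J t * t\<^sup>2)" .
  qed
  also have "\<dots> = 2 * (\<integral>\<^sup>+t. ennreal (J t * t\<^sup>2) \<partial>lborel)" by (rule nn_integral_cmult) measurable
  finally show ?thesis .
qed

text \<open>With A = \<kappa> + \<theta>, write H = G + \<kappa> H + \<theta> H and apply I - V. By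
  \<open>cusp_ker_smoothing\<close> the last term becomes a multiple of \<open>moment_ker J\<close>
  applied to \<open>G\<close>, so only the \<kappa>-term still contains \<open>H\<close>, in a form
  ready for iteration.\<close>

lemma smoothing_step:
  assumes J: "kernel J" and even: "\<And>t. J (- t) = J t" and mass: "(\<integral>t. J t \<partial>lborel) = 1" and h: "0 < h"
    and H: "per_L1 H"
  defines "G \<equiv> \<lambda>x. H x - conv (box_ker h) H x"
  shows "H x - conv J H x = (G x - conv J G x) + 4 / h\<^sup>2 * conv (moment_ker J) G x
    + (conv (rest_ker h) H x - conv J (conv (rest_ker h) H) x)"
proof -
  note kb = kernel_box_ker[OF h] and kt = kernel_cusp_ker[OF h] and kr = kernel_rest_ker[OF h] and km = kernel_moment_ker[OF J]
  have G: "per_L1 G" unfolding G_def by (intro per_L1_diff H per_L1_conv kb)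
  have split: "conv (box_ker h) H = (\<lambda>x. conv (rest_ker h) H x + conv (cusp_ker h) H x)"
    using conv_kernel_add[OF kr kt H] by (simp add: rest_ker_def)
  have Hx: "H = (\<lambda>x. G x + (conv (rest_ker h) H x + conv (cusp_ker h) H x))"
    by (simp add: G_def split)
  have "conv J H = conv J (\<lambda>x. G x + (conv (rest_ker h) H x + conv (cusp_ker h) H x))"
    using Hx by simp
  also have "\<dots> = (\<lambda>x. conv J G x + (conv J (conv (rest_ker h) H) x + conv J (conv (cusp_ker h) H) x))"
    using J G H kr kt by (simp add: conv_add per_L1_add per_L1_conv)
  finally have JH: "conv J H x = conv J G x + (conv J (conv (rest_ker h) H) x + conv J (conv (cusp_ker h) H) x)" by simp
  have "conv (cusp_ker h) H x - conv J (conv (cusp_ker h) H) x = conv (\<lambda>u. cusp_ker h u - kconv J (cusp_ker h) u) H x"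
    using J kt H by (simp add: conv_conv conv_kernel_diff kernel_kconv)
  also have "\<dots> = 4 / h\<^sup>2 * conv (\<lambda>u. moment_ker J u - kconv (moment_ker J) (box_ker h) u) H x"
    unfolding cusp_ker_smoothing[OF J even mass h] conv_kernel_cmult ..
  also have "conv (\<lambda>u. moment_ker J u - kconv (moment_ker J) (box_ker h) u) H x = conv (moment_ker J) G x"
    unfolding G_def using km kb H by (simp add: conv_kernel_diff kernel_kconv conv_diff per_L1_conv conv_conv)
  finally have "conv (cusp_ker h) H x - conv J (conv (cusp_ker h) H) x = 4 / h\<^sup>2 * conv (moment_ker J) G x" .
  moreover have "H x = G x + (conv (rest_ker h) H x + conv (cusp_ker h) H x)" using fun_cong[OF Hx, of x] .
  ultimately show ?thesis using JH by simp
qed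

section \<open>Powers of the rest kernel and the Neumann series\<close>

lemma per_L1_conv_funpow: "kernel K \<Longrightarrow> per_L1 f \<Longrightarrow> per_L1 ((conv K ^^ N) f)"
  by (induction N) (auto intro: per_L1_conv)

lemma conv_funpow_commute:
  assumes "kernel K" "kernel L" "per_L1 f"
  shows "conv L ((conv K ^^ N) f) = (conv K ^^ N) (conv L f)"
  using assms by (induction N) (auto simp: conv_commute per_L1_conv_funpow)

lemma conv_funpow_diff:
  assumes "kernel K" "per_L1 f" "per_L1 g"
  shows "(conv K ^^ N) (\<lambda>x. f x - g x) = (\<lambda>x. (conv K ^^ N) f x - (conv K ^^ N) g x)"
  using assms by (induction N) (auto simp: conv_diff per_L1_conv_funpow)

text \<open>In the convolution power one factor is bounded by its maximum \<open>1 / h\<close>, the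
  others by their mass \<open>7 / 8\<close>, and the supports add up. The bound is one on kernels
  because the operator norm of \<kappa> is known only up to the factor \<open>D\<close> and may
  exceed 1.\<close>

lemma rest_ker_funpow_le:
  assumes h: "0 < h" and f: "per_L1 f"
  shows "ennreal \<bar>(conv (rest_ker h) ^^ Suc N) f x\<bar>
    \<le> (\<integral>\<^sup>+t. (ennreal ((7/8) ^ N / h) * indicator {-(real (Suc N) * h/2)..real (Suc N) * h/2} t) * ennreal \<bar>f (x + t)\<bar> \<partial>lborel)"
proof (induction N arbitrary: x)
  case 0
  have "ennreal \<bar>(conv (rest_ker h) ^^ Suc 0) f x\<bar> \<le> (\<integral>\<^sup>+t. ennreal \<bar>rest_ker h t\<bar> * ennreal \<bar>f (x + t)\<bar> \<partial>lborel)"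
    using abs_conv_le[OF kernel_rest_ker[OF h] f, of x] by simp
  also have "\<dots> \<le> (\<integral>\<^sup>+t. (ennreal ((7/8) ^ 0 / h) * indicator {-(real (Suc 0) * h/2)..real (Suc 0) * h/2} t) * ennreal \<bar>f (x + t)\<bar> \<partial>lborel)"
  proof (intro nn_integral_mono mult_right_mono)
    fix t
    show "ennreal \<bar>rest_ker h t\<bar> \<le> ennreal ((7/8) ^ 0 / h) * indicator {-(real (Suc 0) * h/2)..real (Suc 0) * h/2} t"
    proof (cases "\<bar>t\<bar> \<le> h / 2")
      case True
      then show ?thesis using rest_ker_bounds[OF h, of t] by (auto simp: box_ker_def indicator_def abs_le_iff intro!: ennreal_leI)
    next
      case False
      then show ?thesis using rest_ker_bounds[OF h, of t] by (auto simp: box_ker_def)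
    qed
  qed simp
  finally show ?case .
next
  case (Suc N)
  let ?\<kappa> = "rest_ker h" and ?c = "ennreal ((7/8) ^ N / h)"
  let ?I = "\<lambda>N t. indicator {-(real N * h/2)..real N * h/2} t :: ennreal"
  have [measurable]: "f \<in> borel_measurable borel" using f by (rule per_L1_borel)
  let ?Q = "\<integral>\<^sup>+t. ?I (Suc (Suc N)) t * ennreal \<bar>f (x + t)\<bar> \<partial>lborel"
  have "ennreal \<bar>(conv ?\<kappa> ^^ Suc (Suc N)) f x\<bar> \<le> (\<integral>\<^sup>+u. ennreal \<bar>?\<kappa> u\<bar> * ennreal \<bar>(conv ?\<kappa> ^^ Suc N) f (x + u)\<bar> \<partial>lborel)"
    using abs_conv_le[OF kernel_rest_ker[OF h] per_L1_conv_funpow[OF kernel_rest_ker[OF h] f, of "Suc N"], of x] by simp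
  also have "\<dots> \<le> (\<integral>\<^sup>+u. ennreal (?\<kappa> u) * (?c * ?Q) \<partial>lborel)"
  proof (rule nn_integral_mono)
    fix u
    show "ennreal \<bar>?\<kappa> u\<bar> * ennreal \<bar>(conv ?\<kappa> ^^ Suc N) f (x + u)\<bar> \<le> ennreal (?\<kappa> u) * (?c * ?Q)"
    proof (cases "\<bar>u\<bar> \<le> h / 2")
      case True
      have "ennreal \<bar>(conv ?\<kappa> ^^ Suc N) f (x + u)\<bar> \<le> (\<integral>\<^sup>+t. (?c * ?I (Suc N) t) * ennreal \<bar>f ((x + u) + t)\<bar> \<partial>lborel)"
        by (rule Suc)
      also have "\<dots> \<le> (\<integral>\<^sup>+t. ?c * (?I (Suc (Suc N)) (t + u) * ennreal \<bar>f (x + (t + u))\<bar>) \<partial>lborel)"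
      proof (rule nn_integral_mono)
        fix t
        \<comment> \<open>A shift by at most \<open>h / 2\<close> is absorbed by the longer interval
          of the next stage.\<close>
        have "?I (Suc N) t \<le> ?I (Suc (Suc N)) (t + u)"
        proof -
          have "- h \<le> 2 * u" "2 * u \<le> h" using True by arith+
          moreover define a where "a = real (Suc N) * h"
          moreover have "real (Suc (Suc N)) * h = a + h" by (simp add: algebra_simps a_def)
          ultimately show ?thesis by (auto simp: indicator_def simp del: of_nat_Suc simp flip: a_def) (simp add: field_simps)
        qed
        from mult_right_mono[OF this, of "ennreal \<bar>f (x + (t + u))\<bar>"]
        show "(?c * ?I (Suc N) t) * ennreal \<bar>f ((x + u) + t)\<bar> \<le> ?c * (?I (Suc (Suc N)) (t + u) * ennreal \<bar>f (x + (t + u))\<bar>)"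
          by (simp add: add_ac mult.assoc mult_left_mono)
      qed
      also have "\<dots> = (\<integral>\<^sup>+t. ?c * (?I (Suc (Suc N)) t * ennreal \<bar>f (x + t)\<bar>) \<partial>lborel)"
        by (rule nn_integral_shift[of "\<lambda>t. ?c * (?I (Suc (Suc N)) t * ennreal \<bar>f (x + t)\<bar>)"]) measurable
      also have "\<dots> = ?c * ?Q" by (rule nn_integral_cmult) measurable
      finally show ?thesis using rest_ker_bounds(1)[OF h] by (intro mult_mono) auto
    next
      case False
      then have "?\<kappa> u = 0" using rest_ker_bounds[OF h, of u] by (auto simp: box_ker_def)
      then show ?thesis by simp
    qed
  qed
  also have "\<dots> = (\<integral>\<^sup>+u. ennreal (?\<kappa> u) \<partial>lborel) * (?c * ?Q)" by (rule nn_integral_multc) measurable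
  also have "\<dots> \<le> ennreal (7/8) * (?c * ?Q)" by (intro mult_right_mono rest_ker_mass h) auto
  also have "\<dots> = ennreal ((7/8) ^ Suc N / h) * ?Q"
    using h by (simp add: mult.assoc[symmetric] ennreal_mult[symmetric])
  also have "\<dots> = (\<integral>\<^sup>+t. ennreal ((7/8) ^ Suc N / h) * (?I (Suc (Suc N)) t * ennreal \<bar>f (x + t)\<bar>) \<partial>lborel)"
    by (rule nn_integral_cmult[symmetric]) measurable
  finally show ?case by (simp add: mult.assoc)
qed

context box_bounded
begin

lemma rnrm_rest_ker_funpow:
  assumes h: "0 < h" and f: "per_L1 f"
  shows "rnrm ((conv (rest_ker h) ^^ Suc N) f) \<le> ennreal (D * (real (Suc N) * (7/8) ^ N)) * rnrm f"
proof -
  have [measurable]: "f \<in> borel_measurable borel" using f by (rule per_L1_borel)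
  let ?M = "\<lambda>t. ennreal ((7/8) ^ N / h) * indicator {-(real (Suc N) * h/2)..real (Suc N) * h/2} t"
  have mass: "(\<integral>\<^sup>+t. ?M t \<partial>lborel) = ennreal (real (Suc N) * (7/8) ^ N)"
    using h by (subst nn_integral_cmult) (auto simp: ennreal_mult[symmetric] mult_ac simp del: of_nat_Suc)
  have "rnrm ((conv (rest_ker h) ^^ Suc N) f) \<le> nrm (\<lambda>x. \<integral>\<^sup>+t. ?M t * ennreal \<bar>f (x + t)\<bar> \<partial>lborel)"
    by (intro wnorm_mono rest_ker_funpow_le h f)
  also have "\<dots> \<le> ennreal D * (\<integral>\<^sup>+t. ?M t \<partial>lborel) * rnrm f"
  proof (rule nrm_decreasing_kernel)
    show "?M y \<le> ?M x" if "\<bar>x\<bar> \<le> \<bar>y\<bar>" for x y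
      using that by (intro mult_left_mono) (auto simp: indicator_def abs_le_iff simp del: of_nat_Suc)
    show "?M t < \<infinity>" for t by (auto simp: ennreal_mult_less_top indicator_def)
    show "(\<integral>\<^sup>+t. ?M t \<partial>lborel) < \<infinity>" unfolding mass by simp
  qed (use f in \<open>auto simp: per_L1_def per_def\<close>)
  also have "\<dots> = ennreal (D * (real (Suc N) * (7/8) ^ N)) * rnrm f"
    unfolding mass using D_pos by (simp add: ennreal_mult)
  finally show ?thesis .
qed

text \<open>The value of the differentiated geometric series is
  \<open>1 / (1 - 7 / 8)\<^sup>2 = 64\<close>.\<close>

lemma sum_rest_ker_weights: "(\<Sum>n<N. real (Suc n) * (7/8) ^ n) \<le> (64::real)"
proof -
  have "(\<lambda>n. of_nat (Suc n) * (7/8) ^ n) sums (1 / (1 - (7/8::real))\<^sup>2)"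
    by (rule geometric_deriv_sums) simp
  then have s: "(\<lambda>n. real (Suc n) * (7/8) ^ n) sums 64" by (simp add: power2_eq_square)
  have "(\<Sum>n<N. real (Suc n) * (7/8) ^ n) \<le> (\<Sum>n. real (Suc n) * (7/8) ^ n)"
    by (rule sum_le_suminf[OF sums_summable[OF s]]) auto
  also have "\<dots> = 64" using s by (rule sums_unique[symmetric])
  finally show ?thesis .
qed

text \<open>With \<open>A = conv (box_ker h)\<close> and \<open>V = conv J\<close>, iterating \<open>smoothing_step\<close> inverts \<open>I - A\<close>
  by a Neumann series on the part that \<open>I - V\<close> does not annihilate.\<close>

lemma smoothing_le_box_difference:
  assumes J: "kernel J" and J0: "\<And>t. 0 \<le> J t" and even: "\<And>t. J (- t) = J t" and mass: "(\<integral>t. J t \<partial>lborel) = 1"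
    and [measurable]: "M \<in> borel_measurable borel" and M: "\<And>x y. \<bar>x\<bar> \<le> \<bar>y\<bar> \<Longrightarrow> M y \<le> M x" "\<And>t. J t \<le> M t"
    and I: "(\<integral>\<^sup>+t. ennreal (M t) \<partial>lborel) \<le> ennreal I" "0 \<le> I"
    and m2: "(\<integral>\<^sup>+t. ennreal (J t * t\<^sup>2) \<partial>lborel) \<le> ennreal m2" "0 \<le> m2"
    and h: "0 < h" and F: "per_L1 F" and fin: "rnrm F < \<infinity>"
  shows "rnrm (\<lambda>x. F x - conv J F x)
    \<le> ennreal ((1 + D * I + 4 / h\<^sup>2 * (D * (2 * m2))) * (1 + 64 * D)) * rnrm (\<lambda>x. F x - conv (box_ker h) F x)"
proof -
  have [measurable]: "J \<in> borel_measurable borel" "F \<in> borel_measurable borel" using J F kernel_borel per_L1_borel by auto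
  note kb = kernel_box_ker[OF h] and kr = kernel_rest_ker[OF h] and km = kernel_moment_ker[OF J]
  have V: "rnrm (conv J f) \<le> ennreal (D * I) * rnrm f" if f: "per_L1 f" for f
    using J0 M I by (intro rnrm_conv[OF J f]) auto
  have IV: "rnrm (\<lambda>x. f x - conv J f x) \<le> ennreal (1 + D * I) * rnrm f" if f: "per_L1 f" for f
  proof -
    have "rnrm (\<lambda>x. f x - conv J f x) \<le> rnrm f + rnrm (conv J f)"
      using per_L1_borel[OF f] by (intro rnrm_diff) auto
    also have "\<dots> \<le> 1 * rnrm f + ennreal (D * I) * rnrm f" using V[OF f] by (intro add_mono) auto
    also have "\<dots> = ennreal (1 + D * I) * rnrm f" using D_pos I by (simp add: distrib_right[symmetric] flip: ennreal_1 ennreal_plus)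
    finally show ?thesis .
  qed
  have Mo: "rnrm (\<lambda>x. 4 / h\<^sup>2 * conv (moment_ker J) f x) \<le> ennreal (4 / h\<^sup>2 * (D * (2 * m2))) * rnrm f" if f: "per_L1 f" for f
  proof -
    have [measurable]: "f \<in> borel_measurable borel" using f by (rule per_L1_borel)
    have "(\<integral>\<^sup>+t. ennreal (moment_ker J t) \<partial>lborel) \<le> 2 * (\<integral>\<^sup>+t. ennreal (J t * t\<^sup>2) \<partial>lborel)" by (rule moment_ker_mass[OF J J0])
    also have "\<dots> \<le> 2 * ennreal m2" using m2 by (intro mult_left_mono) auto
    also have "\<dots> = ennreal (2 * m2)" using m2 by (simp add: ennreal_mult)
    finally have "rnrm (conv (moment_ker J) f) \<le> ennreal (D * (2 * m2)) * rnrm f"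
      using moment_ker_nonneg[OF J0] moment_ker_decr[OF J J0] by (intro rnrm_conv[OF km f, where M = "moment_ker J"]) auto
    then have "ennreal \<bar>4 / h\<^sup>2\<bar> * rnrm (conv (moment_ker J) f) \<le> ennreal \<bar>4 / h\<^sup>2\<bar> * (ennreal (D * (2 * m2)) * rnrm f)"
      by (rule mult_left_mono) simp
    also have "\<dots> = ennreal (4 / h\<^sup>2 * (D * (2 * m2))) * rnrm f"
      using D_pos m2 by (simp add: ennreal_mult[symmetric] mult.assoc[symmetric])
    finally have "ennreal \<bar>4 / h\<^sup>2\<bar> * rnrm (conv (moment_ker J) f) \<le> ennreal (4 / h\<^sup>2 * (D * (2 * m2))) * rnrm f" .
    with rnrm_cmult[of "conv (moment_ker J) f" "4 / h\<^sup>2"] show ?thesis by (auto intro: order.trans)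
  qed
  \<comment> \<open>\<open>1 + D * I\<close> bounds the difference of the identity and
    \<open>conv J\<close>; the last summand bounds \<open>4 / h\<^sup>2\<close> times
    \<open>conv (moment_ker J)\<close>, whose kernel has mass at most twice the second
    moment.\<close>
  define c where "c = 1 + D * I + 4 / h\<^sup>2 * (D * (2 * m2))"
  have c0: "0 \<le> c" using D_pos I m2 by (simp add: c_def)
  define G where "G = (\<lambda>x. F x - conv (box_ker h) F x)"
  have G: "per_L1 G" unfolding G_def by (intro per_L1_diff F per_L1_conv kb)
  define K where "K N = (conv (rest_ker h) ^^ N)" for N
  have KS: "K (Suc N) f = conv (rest_ker h) (K N f)" for N f by (simp add: K_def)
  have KL: "per_L1 (K N f)" if "per_L1 f" for N f unfolding K_def by (rule per_L1_conv_funpow[OF kr that])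
  \<comment> \<open>\<open>smoothing_step\<close> for \<open>H = K N F\<close>; since powers of
    \<kappa> commute with the box average, the difference occurring there is
    \<open>K N G\<close>.\<close>
  have step: "rnrm (\<lambda>x. K N F x - conv J (K N F) x) \<le> ennreal c * rnrm (K N G) + rnrm (\<lambda>x. K (Suc N) F x - conv J (K (Suc N) F) x)" for N
  proof -
    let ?H = "K N F"
    have H: "per_L1 ?H" by (rule KL[OF F])
    have GN: "(\<lambda>x. ?H x - conv (box_ker h) ?H x) = K N G"
      unfolding K_def G_def using kr kb F by (simp add: conv_funpow_commute conv_funpow_diff per_L1_conv)
    have [measurable]: "K N G \<in> borel_measurable borel" "K (Suc N) F \<in> borel_measurable borel" using KL[OF G] KL[OF F] per_L1_borel by auto
    have eq: "?H x - conv J ?H x = (K N G x - conv J (K N G) x) + 4 / h\<^sup>2 * conv (moment_ker J) (K N G) x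
       + (K (Suc N) F x - conv J (K (Suc N) F) x)" for x
    proof -
      have "?H x - conv (box_ker h) ?H x = K N G x" by (rule fun_cong[OF GN])
      with smoothing_step[OF J even mass h H, of x] show ?thesis unfolding GN KS by (simp only:)
    qed
    have "rnrm (\<lambda>x. ?H x - conv J ?H x)
      \<le> rnrm (\<lambda>x. (K N G x - conv J (K N G) x) + 4 / h\<^sup>2 * conv (moment_ker J) (K N G) x) + rnrm (\<lambda>x. K (Suc N) F x - conv J (K (Suc N) F) x)"
      unfolding eq by (intro rnrm_add) auto
    also have "\<dots> \<le> (rnrm (\<lambda>x. K N G x - conv J (K N G) x) + rnrm (\<lambda>x. 4 / h\<^sup>2 * conv (moment_ker J) (K N G) x))
       + rnrm (\<lambda>x. K (Suc N) F x - conv J (K (Suc N) F) x)"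
      by (intro add_right_mono rnrm_add) auto
    also have "\<dots> \<le> (ennreal (1 + D * I) * rnrm (K N G) + ennreal (4 / h\<^sup>2 * (D * (2 * m2))) * rnrm (K N G))
       + rnrm (\<lambda>x. K (Suc N) F x - conv J (K (Suc N) F) x)"
      by (intro add_right_mono add_mono IV Mo KL G)
    also have "ennreal (1 + D * I) * rnrm (K N G) + ennreal (4 / h\<^sup>2 * (D * (2 * m2))) * rnrm (K N G) = ennreal c * rnrm (K N G)"
    proof -
      have "ennreal c = ennreal (1 + D * I) + ennreal (4 / h\<^sup>2 * (D * (2 * m2)))"
        unfolding c_def using D_pos I m2 by (intro ennreal_plus) auto
      then show ?thesis by (simp only: distrib_right)
    qed
    finally show ?thesis .
  qed
  have iter: "rnrm (\<lambda>x. F x - conv J F x) \<le> ennreal c * (\<Sum>i<N. rnrm (K i G)) + rnrm (\<lambda>x. K N F x - conv J (K N F) x)" for N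
  proof (induction N)
    case 0
    then show ?case by (simp add: K_def)
  next
    case (Suc N)
    have "rnrm (\<lambda>x. F x - conv J F x) \<le> ennreal c * (\<Sum>i<N. rnrm (K i G)) + (ennreal c * rnrm (K N G) + rnrm (\<lambda>x. K (Suc N) F x - conv J (K (Suc N) F) x))"
      using add_left_mono[OF step[of N]] Suc by (rule order.trans[rotated])
    then show ?case by (simp add: distrib_left add.assoc)
  qed
  \<comment> \<open>The power 0 contributes 1, all others together at most
    \<open>64 * D\<close>.\<close>
  have sumG: "(\<Sum>i<Suc N. rnrm (K i G)) \<le> ennreal (1 + 64 * D) * rnrm G" for N
  proof -
    have "(\<Sum>i<N. rnrm (K (Suc i) G)) \<le> (\<Sum>i<N. ennreal (D * (real (Suc i) * (7/8) ^ i)) * rnrm G)"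
      unfolding K_def by (intro sum_mono rnrm_rest_ker_funpow h G)
    also have "\<dots> = (\<Sum>i<N. ennreal (D * (real (Suc i) * (7/8) ^ i))) * rnrm G" by (rule sum_distrib_right[symmetric])
    also have "(\<Sum>i<N. ennreal (D * (real (Suc i) * (7/8) ^ i))) = ennreal (\<Sum>i<N. D * (real (Suc i) * (7/8) ^ i))"
      using D_pos by (intro sum_ennreal) auto
    also have "(\<Sum>i<N. D * (real (Suc i) * (7/8) ^ i)) = D * (\<Sum>i<N. real (Suc i) * (7/8) ^ i)" by (rule sum_distrib_left[symmetric])
    also have "ennreal \<dots> * rnrm G \<le> ennreal (64 * D) * rnrm G"
      using sum_rest_ker_weights[of N] D_pos by (intro mult_right_mono ennreal_leI) auto
    finally have "(\<Sum>i<Suc N. rnrm (K i G)) \<le> rnrm G + ennreal (64 * D) * rnrm G"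
      by (subst sum.lessThan_Suc_shift) (simp add: K_def add_left_mono)
    also have "rnrm G + ennreal (64 * D) * rnrm G = ennreal (1 + 64 * D) * rnrm G"
      using D_pos by (subst ennreal_plus) (auto simp: distrib_right)
    finally show ?thesis .
  qed
  obtain Q where Q: "rnrm F = ennreal Q" "0 \<le> Q" using fin by (cases "rnrm F") auto
  \<comment> \<open>Bound for the remainder after \<open>Suc N\<close> steps; it tends to 0 because
    the norm \<open>Q\<close> of \<open>F\<close> is a real number.\<close>
  define \<epsilon> where "\<epsilon> N = (1 + D * I) * (D * (real (Suc N) * (7/8) ^ N)) * Q" for N
  have tail: "rnrm (\<lambda>x. K (Suc N) F x - conv J (K (Suc N) F) x) \<le> ennreal (\<epsilon> N)" for N
  proof -
    have "rnrm (\<lambda>x. K (Suc N) F x - conv J (K (Suc N) F) x) \<le> ennreal (1 + D * I) * rnrm (K (Suc N) F)"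
      by (rule IV[OF KL[OF F]])
    also have "\<dots> \<le> ennreal (1 + D * I) * (ennreal (D * (real (Suc N) * (7/8) ^ N)) * rnrm F)"
      unfolding K_def by (intro mult_left_mono rnrm_rest_ker_funpow h F) auto
    also have "\<dots> = ennreal (\<epsilon> N)"
      using D_pos I Q by (simp add: \<epsilon>_def ennreal_mult[symmetric] mult.assoc del: of_nat_Suc ennreal_plus)
    finally show ?thesis .
  qed
  have "(\<lambda>n. real (Suc n) * (7/8) ^ n) \<longlonglongrightarrow> 0"
    using geometric_deriv_sums[of "7/8::real"] by (intro summable_LIMSEQ_zero) (auto dest: sums_summable)
  then have "(\<lambda>N. (1 + D * I) * (D * (real (Suc N) * (7/8) ^ N)) * Q) \<longlonglongrightarrow> (1 + D * I) * (D * 0) * Q"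
    by (intro tendsto_intros)
  then have "(\<lambda>N. ennreal (\<epsilon> N)) \<longlonglongrightarrow> ennreal 0" unfolding \<epsilon>_def by (intro tendsto_ennrealI) simp
  then have lim: "(\<lambda>N. ennreal c * (ennreal (1 + 64 * D) * rnrm G) + ennreal (\<epsilon> N)) \<longlonglongrightarrow> ennreal c * (ennreal (1 + 64 * D) * rnrm G) + ennreal 0"
    by (intro tendsto_add tendsto_const)
  have "rnrm (\<lambda>x. F x - conv J F x) \<le> ennreal c * (ennreal (1 + 64 * D) * rnrm G) + ennreal 0"
  proof (rule LIMSEQ_le_const[OF lim], intro exI allI impI)
    fix N
    show "rnrm (\<lambda>x. F x - conv J F x) \<le> ennreal c * (ennreal (1 + 64 * D) * rnrm G) + ennreal (\<epsilon> N)"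
      by (rule order.trans[OF iter[of "Suc N"]]) (intro add_mono mult_left_mono sumG tail, simp)
  qed
  also have "\<dots> = ennreal (c * (1 + 64 * D)) * rnrm G" using c0 D_pos by (simp add: ennreal_mult mult.assoc)
  finally show ?thesis unfolding c_def G_def .
qed

end

section \<open>Trigonometric polynomials and the Jackson kernel\<close>

lemma trig_polysI:
  "T = (\<lambda>x. \<Sum>i\<le>n. a i * cos (real i * x) + b i * sin (real i * x)) \<Longrightarrow> T \<in> trig_polys n"
  by (auto simp: trig_polys_def)

lemma trig_polys_sum: "finite I \<Longrightarrow> (\<And>i. i \<in> I \<Longrightarrow> T i \<in> trig_polys n) \<Longrightarrow> (\<lambda>x. \<Sum>i\<in>I. T i x) \<in> trig_polys n"
proof (induction I rule: finite_induct)
  case empty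
  have "(\<lambda>x. 0) = (\<lambda>x. \<Sum>i\<le>n. 0 * cos (real i * x) + 0 * sin (real i * x))" by auto
  then show ?case unfolding trig_polys_def by (auto intro!: exI[of _ "\<lambda>_. 0"])
next
  case (insert j I)
  obtain a b where 1: "T j = (\<lambda>x. \<Sum>i\<le>n. a i * cos (real i * x) + b i * sin (real i * x))"
    using insert.prems[of j] by (auto simp: trig_polys_def)
  have "(\<lambda>x. \<Sum>i\<in>I. T i x) \<in> trig_polys n" using insert by auto
  then obtain a' b' where 2: "(\<lambda>x. \<Sum>i\<in>I. T i x) = (\<lambda>x. \<Sum>i\<le>n. a' i * cos (real i * x) + b' i * sin (real i * x))"
    by (auto simp: trig_polys_def)
  have "(\<lambda>x. \<Sum>i\<in>insert j I. T i x) = (\<lambda>x. \<Sum>i\<le>n. (a i + a' i) * cos (real i * x) + (b i + b' i) * sin (real i * x))"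
  proof
    fix x
    have "(\<Sum>i\<in>insert j I. T i x) = (\<Sum>i\<le>n. a i * cos (real i * x) + b i * sin (real i * x)) + (\<Sum>i\<le>n. a' i * cos (real i * x) + b' i * sin (real i * x))"
      using insert.hyps fun_cong[OF 1, of x] fun_cong[OF 2, of x] by simp
    then show "(\<Sum>i\<in>insert j I. T i x) = (\<Sum>i\<le>n. (a i + a' i) * cos (real i * x) + (b i + b' i) * sin (real i * x))"
      by (simp add: sum.distrib[symmetric] distrib_right add_ac)
  qed
  then show ?case by (rule trig_polysI)
qed

lemma trig_polys_add:
  assumes "S \<in> trig_polys n" "T \<in> trig_polys n" shows "(\<lambda>x. S x + T x) \<in> trig_polys n"
  using trig_polys_sum[of "UNIV :: bool set" "\<lambda>b. if b then S else T" n] assms by (simp add: UNIV_bool add.commute)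

lemma trig_polys_cmult:
  assumes "T \<in> trig_polys n" shows "(\<lambda>x. c * T x) \<in> trig_polys n"
proof -
  obtain a b where 1: "T = (\<lambda>x. \<Sum>i\<le>n. a i * cos (real i * x) + b i * sin (real i * x))"
    using assms by (auto simp: trig_polys_def)
  have "(\<lambda>x. c * T x) = (\<lambda>x. \<Sum>i\<le>n. (c * a i) * cos (real i * x) + (c * b i) * sin (real i * x))"
    unfolding 1 by (simp add: sum_distrib_left distrib_left mult.assoc)
  then show ?thesis by (rule trig_polysI)
qed

lemma cos_trig_polys: "i \<le> n \<Longrightarrow> (\<lambda>x. cos (real i * x)) \<in> trig_polys n"
proof -
  assume i: "i \<le> n"
  have "(\<lambda>x. cos (real i * x)) = (\<lambda>x. \<Sum>j\<le>n. (if j = i then 1 else 0) * cos (real j * x) + 0 * sin (real j * x))"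
    using i by (auto simp: if_distrib[of "\<lambda>c. c * _"] sum.delta cong: if_cong)
  then show ?thesis by (rule trig_polysI)
qed

lemma sin_trig_polys: "i \<le> n \<Longrightarrow> (\<lambda>x. sin (real i * x)) \<in> trig_polys n"
proof -
  assume i: "i \<le> n"
  have "(\<lambda>x. sin (real i * x)) = (\<lambda>x. \<Sum>j\<le>n. 0 * cos (real j * x) + (if j = i then 1 else 0) * sin (real j * x))"
    using i by (auto simp: if_distrib[of "\<lambda>c. c * _"] sum.delta cong: if_cong)
  then show ?thesis by (rule trig_polysI)
qed

lemma cos_diff_trig_polys: "i \<le> n \<Longrightarrow> j \<le> n \<Longrightarrow> (\<lambda>x. cos (real i * x - real j * x)) \<in> trig_polys n"
proof (cases "i \<le> j")
  case True
  moreover assume "j \<le> n"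
  moreover have "cos (real i * x - real j * x) = cos (real (j - i) * x)" for x
    using True by (subst cos_minus[symmetric]) (simp add: of_nat_diff algebra_simps)
  ultimately show ?thesis using cos_trig_polys[of "j - i" n] by simp
next
  case False
  moreover assume "i \<le> n"
  moreover have "cos (real i * x - real j * x) = cos (real (i - j) * x)" for x
    using False by (simp add: of_nat_diff algebra_simps)
  ultimately show ?thesis using cos_trig_polys[of "i - j" n] by simp
qed

lemma sin_diff_trig_polys: "i \<le> n \<Longrightarrow> j \<le> n \<Longrightarrow> (\<lambda>x. sin (real i * x - real j * x)) \<in> trig_polys n"
proof (cases "i \<le> j")
  case True
  moreover assume "j \<le> n"
  moreover have "sin (real i * x - real j * x) = (-1) * sin (real (j - i) * x)" for x
    using True sin_minus[of "real (j - i) * x"] by (simp add: of_nat_diff algebra_simps)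
  ultimately show ?thesis using trig_polys_cmult[OF sin_trig_polys[of "j - i" n], of "-1"] by simp
next
  case False
  moreover assume "i \<le> n"
  moreover have "sin (real i * x - real j * x) = sin (real (i - j) * x)" for x
    using False by (simp add: of_nat_diff algebra_simps)
  ultimately show ?thesis using sin_trig_polys[of "i - j" n] by simp
qed

lemma trig_monomial_mult:
  assumes "i \<le> m" "j \<le> n"
  shows "(\<lambda>x. (a * cos (real i * x) + b * sin (real i * x)) * (c * cos (real j * x) + d * sin (real j * x))) \<in> trig_polys (m + n)"
proof -
  let ?u = "\<lambda>x. real i * x" and ?v = "\<lambda>x. real j * x"
  have eq: "(a * cos u + b * sin u) * (c * cos v + d * sin v)
    = ((a * c + b * d) / 2) * cos (u - v) + ((a * c - b * d) / 2) * cos (u + v)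
      + (((a * d + b * c) / 2) * sin (u + v) + ((b * c - a * d) / 2) * sin (u - v))" for u v :: real
    unfolding cos_add cos_diff sin_add sin_diff by (simp add: field_simps)
  have p: "(\<lambda>x. cos (?u x + ?v x)) \<in> trig_polys (m + n)" "(\<lambda>x. sin (?u x + ?v x)) \<in> trig_polys (m + n)"
    using cos_trig_polys[of "i + j" "m + n"] sin_trig_polys[of "i + j" "m + n"] assms by (simp_all add: distrib_right)
  have q: "(\<lambda>x. cos (?u x - ?v x)) \<in> trig_polys (m + n)" "(\<lambda>x. sin (?u x - ?v x)) \<in> trig_polys (m + n)"
    using assms by (auto intro!: cos_diff_trig_polys sin_diff_trig_polys)
  show ?thesis unfolding eq by (intro trig_polys_add trig_polys_cmult p q)
qed

lemma trig_polys_mult: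
  assumes "S \<in> trig_polys m" "T \<in> trig_polys n"
  shows "(\<lambda>x. S x * T x) \<in> trig_polys (m + n)"
proof -
  obtain a b where S: "S = (\<lambda>x. \<Sum>i\<le>m. a i * cos (real i * x) + b i * sin (real i * x))"
    using assms by (auto simp: trig_polys_def)
  obtain c d where T: "T = (\<lambda>x. \<Sum>i\<le>n. c i * cos (real i * x) + d i * sin (real i * x))"
    using assms by (auto simp: trig_polys_def)
  show ?thesis unfolding S T sum_product by (intro trig_polys_sum trig_monomial_mult) auto
qed

lemma trig_polys_mono: "m \<le> n \<Longrightarrow> trig_polys m \<subseteq> trig_polys n"
proof
  fix T assume mn: "m \<le> n" and "T \<in> trig_polys m"
  then obtain a b where T: "T = (\<lambda>x. \<Sum>i\<le>m. a i * cos (real i * x) + b i * sin (real i * x))"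
    by (auto simp: trig_polys_def)
  have "(\<lambda>x. a i * cos (real i * x) + b i * sin (real i * x)) \<in> trig_polys n" if "i \<le> m" for i
    using that mn by (intro trig_polys_add trig_polys_cmult cos_trig_polys sin_trig_polys) auto
  then show "T \<in> trig_polys n" unfolding T by (intro trig_polys_sum) auto
qed

lemma trig_polys_per: "T \<in> trig_polys n \<Longrightarrow> per T"
proof -
  assume "T \<in> trig_polys n"
  then obtain a b where T: "T = (\<lambda>x. \<Sum>i\<le>n. a i * cos (real i * x) + b i * sin (real i * x))"
    by (auto simp: trig_polys_def)
  have "cos (real i * (x + 2 * pi)) = cos (real i * x)" "sin (real i * (x + 2 * pi)) = sin (real i * x)" for i x
    using cos.plus_of_nat[of "real i * x" i] sin.plus_of_nat[of "real i * x" i] by (simp_all add: algebra_simps)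
  then show ?thesis by (simp add: per_def T)
qed

lemma trig_polys_borel: "T \<in> trig_polys n \<Longrightarrow> T \<in> borel_measurable borel"
  unfolding trig_polys_def by auto

section \<open>The Dirichlet kernel\<close>

definition dirichlet :: "nat \<Rightarrow> real \<Rightarrow> real" where
  "dirichlet r t = 1 + 2 * (\<Sum>l=1..r. cos (real l * t))"

text \<open>Multiplication by \<open>sin (t / 2)\<close> makes the cosine sum telescope.\<close>

lemma dirichlet_sin: "dirichlet r t * sin (t / 2) = sin (real (2 * r + 1) * t / 2)"
proof (induction r)
  case (Suc r)
  have "dirichlet (Suc r) t * sin (t / 2) = dirichlet r t * sin (t / 2) + 2 * cos (real (Suc r) * t) * sin (t / 2)"
    by (simp add: dirichlet_def algebra_simps)
  also have "2 * cos (real (Suc r) * t) * sin (t / 2) = sin (real (Suc r) * t + t / 2) - sin (real (Suc r) * t - t / 2)"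
    by (simp add: sin_add sin_diff)
  also have "real (Suc r) * t - t / 2 = real (2 * r + 1) * t / 2" by (simp add: field_simps)
  also have "real (Suc r) * t + t / 2 = real (2 * Suc r + 1) * t / 2" by (simp add: field_simps)
  finally show ?case using Suc by simp
qed (simp add: dirichlet_def)

lemma dirichlet_abs_le: "\<bar>dirichlet r t\<bar> \<le> real (2 * r + 1)"
proof -
  have "\<bar>\<Sum>l=1..r. cos (real l * t)\<bar> \<le> (\<Sum>l=1..r. \<bar>cos (real l * t)\<bar>)" by (rule sum_abs)
  also have "\<dots> \<le> (\<Sum>l=1..r. 1)" by (intro sum_mono) auto
  finally have "\<bar>\<Sum>l=1..r. cos (real l * t)\<bar> \<le> real r" by simp
  then show ?thesis unfolding dirichlet_def by simp
qed

lemma sin_ge_linear: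
  assumes "0 \<le> x" "x \<le> pi / 2" shows "2 / pi * x \<le> sin x"
proof -
  have conv: "concave_on {0..pi/2} sin"
  proof (rule f''_le0_imp_concave)
    show "convex {0..pi/2}" by simp
    show "(sin has_real_derivative cos x) (at x)" for x :: real by (rule DERIV_sin)
    show "(cos has_real_derivative - sin x) (at x)" for x :: real by (auto intro!: derivative_eq_intros)
    show "- sin x \<le> 0" if "x \<in> {0..pi/2}" for x using that by (auto intro!: sin_ge_zero)
  qed
  have "(1 - 2 / pi * x) * sin 0 + (2 / pi * x) * sin (pi / 2) \<le> sin ((1 - 2 / pi * x) *\<^sub>R 0 + (2 / pi * x) *\<^sub>R (pi / 2))"
    using assms by (intro concave_onD[OF conv]) (auto simp: field_simps)
  then show ?thesis by simp
qed

lemma dirichlet_decay: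
  assumes "t \<noteq> 0" "\<bar>t\<bar> \<le> pi" shows "\<bar>dirichlet r t\<bar> \<le> pi / \<bar>t\<bar>"
proof -
  have "2 / pi * (\<bar>t\<bar> / 2) \<le> sin (\<bar>t\<bar> / 2)" using assms by (intro sin_ge_linear) auto
  moreover have "\<bar>sin (t / 2)\<bar> = sin (\<bar>t\<bar> / 2)" using sin_ge_zero[of "\<bar>t\<bar> / 2"] assms by (cases "0 \<le> t") auto
  ultimately have s: "\<bar>t\<bar> / pi \<le> \<bar>sin (t / 2)\<bar>" by simp
  have "\<bar>dirichlet r t\<bar> * (\<bar>t\<bar> / pi) \<le> \<bar>dirichlet r t\<bar> * \<bar>sin (t / 2)\<bar>" using s by (intro mult_left_mono) auto
  also have "\<dots> = \<bar>sin (real (2 * r + 1) * t / 2)\<bar>" by (simp only: abs_mult[symmetric] dirichlet_sin)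
  also have "\<dots> \<le> 1" by (rule abs_sin_le_one)
  finally show ?thesis using assms by (simp add: field_simps)
qed

text \<open>In \<open>dirichlet_sin\<close> the argument of the right-hand sine stays within a
  quarter period, where the sine lies above its chord, while \<open>sin (t / 2)\<close> is at most
  \<open>t / 2\<close> for positive \<open>t\<close>. The bound serves to estimate the normalising
  constant of the Jackson kernel.\<close>

lemma dirichlet_lower:
  assumes "\<bar>t\<bar> \<le> pi / real (2 * r + 1)" shows "2 / pi * real (2 * r + 1) \<le> dirichlet r t"
proof -
  let ?m = "real (2 * r + 1)"
  have m: "1 \<le> ?m" by simp
  have eq: "dirichlet r t = dirichlet r \<bar>t\<bar>" by (auto simp: dirichlet_def abs_if)
  show ?thesis
  proof (cases "t = 0")
    case True
    have "2 / pi * ?m \<le> 1 * ?m" using pi_ge_two by (intro mult_right_mono) (auto simp: field_simps)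
    then show ?thesis using True by (simp add: dirichlet_def)
  next
    case False
    define s where "s = \<bar>t\<bar>"
    have s: "0 < s" "?m * s \<le> pi" using False assms m by (auto simp: s_def field_simps)
    have spi: "s \<le> pi"
    proof -
      have "1 * s \<le> ?m * s" using m s by (intro mult_right_mono) auto
      also note s(2)
      finally show ?thesis by simp
    qed
    have "2 / pi * (?m * s / 2) \<le> sin (?m * s / 2)" using s m by (intro sin_ge_linear) auto
    also have "\<dots> = dirichlet r s * sin (s / 2)" by (simp only: dirichlet_sin)
    finally have 1: "?m * s / pi \<le> dirichlet r s * sin (s / 2)" by simp
    have s2: "0 < sin (s / 2)" "sin (s / 2) \<le> s / 2" using s spi sin_x_le_x[of "s / 2"] by (auto intro!: sin_gt_zero)
    have "0 < ?m * s / pi" using s m by (intro divide_pos_pos mult_pos_pos) auto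
    with 1 have "0 < dirichlet r s * sin (s / 2)" by linarith
    then have "0 < dirichlet r s" using s2 by (simp add: zero_less_mult_iff)
    then have "dirichlet r s * sin (s / 2) \<le> dirichlet r s * (s / 2)" using s2 by (intro mult_left_mono) auto
    with 1 have "?m * s / pi \<le> dirichlet r s * (s / 2)" by linarith
    then have "s * (2 / pi * ?m) \<le> s * dirichlet r s" by (simp add: field_simps)
    then have "2 / pi * ?m \<le> dirichlet r s" using s(1) by (subst (asm) mult_le_cancel_left_pos)
    then show ?thesis using eq by (simp add: s_def)
  qed
qed

lemma dirichlet_trig_polys: "dirichlet r \<in> trig_polys r"
proof -
  have "(\<lambda>t. 1 * cos (real 0 * t)) \<in> trig_polys r" by (intro trig_polys_cmult cos_trig_polys) simp
  then have 1: "(\<lambda>t. 1) \<in> trig_polys r" by simp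
  have "(\<lambda>t. 1 + 2 * (\<Sum>l=1..r. cos (real l * t))) \<in> trig_polys r"
    by (intro trig_polys_add trig_polys_cmult trig_polys_sum cos_trig_polys 1) auto
  then show ?thesis unfolding dirichlet_def[abs_def] .
qed

lemma dirichlet_power4_trig_polys: "(\<lambda>t. (dirichlet r t) ^ 4) \<in> trig_polys (4 * r)"
proof -
  note d = dirichlet_trig_polys[of r]
  have "(\<lambda>t. (dirichlet r t * dirichlet r t) * (dirichlet r t * dirichlet r t)) \<in> trig_polys ((r + r) + (r + r))"
    by (intro trig_polys_mult d)
  moreover have "(\<lambda>t. (dirichlet r t) ^ 4) = (\<lambda>t. (dirichlet r t * dirichlet r t) * (dirichlet r t * dirichlet r t))"
    by (simp add: power4_eq_xxxx mult.assoc)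
  moreover have "(r + r) + (r + r) = 4 * r" by simp
  ultimately show ?thesis by simp
qed

text \<open>Combines the bound \<open>m\<close> near 0 with \<open>pi / |t|\<close> away from 0: the
  squared kernel times \<open>1 + (m * t)\<^sup>2\<close> is at most
  \<open>(1 + 16) * m\<^sup>2\<close>, as \<open>pi\<close> is below 4. The 17 is rounded up to 20,
  and 400 is its square.\<close>

lemma dirichlet_power4_upper:
  fixes r :: nat and t :: real
  assumes "\<bar>t\<bar> \<le> pi"
  defines "m \<equiv> real (2 * r + 1)"
  shows "(dirichlet r t) ^ 4 \<le> 400 * m ^ 4 / (1 + (m * t)\<^sup>2)\<^sup>2"
proof -
  have m: "1 \<le> m" by (simp add: m_def)
  have "(dirichlet r t)\<^sup>2 * (1 + (m * t)\<^sup>2) \<le> 20 * m\<^sup>2"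
  proof -
    have 1: "(dirichlet r t)\<^sup>2 \<le> m\<^sup>2"
      using dirichlet_abs_le[of r t] m unfolding m_def by (simp add: abs_le_square_iff[symmetric])
    have 2: "(dirichlet r t)\<^sup>2 * t\<^sup>2 \<le> 16"
    proof (cases "t = 0")
      case False
      have "\<bar>dirichlet r t\<bar> * \<bar>t\<bar> \<le> pi" using dirichlet_decay[OF False assms(1), of r] False by (simp add: field_simps)
      also have "\<dots> \<le> 4" using pi_less_4 by simp
      finally have "(\<bar>dirichlet r t\<bar> * \<bar>t\<bar>)\<^sup>2 \<le> 4\<^sup>2" by (intro power_mono) auto
      then show ?thesis by (simp add: power_mult_distrib)
    qed simp
    have "(dirichlet r t)\<^sup>2 * (1 + (m * t)\<^sup>2) = (dirichlet r t)\<^sup>2 + m\<^sup>2 * ((dirichlet r t)\<^sup>2 * t\<^sup>2)"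
      by (simp add: algebra_simps power_mult_distrib)
    also have "\<dots> \<le> m\<^sup>2 + m\<^sup>2 * 16" using 1 2 by (intro add_mono mult_left_mono) auto
    finally show ?thesis using zero_le_power2[of m] by linarith
  qed
  then have "((dirichlet r t)\<^sup>2 * (1 + (m * t)\<^sup>2))\<^sup>2 \<le> (20 * m\<^sup>2)\<^sup>2"
    by (intro power_mono) auto
  then have le: "(dirichlet r t) ^ 4 * (1 + (m * t)\<^sup>2)\<^sup>2 \<le> 400 * m ^ 4"
    by (simp add: power_mult_distrib power2_eq_square power4_eq_xxxx mult_ac)
  have "0 < (1 + (m * t)\<^sup>2)\<^sup>2" by (intro zero_less_power add_pos_nonneg) auto
  with le show ?thesis by (subst pos_le_divide_eq) auto
qed

section \<open>Convolution with trigonometric polynomials\<close>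

lemma set_integral_per_Ico:
  fixes g :: "real \<Rightarrow> real"
  assumes [measurable]: "g \<in> borel_measurable borel" and "per g"
  shows "(LINT y:{t..<t + 2 * pi}|lborel. g y) = (LINT y:{0..<2 * pi}|lborel. g y)"
proof -
  have *: "(LINT y:{a..<b}|lborel. g y) = enn2real (\<integral>\<^sup>+y\<in>{a..<b}. ennreal (g y) \<partial>lborel) - enn2real (\<integral>\<^sup>+y\<in>{a..<b}. ennreal (- g y) \<partial>lborel)"
    if "set_integrable lborel {a..<b} g" for a b
    unfolding set_lebesgue_integral_def using that
    by (subst real_lebesgue_integral_def)
      (auto simp: set_integrable_def indicator_def if_distrib[of ennreal] if_distrib[of uminus] intro!: arg_cong2[of _ _ _ _ "(-)"] arg_cong[of _ _ enn2real] nn_integral_cong)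
  have pos: "(\<integral>\<^sup>+y\<in>{t..<t + 2 * pi}. ennreal (g y) \<partial>lborel) = (\<integral>\<^sup>+y\<in>{0..<2 * pi}. ennreal (g y) \<partial>lborel)"
    using per_int_Ico[of "\<lambda>y. ennreal (g y)" t] assms(2) by (simp add: per_def per_int_def)
  have neg: "(\<integral>\<^sup>+y\<in>{t..<t + 2 * pi}. ennreal (- g y) \<partial>lborel) = (\<integral>\<^sup>+y\<in>{0..<2 * pi}. ennreal (- g y) \<partial>lborel)"
    using per_int_Ico[of "\<lambda>y. ennreal (- g y)" t] assms(2) by (simp add: per_def per_int_def)
  have abs: "(\<integral>\<^sup>+y\<in>{t..<t + 2 * pi}. ennreal \<bar>g y\<bar> \<partial>lborel) = (\<integral>\<^sup>+y\<in>{0..<2 * pi}. ennreal \<bar>g y\<bar> \<partial>lborel)"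
    using per_int_Ico[of "\<lambda>y. ennreal \<bar>g y\<bar>" t] assms(2) by (simp add: per_def per_int_def)
  have int: "set_integrable lborel {a..<b} g \<longleftrightarrow> (\<integral>\<^sup>+y\<in>{a..<b}. ennreal \<bar>g y\<bar> \<partial>lborel) < \<infinity>" for a b
    unfolding set_integrable_def
    by (subst integrable_iff_bounded) (auto simp: abs_mult ennreal_mult mult.commute simp flip: ennreal_indicator)
  show ?thesis
  proof (cases "set_integrable lborel {0..<2 * pi} g")
    case True
    then have "set_integrable lborel {t..<t + 2 * pi} g" unfolding int abs .
    with True show ?thesis by (simp add: * pos neg)
  next
    case False
    then have "\<not> set_integrable lborel {t..<t + 2 * pi} g" unfolding int abs .
    with False show ?thesis by (simp add: set_lebesgue_integral_def set_integrable_def not_integrable_integral_eq)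
  qed
qed

text \<open>The half-open interval is exactly one period, so after substituting
  \<open>y = x + t\<close> periodicity fixes the range of integration; the addition theorems then
  separate \<open>x\<close> from \<open>y\<close>, and the Fourier integrals of \<open>f\<close>
  become coefficients.\<close>

lemma conv_trig_poly_kernel:
  assumes P: "P \<in> trig_polys n" and f: "per_L1 f"
  shows "conv (\<lambda>t. P t * indicator {-pi..<pi} t) f \<in> trig_polys n"
proof -
  have [measurable]: "f \<in> borel_measurable borel" "P \<in> borel_measurable borel" using f P per_L1_borel trig_polys_borel by auto
  obtain a b where ab: "P = (\<lambda>x. \<Sum>i\<le>n. a i * cos (real i * x) + b i * sin (real i * x))"
    using P by (auto simp: trig_polys_def)
  define C S where "C i = (LINT y:{0..<2*pi}|lborel. cos (real i * y) * f y)" and "S i = (LINT y:{0..<2*pi}|lborel. sin (real i * y) * f y)" for i :: nat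
  have fint: "integrable lborel (\<lambda>y. indicator {0..<2*pi} y * f y)"
    using f unfolding per_L1_def per_int_def
    by (subst integrable_iff_bounded) (auto simp: abs_mult ennreal_mult mult.commute simp flip: ennreal_indicator)
  have int: "integrable lborel (\<lambda>y. indicator {0..<2*pi} y * (u y * f y))" if [measurable]: "u \<in> borel_measurable borel" and "\<And>y. \<bar>u y\<bar> \<le> 1" for u
  proof (rule Bochner_Integration.integrable_bound[OF fint])
    show "AE y in lborel. norm (indicator {0..<2*pi} y * (u y * f y)) \<le> norm (indicator {0..<2*pi} y * f y)"
      using that(2) by (auto simp: abs_mult indicator_def intro!: mult_left_le_one_le)
  qed measurable
  have "conv (\<lambda>t. P t * indicator {-pi..<pi} t) f x = (\<Sum>i\<le>n. (a i * C i + b i * S i) * cos (real i * x) + (a i * S i - b i * C i) * sin (real i * x))" for x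
  proof -
    have "conv (\<lambda>t. P t * indicator {-pi..<pi} t) f x = (\<integral>y. P (y - x) * indicator {-pi..<pi} (y - x) * f y \<partial>lborel)"
      unfolding conv_def
      using lborel_integral_real_affine[of 1 "\<lambda>y. P (y - x) * indicator {-pi..<pi} (y - x) * f y" x] by simp
    also have "\<dots> = (LINT y:{x - pi..<(x - pi) + 2 * pi}|lborel. P (y - x) * f y)"
      unfolding set_lebesgue_integral_def by (intro Bochner_Integration.integral_cong) (auto simp: indicator_def)
    also have "\<dots> = (LINT y:{0..<2 * pi}|lborel. P (y - x) * f y)"
      using per_shift_minus[OF trig_polys_per[OF P], of x] f by (intro set_integral_per_Ico) (auto simp: per_def per_L1_def)
    also have "\<dots> = (\<integral>y. (\<Sum>i\<le>n. (a i * cos (real i * x) - b i * sin (real i * x)) * (indicator {0..<2*pi} y * (cos (real i * y) * f y))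
       + (a i * sin (real i * x) + b i * cos (real i * x)) * (indicator {0..<2*pi} y * (sin (real i * y) * f y))) \<partial>lborel)"
      unfolding set_lebesgue_integral_def ab
    proof (intro Bochner_Integration.integral_cong refl)
      fix y
      have "(\<Sum>i\<le>n. a i * cos (real i * (y - x)) + b i * sin (real i * (y - x)))
        = (\<Sum>i\<le>n. (a i * cos (real i * x) - b i * sin (real i * x)) * cos (real i * y) + (a i * sin (real i * x) + b i * cos (real i * x)) * sin (real i * y))"
        by (intro sum.cong refl) (simp add: right_diff_distrib cos_diff sin_diff algebra_simps)
      then show "indicator {0..<2*pi} y *\<^sub>R ((\<Sum>i\<le>n. a i * cos (real i * (y - x)) + b i * sin (real i * (y - x))) * f y)
        = (\<Sum>i\<le>n. (a i * cos (real i * x) - b i * sin (real i * x)) * (indicator {0..<2*pi} y * (cos (real i * y) * f y))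
       + (a i * sin (real i * x) + b i * cos (real i * x)) * (indicator {0..<2*pi} y * (sin (real i * y) * f y)))"
        by (simp add: sum_distrib_left sum_distrib_right algebra_simps)
    qed
    also have "\<dots> = (\<Sum>i\<le>n. (a i * cos (real i * x) - b i * sin (real i * x)) * C i + (a i * sin (real i * x) + b i * cos (real i * x)) * S i)"
      unfolding C_def S_def set_lebesgue_integral_def
      by (subst Bochner_Integration.integral_sum)
        (auto intro!: sum.cong Bochner_Integration.integrable_add integrable_mult_right int simp: int)
    also have "\<dots> = (\<Sum>i\<le>n. (a i * C i + b i * S i) * cos (real i * x) + (a i * S i - b i * C i) * sin (real i * x))"
      by (intro sum.cong refl) (simp add: algebra_simps)
    finally show ?thesis .
  qed
  then have "conv (\<lambda>t. P t * indicator {-pi..<pi} t) f = (\<lambda>x. \<Sum>i\<le>n. (a i * C i + b i * S i) * cos (real i * x) + (a i * S i - b i * C i) * sin (real i * x))"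
    by (rule ext)
  then show ?thesis by (rule trig_polysI)
qed

lemma nn_integral_Cauchy_density:
  assumes m: "0 < m"
  shows "(\<integral>\<^sup>+t. ennreal (m / (1 + (m * t)\<^sup>2)) \<partial>lborel) \<le> ennreal pi"
proof -
  let ?f = "\<lambda>t. m / (1 + (m * t)\<^sup>2)"
  have pos: "0 < 1 + (m * t)\<^sup>2" for t by (intro add_pos_nonneg) auto
  have half: "(\<integral>\<^sup>+t. ennreal (?f t) * indicator {0..} t \<partial>lborel) = ennreal (pi / 2 - arctan (m * 0))"
  proof (rule nn_integral_FTC_atLeast)
    show "((\<lambda>t. arctan (m * t)) has_real_derivative ?f t) (at t)" for t
      using pos[of t] by (auto intro!: derivative_eq_intros simp: field_simps)
    show "0 \<le> ?f t" for t using pos[of t] m by auto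
    have "filterlim (\<lambda>t. m * t) at_top at_top"
      using m by (intro filterlim_tendsto_pos_mult_at_top[OF tendsto_const _ filterlim_ident]) auto
    then show "((\<lambda>t. arctan (m * t)) \<longlongrightarrow> pi / 2) at_top"
      by (rule filterlim_compose[OF tendsto_arctan_at_top])
  qed measurable
  have "(\<integral>\<^sup>+t. ennreal (?f t) \<partial>lborel) \<le> (\<integral>\<^sup>+t. ennreal (?f t) * indicator {0..} t + ennreal (?f (- t)) * indicator {0..} (- t) \<partial>lborel)"
    by (intro nn_integral_mono) (auto simp: indicator_def)
  also have "\<dots> = (\<integral>\<^sup>+t. ennreal (?f t) * indicator {0..} t \<partial>lborel) + (\<integral>\<^sup>+t. ennreal (?f (- t)) * indicator {0..} (- t) \<partial>lborel)"
    by (rule nn_integral_add) measurable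
  also have "(\<integral>\<^sup>+t. ennreal (?f (- t)) * indicator {0..} (- t) \<partial>lborel) = (\<integral>\<^sup>+t. ennreal (?f t) * indicator {0..} t \<partial>lborel)"
    by (rule nn_integral_reflect[of "\<lambda>t. ennreal (?f t) * indicator {0..} t"]) measurable
  finally show ?thesis unfolding half by (simp flip: ennreal_plus)
qed

text \<open>The normalised fourth power of the Dirichlet kernel. The fourth power decays fast enough
  for a second moment of order \<open>1 / m\<^sup>2\<close>; the square would only give
  \<open>1 / m\<close>. In \<open>c\<close>, the 13 rounds \<open>400 / 32\<close> upwards,
  \<open>pi ^ 3\<close> comes from the normalising constant and one more \<open>pi\<close> from the
  integral of the majorant.\<close>

lemma jackson_kernel:
  fixes r :: nat
  defines "m \<equiv> real (2 * r + 1)" and "c \<equiv> 13 * pi ^ 4"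
  shows "\<exists>J. kernel J \<and> (\<forall>t. 0 \<le> J t) \<and> (\<forall>t. J (- t) = J t) \<and> (\<integral>t. J t \<partial>lborel) = 1 \<and>
    (\<exists>M. M \<in> borel_measurable borel \<and> (\<forall>x y. \<bar>x\<bar> \<le> \<bar>y\<bar> \<longrightarrow> M y \<le> M x) \<and> (\<forall>t. J t \<le> M t) \<and> (\<integral>\<^sup>+t. ennreal (M t) \<partial>lborel) \<le> ennreal c) \<and>
    (\<integral>\<^sup>+t. ennreal (J t * t\<^sup>2) \<partial>lborel) \<le> ennreal (c / m\<^sup>2) \<and>
    (\<forall>f. per_L1 f \<longrightarrow> (\<exists>T\<in>trig_polys (4 * r). \<forall>x. conv J f x = T x))"
proof -
  have m: "1 \<le> m" by (simp add: m_def)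
  let ?P = "\<lambda>t. (dirichlet r t) ^ 4"
  have [measurable]: "dirichlet r \<in> borel_measurable borel" by (rule trig_polys_borel[OF dirichlet_trig_polys])
  have even: "dirichlet r (- t) = dirichlet r t" for t by (simp add: dirichlet_def)
  define K where "K t = ?P t * indicator {-pi..pi} t" for t
  have [measurable]: "K \<in> borel_measurable borel" unfolding K_def[abs_def] by measurable
  have K0: "0 \<le> K t" for t by (simp add: K_def indicator_def)
  have Kk: "kernel K"
  proof (rule kernelI[of _ "m ^ 4" pi])
    show "\<bar>K t\<bar> \<le> m ^ 4" for t
    proof -
      have "\<bar>dirichlet r t\<bar> ^ 4 \<le> m ^ 4" using dirichlet_abs_le[of r t] by (intro power_mono) (auto simp: m_def)
      then show ?thesis using m by (auto simp: K_def indicator_def power_abs)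
    qed
    show "K t = 0" if "pi < \<bar>t\<bar>" for t using that by (auto simp: K_def indicator_def)
  qed measurable
  define Z where "Z = (\<integral>t. K t \<partial>lborel)"
  \<comment> \<open>The lower bound \<open>2 / pi * m\<close> for the Dirichlet kernel, to the
    fourth power, on an interval of length \<open>2 * pi / m\<close>.\<close>
  have Z: "32 * m ^ 3 / pi ^ 3 \<le> Z"
  proof -
    have "(\<integral>t. (2 / pi * m) ^ 4 * indicator {-(pi/m)..pi/m} t \<partial>lborel) \<le> Z"
      unfolding Z_def
    proof (rule integral_mono)
      show "integrable lborel (\<lambda>t. (2 / pi * m) ^ 4 * indicator {-(pi/m)..pi/m} t)"
        by (intro integrable_mult_right integrable_real_indicator) (auto simp: emeasure_lborel_Icc_eq)
      show "integrable lborel K" by (rule kernel_integrable(1)[OF Kk])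
      fix t
      show "(2 / pi * m) ^ 4 * indicator {-(pi/m)..pi/m} t \<le> K t"
      proof (cases "t \<in> {-(pi/m)..pi/m}")
        case True
        then have t: "\<bar>t\<bar> \<le> pi / m" unfolding atLeastAtMost_iff by arith
        have "pi / m \<le> pi / 1" using m by (intro divide_left_mono) auto
        then have "\<bar>t\<bar> \<le> pi" using t by simp
        then have tI: "t \<in> {-pi..pi}" unfolding atLeastAtMost_iff by arith
        have "2 / pi * m \<le> dirichlet r t" using dirichlet_lower[of t r] t by (simp add: m_def)
        then have "(2 / pi * m) ^ 4 \<le> ?P t" using m by (intro power_mono) auto
        then show ?thesis using True tI by (simp add: K_def)
      qed (use K0 in simp)
    qed
    moreover have "(\<integral>t. (2 / pi * m) ^ 4 * indicator {-(pi/m)..pi/m} t \<partial>lborel) = 32 * m ^ 3 / pi ^ 3"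
      using m by (simp add: field_simps power4_eq_xxxx power3_eq_cube)
    ultimately show ?thesis by simp
  qed
  have "0 < 32 * m ^ 3 / pi ^ 3" using m by (intro divide_pos_pos) auto
  with Z have Z0: "0 < Z" by linarith
  define J where "J t = K t / Z" for t
  have J0: "0 \<le> J t" for t using K0[of t] Z0 by (simp add: J_def)
  have [measurable]: "J \<in> borel_measurable borel" unfolding J_def[abs_def] by measurable
  have Jk: "kernel J"
  proof -
    obtain R B where RB: "0 < R" "0 \<le> B" "\<And>t. \<bar>K t\<bar> \<le> B" "\<And>t. t \<notin> {-R..<R} \<Longrightarrow> K t = 0" by (rule kernelE[OF Kk]) blast
    show ?thesis
    proof (rule kernelI[of _ "B / Z" R])
      show "\<bar>J t\<bar> \<le> B / Z" for t using RB(3)[of t] Z0 by (auto simp: J_def divide_right_mono)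
      show "J t = 0" if "R < \<bar>t\<bar>" for t
      proof -
        have "t \<notin> {-R..<R}" using that by auto
        then show ?thesis using RB(4) by (simp add: J_def)
      qed
    qed measurable
  qed
  have J1: "(\<integral>t. J t \<partial>lborel) = 1" using Z0 by (simp add: J_def Z_def[symmetric])
  have Jev: "J (- t) = J t" for t by (auto simp: J_def K_def even indicator_def)
  have up: "J t \<le> 13 * pi ^ 3 * (m / (1 + (m * t)\<^sup>2)\<^sup>2)" for t
  proof (cases "\<bar>t\<bar> \<le> pi")
    case True
    have pos: "0 < (1 + (m * t)\<^sup>2)\<^sup>2" by (intro zero_less_power add_pos_nonneg) auto
    have "K t \<le> ?P t" by (simp add: K_def indicator_def)
    also have "\<dots> \<le> 400 * m ^ 4 / (1 + (m * t)\<^sup>2)\<^sup>2" using dirichlet_power4_upper[OF True, of r] by (simp add: m_def)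
    finally have "J t \<le> (400 * m ^ 4 / (1 + (m * t)\<^sup>2)\<^sup>2) / Z" unfolding J_def using Z0 by (intro divide_right_mono) auto
    also have "\<dots> \<le> (400 * m ^ 4 / (1 + (m * t)\<^sup>2)\<^sup>2) / (32 * m ^ 3 / pi ^ 3)"
      using Z m pos by (intro divide_left_mono mult_pos_pos) (auto intro: order.strict_trans2[OF _ Z])
    also have "\<dots> = 25 / 2 * pi ^ 3 * (m / (1 + (m * t)\<^sup>2)\<^sup>2)"
      using m pos by (simp add: field_simps power4_eq_xxxx power3_eq_cube)
    also have "\<dots> \<le> 13 * pi ^ 3 * (m / (1 + (m * t)\<^sup>2)\<^sup>2)" using m pos by (intro mult_right_mono) auto
    finally show ?thesis .
  next
    case False
    then have "J t = 0" by (auto simp: J_def K_def indicator_def)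
    then show ?thesis using m by simp
  qed
  have q1: "1 \<le> 1 + (m * t)\<^sup>2" for t by simp
  \<comment> \<open>Dropping the square in the denominator keeps integrability and gives an even
    majorant decreasing away from 0, whose integral is an arctangent.\<close>
  define M where "M t = 13 * pi ^ 3 * (m / (1 + (m * t)\<^sup>2))" for t
  have JM: "J t \<le> M t" for t
  proof -
    have "1 + (m * t)\<^sup>2 \<le> (1 + (m * t)\<^sup>2)\<^sup>2" using self_le_power[OF q1, of 2 t] by simp
    moreover have "0 < 1 + (m * t)\<^sup>2" by (intro add_pos_nonneg) auto
    ultimately have "m / (1 + (m * t)\<^sup>2)\<^sup>2 \<le> m / (1 + (m * t)\<^sup>2)"
      using m by (intro divide_left_mono mult_pos_pos zero_less_power) auto
    then have "13 * pi ^ 3 * (m / (1 + (m * t)\<^sup>2)\<^sup>2) \<le> M t" unfolding M_def by (intro mult_left_mono) auto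
    with up[of t] show ?thesis by linarith
  qed
  have Mdecr: "M y \<le> M x" if "\<bar>x\<bar> \<le> \<bar>y\<bar>" for x y
  proof -
    have "x\<^sup>2 \<le> y\<^sup>2" using that by (simp add: abs_le_square_iff)
    then have "(m * x)\<^sup>2 \<le> (m * y)\<^sup>2" by (simp add: power_mult_distrib mult_left_mono)
    then show ?thesis unfolding M_def using m q1 by (intro mult_left_mono divide_left_mono) (auto intro!: mult_pos_pos add_pos_nonneg)
  qed
  have [measurable]: "M \<in> borel_measurable borel" unfolding M_def[abs_def] by measurable
  have Mint: "(\<integral>\<^sup>+t. ennreal (M t) \<partial>lborel) \<le> ennreal c"
  proof -
    have "ennreal (M t) = ennreal (13 * pi ^ 3) * ennreal (m / (1 + (m * t)\<^sup>2))" for t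
      unfolding M_def using m by (intro ennreal_mult) auto
    then have "(\<integral>\<^sup>+t. ennreal (M t) \<partial>lborel) = (\<integral>\<^sup>+t. ennreal (13 * pi ^ 3) * ennreal (m / (1 + (m * t)\<^sup>2)) \<partial>lborel)"
      by (simp only:)
    also have "\<dots> = ennreal (13 * pi ^ 3) * (\<integral>\<^sup>+t. ennreal (m / (1 + (m * t)\<^sup>2)) \<partial>lborel)"
      by (rule nn_integral_cmult) measurable
    also have "\<dots> \<le> ennreal (13 * pi ^ 3) * ennreal pi"
      using m by (intro mult_left_mono nn_integral_Cauchy_density) auto
    also have "\<dots> = ennreal c" by (simp add: c_def ennreal_mult[symmetric] power4_eq_xxxx power3_eq_cube)
    finally show ?thesis .
  qed
  have J2: "(\<integral>\<^sup>+t. ennreal (J t * t\<^sup>2) \<partial>lborel) \<le> ennreal (c / m\<^sup>2)"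
  proof -
    have "J t * t\<^sup>2 \<le> 1 / m\<^sup>2 * M t" for t
    proof -
      have pos: "0 < 1 + (m * t)\<^sup>2" by (intro add_pos_nonneg) auto
      have "J t * t\<^sup>2 \<le> 13 * pi ^ 3 * (m / (1 + (m * t)\<^sup>2)\<^sup>2) * t\<^sup>2" by (intro mult_right_mono up) auto
      \<comment> \<open>One of the two factors \<open>1 + (m * t)\<^sup>2\<close> absorbs
        \<open>t\<^sup>2\<close> at the price of \<open>1 / m\<^sup>2\<close>.\<close>
      also have "\<dots> = 1 / m\<^sup>2 * (13 * pi ^ 3 * (m / (1 + (m * t)\<^sup>2))) * ((m * t)\<^sup>2 / (1 + (m * t)\<^sup>2))"
        using m by (simp add: power_mult_distrib power2_eq_square[of "1 + _"])
      also have "\<dots> \<le> 1 / m\<^sup>2 * (13 * pi ^ 3 * (m / (1 + (m * t)\<^sup>2))) * 1"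
        using m pos by (intro mult_left_mono) auto
      finally show ?thesis by (simp add: M_def)
    qed
    then have "(\<integral>\<^sup>+t. ennreal (J t * t\<^sup>2) \<partial>lborel) \<le> (\<integral>\<^sup>+t. ennreal (1 / m\<^sup>2) * ennreal (M t) \<partial>lborel)"
      by (intro nn_integral_mono) (subst ennreal_mult'[symmetric], auto intro!: ennreal_leI)
    also have "\<dots> = ennreal (1 / m\<^sup>2) * (\<integral>\<^sup>+t. ennreal (M t) \<partial>lborel)" by (rule nn_integral_cmult) measurable
    also have "\<dots> \<le> ennreal (1 / m\<^sup>2) * ennreal c" by (intro mult_left_mono Mint) auto
    also have "\<dots> = ennreal (c / m\<^sup>2)" by (simp add: ennreal_mult[symmetric] c_def)
    finally show ?thesis .
  qed
  have Jtrig: "\<exists>T\<in>trig_polys (4 * r). \<forall>x. conv J f x = T x" if f: "per_L1 f" for f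
  proof -
    let ?L = "\<lambda>t. ?P t * indicator {-pi..<pi} t"
    \<comment> \<open>The closed interval that keeps \<open>J\<close> even and the half-open one
      that is a full period differ by a null set.\<close>
    have "conv J f x = 1 / Z * conv ?L f x" for x
    proof -
      have "conv J f x = (\<integral>t. 1 / Z * (?L t * f (x + t)) \<partial>lborel)"
        unfolding conv_def
      proof (rule integral_cong_AE)
        show "AE t in lborel. J t * f (x + t) = 1 / Z * (?L t * f (x + t))"
          using AE_lborel_singleton[of pi] by eventually_elim (auto simp: J_def K_def indicator_def)
      qed (use per_L1_borel[OF f] in measurable)
      then show ?thesis by (simp add: conv_def)
    qed
    moreover have "(\<lambda>x. 1 / Z * conv ?L f x) \<in> trig_polys (4 * r)"
      by (intro trig_polys_cmult conv_trig_poly_kernel dirichlet_power4_trig_polys f)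
    ultimately show ?thesis by (intro bexI[of _ "\<lambda>x. 1 / Z * conv ?L f x"]) auto
  qed
  show ?thesis
    by (rule exI[of _ J]) (use Jk J0 Jev J1 JM Mdecr Mint J2 Jtrig in \<open>auto intro!: exI[of _ M]\<close>)
qed

section \<open>Powers of averaging operators\<close>

text \<open>The kernel of the average to the power \<open>Suc i\<close>: the power 0 has no kernel,
  hence the shift by one. Values in \<open>ennreal\<close> avoid integrability questions.\<close>

primrec box_iter :: "real \<Rightarrow> nat \<Rightarrow> real \<Rightarrow> ennreal" where
  "box_iter h 0 u = ennreal (box_ker h u)"
| "box_iter h (Suc i) u = (\<integral>\<^sup>+s. ennreal (box_ker h s) * box_iter h i (u - s) \<partial>lborel)"

lemma box_iter_borel [measurable]: "box_iter h i \<in> borel_measurable borel"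
proof (induction i)
  case 0
  have "box_iter h 0 = (\<lambda>u. ennreal (box_ker h u))" by auto
  then show ?case by simp
next
  case (Suc i)
  note Suc[measurable]
  have "box_iter h (Suc i) = (\<lambda>u. \<integral>\<^sup>+s. ennreal (box_ker h s) * box_iter h i (u - s) \<partial>lborel)" by auto
  also have "\<dots> \<in> borel_measurable borel" by measurable
  finally show ?case .
qed

lemma box_ker_nonneg: "0 < h \<Longrightarrow> 0 \<le> box_ker h t"
  by (simp add: box_ker_def)

lemma box_ker_mass: assumes "0 < h" shows "(\<integral>\<^sup>+s. ennreal (box_ker h s) \<partial>lborel) = 1" "(\<integral>s. box_ker h s \<partial>lborel) = 1"
proof -
  have eq: "box_ker h s = 1 / h * indicator {-(h/2)..h/2} s" for s
    by (auto simp: box_ker_def indicator_def abs_le_iff)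
  have "(\<integral>\<^sup>+s. ennreal (box_ker h s) \<partial>lborel) = (\<integral>\<^sup>+s. ennreal (1 / h) * indicator {-(h/2)..h/2} s \<partial>lborel)"
    unfolding eq by (intro nn_integral_cong) (auto simp: indicator_def)
  also have "\<dots> = 1" using assms by (subst nn_integral_cmult) (auto simp: ennreal_mult[symmetric])
  finally show "(\<integral>\<^sup>+s. ennreal (box_ker h s) \<partial>lborel) = 1" .
  then show "(\<integral>s. box_ker h s \<partial>lborel) = 1"
    using assms by (subst integral_eq_nn_integral) (auto simp: box_ker_nonneg)
qed

lemma box_iter_mass: assumes h: "0 < h" shows "(\<integral>\<^sup>+u. box_iter h i u \<partial>lborel) = 1"
proof (induction i)
  case 0
  then show ?case using box_ker_mass[OF h] by simp
next
  case (Suc i)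
  have "(\<integral>\<^sup>+u. box_iter h (Suc i) u \<partial>lborel) = (\<integral>\<^sup>+s. \<integral>\<^sup>+u. ennreal (box_ker h s) * box_iter h i (u - s) \<partial>lborel \<partial>lborel)"
    unfolding box_iter.simps by (rule lborel_pair.Fubini') measurable
  also have "\<dots> = (\<integral>\<^sup>+s. ennreal (box_ker h s) * (\<integral>\<^sup>+u. box_iter h i (u + (- s)) \<partial>lborel) \<partial>lborel)"
    by (intro nn_integral_cong) (subst nn_integral_cmult, auto)
  also have "\<dots> = (\<integral>\<^sup>+s. ennreal (box_ker h s) * 1 \<partial>lborel)"
    by (subst nn_integral_shift) (auto simp: Suc)
  finally show ?case using box_ker_mass[OF h] by simp
qed

lemma box_iter_le: assumes h: "0 < h" shows "box_iter h i u \<le> ennreal (1 / h)"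
proof (induction i arbitrary: u)
  case (Suc i)
  have "box_iter h (Suc i) u \<le> (\<integral>\<^sup>+s. ennreal (box_ker h s) * ennreal (1 / h) \<partial>lborel)"
    unfolding box_iter.simps by (intro nn_integral_mono mult_left_mono Suc) auto
  also have "\<dots> = ennreal (1 / h)" by (subst nn_integral_multc) (auto simp: box_ker_mass[OF h])
  finally show ?case .
qed (use h in \<open>auto simp: box_ker_def\<close>)

text \<open>The part of the outer window that misses the inner one is moved by \<open>c\<close> into
  the part of the inner window that misses the outer one; no point increases its distance from
  0.\<close>

lemma interval_mass_decreasing:
  fixes K :: "real \<Rightarrow> ennreal"
  assumes [measurable]: "K \<in> borel_measurable borel" and K: "\<And>x y. \<bar>x\<bar> \<le> \<bar>y\<bar> \<Longrightarrow> K y \<le> K x" and h: "0 < h" and xy: "0 \<le> x" "x \<le> y"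
  shows "(\<integral>\<^sup>+v\<in>{y-h/2..<y+h/2}. K v \<partial>lborel) \<le> (\<integral>\<^sup>+v\<in>{x-h/2..<x+h/2}. K v \<partial>lborel)"
proof -
  let ?I = "\<lambda>u. {u-h/2..<u+h/2}"
  \<comment> \<open>For overlapping windows the two differences are translates of each other by
    \<open>h\<close>; otherwise the windows themselves are translates by
    \<open>y - x\<close>.\<close>
  define c where "c = max h (y - x)"
  have "(\<integral>\<^sup>+v\<in>?I y - ?I x. K v \<partial>lborel) = (\<integral>\<^sup>+v. K (v + c) * indicator (?I y - ?I x) (v + c) \<partial>lborel)"
    by (rule nn_integral_shift[symmetric, of "\<lambda>v. K v * indicator (?I y - ?I x) v"]) measurable
  also have "\<dots> \<le> (\<integral>\<^sup>+v\<in>?I x - ?I y. K v \<partial>lborel)"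
  proof (rule nn_integral_mono)
    fix v
    show "K (v + c) * indicator (?I y - ?I x) (v + c) \<le> K v * indicator (?I x - ?I y) v"
    proof (cases "v + c \<in> ?I y - ?I x")
      case True
      have yv: "y - h / 2 \<le> v + c" "v + c < y + h / 2" using True by auto
      then have xv: "x + h / 2 \<le> v + c" using True xy by auto
      have v: "x - h / 2 \<le> v \<and> v < x + h / 2 \<and> v < y - h / 2 \<and> 0 \<le> c \<and> - (v + c) \<le> v"
      proof (cases "y - x < h")
        case True
        then have "c = h" by (simp add: c_def)
        then show ?thesis using True yv xv xy h by linarith
      next
        case False
        then have "c = y - x" by (simp add: c_def)
        then show ?thesis using False yv xv xy h by linarith
      qed
      then have "\<bar>v\<bar> \<le> v + c" by (simp add: abs_le_iff)
      then have "\<bar>v\<bar> \<le> \<bar>v + c\<bar>" by (rule order.trans) simp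
      moreover have "v \<in> ?I x - ?I y" using v by auto
      ultimately have "indicator (?I x - ?I y) v = (1::ennreal)" "K (v + c) \<le> K v" by (auto intro: K)
      moreover have "indicator (?I y - ?I x) (v + c) = (1::ennreal)" using True by simp
      ultimately show ?thesis by (simp only: mult_1_right)
    qed simp
  qed
  finally have le: "(\<integral>\<^sup>+v\<in>?I y - ?I x. K v \<partial>lborel) \<le> (\<integral>\<^sup>+v\<in>?I x - ?I y. K v \<partial>lborel)" .
  have "(\<integral>\<^sup>+v\<in>?I y. K v \<partial>lborel) = (\<integral>\<^sup>+v\<in>?I y \<inter> ?I x. K v \<partial>lborel) + (\<integral>\<^sup>+v\<in>?I y - ?I x. K v \<partial>lborel)"
    by (subst nn_integral_add[symmetric]) (auto intro!: nn_integral_cong simp: indicator_def)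
  also have "\<dots> \<le> (\<integral>\<^sup>+v\<in>?I y \<inter> ?I x. K v \<partial>lborel) + (\<integral>\<^sup>+v\<in>?I x - ?I y. K v \<partial>lborel)"
    by (rule add_left_mono[OF le])
  also have "\<dots> = (\<integral>\<^sup>+v\<in>?I x. K v \<partial>lborel)"
    by (subst nn_integral_add[symmetric]) (auto intro!: nn_integral_cong simp: indicator_def)
  finally show ?thesis .
qed

text \<open>Convolution with a box keeps a kernel even and decreasing away from 0, by
  \<open>interval_mass_decreasing\<close>. This allows every power of the average to be bounded
  through its kernel.\<close>

lemma box_iter_decr:
  assumes h: "0 < h" shows "\<bar>x\<bar> \<le> \<bar>y\<bar> \<Longrightarrow> box_iter h i y \<le> box_iter h i x"
proof (induction i arbitrary: x y)
  case 0
  then show ?case using h by (auto simp: box_ker_def)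
next
  case (Suc i)
  let ?K = "box_iter h i"
  \<comment> \<open>The induction hypothesis in both directions: points of equal modulus get equal
    values.\<close>
  have even: "?K (- v) = ?K v" for v by (rule antisym; rule Suc.IH) auto
  have eq: "box_iter h (Suc i) u = ennreal (1 / h) * (\<integral>\<^sup>+v\<in>{u-h/2..<u+h/2}. ?K v \<partial>lborel)" for u
  proof -
    have "box_iter h (Suc i) u = (\<integral>\<^sup>+s. ennreal (box_ker h (- s)) * ?K (u - (- s)) \<partial>lborel)"
      unfolding box_iter.simps by (rule nn_integral_reflect[symmetric]) measurable
    also have "\<dots> = (\<integral>\<^sup>+s. ennreal (1 / h) * (?K (s + u) * indicator {u-h/2..<u+h/2} (s + u)) \<partial>lborel)"
    proof (rule nn_integral_cong_AE)
      show "AE s in lborel. ennreal (box_ker h (- s)) * ?K (u - (- s)) = ennreal (1 / h) * (?K (s + u) * indicator {u-h/2..<u+h/2} (s + u))"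
        using AE_lborel_singleton[of "h/2"]
        by eventually_elim (auto simp: box_ker_def indicator_def add.commute abs_le_iff)
    qed
    also have "\<dots> = (\<integral>\<^sup>+v. ennreal (1 / h) * (?K v * indicator {u-h/2..<u+h/2} v) \<partial>lborel)"
      by (rule nn_integral_shift[of "\<lambda>v. ennreal (1 / h) * (?K v * indicator {u-h/2..<u+h/2} v)"]) measurable
    also have "\<dots> = ennreal (1 / h) * (\<integral>\<^sup>+v\<in>{u-h/2..<u+h/2}. ?K v \<partial>lborel)" by (rule nn_integral_cmult) measurable
    finally show ?thesis .
  qed
  have ev: "box_iter h (Suc i) (- u) = box_iter h (Suc i) u" for u
  proof -
    have "box_iter h (Suc i) (- u) = (\<integral>\<^sup>+s. ennreal (box_ker h (- s)) * ?K (- u - (- s)) \<partial>lborel)"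
      unfolding box_iter.simps by (rule nn_integral_reflect[symmetric]) measurable
    also have "\<dots> = (\<integral>\<^sup>+s. ennreal (box_ker h s) * ?K (- (u - s)) \<partial>lborel)"
      by (intro nn_integral_cong) (auto simp: box_ker_def)
    finally show ?thesis unfolding even by simp
  qed
  have evabs: "box_iter h (Suc i) u = box_iter h (Suc i) \<bar>u\<bar>" for u
    using ev[of u] by (cases "0 \<le> u") auto
  show ?case
    unfolding evabs[of x] evabs[of y] unfolding eq
    by (intro mult_left_mono interval_mass_decreasing h Suc.IH Suc.prems) auto
qed

lemma box_funpow_le:
  assumes h: "0 < h" and f: "per_L1 f"
  shows "ennreal \<bar>(conv (box_ker h) ^^ Suc i) f x\<bar> \<le> (\<integral>\<^sup>+t. box_iter h i t * ennreal \<bar>f (x + t)\<bar> \<partial>lborel)"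
proof (induction i arbitrary: x)
  case 0
  show ?case using abs_conv_le[OF kernel_box_ker[OF h] f, of x] by (simp add: box_ker_nonneg[OF h])
next
  case (Suc i)
  have [measurable]: "f \<in> borel_measurable borel" using f by (rule per_L1_borel)
  let ?b = "box_ker h"
  have "ennreal \<bar>(conv ?b ^^ Suc (Suc i)) f x\<bar> \<le> (\<integral>\<^sup>+s. ennreal \<bar>?b s\<bar> * ennreal \<bar>(conv ?b ^^ Suc i) f (x + s)\<bar> \<partial>lborel)"
    using abs_conv_le[OF kernel_box_ker[OF h] per_L1_conv_funpow[OF kernel_box_ker[OF h] f, of "Suc i"], of x] by simp
  also have "\<dots> \<le> (\<integral>\<^sup>+s. ennreal (?b s) * (\<integral>\<^sup>+t. box_iter h i t * ennreal \<bar>f ((x + s) + t)\<bar> \<partial>lborel) \<partial>lborel)"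
    using Suc box_ker_nonneg[OF h] by (intro nn_integral_mono mult_mono) auto
  also have "\<dots> = (\<integral>\<^sup>+s. \<integral>\<^sup>+u. ennreal (?b s) * (box_iter h i (u - s) * ennreal \<bar>f (x + u)\<bar>) \<partial>lborel \<partial>lborel)"
  proof (intro nn_integral_cong)
    fix s
    have "(\<integral>\<^sup>+t. box_iter h i t * ennreal \<bar>f ((x + s) + t)\<bar> \<partial>lborel) = (\<integral>\<^sup>+t. box_iter h i ((t + s) - s) * ennreal \<bar>f (x + (t + s))\<bar> \<partial>lborel)"
      by (simp add: add_ac)
    also have "\<dots> = (\<integral>\<^sup>+u. box_iter h i (u - s) * ennreal \<bar>f (x + u)\<bar> \<partial>lborel)"
      by (rule nn_integral_shift[of "\<lambda>u. box_iter h i (u - s) * ennreal \<bar>f (x + u)\<bar>"]) measurable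
    finally show "ennreal (?b s) * (\<integral>\<^sup>+t. box_iter h i t * ennreal \<bar>f ((x + s) + t)\<bar> \<partial>lborel)
      = (\<integral>\<^sup>+u. ennreal (?b s) * (box_iter h i (u - s) * ennreal \<bar>f (x + u)\<bar>) \<partial>lborel)"
      by (simp add: nn_integral_cmult)
  qed
  also have "\<dots> = (\<integral>\<^sup>+u. \<integral>\<^sup>+s. ennreal (?b s) * (box_iter h i (u - s) * ennreal \<bar>f (x + u)\<bar>) \<partial>lborel \<partial>lborel)"
    by (rule lborel_pair.Fubini') measurable
  also have "\<dots> = (\<integral>\<^sup>+u. box_iter h (Suc i) u * ennreal \<bar>f (x + u)\<bar> \<partial>lborel)"
    unfolding box_iter.simps by (intro nn_integral_cong) (simp add: mult.assoc[symmetric] nn_integral_multc)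
  finally show ?case .
qed

context box_bounded
begin

text \<open>\<open>D\<close> enters once for every power, since all iterated kernels have mass 1 and
  decrease away from 0. The summand 1 covers the power 0.\<close>

lemma rnrm_box_funpow:
  assumes h: "0 < h" and f: "per_L1 f"
  shows "rnrm ((conv (box_ker h) ^^ i) f) \<le> ennreal (1 + D) * rnrm f"
proof (cases i)
  case 0
  have "1 * rnrm f \<le> ennreal (1 + D) * rnrm f"
    using D_pos ennreal_leI[of 1 "1 + D"] by (intro mult_right_mono) (auto simp del: ennreal_plus)
  then show ?thesis using 0 by simp
next
  case (Suc j)
  have [measurable]: "f \<in> borel_measurable borel" using f by (rule per_L1_borel)
  have "rnrm ((conv (box_ker h) ^^ Suc j) f) \<le> nrm (\<lambda>x. \<integral>\<^sup>+t. box_iter h j t * ennreal \<bar>f (x + t)\<bar> \<partial>lborel)"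
    by (intro wnorm_mono box_funpow_le h f)
  also have "\<dots> \<le> ennreal D * (\<integral>\<^sup>+t. box_iter h j t \<partial>lborel) * rnrm f"
  proof (rule nrm_decreasing_kernel)
    show "box_iter h j t < \<infinity>" for t by (rule order.strict_trans1[OF box_iter_le[OF h]]) simp
  qed (use f h in \<open>auto simp: per_L1_def per_def box_iter_mass intro: box_iter_decr\<close>)
  also have "\<dots> \<le> ennreal (1 + D) * rnrm f"
    unfolding box_iter_mass[OF h] using D_pos by (auto intro!: mult_right_mono ennreal_leI simp del: ennreal_plus)
  finally show ?thesis using Suc by simp
qed

lemma rnrm_conv_box: "0 < h \<Longrightarrow> per_L1 f \<Longrightarrow> rnrm (conv (box_ker h) f) \<le> ennreal (1 + D) * rnrm f"
  using rnrm_box_funpow[of h f 1] by simp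

end

section \<open>Iterated differences and approximation by trigonometric polynomials\<close>

definition conv_diff_op :: "(real \<Rightarrow> real) \<Rightarrow> (real \<Rightarrow> real) \<Rightarrow> real \<Rightarrow> real" where
  "conv_diff_op K f x = f x - conv K f x"

lemma per_L1_conv_diff_op: "kernel K \<Longrightarrow> per_L1 f \<Longrightarrow> per_L1 (conv_diff_op K f)"
  unfolding conv_diff_op_def[abs_def] by (intro per_L1_diff per_L1_conv)

lemma conv_diff_op_commute:
  "kernel K \<Longrightarrow> kernel L \<Longrightarrow> per_L1 f \<Longrightarrow> conv_diff_op K (conv_diff_op L f) = conv_diff_op L (conv_diff_op K f)"
  unfolding conv_diff_op_def[abs_def] by (simp add: conv_diff per_L1_conv conv_commute[of K L] algebra_simps)

lemma per_L1_conv_diff_op_funpow: "kernel K \<Longrightarrow> per_L1 f \<Longrightarrow> per_L1 ((conv_diff_op K ^^ r) f)"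
  by (induction r) (auto intro: per_L1_conv_diff_op)

lemma conv_diff_op_funpow_commute:
  "kernel K \<Longrightarrow> kernel L \<Longrightarrow> per_L1 f \<Longrightarrow> conv_diff_op L ((conv_diff_op K ^^ r) f) = (conv_diff_op K ^^ r) (conv_diff_op L f)"
  by (induction r) (auto simp: conv_diff_op_commute[of L K] per_L1_conv_diff_op_funpow)

text \<open>Each application of I - V subtracts one more value of V, and these values are
  trigonometric polynomials of degree at most \<open>n\<close>.\<close>

lemma conv_diff_op_funpow_trig:
  assumes J: "kernel J" and f: "per_L1 f" and V: "\<And>g. per_L1 g \<Longrightarrow> \<exists>T\<in>trig_polys n. \<forall>x. conv J g x = T x"
  shows "\<exists>T\<in>trig_polys n. \<forall>x. (conv_diff_op J ^^ r) f x = f x - T x"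
proof (induction r)
  case 0
  have "(\<lambda>x. 0 * cos (real 0 * x)) \<in> trig_polys n" by (intro trig_polys_cmult cos_trig_polys) simp
  then show ?case by (intro bexI[of _ "\<lambda>x. 0"]) auto
next
  case (Suc r)
  then obtain T where T: "T \<in> trig_polys n" "\<And>x. (conv_diff_op J ^^ r) f x = f x - T x" by blast
  obtain T' where T': "T' \<in> trig_polys n" "\<And>x. conv J ((conv_diff_op J ^^ r) f) x = T' x"
    using V[OF per_L1_conv_diff_op_funpow[OF J f, of r]] by blast
  have "(\<lambda>x. T x + T' x) \<in> trig_polys n" by (rule trig_polys_add[OF T(1) T'(1)])
  moreover have "(conv_diff_op J ^^ Suc r) f x = f x - (T x + T' x)" for x
    using T(2)[of x] T'(2)[of x] by (simp add: conv_diff_op_def)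
  ultimately show ?case by (intro bexI[of _ "\<lambda>x. T x + T' x"] allI)
qed

context box_bounded
begin

text \<open>\<open>smoothing_le_box_difference\<close> exchanges one factor I - V for I - A at the
  cost of a constant times \<open>(n / j)\<^sup>2\<close>. As the factors commute, \<open>r\<close>
  exchanges lead from one \<open>r\<close>-th power to the other; each of them requires a finite
  norm, which is therefore carried along.\<close>

lemma ex_trig_poly_approx:
  "\<exists>C>0. \<forall>f n j r. per_L1 f \<longrightarrow> rnrm f < \<infinity> \<longrightarrow> 1 \<le> j \<longrightarrow> j \<le> n \<longrightarrow>
    (\<exists>T\<in>trig_polys j. rnrm (\<lambda>x. f x - T x)
      \<le> ennreal ((C * (real n / real j)\<^sup>2) ^ r) * rnrm ((conv_diff_op (box_ker (1 / real n)) ^^ r) f))"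
proof -
  define c where "c = 13 * pi ^ 4"
  have c: "0 < c" by (simp add: c_def)
  \<comment> \<open>The 72 is \<open>4 * 2 * 9\<close>: from \<open>4 / h\<^sup>2\<close> with
    \<open>h = 1 / n\<close>, from twice the second moment, and from
    \<open>1 / m\<^sup>2 \<le> 9 / j\<^sup>2\<close>.\<close>
  define C where "C = (1 + D * c + 72 * D * c) * (1 + 64 * D)"
  have C: "0 < C" unfolding C_def using D_pos c by (intro mult_pos_pos add_pos_nonneg) auto
  have "\<exists>T\<in>trig_polys j. rnrm (\<lambda>x. f x - T x)
      \<le> ennreal ((C * (real n / real j)\<^sup>2) ^ r) * rnrm ((conv_diff_op (box_ker (1 / real n)) ^^ r) f)"
    if f: "per_L1 f" "rnrm f < \<infinity>" and j: "1 \<le> j" "j \<le> n" for f :: "real \<Rightarrow> real" and n j r :: nat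
  proof -
    \<comment> \<open>The fourth power of a Dirichlet kernel of degree \<open>r'\<close> has degree
      at most \<open>4 * r'\<close>. For \<open>j < 4\<close> the kernel is constant on a period,
      which is still admissible.\<close>
    define r' where "r' = j div 4"
    define m where "m = real (2 * r' + 1)"
    have m: "real j \<le> 3 * m" and m1: "1 \<le> m"
    proof -
      have "j \<le> 3 * (2 * r' + 1)" unfolding r'_def by presburger
      then have "real j \<le> real (3 * (2 * r' + 1))" by (simp only: of_nat_le_iff)
      then show "real j \<le> 3 * m" by (simp add: m_def)
    qed (simp add: m_def)
    obtain J M where J: "kernel J" "\<And>t. 0 \<le> J t" "\<And>t. J (- t) = J t" "(\<integral>t. J t \<partial>lborel) = 1"
      and M: "M \<in> borel_measurable borel" "\<And>x y. \<bar>x\<bar> \<le> \<bar>y\<bar> \<Longrightarrow> M y \<le> M x" "\<And>t. J t \<le> M t" "(\<integral>\<^sup>+t. ennreal (M t) \<partial>lborel) \<le> ennreal c"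
      and J2: "(\<integral>\<^sup>+t. ennreal (J t * t\<^sup>2) \<partial>lborel) \<le> ennreal (c / m\<^sup>2)"
      and V: "\<And>f. per_L1 f \<Longrightarrow> \<exists>T\<in>trig_polys (4 * r'). \<forall>x. conv J f x = T x"
      using jackson_kernel[of r'] unfolding c_def m_def by blast
    define h where "h = 1 / real n"
    have h: "0 < h" using j by (simp add: h_def)
    note kb = kernel_box_ker[OF h]
    define B where "B = C * (real n / real j)\<^sup>2"
    have nj: "1 \<le> (real n / real j)\<^sup>2" using j by (simp add: one_le_power)
    have B: "0 \<le> B" using C by (simp add: B_def)
    have le: "(1 + D * c + 4 / h\<^sup>2 * (D * (2 * (c / m\<^sup>2)))) * (1 + 64 * D) \<le> B"
    proof -
      have "1 / m\<^sup>2 \<le> 9 / (real j)\<^sup>2"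
      proof -
        have "(real j)\<^sup>2 \<le> (3 * m)\<^sup>2" using m j by (intro power_mono) auto
        then have "(real j)\<^sup>2 \<le> 9 * m\<^sup>2" by (simp add: power_mult_distrib)
        then show ?thesis using j m1 by (simp add: field_simps)
      qed
      then have "8 * D * c * (real n)\<^sup>2 * (1 / m\<^sup>2) \<le> 8 * D * c * (real n)\<^sup>2 * (9 / (real j)\<^sup>2)"
        using D_pos c by (intro mult_left_mono) auto
      then have "4 / h\<^sup>2 * (D * (2 * (c / m\<^sup>2))) \<le> 72 * D * c * (real n / real j)\<^sup>2"
        by (simp add: h_def power_divide mult_ac)
      moreover have "1 + D * c \<le> (1 + D * c) * (real n / real j)\<^sup>2"
        using nj D_pos c mult_left_mono[OF nj, of "1 + D * c"] by simp
      ultimately have "1 + D * c + 4 / h\<^sup>2 * (D * (2 * (c / m\<^sup>2))) \<le> (1 + D * c + 72 * D * c) * (real n / real j)\<^sup>2"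
        by (simp add: distrib_right)
      then have "(1 + D * c + 4 / h\<^sup>2 * (D * (2 * (c / m\<^sup>2)))) * (1 + 64 * D) \<le> ((1 + D * c + 72 * D * c) * (real n / real j)\<^sup>2) * (1 + 64 * D)"
        using D_pos by (intro mult_right_mono) auto
      then show ?thesis by (simp add: B_def C_def mult_ac)
    qed
    have one: "rnrm (conv_diff_op J F) \<le> ennreal B * rnrm (conv_diff_op (box_ker h) F)" if F: "per_L1 F" "rnrm F < \<infinity>" for F
    proof -
      have "rnrm (conv_diff_op J F) \<le> ennreal ((1 + D * c + 4 / h\<^sup>2 * (D * (2 * (c / m\<^sup>2)))) * (1 + 64 * D)) * rnrm (conv_diff_op (box_ker h) F)"
        unfolding conv_diff_op_def
        by (rule smoothing_le_box_difference[OF J M(1,2,3,4) _ J2 _ h F]) (use c in auto)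
      also have "\<dots> \<le> ennreal B * rnrm (conv_diff_op (box_ker h) F)" by (intro mult_right_mono ennreal_leI le) auto
      finally show ?thesis .
    qed
    have finb: "rnrm (conv_diff_op (box_ker h) F) < \<infinity>" if F: "per_L1 F" "rnrm F < \<infinity>" for F
    proof -
      have "rnrm (conv_diff_op (box_ker h) F) \<le> rnrm F + rnrm (conv (box_ker h) F)"
        unfolding conv_diff_op_def using per_L1_borel[OF F(1)] by (intro rnrm_diff) auto
      also have "\<dots> \<le> rnrm F + ennreal (1 + D) * rnrm F" by (intro add_left_mono rnrm_conv_box h F)
      also have "\<dots> < \<infinity>" using F(2) by (simp add: ennreal_mult_less_top del: ennreal_plus)
      finally show ?thesis .
    qed
    have iter: "rnrm ((conv_diff_op J ^^ r) F) \<le> ennreal (B ^ r) * rnrm ((conv_diff_op (box_ker h) ^^ r) F)" if F: "per_L1 F" "rnrm F < \<infinity>" for F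
      using F
    proof (induction r arbitrary: F)
      case (Suc r)
      have fin: "rnrm ((conv_diff_op J ^^ r) F) < \<infinity>"
        using Suc.prems
      proof (induction r)
        case (Suc r)
        have "rnrm ((conv_diff_op J ^^ Suc r) F) \<le> ennreal B * rnrm (conv_diff_op (box_ker h) ((conv_diff_op J ^^ r) F))"
          using one[OF per_L1_conv_diff_op_funpow[OF J(1) Suc.prems(1)] Suc.IH[OF Suc.prems]] by simp
        also have "\<dots> < \<infinity>"
          using finb[OF per_L1_conv_diff_op_funpow[OF J(1) Suc.prems(1)] Suc.IH[OF Suc.prems]] by (simp add: ennreal_mult_less_top)
        finally show ?case .
      qed auto
      have "rnrm ((conv_diff_op J ^^ Suc r) F) \<le> ennreal B * rnrm (conv_diff_op (box_ker h) ((conv_diff_op J ^^ r) F))"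
        using one[OF per_L1_conv_diff_op_funpow[OF J(1) Suc.prems(1)] fin] by simp
      also have "conv_diff_op (box_ker h) ((conv_diff_op J ^^ r) F) = (conv_diff_op J ^^ r) (conv_diff_op (box_ker h) F)"
        by (rule conv_diff_op_funpow_commute[OF J(1) kb Suc.prems(1)])
      also have "ennreal B * rnrm ((conv_diff_op J ^^ r) (conv_diff_op (box_ker h) F))
        \<le> ennreal B * (ennreal (B ^ r) * rnrm ((conv_diff_op (box_ker h) ^^ r) (conv_diff_op (box_ker h) F)))"
        using Suc.prems kb finb by (intro mult_left_mono Suc.IH per_L1_conv_diff_op) auto
      also have "\<dots> = ennreal (B ^ Suc r) * rnrm ((conv_diff_op (box_ker h) ^^ Suc r) F)"
        using B by (simp add: funpow_Suc_right ennreal_mult mult.assoc del: funpow.simps)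
      finally show ?case .
    qed simp
    obtain T where T: "T \<in> trig_polys (4 * r')" "\<And>x. (conv_diff_op J ^^ r) f x = f x - T x"
      using conv_diff_op_funpow_trig[OF J(1) f(1) V] by blast
    have "T \<in> trig_polys j" using T(1) trig_polys_mono[of "4 * r'" j] by (auto simp: r'_def)
    moreover have "rnrm (\<lambda>x. f x - T x) \<le> ennreal (B ^ r) * rnrm ((conv_diff_op (box_ker h) ^^ r) f)"
      using iter[OF f] by (simp add: T(2))
    ultimately show ?thesis unfolding B_def h_def by blast
  qed
  with C show ?thesis by blast
qed

end

section \<open>Fractional differences\<close>

text \<open>The power series coefficients of (1 - x)^a. With \<open>gchoose\<close>, a polynomial in
  \<open>a\<close>, no poles of the Gamma function have to be considered;
  \<open>diff_coeff_gen_binom\<close> makes the link.\<close>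

definition diff_coeff :: "real \<Rightarrow> nat \<Rightarrow> real" where
  "diff_coeff a i = (-1) ^ i * (a gchoose i)"

lemma diff_coeff_0 [simp]: "diff_coeff a 0 = 1"
  by (simp add: diff_coeff_def)

lemma diff_coeff_gen_binom:
  assumes "0 < k" shows "(-1) ^ j * gen_binom k j = diff_coeff k j"
proof -
  have "k + 1 \<notin> \<int>\<^sub>\<le>\<^sub>0" using assms by (auto simp: nonpos_Ints_def)
  then have "(k gchoose j) = Gamma (k + 1) / (fact j * Gamma (k - real j + 1))" by (rule gbinomial_Gamma)
  moreover have "Gamma (real j + 1) = fact j" by (simp add: Gamma_fact add.commute)
  ultimately show ?thesis
    by (simp add: diff_coeff_def gen_binom_def rGamma_inverse_Gamma divide_inverse)
qed

lemma diff_coeff_Suc: "diff_coeff a (Suc i) = diff_coeff a i * ((real i - a) / real (Suc i))"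
proof -
  have "real (Suc i) * (a gchoose Suc i) = (a - real i) * (a gchoose i)"
    using gbinomial_mult_1[of a i] by (simp add: algebra_simps)
  then have "(a gchoose Suc i) = (a - real i) * (a gchoose i) / real (Suc i)"
    by (simp add: field_simps del: of_nat_Suc)
  then show ?thesis
    unfolding diff_coeff_def by (simp only: power_Suc) (simp add: field_simps del: of_nat_Suc)
qed

text \<open>Dividing (1 - x)^a by 1 - x sums the coefficients.\<close>

lemma sum_diff_coeff: "(\<Sum>i\<le>m. diff_coeff a i) = diff_coeff (a - 1) m"
  using gbinomial_sum_lower_neg[of a m] by (simp add: diff_coeff_def mult.commute)

text \<open>From the index \<open>a\<close> on the coefficients no longer change sign, so sums of
  moduli are moduli of sums. By \<open>sum_diff_coeff\<close> the partial sums are coefficients for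
  \<open>a - 1\<close>, which do not grow in modulus from there on because consecutive ratios are at
  most 1.\<close>

lemma summable_diff_coeff:
  assumes a: "0 \<le> a" shows "summable (\<lambda>i. \<bar>diff_coeff a i\<bar>)"
proof -
  obtain N :: nat where N: "a \<le> real N" using real_arch_simple by blast
  have bnd: "\<bar>diff_coeff (a - 1) (N + m)\<bar> \<le> \<bar>diff_coeff (a - 1) N\<bar>" for m
  proof (induction m)
    case (Suc m)
    have q: "\<bar>(real (N + m) - (a - 1)) / real (Suc (N + m))\<bar> \<le> 1" using N a by (simp add: field_simps)
    have "\<bar>diff_coeff (a - 1) (N + Suc m)\<bar> = \<bar>diff_coeff (a - 1) (N + m)\<bar> * \<bar>(real (N + m) - (a - 1)) / real (Suc (N + m))\<bar>"
      by (simp only: add_Suc_right diff_coeff_Suc abs_mult)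
    also have "\<dots> \<le> \<bar>diff_coeff (a - 1) (N + m)\<bar> * 1" by (intro mult_left_mono q) auto
    finally show ?case using Suc by simp
  qed simp
  have sign: "diff_coeff a (N + i) * diff_coeff a N \<ge> 0 \<and> (diff_coeff a N = 0 \<longrightarrow> diff_coeff a (N + i) = 0)" for i
  proof (induction i)
    case (Suc i)
    have "0 \<le> (real (N + i) - a) / real (Suc (N + i))" using N by simp
    then have "0 \<le> (diff_coeff a (N + i) * diff_coeff a N) * ((real (N + i) - a) / real (Suc (N + i)))"
      by (rule mult_nonneg_nonneg[OF conjunct1[OF Suc]])
    then show ?case using Suc by (simp only: add_Suc_right diff_coeff_Suc mult_ac) simp
  qed simp
  have absum: "(\<Sum>i<m. \<bar>diff_coeff a (N + i)\<bar>) = \<bar>\<Sum>i<m. diff_coeff a (N + i)\<bar>" for m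
  proof (cases "0 \<le> diff_coeff a N")
    case True
    have "0 \<le> diff_coeff a (N + i)" for i using sign[of i] True by (cases "diff_coeff a N = 0") (auto simp: zero_le_mult_iff)
    then show ?thesis by (simp add: sum_nonneg)
  next
    case False
    then have "diff_coeff a (N + i) \<le> 0" for i using sign[of i] by (auto simp: zero_le_mult_iff)
    then show ?thesis by (simp add: sum_nonpos sum_negf[symmetric])
  qed
  have "summable (\<lambda>i. \<bar>diff_coeff a (N + i)\<bar>)"
  proof (rule summableI_nonneg_bounded)
    fix m
    have "(\<Sum>i<N + m. diff_coeff a i) = (\<Sum>i<N. diff_coeff a i) + (\<Sum>i<m. diff_coeff a (N + i))"
      by (induction m) (auto simp: add.assoc)
    then have "\<bar>\<Sum>i<m. diff_coeff a (N + i)\<bar> \<le> \<bar>\<Sum>i<N. diff_coeff a i\<bar> + \<bar>\<Sum>i<N + m. diff_coeff a i\<bar>" by linarith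
    also have "\<bar>\<Sum>i<N + m. diff_coeff a i\<bar> \<le> \<bar>\<Sum>i<N. diff_coeff a i\<bar> + \<bar>diff_coeff (a - 1) N\<bar>"
    proof (cases m)
      case (Suc m')
      then have "(\<Sum>i<N + m. diff_coeff a i) = diff_coeff (a - 1) (N + m')"
        using sum_diff_coeff[of a "N + m'"] by (simp add: lessThan_Suc_atMost)
      then show ?thesis using bnd[of m'] by simp
    qed simp
    finally show "(\<Sum>i<m. \<bar>diff_coeff a (N + i)\<bar>) \<le> \<bar>\<Sum>i<N. diff_coeff a i\<bar> + (\<bar>\<Sum>i<N. diff_coeff a i\<bar> + \<bar>diff_coeff (a - 1) N\<bar>)"
      unfolding absum by simp
  qed simp
  then show ?thesis using summable_iff_shift[of "\<lambda>i. \<bar>diff_coeff a i\<bar>" N] by (simp add: add.commute)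
qed

lemma diff_coeff_convolution: "(\<Sum>l\<le>n. diff_coeff b l * diff_coeff a (n - l)) = diff_coeff (a + b) n"
proof -
  have "(\<Sum>l\<le>n. diff_coeff b l * diff_coeff a (n - l)) = (\<Sum>l\<le>n. (-1) ^ n * ((b gchoose l) * (a gchoose (n - l))))"
  proof (intro sum.cong refl)
    fix l assume "l \<in> {..n}"
    then have "(-1::real) ^ l * (-1) ^ (n - l) = (-1) ^ n" by (simp flip: power_add)
    then show "diff_coeff b l * diff_coeff a (n - l) = (-1) ^ n * ((b gchoose l) * (a gchoose (n - l)))"
      unfolding diff_coeff_def by (metis mult.assoc mult.left_commute)
  qed
  also have "\<dots> = (-1) ^ n * (\<Sum>l\<in>{0..n}. (b gchoose l) * (a gchoose (n - l)))" by (simp add: sum_distrib_left atLeast0AtMost)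
  finally show ?thesis by (simp add: gbinomial_Vandermonde diff_coeff_def add.commute)
qed

text \<open>Absolute summability over all pairs permits summation along the diagonals
  \<open>l + i = n\<close>. With \<open>\<alpha> n\<close> the value at a point of the
  \<open>n\<close>-th power of the average applied to \<open>f\<close>, this gives the semigroup law
  of fractional differences.\<close>

lemma suminf_twisted_Cauchy_product:
  fixes p q \<alpha> :: "nat \<Rightarrow> real"
  assumes p: "summable (\<lambda>i. \<bar>p i\<bar>)" and q: "summable (\<lambda>i. \<bar>q i\<bar>)" and \<alpha>: "\<And>n. \<bar>\<alpha> n\<bar> \<le> M"
  shows "(\<Sum>l. q l * (\<Sum>i. p i * \<alpha> (l + i))) = (\<Sum>n. (\<Sum>l\<le>n. q l * p (n - l)) * \<alpha> n)"
proof -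
  define s where "s = (\<lambda>(l, i). q l * (p i * \<alpha> (l + i)))"
  have M: "0 \<le> M" using \<alpha>[of 0] by simp
  have p': "(\<lambda>i. \<bar>p i\<bar>) summable_on UNIV" and q': "(\<lambda>i. \<bar>q i\<bar>) summable_on UNIV"
    using norm_summable_imp_summable_on[of "\<lambda>i. \<bar>p i\<bar>"] norm_summable_imp_summable_on[of "\<lambda>i. \<bar>q i\<bar>"] p q by simp_all
  have prod: "(\<lambda>z. norm ((\<lambda>(l, i). q l * p i) z)) summable_on (UNIV \<times> UNIV)"
    unfolding Infinite_Sum.abs_summable_on_Sigma_iff
    using p' q' by (auto simp: abs_mult infsum_cmult_right' infsum_nonneg intro!: summable_on_cmult_right summable_on_cmult_left)
  have "(\<lambda>z. norm (s z)) summable_on UNIV \<times> UNIV"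
  proof (rule summable_on_comparison_test)
    show "(\<lambda>z. M * norm ((\<lambda>(l, i). q l * p i) z)) summable_on (UNIV \<times> UNIV)" by (rule summable_on_cmult_right[OF prod])
    show "norm (s z) \<le> M * norm ((\<lambda>(l, i). q l * p i) z)" for z
    proof -
      obtain l i where z: "z = (l, i)" by (cases z)
      have "\<bar>q l\<bar> * (\<bar>p i\<bar> * \<bar>\<alpha> (l + i)\<bar>) \<le> \<bar>q l\<bar> * (\<bar>p i\<bar> * M)" by (intro mult_left_mono \<alpha>) auto
      then show ?thesis using M by (simp add: z s_def abs_mult mult_ac)
    qed
  qed auto
  then have s: "s summable_on UNIV \<times> UNIV" by (rule Infinite_Sum.abs_summable_summable)
  have in_sum: "summable (\<lambda>i. norm (p i * \<alpha> (l + i)))" for l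
    by (rule summable_comparison_test'[where g = "\<lambda>i. \<bar>p i\<bar> * M" and N = 0]) (auto simp: abs_mult \<alpha> intro!: mult_left_mono summable_mult2 p)
  have inner: "(\<Sum>\<^sub>\<infinity>i. s (l, i)) = q l * (\<Sum>i. p i * \<alpha> (l + i))" for l
  proof -
    have "((\<lambda>i. p i * \<alpha> (l + i)) has_sum (\<Sum>i. p i * \<alpha> (l + i))) UNIV"
      by (rule norm_summable_imp_has_sum[OF in_sum summable_sums[OF summable_norm_cancel[OF in_sum]]])
    then show ?thesis unfolding s_def by (simp add: has_sum_cmult_right infsumI)
  qed
  have "(\<lambda>l. q l * (\<Sum>i. p i * \<alpha> (l + i))) summable_on UNIV"
    using summable_on_Sigma_banach[of "\<lambda>l i. s (l, i)" UNIV "\<lambda>_. UNIV"] s by (simp add: inner case_prod_unfold)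
  then have left: "(\<Sum>l. q l * (\<Sum>i. p i * \<alpha> (l + i))) = (\<Sum>\<^sub>\<infinity>l. \<Sum>\<^sub>\<infinity>i. s (l, i))"
    unfolding inner by (intro sums_unique[symmetric] has_sum_imp_sums has_sum_infsum)
  also have "\<dots> = infsum s (UNIV \<times> UNIV)"
    using infsum_Sigma'_banach[of "\<lambda>l i. s (l, i)" UNIV "\<lambda>_. UNIV"] s by (simp add: case_prod_unfold)
  also have "\<dots> = infsum (\<lambda>(n, l). s (l, n - l)) (SIGMA n:UNIV. {..n})"
    by (rule infsum_reindex_bij_witness[of _ "\<lambda>(n, l). (l, n - l)" "\<lambda>(l, i). (l + i, l)"]) auto
  also have "\<dots> = (\<Sum>\<^sub>\<infinity>n. \<Sum>\<^sub>\<infinity>l\<in>{..n}. s (l, n - l))"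
  proof -
    have "(\<lambda>(n, l). s (l, n - l)) summable_on (SIGMA n:UNIV. {..n}) \<longleftrightarrow> s summable_on UNIV \<times> UNIV"
      by (rule summable_on_reindex_bij_witness[of _ "\<lambda>(l, i). (l + i, l)" "\<lambda>(n, l). (l, n - l)"]) auto
    with s have 1: "(\<lambda>(n, l). s (l, n - l)) summable_on (SIGMA n:UNIV. {..n})" by simp
    show ?thesis by (rule infsum_Sigma'_banach[OF 1, symmetric])
  qed
  also have "\<dots> = (\<Sum>\<^sub>\<infinity>n. (\<Sum>l\<le>n. q l * p (n - l)) * \<alpha> n)"
    by (intro infsum_cong) (auto simp: s_def sum_distrib_right mult.assoc intro!: sum.cong)
  also have "\<dots> = (\<Sum>n. (\<Sum>l\<le>n. q l * p (n - l)) * \<alpha> n)"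
  proof -
    have 1: "(\<lambda>(n, l). s (l, n - l)) summable_on (SIGMA n:UNIV. {..n})"
      using s by (subst summable_on_reindex_bij_witness[of _ "\<lambda>(l, i). (l + i, l)" "\<lambda>(n, l). (l, n - l)" "UNIV \<times> UNIV" s]) auto
    have "(\<lambda>n. \<Sum>\<^sub>\<infinity>l\<in>{..n}. s (l, n - l)) summable_on UNIV"
      by (rule summable_on_Sigma_banach[OF 1])
    moreover have "(\<Sum>\<^sub>\<infinity>l\<in>{..n}. s (l, n - l)) = (\<Sum>l\<le>n. q l * p (n - l)) * \<alpha> n" for n
      by (auto simp: s_def sum_distrib_right mult.assoc intro!: sum.cong)
    ultimately have "(\<lambda>n. (\<Sum>l\<le>n. q l * p (n - l)) * \<alpha> n) summable_on UNIV" by simp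
    then show ?thesis by (intro sums_unique has_sum_imp_sums has_sum_infsum)
  qed
  finally show ?thesis .
qed

text \<open>The binomial series for (I - A)^a is summed pointwise, which gives a concrete function.
  That it is the limit in the norm as well is part of \<open>frac_diff_exists\<close>.\<close>

definition frac_op :: "real \<Rightarrow> real \<Rightarrow> (real \<Rightarrow> real) \<Rightarrow> real \<Rightarrow> real" where
  "frac_op h a f x = (\<Sum>i. diff_coeff a i * (conv (box_ker h) ^^ i) f x)"

text \<open>Windows around the points of one period lie in a fixed bounded interval, on which
  \<open>f\<close> is integrable. Consequently all powers of the average from the first on share one
  bound, and the binomial series converges at every point.\<close>

lemma conv_box_bounded:
  assumes h: "0 < h" and f: "per_L1 f"
  shows "\<exists>B\<ge>0. \<forall>x. \<bar>conv (box_ker h) f x\<bar> \<le> B"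
proof -
  have [measurable]: "f \<in> borel_measurable borel" using f by (rule per_L1_borel)
  let ?I = "\<integral>\<^sup>+y\<in>{-h..<2*pi+h}. ennreal \<bar>f y\<bar> \<partial>lborel"
  define B where "B = enn2real (ennreal (1 / h) * ?I)"
  have B: "ennreal B = ennreal (1 / h) * ?I"
    unfolding B_def using per_L1_Ico_finite[OF f, of "-h" "2*pi+h"] by (simp add: ennreal_mult_less_top)
  have bnd: "\<bar>conv (box_ker h) f x\<bar> \<le> B" if x: "0 \<le> x" "x < 2 * pi" for x
  proof -
    have "ennreal \<bar>conv (box_ker h) f x\<bar> \<le> (\<integral>\<^sup>+t. ennreal \<bar>box_ker h t\<bar> * ennreal \<bar>f (x + t)\<bar> \<partial>lborel)"
      by (rule abs_conv_le[OF kernel_box_ker[OF h] f])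
    also have "\<dots> \<le> (\<integral>\<^sup>+t. ennreal (1 / h) * (ennreal \<bar>f (t + x)\<bar> * indicator {-h..<2*pi+h} (t + x)) \<partial>lborel)"
      using x h by (intro nn_integral_mono) (auto simp: box_ker_def indicator_def add.commute abs_le_iff)
    also have "\<dots> = (\<integral>\<^sup>+y. ennreal (1 / h) * (ennreal \<bar>f y\<bar> * indicator {-h..<2*pi+h} y) \<partial>lborel)"
      by (rule nn_integral_shift[of "\<lambda>y. ennreal (1 / h) * (ennreal \<bar>f y\<bar> * indicator {-h..<2*pi+h} y)"]) measurable
    also have "\<dots> = ennreal B" unfolding B by (rule nn_integral_cmult) measurable
    finally show ?thesis by (simp add: ennreal_le_iff B_def)
  qed
  have "\<bar>conv (box_ker h) f x\<bar> \<le> B" for x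
  proof -
    define k where "k = \<lfloor>x / (2 * pi)\<rfloor>"
    have "of_int k \<le> x / (2 * pi)" "x / (2 * pi) < of_int k + 1" by (auto simp: k_def)
    then have "0 \<le> x - 2 * pi * of_int k" "x - 2 * pi * of_int k < 2 * pi" by (auto simp: field_simps)
    moreover have "conv (box_ker h) f x = conv (box_ker h) f (x - 2 * pi * of_int k)"
      using per_of_int[OF conv_per, of f "box_ker h" "x - 2 * pi * of_int k" k] f by (simp add: per_L1_def)
    ultimately show ?thesis using bnd by simp
  qed
  moreover have "0 \<le> B" by (simp add: B_def)
  ultimately show ?thesis by blast
qed

lemma conv_box_sup:
  assumes h: "0 < h" and f: "per_L1 f" and B: "\<And>x. \<bar>f x\<bar> \<le> B"
  shows "\<bar>conv (box_ker h) f x\<bar> \<le> B"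
proof -
  have B0: "0 \<le> B" using B[of 0] by simp
  have "ennreal \<bar>conv (box_ker h) f x\<bar> \<le> (\<integral>\<^sup>+t. ennreal \<bar>box_ker h t\<bar> * ennreal \<bar>f (x + t)\<bar> \<partial>lborel)"
    by (rule abs_conv_le[OF kernel_box_ker[OF h] f])
  also have "\<dots> \<le> (\<integral>\<^sup>+t. ennreal (box_ker h t) * ennreal B \<partial>lborel)"
    using B box_ker_nonneg[OF h] by (intro nn_integral_mono mult_mono ennreal_leI) auto
  also have "\<dots> = ennreal B" by (subst nn_integral_multc) (auto simp: box_ker_mass[OF h])
  finally show ?thesis using B0 by (simp add: ennreal_le_iff)
qed

lemma conv_box_funpow_bounded:
  assumes h: "0 < h" and f: "per_L1 f"
  obtains B where "0 \<le> B" "\<And>i x. 1 \<le> i \<Longrightarrow> \<bar>(conv (box_ker h) ^^ i) f x\<bar> \<le> B"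
    "\<And>i x. \<bar>(conv (box_ker h) ^^ i) f x\<bar> \<le> \<bar>f x\<bar> + B"
proof -
  obtain B where B: "0 \<le> B" "\<And>x. \<bar>conv (box_ker h) f x\<bar> \<le> B" using conv_box_bounded[OF h f] by blast
  have *: "\<bar>(conv (box_ker h) ^^ Suc i) f x\<bar> \<le> B" for i x
  proof (induction i arbitrary: x)
    case (Suc i)
    have "(conv (box_ker h) ^^ Suc (Suc i)) f = conv (box_ker h) ((conv (box_ker h) ^^ Suc i) f)" by simp
    then show ?case
      using conv_box_sup[OF h per_L1_conv_funpow[OF kernel_box_ker[OF h] f, of "Suc i"] Suc, of x] by simp
  qed (use B in simp)
  show thesis
  proof (rule that[OF B(1)])
    show "\<bar>(conv (box_ker h) ^^ i) f x\<bar> \<le> B" if "1 \<le> i" for i x using *[of "i - 1" x] that by (cases i) auto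
    show "\<bar>(conv (box_ker h) ^^ i) f x\<bar> \<le> \<bar>f x\<bar> + B" for i x
      using *[of "i - 1" x] B(1) by (cases i) auto
  qed
qed

lemma frac_op_summable:
  assumes h: "0 < h" and f: "per_L1 f" and a: "0 \<le> a"
  shows "summable (\<lambda>i. \<bar>diff_coeff a i * (conv (box_ker h) ^^ i) f x\<bar>)"
proof -
  obtain B where "0 \<le> B" and B: "\<And>i x. \<bar>(conv (box_ker h) ^^ i) f x\<bar> \<le> \<bar>f x\<bar> + B"
    by (rule conv_box_funpow_bounded[OF h f]) blast
  show ?thesis
    by (rule summable_comparison_test'[where g = "\<lambda>i. \<bar>diff_coeff a i\<bar> * (\<bar>f x\<bar> + B)" and N = 0])
      (auto simp: abs_mult B intro!: mult_left_mono summable_mult2 summable_diff_coeff a)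
qed

lemma abs_frac_op_le:
  assumes h: "0 < h" and f: "per_L1 f" and a: "0 \<le> a"
  shows "\<exists>B\<ge>0. \<forall>x. \<bar>frac_op h a f x\<bar> \<le> (\<Sum>i. \<bar>diff_coeff a i\<bar>) * (\<bar>f x\<bar> + B)"
proof -
  let ?A = "\<lambda>i. (conv (box_ker h) ^^ i) f"
  obtain B where B0: "0 \<le> B" and B: "\<And>i x. \<bar>?A i x\<bar> \<le> \<bar>f x\<bar> + B"
    by (rule conv_box_funpow_bounded[OF h f]) blast
  have "\<bar>frac_op h a f x\<bar> \<le> (\<Sum>i. \<bar>diff_coeff a i\<bar>) * (\<bar>f x\<bar> + B)" for x
  proof -
    have "\<bar>frac_op h a f x\<bar> \<le> (\<Sum>i. \<bar>diff_coeff a i * ?A i x\<bar>)"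
      unfolding frac_op_def by (rule summable_rabs[OF frac_op_summable[OF h f a]])
    also have "\<dots> \<le> (\<Sum>i. \<bar>diff_coeff a i\<bar> * (\<bar>f x\<bar> + B))"
      by (intro suminf_le frac_op_summable h f a summable_mult2 summable_diff_coeff) (auto simp: abs_mult B intro!: mult_left_mono)
    also have "\<dots> = (\<Sum>i. \<bar>diff_coeff a i\<bar>) * (\<bar>f x\<bar> + B)" by (rule suminf_mult2[symmetric]) (rule summable_diff_coeff[OF a])
    finally show ?thesis .
  qed
  with B0 show ?thesis by blast
qed

lemma per_L1_frac_op:
  assumes h: "0 < h" and f: "per_L1 f" and a: "0 \<le> a"
  shows "per_L1 (frac_op h a f)"
proof -
  let ?A = "\<lambda>i. (conv (box_ker h) ^^ i) f"
  have A: "per_L1 (?A i)" for i by (rule per_L1_conv_funpow[OF kernel_box_ker[OF h] f])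
  have [measurable]: "f \<in> borel_measurable borel" "\<And>i. ?A i \<in> borel_measurable borel" using f A per_L1_borel by auto
  define S where "S = (\<Sum>i. \<bar>diff_coeff a i\<bar>)"
  have S: "0 \<le> S" unfolding S_def by (intro suminf_nonneg summable_diff_coeff a) auto
  obtain B where B0: "0 \<le> B" and le: "\<And>x. \<bar>frac_op h a f x\<bar> \<le> S * (\<bar>f x\<bar> + B)"
    using abs_frac_op_le[OF h f a] unfolding S_def by blast
  have "frac_op h a f \<in> borel_measurable borel" unfolding frac_op_def[abs_def] by measurable
  moreover have "per (frac_op h a f)" using A unfolding per_L1_def per_def frac_op_def by simp
  moreover have "per_int (\<lambda>x. ennreal \<bar>frac_op h a f x\<bar>) < \<infinity>"
  proof -
    have "per_int (\<lambda>x. ennreal \<bar>frac_op h a f x\<bar>) \<le> per_int (\<lambda>x. ennreal S * (ennreal \<bar>f x\<bar> + ennreal B))"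
      using le S B0 by (intro per_int_mono) (simp add: ennreal_mult[symmetric] ennreal_leI flip: ennreal_plus)
    also have "\<dots> = ennreal S * (per_int (\<lambda>x. ennreal \<bar>f x\<bar>) + per_int (\<lambda>x. ennreal B))"
      by (subst per_int_cmult) (auto simp: per_int_add)
    also have "per_int (\<lambda>x. ennreal B) < \<infinity>" by (simp add: per_int_def nn_integral_cmult ennreal_mult_less_top)
    then have "ennreal S * (per_int (\<lambda>x. ennreal \<bar>f x\<bar>) + per_int (\<lambda>x. ennreal B)) < \<infinity>"
      using f by (simp add: ennreal_mult_less_top per_L1_def)
    finally show ?thesis .
  qed
  ultimately show ?thesis by (simp add: per_L1_def)
qed

text \<open>Series and integral may be interchanged, since the terms are dominated by the summable
  \<open>|diff_coeff a i|\<close> times one integrable function.\<close>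

lemma conv_frac_op:
  assumes h: "0 < h" and f: "per_L1 f" and a: "0 \<le> a"
  shows "conv (box_ker h) (frac_op h a f) = frac_op h a (conv (box_ker h) f)"
proof
  fix x
  let ?A = "\<lambda>i. (conv (box_ker h) ^^ i) f" and ?b = "box_ker h"
  note kb = kernel_box_ker[OF h]
  have A: "per_L1 (?A i)" for i by (rule per_L1_conv_funpow[OF kb f])
  obtain B where B0: "0 \<le> B" and B: "\<And>i x. \<bar>?A i x\<bar> \<le> \<bar>f x\<bar> + B"
    by (rule conv_box_funpow_bounded[OF h f]) blast
  have fB: "integrable lborel (\<lambda>t. ?b t * (\<bar>f (x + t)\<bar> + B))"
  proof -
    have "integrable lborel (\<lambda>t. \<bar>?b t * f (x + t)\<bar> + ?b t * B)"
      using conv_integrable[OF kb f] kernel_integrable(1)[OF kb] by auto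
    then show ?thesis by (simp add: distrib_left abs_mult box_ker_nonneg[OF h])
  qed
  have int: "integrable lborel (\<lambda>t. diff_coeff a i * (?b t * ?A i (x + t)))" for i
    by (intro integrable_mult_right conv_integrable kb A)
  have "conv ?b (frac_op h a f) x = (\<integral>t. (\<Sum>i. diff_coeff a i * (?b t * ?A i (x + t))) \<partial>lborel)"
    unfolding conv_def[of _ "frac_op h a f"] frac_op_def
  proof (intro Bochner_Integration.integral_cong refl)
    fix t
    show "?b t * (\<Sum>i. diff_coeff a i * ?A i (x + t)) = (\<Sum>i. diff_coeff a i * (?b t * ?A i (x + t)))"
      using summable_rabs_cancel[OF frac_op_summable[OF h f a, of "x + t"]]
      by (subst suminf_mult[symmetric]) (auto simp: mult_ac)
  qed
  also have "\<dots> = (\<Sum>i. \<integral>t. diff_coeff a i * (?b t * ?A i (x + t)) \<partial>lborel)"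
  proof (rule integral_suminf[OF int])
    show "AE t in lborel. summable (\<lambda>i. norm (diff_coeff a i * (?b t * ?A i (x + t))))"
    proof (rule AE_I2)
      fix t
      show "summable (\<lambda>i. norm (diff_coeff a i * (?b t * ?A i (x + t))))"
        using summable_mult[OF frac_op_summable[OF h f a, of "x + t"], of "\<bar>?b t\<bar>"] by (simp add: abs_mult mult_ac)
    qed
    show "summable (\<lambda>i. \<integral>t. norm (diff_coeff a i * (?b t * ?A i (x + t))) \<partial>lborel)"
    proof (rule summable_comparison_test'[where g = "\<lambda>i. \<bar>diff_coeff a i\<bar> * (\<integral>t. ?b t * (\<bar>f (x + t)\<bar> + B) \<partial>lborel)" and N = 0])
      show "summable (\<lambda>i. \<bar>diff_coeff a i\<bar> * (\<integral>t. ?b t * (\<bar>f (x + t)\<bar> + B) \<partial>lborel))"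
        by (intro summable_mult2 summable_diff_coeff a)
      fix i
      have "(\<integral>t. norm (diff_coeff a i * (?b t * ?A i (x + t))) \<partial>lborel) \<le> (\<integral>t. \<bar>diff_coeff a i\<bar> * (?b t * (\<bar>f (x + t)\<bar> + B)) \<partial>lborel)"
        using int fB B box_ker_nonneg[OF h] by (intro integral_mono integrable_norm integrable_mult_right) (auto simp: abs_mult intro!: mult_left_mono)
      then show "norm (\<integral>t. norm (diff_coeff a i * (?b t * ?A i (x + t))) \<partial>lborel) \<le> \<bar>diff_coeff a i\<bar> * (\<integral>t. ?b t * (\<bar>f (x + t)\<bar> + B) \<partial>lborel)"
        by simp
    qed
  qed
  also have "\<dots> = frac_op h a (conv ?b f) x"
    unfolding frac_op_def by (simp add: conv_funpow_commute[OF kb kb f, symmetric]) (simp add: conv_def)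
  finally show "conv ?b (frac_op h a f) x = frac_op h a (conv ?b f) x" .
qed

lemma conv_funpow_frac_op:
  assumes h: "0 < h" and f: "per_L1 f" and a: "0 \<le> a"
  shows "(conv (box_ker h) ^^ l) (frac_op h a f) x = (\<Sum>i. diff_coeff a i * (conv (box_ker h) ^^ (l + i)) f x)"
proof -
  note kb = kernel_box_ker[OF h]
  have "(conv (box_ker h) ^^ l) (frac_op h a f) = frac_op h a ((conv (box_ker h) ^^ l) f)"
    using f by (induction l) (auto simp: conv_frac_op[OF h _ a] per_L1_conv_funpow[OF kb])
  then show ?thesis by (simp add: frac_op_def funpow_add add.commute[of l])
qed

text \<open>Both series together form a double sum in which the average occurs to the power
  \<open>l + i\<close>; summing along diagonals reduces the law to Vandermonde's identity.\<close>

lemma frac_op_frac_op: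
  assumes h: "0 < h" and f: "per_L1 f" and a: "0 \<le> a" and b: "0 \<le> b"
  shows "frac_op h b (frac_op h a f) = frac_op h (a + b) f"
proof
  fix x
  obtain B where B0: "0 \<le> B" and B: "\<And>i x. \<bar>(conv (box_ker h) ^^ i) f x\<bar> \<le> \<bar>f x\<bar> + B"
    by (rule conv_box_funpow_bounded[OF h f]) blast
  have "frac_op h b (frac_op h a f) x = (\<Sum>l. diff_coeff b l * (\<Sum>i. diff_coeff a i * (conv (box_ker h) ^^ (l + i)) f x))"
    unfolding frac_op_def[of h b] by (simp add: conv_funpow_frac_op[OF h f a])
  also have "\<dots> = (\<Sum>n. (\<Sum>l\<le>n. diff_coeff b l * diff_coeff a (n - l)) * (conv (box_ker h) ^^ n) f x)"
    by (rule suminf_twisted_Cauchy_product[where \<alpha> = "\<lambda>n. (conv (box_ker h) ^^ n) f x" and M = "\<bar>f x\<bar> + B"])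
      (intro summable_diff_coeff a b B)+
  finally show "frac_op h b (frac_op h a f) x = frac_op h (a + b) f x"
    by (simp add: diff_coeff_convolution frac_op_def)
qed

lemma frac_op_0: "frac_op h 0 f = f"
proof
  fix x
  have "diff_coeff 0 i = (if i = 0 then 1 else 0)" for i by (cases i) (auto simp: diff_coeff_def)
  then have "frac_op h 0 f x = (\<Sum>i. if i = 0 then f x else 0)"
    unfolding frac_op_def by (intro suminf_cong) auto
  also have "\<dots> = f x" using suminf_finite[of "{0::nat}" "\<lambda>i. if i = 0 then f x else 0"] by simp
  finally show "frac_op h 0 f x = f x" .
qed

lemma frac_op_1: "frac_op h 1 f = conv_diff_op (box_ker h) f"
proof
  fix x
  have "diff_coeff 1 i = (if i = 0 then 1 else if i = 1 then - 1 else 0)" for i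
  proof -
    have "(1::real) gchoose i = of_nat (1 choose i)" using binomial_gbinomial[of 1 i, where 'a = real] by simp
    then show ?thesis by (cases "i \<le> 1") (auto simp: diff_coeff_def binomial_eq_0 le_Suc_eq)
  qed
  then have "frac_op h 1 f x = (\<Sum>i\<in>{0,1}. diff_coeff 1 i * (conv (box_ker h) ^^ i) f x)"
    unfolding frac_op_def by (intro suminf_finite) auto
  then show "frac_op h 1 f x = conv_diff_op (box_ker h) f x"
    by (simp add: conv_diff_op_def diff_coeff_def)
qed

lemma frac_op_of_nat:
  assumes h: "0 < h" and f: "per_L1 f"
  shows "frac_op h (real r) f = (conv_diff_op (box_ker h) ^^ r) f"
proof (induction r)
  case (Suc r)
  have "frac_op h (real (Suc r)) f = frac_op h 1 (frac_op h (real r) f)"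
    using frac_op_frac_op[OF h f, of "real r" 1] by (simp add: add.commute)
  then show ?case using Suc by (simp add: frac_op_1)
qed (simp add: frac_op_0)

context box_bounded
begin

text \<open>The coefficients are absolutely summable, and the bound for powers of the average does
  not depend on the power.\<close>

lemma rnrm_frac_op:
  assumes h: "0 < h" and f: "per_L1 f" and a: "0 \<le> a"
  shows "rnrm (frac_op h a f) \<le> ennreal ((\<Sum>i. \<bar>diff_coeff a i\<bar>) * (1 + D)) * rnrm f"
proof -
  let ?A = "\<lambda>i. (conv (box_ker h) ^^ i) f"
  have A: "per_L1 (?A i)" for i by (rule per_L1_conv_funpow[OF kernel_box_ker[OF h] f])
  have [measurable]: "f \<in> borel_measurable borel" "\<And>i. ?A i \<in> borel_measurable borel" using f A per_L1_borel by auto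
  have "rnrm (frac_op h a f) \<le> nrm (\<lambda>x. \<Sum>i. ennreal \<bar>diff_coeff a i\<bar> * ennreal \<bar>?A i x\<bar>)"
  proof (rule wnorm_mono)
    fix x
    have "ennreal \<bar>frac_op h a f x\<bar> \<le> ennreal (\<Sum>i. \<bar>diff_coeff a i * ?A i x\<bar>)"
      unfolding frac_op_def by (intro ennreal_leI summable_rabs frac_op_summable h f a)
    also have "\<dots> = (\<Sum>i. ennreal \<bar>diff_coeff a i * ?A i x\<bar>)"
      by (intro suminf_ennreal2[symmetric] frac_op_summable h f a) auto
    finally show "ennreal \<bar>frac_op h a f x\<bar> \<le> (\<Sum>i. ennreal \<bar>diff_coeff a i\<bar> * ennreal \<bar>?A i x\<bar>)"
      by (simp add: abs_mult ennreal_mult)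
  qed
  also have "\<dots> \<le> (\<Sum>i. nrm (\<lambda>x. ennreal \<bar>diff_coeff a i\<bar> * ennreal \<bar>?A i x\<bar>))" by (rule nrm_suminf) measurable
  also have "\<dots> \<le> (\<Sum>i. ennreal \<bar>diff_coeff a i\<bar> * (ennreal (1 + D) * rnrm f))"
  proof (intro suminf_le)
    fix i
    have "nrm (\<lambda>x. ennreal \<bar>diff_coeff a i\<bar> * ennreal \<bar>?A i x\<bar>) \<le> ennreal \<bar>diff_coeff a i\<bar> * rnrm (?A i)"
      by (rule nrm_cmult) measurable
    also have "\<dots> \<le> ennreal \<bar>diff_coeff a i\<bar> * (ennreal (1 + D) * rnrm f)"
      by (intro mult_left_mono rnrm_box_funpow h f) auto
    finally show "nrm (\<lambda>x. ennreal \<bar>diff_coeff a i\<bar> * ennreal \<bar>?A i x\<bar>) \<le> ennreal \<bar>diff_coeff a i\<bar> * (ennreal (1 + D) * rnrm f)" .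
  qed auto
  also have "\<dots> = (\<Sum>i. ennreal \<bar>diff_coeff a i\<bar>) * (ennreal (1 + D) * rnrm f)" by (rule ennreal_suminf_multc)
  also have "(\<Sum>i. ennreal \<bar>diff_coeff a i\<bar>) = ennreal (\<Sum>i. \<bar>diff_coeff a i\<bar>)"
    by (intro suminf_ennreal2 summable_diff_coeff a) auto
  also have "ennreal (\<Sum>i. \<bar>diff_coeff a i\<bar>) * (ennreal (1 + D) * rnrm f) = ennreal ((\<Sum>i. \<bar>diff_coeff a i\<bar>) * (1 + D)) * rnrm f"
    using D_pos by (subst ennreal_mult) (auto simp: mult.assoc suminf_nonneg summable_diff_coeff a simp del: ennreal_plus)
  finally show ?thesis .
qed

text \<open>An integer exponent \<open>r \<ge> k\<close> is reached by applying the bounded operator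
  \<open>frac_op h (r - k)\<close>. Each of the \<open>r\<close> integer differences costs
  \<open>(n / j)\<^sup>2\<close>, so the exponent obtained is \<open>2 * r\<close>.\<close>

lemma fractional_jackson:
  assumes k: "0 < k"
  shows "\<exists>C>0. \<exists>r. \<forall>f n j. per_L1 f \<longrightarrow> rnrm f < \<infinity> \<longrightarrow> 1 \<le> j \<longrightarrow> j \<le> n \<longrightarrow>
    (\<exists>T\<in>trig_polys j. rnrm (\<lambda>x. f x - T x)
      \<le> ennreal (C * (real n / real j) ^ r) * rnrm (frac_op (1 / real n) k f))"
proof -
  obtain C where C: "0 < C" and app: "\<And>f n j r. per_L1 f \<Longrightarrow> rnrm f < \<infinity> \<Longrightarrow> 1 \<le> j \<Longrightarrow> j \<le> n \<Longrightarrow>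
    \<exists>T\<in>trig_polys j. rnrm (\<lambda>x. f x - T x)
      \<le> ennreal ((C * (real n / real j)\<^sup>2) ^ r) * rnrm ((conv_diff_op (box_ker (1 / real n)) ^^ r) f)"
    using ex_trig_poly_approx by blast
  obtain r :: nat where r: "k \<le> real r" using real_arch_simple by blast
  define a where "a = real r - k"
  have a: "0 \<le> a" using r by (simp add: a_def)
  define S where "S = (\<Sum>i. \<bar>diff_coeff a i\<bar>) * (1 + D)"
  have S: "0 \<le> S" unfolding S_def using D_pos by (intro mult_nonneg_nonneg suminf_nonneg summable_diff_coeff a) auto
  have main: "\<exists>T\<in>trig_polys j. rnrm (\<lambda>x. f x - T x) \<le> ennreal ((C ^ r * (S + 1)) * (real n / real j) ^ (2 * r)) * rnrm (frac_op (1 / real n) k f)"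
    if f: "per_L1 f" "rnrm f < \<infinity>" and j: "1 \<le> j" "j \<le> n" for f n j
  proof -
    have h: "0 < 1 / real n" using j by simp
    obtain T where T: "T \<in> trig_polys j" "rnrm (\<lambda>x. f x - T x)
      \<le> ennreal ((C * (real n / real j)\<^sup>2) ^ r) * rnrm ((conv_diff_op (box_ker (1 / real n)) ^^ r) f)"
      using app[OF f j] by blast
    have "(conv_diff_op (box_ker (1 / real n)) ^^ r) f = frac_op (1 / real n) a (frac_op (1 / real n) k f)"
      using k a by (simp add: frac_op_frac_op[OF h f(1)] frac_op_of_nat[OF h f(1), symmetric]) (simp add: a_def)
    then have "rnrm ((conv_diff_op (box_ker (1 / real n)) ^^ r) f) \<le> ennreal S * rnrm (frac_op (1 / real n) k f)"
      unfolding S_def using rnrm_frac_op[OF h per_L1_frac_op[OF h f(1)] a, of k] k by simp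
    also have "\<dots> \<le> ennreal (S + 1) * rnrm (frac_op (1 / real n) k f)" by (intro mult_right_mono ennreal_leI) auto
    finally have "ennreal ((C * (real n / real j)\<^sup>2) ^ r) * rnrm ((conv_diff_op (box_ker (1 / real n)) ^^ r) f)
      \<le> ennreal ((C * (real n / real j)\<^sup>2) ^ r) * (ennreal (S + 1) * rnrm (frac_op (1 / real n) k f))"
      by (rule mult_left_mono) simp
    also have "\<dots> = ennreal ((C * (real n / real j)\<^sup>2) ^ r * (S + 1)) * rnrm (frac_op (1 / real n) k f)"
      using C S by (subst ennreal_mult) (auto simp: mult.assoc simp del: ennreal_plus)
    also have "(C * (real n / real j)\<^sup>2) ^ r * (S + 1) = (C ^ r * (S + 1)) * (real n / real j) ^ (2 * r)"
      by (simp add: power_mult_distrib power_mult)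
    finally show ?thesis using T by (intro bexI[of _ T]) (auto intro: order.trans)
  qed
  have "0 < C ^ r * (S + 1)" using C S by simp
  then show ?thesis using main by (intro exI[of _ "C ^ r * (S + 1)"] conjI exI[of _ "2 * r"]) auto
qed

end

section \<open>Borel versions\<close>

lemma AE_lborel_translate:
  assumes "AE x in lborel. P (x :: real)" shows "AE x in lborel. P (x + t)"
proof -
  obtain N where N: "{x. \<not> P x} \<subseteq> N" "emeasure lborel N = 0" "N \<in> sets borel"
    using AE_E[OF assms] by (auto simp: null_sets_def)
  have "(\<integral>\<^sup>+x. indicator N (x + t) \<partial>lborel) = (\<integral>\<^sup>+x. indicator N x \<partial>lborel)"
    using N by (intro nn_integral_shift) auto
  also have "\<dots> = 0" using N by simp
  finally have "AE x in lborel. indicator N (x + t) = (0::ennreal)"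
    using N by (subst (asm) nn_integral_0_iff_AE) auto
  then show ?thesis
  proof eventually_elim
    case (elim x)
    then have "x + t \<notin> N" by (auto simp: indicator_def split: if_splits)
    then show ?case using N(1) by auto
  qed
qed

text \<open>A Borel version is restricted to one period and extended periodically. It still agrees
  almost everywhere, since the countably many translates of the exceptional set are null.\<close>

lemma ex_borel_periodic_version:
  assumes f: "f \<in> borel_measurable lebesgue" and fper: "periodic_2pi f"
  shows "\<exists>f0. f0 \<in> borel_measurable borel \<and> per f0 \<and> (AE x in lborel. f x = f0 x)"
proof -
  obtain f1 where f1 [measurable]: "f1 \<in> borel_measurable lborel" and ae: "AE x in lborel. f x = f1 x"
    using completion_ex_borel_measurable_real[OF f] by auto
  define f0 where "f0 x = f1 (x - 2 * pi * real_of_int \<lfloor>x / (2 * pi)\<rfloor>)" for x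
  have [measurable]: "f0 \<in> borel_measurable borel" unfolding f0_def[abs_def] by measurable
  have "per f0"
  proof -
    have "(x + 2 * pi) / (2 * pi) = x / (2 * pi) + 1" for x :: real by (simp add: field_simps)
    then have "\<lfloor>(x + 2 * pi) / (2 * pi)\<rfloor> = \<lfloor>x / (2 * pi)\<rfloor> + 1" for x :: real by simp
    then show ?thesis by (simp add: per_def f0_def algebra_simps)
  qed
  moreover have "AE x in lborel. f x = f0 x"
  proof -
    have fp: "per f" using fper by (simp add: per_def periodic_2pi_def)
    have "AE x in lborel. \<forall>k::int. f (x + (- 2 * pi * of_int k)) = f1 (x + (- 2 * pi * of_int k))"
      unfolding AE_all_countable by (intro allI AE_lborel_translate ae)
    then show ?thesis
    proof eventually_elim
      case (elim x)
      have "f x = f (x - 2 * pi * of_int \<lfloor>x / (2 * pi)\<rfloor>)"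
        using per_of_int[OF fp, of "x - 2 * pi * of_int \<lfloor>x / (2 * pi)\<rfloor>" "\<lfloor>x / (2 * pi)\<rfloor>"] by simp
      then show ?case using elim[rule_format, of "\<lfloor>x / (2 * pi)\<rfloor>"] by (simp add: f0_def)
    qed
  qed
  ultimately show ?thesis using \<open>f0 \<in> borel_measurable borel\<close> by blast
qed

lemma nn_integral_lebesgue_cong:
  assumes "AE x in lborel. F x = F0 x"
  shows "(\<integral>\<^sup>+x. F x \<partial>lebesgue) = (\<integral>\<^sup>+x. F0 x \<partial>lborel)"
proof -
  have "(\<integral>\<^sup>+x. F x \<partial>lebesgue) = (\<integral>\<^sup>+x. F0 x \<partial>lebesgue)" by (intro nn_integral_cong_AE AE_completion assms)
  then show ?thesis by (simp add: nn_integral_completion)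
qed

lemma nn_integral_lebesgue_Icc:
  fixes F F0 :: "real \<Rightarrow> ennreal"
  assumes "AE x in lborel. F x = F0 x"
  shows "(\<integral>\<^sup>+x\<in>{a..b}. F x \<partial>lebesgue) = (\<integral>\<^sup>+x\<in>{a..<b}. F0 x \<partial>lborel)"
proof (rule nn_integral_lebesgue_cong)
  show "AE x in lborel. F x * indicator {a..b} x = F0 x * indicator {a..<b} x"
    using assms AE_lborel_singleton[of b] by eventually_elim (auto simp: indicator_def)
qed

lemma nn_integral_lebesgue_per_int:
  assumes "AE x in lborel. F x = F0 x"
  shows "(\<integral>\<^sup>+x\<in>{0..2*pi}. F x \<partial>lebesgue) = per_int F0"
  using nn_integral_lebesgue_Icc[OF assms, of 0 "2 * pi"] by (simp add: per_int_def)

text \<open>Both integrals are positive, and in \<open>ennreal\<close> a product of a positive and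
  an infinite factor is infinite; so the finite supremum makes each integral finite.\<close>

lemma Muckenhoupt_Ap_bound:
  assumes W: "W \<in> Muckenhoupt p" and W0 [measurable]: "W0 \<in> borel_measurable borel" and pos: "\<And>x. 0 < W0 x" and ae: "AE x in lborel. W x = W0 x"
  shows "\<exists>A. Ap_bound W0 p A"
proof -
  have p: "1 < p" using W by (simp add: Muckenhoupt_def)
  let ?t = "\<lambda>a b. (ennreal (1 / (b - a)) * (\<integral>\<^sup>+x\<in>{a..<b}. ennreal (W0 x) \<partial>lborel)) *
    ennreal_powr (ennreal (1 / (b - a)) * (\<integral>\<^sup>+x\<in>{a..<b}. ennreal (W0 x powr (1 / (1 - p))) \<partial>lborel)) (p - 1)"
  have e1: "(\<integral>\<^sup>+x\<in>{a..b}. ennreal (W x) \<partial>lebesgue) = (\<integral>\<^sup>+x\<in>{a..<b}. ennreal (W0 x) \<partial>lborel)" for a b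
    by (rule nn_integral_lebesgue_Icc) (use ae in eventually_elim, simp)
  have e2: "(\<integral>\<^sup>+x\<in>{a..b}. ennreal (W x powr (1 / (1 - p))) \<partial>lebesgue) = (\<integral>\<^sup>+x\<in>{a..<b}. ennreal (W0 x powr (1 / (1 - p))) \<partial>lborel)" for a b
    by (rule nn_integral_lebesgue_Icc) (use ae in eventually_elim, simp)
  define S where "S = (SUP (a, b)\<in>{(a, b). a < b}. ?t a b)"
  have "(SUP (a, b)\<in>{(a, b). a < b}.
      (ennreal (1 / (b - a)) * (\<integral>\<^sup>+x\<in>{a..b}. ennreal (W x) \<partial>lebesgue)) *
      ennreal_powr (ennreal (1 / (b - a)) * (\<integral>\<^sup>+x\<in>{a..b}. ennreal (W x powr (1 / (1 - p))) \<partial>lebesgue)) (p - 1)) < \<infinity>"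
    using W by (simp add: Muckenhoupt_def)
  then have S: "S < \<infinity>" unfolding S_def by (simp only: e1 e2)
  then obtain A where A: "S = ennreal A" "0 \<le> A" by (cases S) auto
  have "\<exists>w s. 0 < w \<and> 0 < s \<and> (\<integral>\<^sup>+x\<in>{a..<b}. ennreal (W0 x) \<partial>lborel) = ennreal w \<and>
      (\<integral>\<^sup>+x\<in>{a..<b}. ennreal (W0 x powr (1 / (1 - p))) \<partial>lborel) = ennreal s \<and>
      w / (b - a) * (s / (b - a)) powr (p - 1) \<le> A" if ab: "a < b" for a b
  proof -
    let ?X = "\<integral>\<^sup>+x\<in>{a..<b}. ennreal (W0 x) \<partial>lborel" and ?Y = "\<integral>\<^sup>+x\<in>{a..<b}. ennreal (W0 x powr (1 / (1 - p))) \<partial>lborel"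
    have le: "?t a b \<le> ennreal A" unfolding A(1)[symmetric] S_def using ab by (intro SUP_upper2[of "(a, b)"]) auto
    have X0: "0 < ?X" and Y0: "0 < ?Y"
      by (rule nn_integral_Ico_pos; use pos ab in \<open>simp add: less_imp_neq[OF pos, symmetric]\<close>)+
    have iab: "0 < ennreal (1 / (b - a))" using ab by simp
    have "?Y \<noteq> \<infinity>"
    proof
      assume "?Y = \<infinity>"
      then have "?t a b = \<infinity>" using iab X0 by (auto simp: ennreal_powr_def ennreal_mult_top ennreal_top_mult)
      with le show False by (simp add: top_unique)
    qed
    then obtain s where s: "?Y = ennreal s" "0 \<le> s" by (cases ?Y) auto
    have s0: "0 < s" using Y0 s by (cases "s = 0") auto
    have pw: "ennreal_powr (ennreal (1 / (b - a)) * ?Y) (p - 1) = ennreal ((s / (b - a)) powr (p - 1))"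
      using s s0 ab by (simp add: ennreal_powr_def ennreal_mult[symmetric])
    have pw0: "0 < (s / (b - a)) powr (p - 1)" using s0 ab by simp
    have "?X \<noteq> \<infinity>"
    proof
      assume "?X = \<infinity>"
      then have "?t a b = \<infinity>" unfolding pw using iab pw0 by (auto simp: ennreal_mult_top ennreal_top_mult)
      with le show False by (simp add: top_unique)
    qed
    then obtain w where w: "?X = ennreal w" "0 \<le> w" by (cases ?X) auto
    have w0: "0 < w" using X0 w by (cases "w = 0") auto
    have "?t a b = ennreal (w / (b - a) * (s / (b - a)) powr (p - 1))"
      unfolding pw w using w0 ab by (simp add: ennreal_mult[symmetric])
    with le A have "w / (b - a) * (s / (b - a)) powr (p - 1) \<le> A" by (simp add: ennreal_le_iff)
    then show ?thesis using w s w0 s0 by blast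
  qed
  then show ?thesis unfolding Ap_bound_def using p pos by (intro exI[of _ A]) auto
qed

text \<open>A test function may be replaced by the modulus of a periodic Borel version of it;
  conversely, members of \<open>wtests\<close> are admissible in \<open>orlicz_norm\<close>.\<close>

lemma orlicz_norm_eq_wnorm:
  assumes \<phi>: "young_function \<phi>" and W0 [measurable]: "W0 \<in> borel_measurable borel" and Wae: "AE x in lborel. W x = W0 x" and pos: "\<And>x. 0 < W0 x"
    and f0 [measurable]: "f0 \<in> borel_measurable borel" and fae: "AE x in lborel. f x = f0 x"
  shows "orlicz_norm \<phi> W f = wnorm \<phi> W0 (\<lambda>x. ennreal \<bar>f0 x\<bar>)"
proof (rule antisym)
  show "orlicz_norm \<phi> W f \<le> wnorm \<phi> W0 (\<lambda>x. ennreal \<bar>f0 x\<bar>)"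
    unfolding orlicz_norm_def
  proof (rule SUP_least)
    fix g assume "g \<in> {g. g \<in> borel_measurable lebesgue \<and> periodic_2pi g \<and>
           (\<integral>\<^sup>+x\<in>{0..2*pi}. young_compl \<phi> \<bar>g x\<bar> * ennreal (W x) \<partial>lebesgue) \<le> 1}"
    then have g: "g \<in> borel_measurable lebesgue" "periodic_2pi g" "(\<integral>\<^sup>+x\<in>{0..2*pi}. young_compl \<phi> \<bar>g x\<bar> * ennreal (W x) \<partial>lebesgue) \<le> 1" by auto
    obtain g0 where g0: "g0 \<in> borel_measurable borel" "per g0" "AE x in lborel. g x = g0 x"
      using ex_borel_periodic_version[OF g(1,2)] by blast
    have "(\<integral>\<^sup>+x\<in>{0..2*pi}. young_compl \<phi> \<bar>g x\<bar> * ennreal (W x) \<partial>lebesgue) = per_int (\<lambda>x. young_compl \<phi> \<bar>g0 x\<bar> * ennreal (W0 x))"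
      by (rule nn_integral_lebesgue_per_int) (use Wae g0(3) in eventually_elim, simp)
    with g(3) have "(\<lambda>x. \<bar>g0 x\<bar>) \<in> wtests \<phi> W0" using g0 by (auto simp: wtests_def per_def)
    moreover have "(\<integral>\<^sup>+x\<in>{0..2*pi}. ennreal (\<bar>f x * g x\<bar> * W x) \<partial>lebesgue) = per_int (\<lambda>x. ennreal \<bar>f0 x\<bar> * ennreal (\<bar>g0 x\<bar> * W0 x))"
      by (rule nn_integral_lebesgue_per_int) (use Wae g0(3) fae in eventually_elim, simp add: abs_mult ennreal_mult[symmetric] less_imp_le[OF pos] mult.assoc)
    ultimately show "(\<integral>\<^sup>+x\<in>{0..2*pi}. ennreal (\<bar>f x * g x\<bar> * W x) \<partial>lebesgue) \<le> wnorm \<phi> W0 (\<lambda>x. ennreal \<bar>f0 x\<bar>)"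
      unfolding wnorm_def by (simp add: SUP_upper2)
  qed
  show "wnorm \<phi> W0 (\<lambda>x. ennreal \<bar>f0 x\<bar>) \<le> orlicz_norm \<phi> W f"
    unfolding wnorm_def
  proof (rule SUP_least)
    fix g assume "g \<in> wtests \<phi> W0"
    then have g: "g \<in> borel_measurable borel" "per g" "\<And>x. 0 \<le> g x" "per_int (\<lambda>x. young_compl \<phi> (g x) * ennreal (W0 x)) \<le> 1"
      by (auto simp: wtests_def)
    have "(\<integral>\<^sup>+x\<in>{0..2*pi}. young_compl \<phi> \<bar>g x\<bar> * ennreal (W x) \<partial>lebesgue) = per_int (\<lambda>x. young_compl \<phi> (g x) * ennreal (W0 x))"
      by (rule nn_integral_lebesgue_per_int) (use Wae in eventually_elim, simp add: g(3))
    then have "g \<in> {g. g \<in> borel_measurable lebesgue \<and> periodic_2pi g \<and>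
           (\<integral>\<^sup>+x\<in>{0..2*pi}. young_compl \<phi> \<bar>g x\<bar> * ennreal (W x) \<partial>lebesgue) \<le> 1}"
      using g by (auto simp: per_def periodic_2pi_def intro!: measurable_completion)
    moreover have "(\<integral>\<^sup>+x\<in>{0..2*pi}. ennreal (\<bar>f x * g x\<bar> * W x) \<partial>lebesgue) = per_int (\<lambda>x. ennreal \<bar>f0 x\<bar> * ennreal (g x * W0 x))"
      by (rule nn_integral_lebesgue_per_int) (use Wae fae in eventually_elim, simp add: abs_mult g(3) ennreal_mult[symmetric] less_imp_le[OF pos] mult.assoc)
    ultimately show "per_int (\<lambda>x. ennreal \<bar>f0 x\<bar> * ennreal (g x * W0 x)) \<le> orlicz_norm \<phi> W f"
      unfolding orlicz_norm_def by (intro SUP_upper2[of g]) auto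
  qed
qed

text \<open>Averaging ignores null sets, so the equality holds at every point although
  \<open>f\<close> and \<open>f0\<close> agree only almost everywhere. Their iterates therefore
  coincide from the first power on.\<close>

lemma steklov_eq_conv:
  assumes h: "0 < h" and f: "f \<in> borel_measurable lebesgue" and f0 [measurable]: "f0 \<in> borel_measurable borel" and ae: "AE x in lborel. f x = f0 x"
  shows "steklov h f = conv (box_ker h) f0"
proof
  fix x
  have ae': "AE t in lborel. f (x + t) = f0 (x + t)"
    using AE_lborel_translate[OF ae, of x] by (simp add: add.commute)
  \<comment> \<open>Measurability of translations for the completed sigma-algebra, as the
    one-dimensional case of a statement on diagonal affine maps.\<close>
  have "(\<lambda>t. x + (\<Sum>j\<in>Basis. (1 * (t \<bullet> j)) *\<^sub>R j)) \<in> lebesgue \<rightarrow>\<^sub>M lebesgue"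
    by (rule lebesgue_affine_measurable) simp
  then have "(\<lambda>t. x + t) \<in> lebesgue \<rightarrow>\<^sub>M lebesgue" by simp
  from measurable_compose[OF this f] have fx [measurable]: "(\<lambda>t. f (x + t)) \<in> borel_measurable lebesgue" .
  have "(LINT t:{- (h / 2)..h / 2}|lebesgue. f (x + t)) = (\<integral>t. indicator {- (h / 2)..h / 2} t *\<^sub>R f0 (x + t) \<partial>lebesgue)"
    unfolding set_lebesgue_integral_def
  proof (rule integral_cong_AE)
    show "AE t in lebesgue. indicator {- (h / 2)..h / 2} t *\<^sub>R f (x + t) = indicator {- (h / 2)..h / 2} t *\<^sub>R f0 (x + t)"
      using ae' by (intro AE_completion) (auto elim!: eventually_mono)
    show "(\<lambda>t. indicator {- (h / 2)..h / 2} t *\<^sub>R f (x + t)) \<in> borel_measurable lebesgue"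
      using fx by (intro borel_measurable_scaleR) (auto intro!: borel_measurable_indicator)
    show "(\<lambda>t. indicator {- (h / 2)..h / 2} t *\<^sub>R f0 (x + t)) \<in> borel_measurable lebesgue"
      by (intro measurable_completion) measurable
  qed
  also have "\<dots> = (\<integral>t. indicator {- (h / 2)..h / 2} t *\<^sub>R f0 (x + t) \<partial>lborel)"
    by (rule integral_completion) measurable
  finally have "steklov h f x = (\<integral>t. 1 / h * (indicator {- (h / 2)..h / 2} t *\<^sub>R f0 (x + t)) \<partial>lborel)"
    by (simp add: steklov_def)
  also have "\<dots> = conv (box_ker h) f0 x"
    unfolding conv_def by (intro Bochner_Integration.integral_cong) (auto simp: box_ker_def indicator_def abs_le_iff)
  finally show "steklov h f x = conv (box_ker h) f0 x" .
qed

lemma steklov_funpow: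
  assumes h: "0 < h" and f: "f \<in> borel_measurable lebesgue" and f0: "per_L1 f0" and ae: "AE x in lborel. f x = f0 x"
  shows "(steklov h ^^ Suc j) f = (conv (box_ker h) ^^ Suc j) f0"
proof (induction j)
  case 0
  show ?case using steklov_eq_conv[OF h f per_L1_borel[OF f0] ae] by simp
next
  case (Suc j)
  let ?g = "(conv (box_ker h) ^^ Suc j) f0"
  have "?g \<in> borel_measurable borel" by (rule per_L1_borel[OF per_L1_conv_funpow[OF kernel_box_ker[OF h] f0]])
  then have "steklov h ?g = conv (box_ker h) ?g"
    by (intro steklov_eq_conv h) (auto intro: measurable_completion)
  then show ?case using Suc by simp
qed

text \<open>The powers from 1 on are uniformly bounded, so the tails are uniformly small. The sums
  run to \<open>Suc N\<close> because the term of index 0 is \<open>f\<close> itself, which may be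
  unbounded and must belong to every partial sum.\<close>

lemma frac_op_partial_sums:
  assumes h: "0 < h" and f: "per_L1 f" and a: "0 \<le> a"
  shows "\<exists>\<eta>. \<eta> \<longlonglongrightarrow> 0 \<and> (\<forall>N x. \<bar>(\<Sum>j<Suc N. diff_coeff a j * (conv (box_ker h) ^^ j) f x) - frac_op h a f x\<bar> \<le> \<eta> N)"
proof -
  let ?A = "\<lambda>i. (conv (box_ker h) ^^ i) f" and ?c = "\<lambda>i. \<bar>diff_coeff a i\<bar>"
  obtain B where B0: "0 \<le> B" and B: "\<And>i x. 1 \<le> i \<Longrightarrow> \<bar>?A i x\<bar> \<le> B"
    by (rule conv_box_funpow_bounded[OF h f]) blast
  define \<eta> where "\<eta> N = (\<Sum>i. ?c (i + Suc N)) * B" for N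
  have "(\<lambda>N. (\<Sum>i. ?c (i + Suc N))) \<longlonglongrightarrow> 0"
    using suminf_exist_split2[OF summable_diff_coeff[OF a]] by (rule LIMSEQ_Suc)
  then have "\<eta> \<longlonglongrightarrow> 0 * B" unfolding \<eta>_def[abs_def] by (intro tendsto_intros)
  moreover have "\<bar>(\<Sum>j<Suc N. diff_coeff a j * ?A j x) - frac_op h a f x\<bar> \<le> \<eta> N" for N x
  proof -
    let ?s = "\<lambda>i. diff_coeff a i * ?A i x"
    have sm: "summable (\<lambda>i. \<bar>?s i\<bar>)" by (rule frac_op_summable[OF h f a])
    have "frac_op h a f x = (\<Sum>i. ?s (i + Suc N)) + (\<Sum>j<Suc N. ?s j)"
      unfolding frac_op_def by (rule suminf_split_initial_segment[OF summable_rabs_cancel[OF sm]])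
    then have "\<bar>(\<Sum>j<Suc N. ?s j) - frac_op h a f x\<bar> = \<bar>\<Sum>i. ?s (i + Suc N)\<bar>" by simp
    also have "\<dots> \<le> (\<Sum>i. \<bar>?s (i + Suc N)\<bar>)" by (intro summable_rabs summable_ignore_initial_segment[OF sm])
    also have "\<dots> \<le> (\<Sum>i. ?c (i + Suc N) * B)"
      by (intro suminf_le summable_mult2 summable_ignore_initial_segment[OF sm] summable_ignore_initial_segment[OF summable_diff_coeff[OF a]])
        (auto simp: abs_mult simp del: funpow.simps intro!: mult_left_mono B)
    also have "\<dots> = \<eta> N" unfolding \<eta>_def
      by (intro suminf_mult2[symmetric] summable_ignore_initial_segment[OF summable_diff_coeff[OF a]])
    finally show ?thesis .
  qed
  ultimately show ?thesis by (intro exI[of _ \<eta>]) auto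
qed

lemma wnorm_const_finite:
  assumes \<phi>: "young_function \<phi>" and W [measurable]: "W \<in> borel_measurable borel" "\<And>x. 0 < W x" and fin: "per_int (\<lambda>x. ennreal (W x)) < \<infinity>"
  shows "wnorm \<phi> W (\<lambda>x. 1) < \<infinity>"
proof -
  have "per_int (\<lambda>x. ennreal (\<phi> (1 * \<bar>1\<bar>) * W x)) = ennreal (\<phi> 1) * per_int (\<lambda>x. ennreal (W x))"
    using W young_functionD(1)[OF \<phi>] by (subst per_int_cmult[symmetric]) (auto simp: ennreal_mult')
  also have "\<dots> < \<infinity>" using fin by (simp add: ennreal_mult_less_top)
  finally show ?thesis using wnorm_finite[OF \<phi> W, of "\<lambda>_. 1" 1] by simp
qed

context box_bounded
begin

lemma rnrm_bounded_le:
  assumes "\<And>x. \<bar>f x\<bar> \<le> \<eta>"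
  shows "rnrm f \<le> ennreal \<eta> * nrm (\<lambda>x. 1)"
proof -
  have "rnrm f \<le> nrm (\<lambda>x. ennreal \<eta> * 1)" using assms by (intro wnorm_mono) (simp add: ennreal_leI)
  also have "\<dots> \<le> ennreal \<eta> * nrm (\<lambda>x. 1)" by (rule nrm_cmult) simp
  finally show ?thesis .
qed

end

lemma orlicz_space_per_L1:
  assumes Q: "\<phi> \<in> class_Q" and Ap: "Ap_bound W0 (young_index \<phi>) A" and Wae: "AE x in lborel. W x = W0 x"
    and f: "f \<in> orlicz_space \<phi> W" and f0: "f0 \<in> borel_measurable borel" "per f0" "AE x in lborel. f x = f0 x"
  shows "per_L1 f0" "wnorm \<phi> W0 (\<lambda>x. ennreal \<bar>f0 x\<bar>) < \<infinity>" "\<exists>C>0. per_int (\<lambda>x. ennreal (\<phi> (C * \<bar>f0 x\<bar>) * W0 x)) < \<infinity>"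
proof -
  have young: "young_function \<phi>" using Q by (simp add: class_Q_def)
  have W0: "W0 \<in> borel_measurable borel" "\<And>x. 0 < W0 x" using Ap by (auto simp: Ap_bound_def)
  obtain C where C: "0 < C" "(\<integral>\<^sup>+x\<in>{0..2*pi}. ennreal (\<phi> (C * \<bar>f x\<bar>) * W x) \<partial>lebesgue) < \<infinity>"
    using f by (auto simp: orlicz_space_def)
  have "(\<integral>\<^sup>+x\<in>{0..2*pi}. ennreal (\<phi> (C * \<bar>f x\<bar>) * W x) \<partial>lebesgue) = per_int (\<lambda>x. ennreal (\<phi> (C * \<bar>f0 x\<bar>) * W0 x))"
    by (rule nn_integral_lebesgue_per_int) (use Wae f0(3) in eventually_elim, simp)
  with C have fin: "per_int (\<lambda>x. ennreal (\<phi> (C * \<bar>f0 x\<bar>) * W0 x)) < \<infinity>" by simp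
  then show "\<exists>C>0. per_int (\<lambda>x. ennreal (\<phi> (C * \<bar>f0 x\<bar>) * W0 x)) < \<infinity>" using C by blast
  show "per_L1 f0" using class_Q_integrable[OF Q Ap f0(1) C(1) fin] f0 by (simp add: per_L1_def)
  show "wnorm \<phi> W0 (\<lambda>x. ennreal \<bar>f0 x\<bar>) < \<infinity>" by (rule wnorm_finite[OF young W0 f0(1) C(1) fin])
qed

text \<open>The witness is the pointwise series for the Borel version, corrected by
  \<open>f x - f0 x\<close>, which vanishes almost everywhere. With this correction the term of
  index 0 cancels and the error equals that for \<open>f0\<close> at every point; uniform
  convergence gives convergence in the norm because constants have finite norm.\<close>

lemma frac_diff_exists:
  assumes Q: "\<phi> \<in> class_Q" and Ap: "Ap_bound W0 (young_index \<phi>) A" and bb: "box_bounded \<phi> W0 D" and Wae: "AE x in lborel. W x = W0 x"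
    and k: "0 < k" and h: "0 < h"
    and f: "f \<in> orlicz_space \<phi> W" and f0: "f0 \<in> borel_measurable borel" "per f0" "AE x in lborel. f x = f0 x"
  shows "is_frac_diff \<phi> W k h f (\<lambda>x. frac_op h k f0 x + (f x - f0 x))"
proof -
  interpret box_bounded \<phi> W0 D by (rule bb)
  have young: "young_function \<phi>" using Q by (simp add: class_Q_def)
  have W0: "W0 \<in> borel_measurable borel" "\<And>x. 0 < W0 x" using Ap by (auto simp: Ap_bound_def)
  have [measurable]: "\<phi> \<in> borel_measurable borel" using young by (rule young_function_borel)
  have fm: "f \<in> borel_measurable lebesgue" "periodic_2pi f" using f by (auto simp: orlicz_space_def)
  note f0L = orlicz_space_per_L1[OF Q Ap Wae f f0]
  have k0: "0 \<le> k" using k by simp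
  let ?g = "\<lambda>x. frac_op h k f0 x + (f x - f0 x)"
  have fo: "per_L1 (frac_op h k f0)" by (rule per_L1_frac_op[OF h f0L(1) k0])
  have [measurable]: "frac_op h k f0 \<in> borel_measurable borel" "f0 \<in> borel_measurable borel" using fo f0 per_L1_borel by auto
  have gae: "AE x in lborel. ?g x = frac_op h k f0 x" using f0(3) by eventually_elim simp
  have "?g \<in> borel_measurable lebesgue"
    using fm(1) by (intro borel_measurable_add borel_measurable_diff) (auto intro: measurable_completion)
  moreover have "periodic_2pi ?g" using fm f0(2) fo by (simp add: periodic_2pi_def per_L1_def per_def)
  moreover have "\<exists>C>0. (\<integral>\<^sup>+x\<in>{0..2*pi}. ennreal (\<phi> (C * \<bar>?g x\<bar>) * W x) \<partial>lebesgue) < \<infinity>"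
  proof -
    obtain C where C: "0 < C" "per_int (\<lambda>x. ennreal (\<phi> (C * \<bar>f0 x\<bar>) * W0 x)) < \<infinity>" using f0L(3) by blast
    define S where "S = (\<Sum>i. \<bar>diff_coeff k i\<bar>)"
    have S: "1 \<le> S"
      unfolding S_def using sum_le_suminf[OF summable_diff_coeff[OF k0], of "{0}"] by simp
    obtain B where B: "0 \<le> B" "\<And>x. \<bar>frac_op h k f0 x\<bar> \<le> S * (\<bar>f0 x\<bar> + B)"
      using abs_frac_op_le[OF h f0L(1) k0] unfolding S_def by blast
    \<comment> \<open>\<open>S\<close> cancels the factor in the bound for the series, and the 2
      allows the sum of \<open>|f0 x|\<close> and \<open>B\<close> to be replaced by twice the
      maximum, so that the modular of \<open>f0\<close> with constant \<open>C\<close> can be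
      used.\<close>
    define c where "c = C / (2 * S)"
    have c: "0 < c" "c * S = C / 2" using C S by (auto simp: c_def)
    have pw: "\<phi> (c * \<bar>frac_op h k f0 x\<bar>) \<le> \<phi> (C * \<bar>f0 x\<bar>) + \<phi> (C * B)" for x
    proof -
      have "c * \<bar>frac_op h k f0 x\<bar> \<le> c * (S * (\<bar>f0 x\<bar> + B))" using B(2)[of x] c by (intro mult_left_mono) auto
      also have "\<dots> = C / 2 * (\<bar>f0 x\<bar> + B)" by (simp only: mult.assoc[symmetric] c(2))
      also have "\<dots> \<le> C / 2 * (2 * max \<bar>f0 x\<bar> B)" using C by (intro mult_left_mono) auto
      also have "\<dots> = C * max \<bar>f0 x\<bar> B" by simp
      finally have "\<phi> (c * \<bar>frac_op h k f0 x\<bar>) \<le> \<phi> (C * max \<bar>f0 x\<bar> B)"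
        using c by (intro young_functionD(3)[OF young]) auto
      also have "\<dots> \<le> \<phi> (C * \<bar>f0 x\<bar>) + \<phi> (C * B)"
        using young_functionD(1)[OF young, of "C * \<bar>f0 x\<bar>"] young_functionD(1)[OF young, of "C * B"] by (auto simp: max_def)
      finally show ?thesis .
    qed
    have "(\<integral>\<^sup>+x\<in>{0..2*pi}. ennreal (\<phi> (c * \<bar>?g x\<bar>) * W x) \<partial>lebesgue) = per_int (\<lambda>x. ennreal (\<phi> (c * \<bar>frac_op h k f0 x\<bar>) * W0 x))"
      by (rule nn_integral_lebesgue_per_int) (use Wae gae in eventually_elim, simp)
    also have "\<dots> \<le> per_int (\<lambda>x. ennreal (\<phi> (C * \<bar>f0 x\<bar>) * W0 x) + ennreal (\<phi> (C * B)) * ennreal (W0 x))"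
    proof (rule per_int_mono)
      fix x
      have "\<phi> (c * \<bar>frac_op h k f0 x\<bar>) * W0 x \<le> (\<phi> (C * \<bar>f0 x\<bar>) + \<phi> (C * B)) * W0 x"
        using W0(2)[of x] by (intro mult_right_mono pw) auto
      then show "ennreal (\<phi> (c * \<bar>frac_op h k f0 x\<bar>) * W0 x) \<le> ennreal (\<phi> (C * \<bar>f0 x\<bar>) * W0 x) + ennreal (\<phi> (C * B)) * ennreal (W0 x)"
        using young_functionD(1)[OF young] W0(2)[of x]
        by (simp add: ennreal_mult[symmetric] less_imp_le distrib_right ennreal_leI flip: ennreal_plus)
    qed
    also have "\<dots> = per_int (\<lambda>x. ennreal (\<phi> (C * \<bar>f0 x\<bar>) * W0 x)) + ennreal (\<phi> (C * B)) * per_int (\<lambda>x. ennreal (W0 x))"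
      by (subst per_int_add) (auto simp: per_int_cmult)
    also have "\<dots> < \<infinity>" using C(2) Ap_bound_per_int(2)[OF Ap] by (simp add: ennreal_mult_less_top)
    finally show ?thesis using c(1) by blast
  qed
  ultimately have "?g \<in> orlicz_space \<phi> W" by (simp add: orlicz_space_def)
  moreover have "(\<lambda>N. orlicz_norm \<phi> W (\<lambda>x. (\<Sum>j<N. (-1) ^ j * gen_binom k j * (steklov h ^^ j) f x) - ?g x)) \<longlonglongrightarrow> 0"
  proof -
    let ?A = "\<lambda>i. (conv (box_ker h) ^^ i) f0"
    obtain \<eta> where \<eta>: "\<eta> \<longlonglongrightarrow> 0" "\<And>N x. \<bar>(\<Sum>j<Suc N. diff_coeff k j * ?A j x) - frac_op h k f0 x\<bar> \<le> \<eta> N"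
      using frac_op_partial_sums[OF h f0L(1) k0] by blast
    have A: "?A i \<in> borel_measurable borel" for i
      by (rule per_L1_borel[OF per_L1_conv_funpow[OF kernel_box_ker[OF h] f0L(1)]])
    have eq: "(\<Sum>j<Suc N. (-1) ^ j * gen_binom k j * (steklov h ^^ j) f x) - ?g x
      = (\<Sum>j<Suc N. diff_coeff k j * ?A j x) - frac_op h k f0 x" for N x
    proof -
      have "(\<Sum>j<Suc N. (-1) ^ j * gen_binom k j * (steklov h ^^ j) f x) = f x + (\<Sum>j<N. diff_coeff k (Suc j) * ?A (Suc j) x)"
        unfolding diff_coeff_gen_binom[OF k]
        by (subst sum.lessThan_Suc_shift) (simp only: steklov_funpow[OF h fm(1) f0L(1) f0(3)], simp)
      moreover have "(\<Sum>j<Suc N. diff_coeff k j * ?A j x) = f0 x + (\<Sum>j<N. diff_coeff k (Suc j) * ?A (Suc j) x)"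
        by (subst sum.lessThan_Suc_shift) simp
      ultimately show ?thesis by simp
    qed
    have le: "orlicz_norm \<phi> W (\<lambda>x. (\<Sum>j<Suc N. (-1) ^ j * gen_binom k j * (steklov h ^^ j) f x) - ?g x) \<le> ennreal (\<eta> N) * nrm (\<lambda>x. 1)" for N
    proof -
      have "orlicz_norm \<phi> W (\<lambda>x. (\<Sum>j<Suc N. (-1) ^ j * gen_binom k j * (steklov h ^^ j) f x) - ?g x)
        = rnrm (\<lambda>x. (\<Sum>j<Suc N. diff_coeff k j * ?A j x) - frac_op h k f0 x)"
        unfolding eq using A by (intro orlicz_norm_eq_wnorm[OF young W0(1) Wae W0(2)]) auto
      also have "\<dots> \<le> ennreal (\<eta> N) * nrm (\<lambda>x. 1)" by (rule rnrm_bounded_le[OF \<eta>(2)])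
      finally show ?thesis .
    qed
    obtain q where q: "nrm (\<lambda>x. 1) = ennreal q" "0 \<le> q"
      using wnorm_const_finite[OF young W0 Ap_bound_per_int(2)[OF Ap]] by (cases "nrm (\<lambda>x. 1)") auto
    have "(\<lambda>N. ennreal (\<eta> N) * nrm (\<lambda>x. 1)) = (\<lambda>N. ennreal (\<eta> N * q))"
      unfolding q using q(2) by (simp add: ennreal_mult'')
    moreover have "(\<lambda>N. ennreal (\<eta> N * q)) \<longlonglongrightarrow> ennreal (0 * q)" by (intro tendsto_ennrealI tendsto_intros \<eta>(1))
    ultimately have lim: "(\<lambda>N. ennreal (\<eta> N) * nrm (\<lambda>x. 1)) \<longlonglongrightarrow> 0" by simp
    have "(\<lambda>N. orlicz_norm \<phi> W (\<lambda>x. (\<Sum>j<Suc N. (-1) ^ j * gen_binom k j * (steklov h ^^ j) f x) - ?g x)) \<longlonglongrightarrow> 0"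
      by (rule tendsto_sandwich[OF _ _ tendsto_const lim]) (auto simp: le simp del: sum.lessThan_Suc)
    then show ?thesis by (rule LIMSEQ_imp_Suc)
  qed
  ultimately show ?thesis by (simp add: is_frac_diff_def)
qed

text \<open>\<open>frac_diff\<close> is some limit of the partial sums, and the explicit series is
  another one; the triangle inequality along the sequence bounds the norm of the latter by that of
  the former.\<close>

lemma frac_op_le_frac_diff:
  assumes Q: "\<phi> \<in> class_Q" and Ap: "Ap_bound W0 (young_index \<phi>) A" and bb: "box_bounded \<phi> W0 D" and Wae: "AE x in lborel. W x = W0 x"
    and k: "0 < k" and h: "0 < h"
    and f: "f \<in> orlicz_space \<phi> W" and f0: "f0 \<in> borel_measurable borel" "per f0" "AE x in lborel. f x = f0 x"
  shows "wnorm \<phi> W0 (\<lambda>x. ennreal \<bar>frac_op h k f0 x\<bar>) \<le> orlicz_norm \<phi> W (frac_diff \<phi> W k h f)"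
proof -
  interpret box_bounded \<phi> W0 D by (rule bb)
  have young: "young_function \<phi>" using Q by (simp add: class_Q_def)
  have W0: "W0 \<in> borel_measurable borel" "\<And>x. 0 < W0 x" using Ap by (auto simp: Ap_bound_def)
  let ?g = "\<lambda>x. frac_op h k f0 x + (f x - f0 x)" and ?G = "frac_diff \<phi> W k h f"
  let ?S = "\<lambda>N x. \<Sum>j<N. (-1) ^ j * gen_binom k j * (steklov h ^^ j) f x"
  have g: "is_frac_diff \<phi> W k h f ?g" by (rule frac_diff_exists[OF assms])
  then have G: "is_frac_diff \<phi> W k h f ?G" unfolding frac_diff_def by (rule someI[of "is_frac_diff \<phi> W k h f"])
  have norm: "orlicz_norm \<phi> W u = rnrm u0" if "u0 \<in> borel_measurable borel" "AE x in lborel. u x = u0 x" for u u0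
    by (rule orlicz_norm_eq_wnorm[OF young W0(1) Wae W0(2) that])
  have fm: "f \<in> borel_measurable lebesgue" "periodic_2pi f" using f by (auto simp: orlicz_space_def)
  note f0L = orlicz_space_per_L1[OF Q Ap Wae f f0]
  have fo: "frac_op h k f0 \<in> borel_measurable borel"
    using per_L1_frac_op[OF h f0L(1)] k per_L1_borel by auto
  have Gs: "?G \<in> borel_measurable lebesgue" "periodic_2pi ?G" using G by (auto simp: is_frac_diff_def orlicz_space_def)
  obtain G0 where G0: "G0 \<in> borel_measurable borel" "AE x in lborel. ?G x = G0 x"
    using ex_borel_periodic_version[OF Gs] by blast
  define S0 where "S0 N = (\<lambda>x. \<Sum>j<N. diff_coeff k j * (conv (box_ker h) ^^ j) f0 x)" for N
  have S0: "S0 N \<in> borel_measurable borel" for N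
    unfolding S0_def using per_L1_borel[OF per_L1_conv_funpow[OF kernel_box_ker[OF h] f0L(1)]] by auto
  have SS: "AE x in lborel. ?S N x = S0 N x" for N
    using f0(3)
  proof eventually_elim
    case (elim x)
    have "(steklov h ^^ j) f x = (conv (box_ker h) ^^ j) f0 x" for j
      using steklov_funpow[OF h fm(1) f0L(1) f0(3), of "j - 1"] elim by (cases j) (auto simp del: funpow.simps simp: funpow_0)
    then show ?case unfolding S0_def by (simp add: diff_coeff_gen_binom[OF k])
  qed
  have n1: "orlicz_norm \<phi> W (\<lambda>x. ?S N x - ?g x) = rnrm (\<lambda>x. S0 N x - frac_op h k f0 x)" for N
    by (rule norm) (use S0 fo in simp, use SS[of N] f0(3) in eventually_elim, simp)
  have n2: "orlicz_norm \<phi> W (\<lambda>x. ?S N x - ?G x) = rnrm (\<lambda>x. S0 N x - G0 x)" for N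
    by (rule norm) (use S0 G0 in simp, use SS[of N] G0(2) in eventually_elim, simp)
  have n3: "orlicz_norm \<phi> W ?G = rnrm G0" by (rule norm[OF G0])
  have "(\<lambda>N. rnrm (\<lambda>x. S0 N x - frac_op h k f0 x)) \<longlonglongrightarrow> 0" "(\<lambda>N. rnrm (\<lambda>x. S0 N x - G0 x)) \<longlonglongrightarrow> 0"
    using g G unfolding is_frac_diff_def n1 n2 by auto
  then have "(\<lambda>N. (rnrm (\<lambda>x. S0 N x - frac_op h k f0 x) + rnrm (\<lambda>x. S0 N x - G0 x)) + rnrm G0) \<longlonglongrightarrow> (0 + 0) + rnrm G0"
    by (intro tendsto_add tendsto_const)
  moreover have "rnrm (frac_op h k f0) \<le> (rnrm (\<lambda>x. S0 N x - frac_op h k f0 x) + rnrm (\<lambda>x. S0 N x - G0 x)) + rnrm G0" for N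
  proof -
    have [measurable]: "S0 N \<in> borel_measurable borel" "G0 \<in> borel_measurable borel" "frac_op h k f0 \<in> borel_measurable borel"
      using S0 G0 fo by auto
    have "rnrm (frac_op h k f0) = rnrm (\<lambda>x. ((S0 N x - G0 x) - (S0 N x - frac_op h k f0 x)) + G0 x)" by simp
    also have "\<dots> \<le> rnrm (\<lambda>x. (S0 N x - G0 x) - (S0 N x - frac_op h k f0 x)) + rnrm G0" by (rule rnrm_add) measurable
    also have "\<dots> \<le> (rnrm (\<lambda>x. S0 N x - G0 x) + rnrm (\<lambda>x. S0 N x - frac_op h k f0 x)) + rnrm G0"
      by (intro add_right_mono rnrm_diff) measurable
    finally show ?thesis by (simp add: add.commute)
  qed
  ultimately have "rnrm (frac_op h k f0) \<le> (0 + 0) + rnrm G0" by (intro LIMSEQ_le_const) auto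
  then show ?thesis unfolding n3 by simp
qed

section \<open>The geometric mean of the best approximations\<close>

lemma ennreal_powr_le:
  assumes "x \<le> ennreal (X ^ n)" "0 \<le> X" "1 \<le> n"
  shows "ennreal_powr x (1 / real n) \<le> ennreal X"
proof -
  have "x < \<infinity>" by (rule order.strict_trans1[OF assms(1)]) simp
  then have "ennreal_powr x (1 / real n) = ennreal (enn2real x powr (1 / real n))" by (auto simp: ennreal_powr_def)
  also have "enn2real x \<le> X ^ n" using assms by (metis enn2real_leI zero_le_power)
  then have "enn2real x powr (1 / real n) \<le> (X ^ n) powr (1 / real n)" by (intro powr_mono2) auto
  also have "\<dots> = X" using assms by (cases "X = 0") (auto simp: powr_realpow[symmetric] powr_powr)
  finally show ?thesis by (simp add: ennreal_leI)
qed

text \<open>The product is \<open>n ^ n / fact n\<close>, a single term of the exponential series at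
  \<open>n\<close>.\<close>

lemma prod_div_le_exp: "(\<Prod>j=1..n. real n / real j) \<le> exp (real n)"
proof -
  have "(\<Prod>j=1..n. real n / real j) = real n ^ n / fact n"
    by (simp add: prod_dividef fact_prod)
  also have "\<dots> \<le> exp (real n)"
  proof -
    have "(\<Sum>i\<in>{n}. real n ^ i /\<^sub>R fact i) \<le> (\<Sum>i. real n ^ i /\<^sub>R fact i)"
      by (rule sum_le_suminf[OF summable_exp_generic]) auto
    then show ?thesis by (simp add: exp_def field_simps)
  qed
  finally show ?thesis .
qed

theorem theorem6p1:
  fixes \<phi> W :: "real \<Rightarrow> real" and k :: real
  assumes "\<phi> \<in> class_Q"
    and "W \<in> Muckenhoupt (young_index \<phi>)"
    and "0 < k"
  shows "\<exists>C>0. \<forall>f\<in>orlicz_space \<phi> W. \<forall>n::nat. 1 \<le> n \<longrightarrow>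
    ennreal_powr (\<Prod>j=1..n. best_approx \<phi> W j f) (1 / real n)
      \<le> ennreal C * modulus_smooth \<phi> W k f (1 / real n)"
proof -
  have young: "young_function \<phi>" using assms(1) by (simp add: class_Q_def)
  have w: "W \<in> borel_measurable lebesgue" "AE x in lebesgue. 0 < W x" "periodic_2pi W"
    using assms(2) by (auto simp: Muckenhoupt_def weight_def)
  obtain W1 where W1: "W1 \<in> borel_measurable borel" "per W1" "AE x in lborel. W x = W1 x"
    using ex_borel_periodic_version[OF w(1,3)] by blast
  \<comment> \<open>Positivity is repaired on a null set, so that powers and quotients of the weight
    need no exceptions.\<close>
  define W0 where "W0 x = (if 0 < W1 x then W1 x else 1)" for x
  have W0: "W0 \<in> borel_measurable borel" "\<And>x. 0 < W0 x" "per W0"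
    using W1(1,2) unfolding W0_def[abs_def] by (auto simp: per_def)
  have "AE x in lborel. 0 < W x" using w(2) by (simp add: AE_completion_iff)
  then have Wae: "AE x in lborel. W x = W0 x"
    using W1(3) by eventually_elim (auto simp: W0_def)
  obtain A where Ap: "Ap_bound W0 (young_index \<phi>) A"
    using Muckenhoupt_Ap_bound[OF assms(2) W0(1,2) Wae] by blast
  obtain D where D: "0 < D" and box: "\<And>s F. 0 < s \<Longrightarrow> F \<in> borel_measurable borel \<Longrightarrow> per F \<Longrightarrow>
      wnorm \<phi> W0 (box_avg s F) \<le> ennreal (D * s) * wnorm \<phi> W0 F"
    using class_Q_box_avg[OF assms(1) Ap W0(3)] by blast
  have bb: "box_bounded \<phi> W0 D" by (unfold_locales) (use W0 D box in auto)
  interpret box_bounded \<phi> W0 D by (rule bb)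
  obtain C r where C: "0 < C" and J: "\<And>f n j. per_L1 f \<Longrightarrow> rnrm f < \<infinity> \<Longrightarrow> 1 \<le> j \<Longrightarrow> j \<le> n \<Longrightarrow>
    \<exists>T\<in>trig_polys j. rnrm (\<lambda>x. f x - T x) \<le> ennreal (C * (real n / real j) ^ r) * rnrm (frac_op (1 / real n) k f)"
    using fractional_jackson[OF assms(3)] by blast
  \<comment> \<open>The geometric mean of the factors \<open>(n / j) ^ r\<close> is at most
    \<open>exp r\<close>.\<close>
  define C' where "C' = C * exp (real r)"
  have C': "0 < C'" using C by (simp add: C'_def)
  have "ennreal_powr (\<Prod>j=1..n. best_approx \<phi> W j f) (1 / real n) \<le> ennreal C' * modulus_smooth \<phi> W k f (1 / real n)"
    if f: "f \<in> orlicz_space \<phi> W" and n: "1 \<le> n" for f and n :: nat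
  proof -
    have fm: "f \<in> borel_measurable lebesgue" "periodic_2pi f" using f by (auto simp: orlicz_space_def)
    obtain f0 where f0: "f0 \<in> borel_measurable borel" "per f0" "AE x in lborel. f x = f0 x"
      using ex_borel_periodic_version[OF fm] by blast
    note f0L = orlicz_space_per_L1[OF assms(1) Ap Wae f f0]
    have h: "0 < 1 / real n" using n by simp
    let ?\<Omega> = "modulus_smooth \<phi> W k f (1 / real n)"
    have "rnrm (frac_op (1 / real n) k f0) \<le> orlicz_norm \<phi> W (frac_diff \<phi> W k (1 / real n) f)"
      by (rule frac_op_le_frac_diff[OF assms(1) Ap bb Wae assms(3) h f f0])
    also have "\<dots> \<le> ?\<Omega>" unfolding modulus_smooth_def using h by (intro SUP_upper) auto
    finally have \<Omega>: "rnrm (frac_op (1 / real n) k f0) \<le> ?\<Omega>" .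
    have E: "best_approx \<phi> W j f \<le> ennreal (C * (real n / real j) ^ r) * ?\<Omega>" if j: "j \<in> {1..n}" for j
    proof -
      obtain T where T: "T \<in> trig_polys j" "rnrm (\<lambda>x. f0 x - T x) \<le> ennreal (C * (real n / real j) ^ r) * rnrm (frac_op (1 / real n) k f0)"
        using J[OF f0L(1,2), of j n] j by auto
      have "best_approx \<phi> W j f \<le> orlicz_norm \<phi> W (\<lambda>x. f x - T x)" unfolding best_approx_def by (rule INF_lower[OF T(1)])
      also have "\<dots> = rnrm (\<lambda>x. f0 x - T x)"
        using f0 trig_polys_borel[OF T(1)] by (intro orlicz_norm_eq_wnorm[OF young W0(1) Wae W0(2)]) auto
      also note T(2)
      also have "ennreal (C * (real n / real j) ^ r) * rnrm (frac_op (1 / real n) k f0) \<le> ennreal (C * (real n / real j) ^ r) * ?\<Omega>"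
        by (rule mult_left_mono[OF \<Omega>]) simp
      finally show ?thesis .
    qed
    show ?thesis
    proof (cases "?\<Omega> = \<infinity>")
      case True
      then show ?thesis using C' by (simp add: ennreal_mult_top)
    next
      case False
      then obtain \<omega> where \<omega>: "?\<Omega> = ennreal \<omega>" "0 \<le> \<omega>" by (cases ?\<Omega>) auto
      have "(\<Prod>j=1..n. best_approx \<phi> W j f) \<le> (\<Prod>j=1..n. ennreal (C * (real n / real j) ^ r * \<omega>))"
        using E \<omega> C by (intro prod_mono_ennreal) (auto simp: ennreal_mult)
      also have "\<dots> = ennreal (\<Prod>j=1..n. C * (real n / real j) ^ r * \<omega>)"
        using C \<omega> by (intro prod_ennreal) auto
      also have "(\<Prod>j=1..n. C * (real n / real j) ^ r * \<omega>) = (C * \<omega>) ^ n * (\<Prod>j=1..n. real n / real j) ^ r"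
        by (simp add: prod.distrib prod_power_distrib power_mult_distrib)
      also have "ennreal \<dots> \<le> ennreal ((C' * \<omega>) ^ n)"
      proof (rule ennreal_leI)
        have "(\<Prod>j=1..n. real n / real j) ^ r \<le> exp (real n) ^ r"
          by (intro power_mono prod_div_le_exp prod_nonneg) auto
        also have "\<dots> = exp (real r) ^ n" by (simp add: exp_of_nat_mult[symmetric] mult.commute)
        finally have "(C * \<omega>) ^ n * (\<Prod>j=1..n. real n / real j) ^ r \<le> (C * \<omega>) ^ n * exp (real r) ^ n"
          using C \<omega> by (intro mult_left_mono) auto
        then show "(C * \<omega>) ^ n * (\<Prod>j=1..n. real n / real j) ^ r \<le> (C' * \<omega>) ^ n"
          by (simp add: C'_def power_mult_distrib mult_ac)
      qed
      finally have "ennreal_powr (\<Prod>j=1..n. best_approx \<phi> W j f) (1 / real n) \<le> ennreal (C' * \<omega>)"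
        using C' \<omega> n by (intro ennreal_powr_le) auto
      then show ?thesis using C' \<omega> by (simp add: ennreal_mult)
    qed
  qed
  with C' show ?thesis by blast
qed

end
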